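(* Let $n\ge 1$, let $0<s<1$, and let $\Omega\subset\mathbb R^n$ be a bounded domain with Lipschitz boundary. Let $u\in\widetilde H^s(\Omega)$ with $u\ge 0$. Then $$(-\Delta_\Omega)^s_Nu\ \ge\ (-\Delta_\Omega)^s_Du$$ in the sense of distributions in $\Omega$. If moreover $u\not\equiv 0$, then this inequality holds with strict sign, i.e. $(-\Delta_\Omega)^s_Nu>(-\Delta_\Omega)^s_Du$ in the sense of distributions in $\Omega$.
   Context: Functions are real-valued. Fourier transform: $\mathcal F u(\xi)=(2\pi)^{-n/2}\int_{\mathbb R^n}e^{-i\xi\cdot x}u(x)\,dx$. $H^s(\mathbb R^n)$ is the completion of $\mathcal C_0^\infty(\mathbb R^n)$ with respect to the norm $\|u\|_s^2=\int_{\mathbb R^n}(1+|\xi|^2)^s|\mathcal F u(\xi)|^2\,d\xi$, and $\widetilde H^s(\Omega)=\{u\in H^s(\mathbb R^n):\ \mathrm{supp}\,u\subset\overline\Omega\}$. Functions in $L_2(\Omega)$ are identified with their extensions by zero to $\mathbb R^n$. Let $\lambda_j$ and $\varphi_j$ ($j\in\mathbb N$) be the eigenvalues and the corresponding $L_2(\Omega)$-orthonormal eigenfunctions of the Dirichlet Laplacian $-\Delta$ in $\Omega$, and let $(\cdot,\cdot)$ be the scalar product in $L_2(\Omega)$. The "Navier" fractional Laplacian $(-\Delta_\Omega)^s_N$ and the "Dirichlet" fractional Laplacian $(-\Delta_\Omega)^s_D$ are defined by the quadratic forms $$Q_s^N[u]=((-\Delta_\Omega)^s_Nu,u)=\sum_j\lambda_j^s|(u,\varphi_j)|^2,\qquad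 Q_s^D[u]=((-\Delta_\Omega)^s_Du,u)=\int_{\mathbb R^n}|\xi|^{2s}|\mathcal F u(\xi)|^2\,d\xi,$$ both with domain $\widetilde H^s(\Omega)$. For $u\in\widetilde H^s(\Omega)$, $(-\Delta_\Omega)^s_Nu$ and $(-\Delta_\Omega)^s_Du$ are the distributions in $\Omega$ acting on $\varphi\in\mathcal C_0^\infty(\Omega)$ by $$\langle(-\Delta_\Omega)^s_Nu,\varphi\rangle=\sum_j\lambda_j^s(u,\varphi_j)(\varphi,\varphi_j),\qquad \langle(-\Delta_\Omega)^s_Du,\varphi\rangle=\int_{\mathbb R^n}|\xi|^{2s}\mathcal F u(\xi)\overline{\mathcal F\varphi(\xi)}\,d\xi .$$ For distributions $f,g$ in $\Omega$: $f\ge g$ means $\langle f-g,\varphi\rangle\ge0$ for every $\varphi\in\mathcal C_0^\infty(\Omega)$ with $\varphi\ge0$; $f>g$ means $\langle f-g,\varphi\rangle>0$ for every $\varphi\in\mathcal C_0^\infty(\Omega)$ with $\varphi\ge0$, $\varphi\not\equiv0$. *)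

theory Defs
  imports "HOL-Analysis.Analysis"
begin

text \<open>
  Elements of \<open>L\<^sub>2\<close> are represented by Borel functions on the whole space, and pointwise
  statements about them are read almost everywhere.  The space \<open>\<real>\<^sup>n\<close> is an arbitrary Euclidean
  space, with \<open>n = DIM('a) \<ge> 1\<close>.
\<close>

definition partial_deriv :: "'a::euclidean_space \<Rightarrow> ('a \<Rightarrow> real) \<Rightarrow> 'a \<Rightarrow> real" where
  "partial_deriv b f x = frechet_derivative f (at x) b"

definition laplacian :: "('a::euclidean_space \<Rightarrow> real) \<Rightarrow> 'a \<Rightarrow> real" where
  "laplacian f x = (\<Sum>b\<in>Basis. partial_deriv b (partial_deriv b f) x)"

fun C_diff :: "nat \<Rightarrow> ('a::euclidean_space \<Rightarrow> real) \<Rightarrow> bool" where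
  "C_diff 0 f \<longleftrightarrow> continuous_on UNIV f"
| "C_diff (Suc k) f \<longleftrightarrow> f differentiable_on UNIV \<and> (\<forall>b\<in>Basis. C_diff k (partial_deriv b f))"

definition smooth :: "('a::euclidean_space \<Rightarrow> real) \<Rightarrow> bool" where
  "smooth f \<longleftrightarrow> (\<forall>k. C_diff k f)"

definition test_functions :: "'a::euclidean_space set \<Rightarrow> ('a \<Rightarrow> real) set" where
  "test_functions \<Omega> =
     {\<phi>. smooth \<phi> \<and> compact (closure {x. \<phi> x \<noteq> 0}) \<and> closure {x. \<phi> x \<noteq> 0} \<subseteq> \<Omega>}"

text \<open>
  The defining integral is only meaningful for integrable functions; this covers test functions and
  square-integrable functions supported in a bounded set, the only ones it is applied to.
\<close>

definition fourier :: "('a::euclidean_space \<Rightarrow> real) \<Rightarrow> 'a \<Rightarrow> complex" where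
  "fourier u \<xi> = complex_of_real ((2 * pi) powr (- real DIM('a) / 2)) *
     (\<integral>x. exp (- (\<i> * complex_of_real (\<xi> \<bullet> x))) * complex_of_real (u x) \<partial>lborel)"

definition sobolev_norm :: "real \<Rightarrow> ('a::euclidean_space \<Rightarrow> real) \<Rightarrow> real" where
  "sobolev_norm s u =
     sqrt (\<integral>\<xi>. (1 + (norm \<xi>)\<^sup>2) powr s * (cmod (fourier u \<xi>))\<^sup>2 \<partial>lborel)"

definition square_integrable :: "('a::euclidean_space \<Rightarrow> real) \<Rightarrow> bool" where
  "square_integrable u \<longleftrightarrow> u \<in> borel_measurable lborel \<and> integrable lborel (\<lambda>x. (u x)\<^sup>2)"

definition L2_inner :: "'a::euclidean_space set \<Rightarrow> ('a \<Rightarrow> real) \<Rightarrow> ('a \<Rightarrow> real) \<Rightarrow> real" where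
  "L2_inner \<Omega> u v = (LINT x:\<Omega>|lborel. u x * v x)"

text \<open>
  For \<open>s \<ge> 0\<close> the norm \<open>sobolev_norm s\<close> dominates the \<open>L\<^sub>2\<close> norm, and the abstract completion of the
  test functions on \<open>\<Omega>\<close> embeds into \<open>L\<^sub>2\<close>: its elements are the \<open>L\<^sub>2\<close>-limits of the sequences of test
  functions that are Cauchy with respect to \<open>sobolev_norm s\<close>.
\<close>

definition sobolev_completion :: "real \<Rightarrow> 'a::euclidean_space set \<Rightarrow> ('a \<Rightarrow> real) set" where
  "sobolev_completion s \<Omega> =
     {u. square_integrable u \<and>
         (\<exists>\<phi>. (\<forall>k::nat. \<phi> k \<in> test_functions \<Omega>) \<and>
              (\<forall>e>0. \<exists>N. \<forall>k\<ge>N. \<forall>m\<ge>N. sobolev_norm s (\<lambda>x. \<phi> k x - \<phi> m x) < e) \<and>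
              (\<lambda>k. \<integral>x. (\<phi> k x - u x)\<^sup>2 \<partial>lborel) \<longlonglongrightarrow> 0)}"

definition H_space :: "real \<Rightarrow> ('a::euclidean_space \<Rightarrow> real) set" where
  "H_space s = sobolev_completion s UNIV"

definition ess_support :: "('a::euclidean_space \<Rightarrow> real) \<Rightarrow> 'a set" where
  "ess_support u = - \<Union>{U. open U \<and> (AE x in lborel. x \<in> U \<longrightarrow> u x = 0)}"

definition H_tilde :: "real \<Rightarrow> 'a::euclidean_space set \<Rightarrow> ('a \<Rightarrow> real) set" where
  "H_tilde s \<Omega> = {u \<in> H_space s. ess_support u \<subseteq> closure \<Omega>}"

definition is_domain :: "'a::euclidean_space set \<Rightarrow> bool" where
  "is_domain \<Omega> \<longleftrightarrow> open \<Omega> \<and> connected \<Omega> \<and> \<Omega> \<noteq> {}"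

text \<open>
  Near every boundary point, \<open>\<Omega>\<close> is the strict epigraph, in some unit direction \<open>e\<close>, of a Lipschitz
  function \<open>g\<close> on the hyperplane orthogonal to \<open>e\<close>.
\<close>

definition lipschitz_boundary :: "'a::euclidean_space set \<Rightarrow> bool" where
  "lipschitz_boundary \<Omega> \<longleftrightarrow>
     (\<forall>p\<in>frontier \<Omega>. \<exists>r>0. \<exists>e. \<exists>g::'a \<Rightarrow> real. \<exists>L.
        norm e = 1 \<and> L-lipschitz_on {y. y \<bullet> e = 0} g \<and>
        (\<forall>x\<in>ball p r. x \<in> \<Omega> \<longleftrightarrow> g (x - (x \<bullet> e) *\<^sub>R e) < x \<bullet> e))"

text \<open>
  The Dirichlet Laplacian is the distributional \<open>-\<Delta>\<close> on those functions of \<open>H\<^sub>0\<^sup>1(\<Omega>)\<close> (the completion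
  of the test functions on \<open>\<Omega>\<close> in the \<open>H\<^sup>1\<close> norm) whose distributional Laplacian is in
  \<open>L\<^sub>2(\<Omega>)\<close>; the last condition is automatic when \<open>-\<Delta>v = \<mu>v\<close>.
\<close>

definition dirichlet_eigenpair :: "'a::euclidean_space set \<Rightarrow> real \<Rightarrow> ('a \<Rightarrow> real) \<Rightarrow> bool" where
  "dirichlet_eigenpair \<Omega> \<mu> v \<longleftrightarrow>
     v \<in> sobolev_completion 1 \<Omega> \<and> \<not> (AE x in lborel. v x = 0) \<and>
     (\<forall>\<psi>\<in>test_functions \<Omega>. L2_inner \<Omega> v (\<lambda>x. - laplacian \<psi> x) = \<mu> * L2_inner \<Omega> v \<psi>)"

text \<open>
  All eigenvalues, repeated according to multiplicity, with orthonormal eigenfunctions: the last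
  conjunct says that no eigenfunction can be added to the orthonormal system.  Completeness of the
  system in \<open>L\<^sub>2(\<Omega>)\<close> is not part of the definition.
\<close>

definition dirichlet_eigensystem ::
  "'a::euclidean_space set \<Rightarrow> (nat \<Rightarrow> real) \<Rightarrow> (nat \<Rightarrow> 'a \<Rightarrow> real) \<Rightarrow> bool" where
  "dirichlet_eigensystem \<Omega> lam phi \<longleftrightarrow>
     (\<forall>j. dirichlet_eigenpair \<Omega> (lam j) (phi j)) \<and>
     (\<forall>i j. L2_inner \<Omega> (phi i) (phi j) = (if i = j then 1 else 0)) \<and>
     (\<forall>\<mu> v. dirichlet_eigenpair \<Omega> \<mu> v \<longrightarrow> (\<exists>j. L2_inner \<Omega> v (phi j) \<noteq> 0))"

text \<open>A distribution is represented by its (real) values on test functions.\<close>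

definition navier_frac_laplacian ::
  "'a::euclidean_space set \<Rightarrow> (nat \<Rightarrow> real) \<Rightarrow> (nat \<Rightarrow> 'a \<Rightarrow> real) \<Rightarrow> real \<Rightarrow>
   ('a \<Rightarrow> real) \<Rightarrow> ('a \<Rightarrow> real) \<Rightarrow> real" where
  "navier_frac_laplacian \<Omega> lam phi s u \<phi> =
     (\<Sum>j. lam j powr s * L2_inner \<Omega> u (phi j) * L2_inner \<Omega> \<phi> (phi j))"

text \<open>
  The integral is real for real-valued \<open>u\<close> and \<open>\<phi>\<close>, since the Fourier transform of a real function
  takes conjugate values at \<open>\<xi>\<close> and \<open>-\<xi>\<close>; so \<open>Re\<close> only changes the type.
\<close>

definition dirichlet_frac_laplacian ::
  "real \<Rightarrow> ('a::euclidean_space \<Rightarrow> real) \<Rightarrow> ('a \<Rightarrow> real) \<Rightarrow> real" where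
  "dirichlet_frac_laplacian s u \<phi> =
     Re (\<integral>\<xi>. complex_of_real (norm \<xi> powr (2 * s)) * fourier u \<xi> * cnj (fourier \<phi> \<xi>) \<partial>lborel)"

definition dist_ge ::
  "'a::euclidean_space set \<Rightarrow> (('a \<Rightarrow> real) \<Rightarrow> real) \<Rightarrow> (('a \<Rightarrow> real) \<Rightarrow> real) \<Rightarrow> bool" where
  "dist_ge \<Omega> f g \<longleftrightarrow> (\<forall>\<phi>\<in>test_functions \<Omega>. (\<forall>x. 0 \<le> \<phi> x) \<longrightarrow> 0 \<le> f \<phi> - g \<phi>)"

definition dist_gt ::
  "'a::euclidean_space set \<Rightarrow> (('a \<Rightarrow> real) \<Rightarrow> real) \<Rightarrow> (('a \<Rightarrow> real) \<Rightarrow> real) \<Rightarrow> bool" where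
  "dist_gt \<Omega> f g \<longleftrightarrow>
     (\<forall>\<phi>\<in>test_functions \<Omega>. (\<forall>x. 0 \<le> \<phi> x) \<and> (\<exists>x. \<phi> x \<noteq> 0) \<longrightarrow> 0 < f \<phi> - g \<phi>)"

end

theory Submission
  imports Defs "HOL-Probability.Characteristic_Functions" "HOL-Probability.Sinc_Integral" "HOL-Complex_Analysis.Great_Picard"
    "HOL-Computational_Algebra.Polynomial"
begin

text \<open>
  Up to a positive constant, \<open>\<mu>\<^sup>s\<close> is the integral of \<open>t\<^bsup>s-1\<^esup> \<mu> / (t + \<mu>)\<close> over \<open>t > 0\<close>.  Applied to the
  eigenvalues and to \<open>|\<xi>|\<^sup>2\<close>, this represents the difference of the two fractional Laplacians, tested
  against \<open>\<phi>\<close>, as the integral of \<open>t\<^sup>s (u, w\<^sub>t - v\<^sub>t)\<close>, where \<open>w\<^sub>t\<close> and \<open>v\<^sub>t\<close> are the solutions of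
  \<open>t y - \<Delta> y = \<phi>\<close> on the whole space and on \<open>\<Omega>\<close> with zero boundary values.  Since \<open>\<phi> \<ge> 0\<close>, the
  comparison principle gives \<open>v\<^sub>t \<le> w\<^sub>t\<close>, and the strong maximum principle makes this strict when
  \<open>\<phi> \<noteq> 0\<close>.  Only the completeness of the eigenfunctions needs compactness, namely Rellich's theorem
  for the Dirichlet resolvent.
\<close>

section \<open>Smooth functions\<close>

text \<open>Since \<open>\<mu> / (t + \<mu>) = 1 - t / (t + \<mu>)\<close>, each side becomes an
  integral of (u, \<phi>) minus t times a resolvent pairing. The two copies of (u, \<phi>) cancel
  only if the eigenfunction expansion reproduces (u, \<phi>), which is what completeness provides.
  Maximality of the eigensystem gives it: a nonzero orthogonal complement would contain a further
  eigenvector of the resolvent. All resolvents act on \<phi> and not on u, so the decay of the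
  transform of \<phi> and the square-summable coefficients of its Laplacian control both integrals.
  The obstacle is regularity: the solution on \<Omega> is known only as a limit of test functions,
  and the solution on the whole space does not vanish on the boundary. Hence the comparison is run
  on approximating test functions with a smooth positive part, and the strong maximum principle is
  proved for nonnegative distributional solutions, by averaging them against a truncated heat
  kernel. It leaves the case that both solutions agree on \<Omega>; this is excluded because one has
  zero boundary values and the other is smooth and positive everywhere.\<close>

lemma partial_deriv_eq: "(f has_derivative D) (at x) \<Longrightarrow> partial_deriv b f x = D b"
  unfolding partial_deriv_def using frechet_derivative_at by metis

lemma C_diff_continuous: "C_diff k f \<Longrightarrow> continuous_on UNIV f"
  by (cases k) (auto intro: differentiable_imp_continuous_on)

lemma C_diff_SucD: "C_diff (Suc k) f \<Longrightarrow> C_diff k f"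
proof (induction k arbitrary: f)
  case 0
  then show ?case by (auto intro: differentiable_imp_continuous_on)
next
  case (Suc k)
  then show ?case using C_diff.simps(2) by blast
qed

lemma smooth_differentiable: "smooth f \<Longrightarrow> f differentiable (at x)"
  unfolding smooth_def by (metis C_diff.simps(2) differentiable_on_def UNIV_I)

lemma smooth_continuous: "smooth f \<Longrightarrow> continuous_on S f"
  unfolding smooth_def by (metis C_diff_continuous continuous_on_subset subset_UNIV)

lemma smooth_partial_deriv: "smooth f \<Longrightarrow> b \<in> Basis \<Longrightarrow> smooth (partial_deriv b f)"
  unfolding smooth_def by (metis C_diff.simps(2))

lemma smooth_borel_measurable [measurable_dest]: "smooth f \<Longrightarrow> f \<in> borel_measurable borel"
  using smooth_continuous borel_measurable_continuous_onI by blast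

lemma smooth_C_diff: "smooth f \<Longrightarrow> C_diff k f"
  by (simp add: smooth_def)

lemma differentiable_on_UNIV_at: "f differentiable_on UNIV \<Longrightarrow> f differentiable (at x)"
  by (simp add: differentiable_on_def)

lemma C_diff_const: "C_diff k (\<lambda>x. c)"
proof (induction k arbitrary: c)
  case (Suc k)
  have "partial_deriv b (\<lambda>x. c) = (\<lambda>x. 0)" for b :: 'a
    by (rule ext, rule partial_deriv_eq[where D="\<lambda>h. 0", simplified]) simp
  with Suc show ?case by simp
qed simp

lemma partial_deriv_add:
  assumes "f differentiable (at x)" "g differentiable (at x)"
  shows "partial_deriv b (\<lambda>x. f x + g x) x = partial_deriv b f x + partial_deriv b g x"
proof -
  obtain D E where "(f has_derivative D) (at x)" "(g has_derivative E) (at x)"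
    using assms differentiable_def by blast
  then show ?thesis
    using partial_deriv_eq[OF has_derivative_add] partial_deriv_eq by metis
qed

lemma partial_deriv_mult:
  assumes "f differentiable (at x)" "g differentiable (at x)"
  shows "partial_deriv b (\<lambda>x. f x * g x) x = f x * partial_deriv b g x + partial_deriv b f x * g x"
proof -
  obtain D E where D: "(f has_derivative D) (at x)" "(g has_derivative E) (at x)"
    using assms differentiable_def by blast
  show ?thesis
    using partial_deriv_eq[OF has_derivative_mult[OF D], of b] partial_deriv_eq[OF D(1)] partial_deriv_eq[OF D(2)]
    by simp
qed

lemma partial_deriv_compose:
  assumes "f differentiable (at x)" "(g has_real_derivative g') (at (f x))"
  shows "partial_deriv b (\<lambda>x. g (f x)) x = g' * partial_deriv b f x"
proof -
  obtain D where D: "(f has_derivative D) (at x)"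
    using assms differentiable_def by blast
  have "((\<lambda>x. g (f x)) has_derivative (\<lambda>h. g' * D h)) (at x)"
    using has_derivative_compose[OF D] assms(2) by (simp add: has_field_derivative_def)
  then show ?thesis using partial_deriv_eq D by metis
qed

lemma C_diff_add: "C_diff k f \<Longrightarrow> C_diff k g \<Longrightarrow> C_diff k (\<lambda>x. f x + g x)"
proof (induction k arbitrary: f g)
  case 0
  then show ?case by (auto intro: continuous_on_add)
next
  case (Suc k)
  then have d: "f differentiable (at x)" "g differentiable (at x)" for x
    by (auto intro: differentiable_on_UNIV_at)
  have "partial_deriv b (\<lambda>x. f x + g x) = (\<lambda>x. partial_deriv b f x + partial_deriv b g x)" for b
    using d by (auto simp: partial_deriv_add)
  with Suc show ?case by auto
qed

lemma C_diff_mult: "C_diff k f \<Longrightarrow> C_diff k g \<Longrightarrow> C_diff k (\<lambda>x. f x * g x)"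
proof (induction k arbitrary: f g)
  case 0
  then show ?case by (auto intro: continuous_on_mult)
next
  case (Suc k)
  then have d: "f differentiable (at x)" "g differentiable (at x)" for x
    by (auto intro: differentiable_on_UNIV_at)
  have "partial_deriv b (\<lambda>x. f x * g x) = (\<lambda>x. f x * partial_deriv b g x + partial_deriv b f x * g x)" for b
    using d by (auto simp: partial_deriv_mult)
  moreover have "C_diff k f" "C_diff k g"
    using Suc C_diff_SucD by blast+
  ultimately show ?case using Suc by (auto intro!: C_diff_add)
qed

text \<open>The chain rule turns \<open>H m\<close> into \<open>H (Suc m)\<close> times a partial
  derivative, so the induction on \<open>k\<close> has to carry the whole sequence of derivatives of
  the outer function, with \<open>m\<close> arbitrary.\<close>

lemma C_diff_compose:
  assumes H: "\<And>m x. (H m has_real_derivative H (Suc m) x) (at x)"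
  shows "C_diff k f \<Longrightarrow> C_diff k (\<lambda>x. H m (f x))"
proof (induction k arbitrary: f m)
  case 0
  have "continuous_on UNIV (H m)"
    using H DERIV_continuous_on by blast
  then show ?case using 0 continuous_on_compose2 by fastforce
next
  case (Suc k)
  then have d: "f differentiable (at x)" for x
    by (auto intro: differentiable_on_UNIV_at)
  have e: "(\<lambda>x. H m (f x)) differentiable (at x)" for x
    using d[of x] H[of m "f x"] differentiable_compose[of "H m" f x UNIV]
    by (meson differentiable_def has_field_derivative_imp_has_derivative has_derivative_at_withinI differentiable_compose)
  have "partial_deriv b (\<lambda>x. H m (f x)) = (\<lambda>x. H (Suc m) (f x) * partial_deriv b f x)" for b
    using d H by (auto intro!: partial_deriv_compose)
  moreover have "C_diff k f" using Suc C_diff_SucD by blast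
  ultimately show ?case using Suc e by (auto intro!: C_diff_mult simp: differentiable_on_def)
qed

lemma smooth_const [simp]: "smooth (\<lambda>x. c)"
  by (simp add: smooth_def C_diff_const)

lemma smooth_add: "smooth f \<Longrightarrow> smooth g \<Longrightarrow> smooth (\<lambda>x. f x + g x)"
  by (simp add: smooth_def C_diff_add)

lemma smooth_mult: "smooth f \<Longrightarrow> smooth g \<Longrightarrow> smooth (\<lambda>x. f x * g x)"
  by (simp add: smooth_def C_diff_mult)

lemma smooth_minus: "smooth f \<Longrightarrow> smooth (\<lambda>x. - f x)"
  using smooth_mult[of "\<lambda>x. -1" f] by simp

lemma smooth_diff: "smooth f \<Longrightarrow> smooth g \<Longrightarrow> smooth (\<lambda>x. f x - g x)"
  using smooth_add[of f "\<lambda>x. - g x"] by (simp add: smooth_minus)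

lemma smooth_sum: "(\<And>i. i \<in> I \<Longrightarrow> smooth (f i)) \<Longrightarrow> smooth (\<lambda>x. \<Sum>i\<in>I. f i x)"
  by (induction I rule: infinite_finite_induct) (auto intro: smooth_add)

lemma smooth_compose:
  assumes "\<And>m x. (H m has_real_derivative H (Suc m) x) (at x)" "smooth f"
  shows "smooth (\<lambda>x. H m (f x))"
  unfolding smooth_def
  by (intro allI C_diff_compose[where H=H] assms(1)) (use assms(2) in \<open>simp add: smooth_def\<close>)

lemma smooth_exp: "smooth f \<Longrightarrow> smooth (\<lambda>x. exp (f x))"
  using smooth_compose[of "\<lambda>m. exp" f 0] by auto

lemma partial_deriv_inner: "partial_deriv b (\<lambda>x. (x - y) \<bullet> a) x = b \<bullet> a"
  by (rule partial_deriv_eq) (auto intro!: derivative_eq_intros)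

lemma smooth_inner: "smooth (\<lambda>x. (x - y) \<bullet> a)"
proof -
  have "partial_deriv b (\<lambda>x. (x - y) \<bullet> a) = (\<lambda>x. b \<bullet> a)" for b
    by (auto simp: partial_deriv_inner)
  moreover have "(\<lambda>x. (x - y) \<bullet> a) differentiable (at x)" for x
    unfolding differentiable_def by (rule exI) (auto intro!: derivative_eq_intros)
  ultimately have "C_diff (Suc k) (\<lambda>x. (x - y) \<bullet> a)" for k
    by (auto simp: C_diff_const differentiable_on_def)
  then show ?thesis unfolding smooth_def using C_diff_SucD by blast
qed

lemma smooth_dist_square: "smooth (\<lambda>x. (norm (x - y))\<^sup>2)"
proof -
  have "(\<lambda>x. (norm (x - y))\<^sup>2) = (\<lambda>x. \<Sum>b\<in>Basis. ((x - y) \<bullet> b) * ((x - y) \<bullet> b))"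
    unfolding power2_norm_eq_inner by (subst euclidean_inner) simp
  then show ?thesis by (auto intro!: smooth_sum smooth_mult smooth_inner)
qed

lemma partial_deriv_dist_square:
  "partial_deriv b (\<lambda>x. (norm (x - y))\<^sup>2) x = 2 * ((x - y) \<bullet> b)"
  unfolding power2_norm_eq_inner
  by (rule partial_deriv_eq[THEN trans]) (auto intro!: derivative_eq_intros simp: inner_commute)

definition grad :: "('a::euclidean_space \<Rightarrow> real) \<Rightarrow> 'a \<Rightarrow> 'a" where
  "grad f x = (\<Sum>b\<in>Basis. partial_deriv b f x *\<^sub>R b)"

lemma grad_has_derivative:
  assumes "f differentiable (at x)"
  shows "(f has_derivative (\<lambda>h. grad f x \<bullet> h)) (at x)"
proof -
  obtain D where D: "(f has_derivative D) (at x)"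
    using assms differentiable_def by blast
  then interpret D: bounded_linear D by (rule has_derivative_bounded_linear)
  have "D h = grad f x \<bullet> h" for h
  proof -
    have "D h = D (\<Sum>b\<in>Basis. (h \<bullet> b) *\<^sub>R b)" by (simp add: euclidean_representation)
    also have "\<dots> = (\<Sum>b\<in>Basis. (h \<bullet> b) * D b)" by (simp add: D.sum D.scaleR)
    also have "\<dots> = grad f x \<bullet> h"
      unfolding grad_def inner_sum_left
      by (intro sum.cong) (auto simp: partial_deriv_eq[OF D] inner_commute)
    finally show ?thesis .
  qed
  then have "D = (\<lambda>h. grad f x \<bullet> h)" by auto
  with D show ?thesis by simp
qed

lemma grad_inner_Basis: "b \<in> Basis \<Longrightarrow> grad f x \<bullet> b = partial_deriv b f x"
  by (simp add: grad_def inner_sum_left inner_Basis if_distrib cong: if_cong)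

lemma grad_inner_grad: "grad f x \<bullet> grad g x = (\<Sum>b\<in>Basis. partial_deriv b f x * partial_deriv b g x)"
  by (subst euclidean_inner) (auto simp: grad_inner_Basis)

lemma has_derivative_grad_unique:
  assumes "(f has_derivative (\<lambda>h. a \<bullet> h)) (at x)"
  shows "grad f x = a"
proof -
  have "partial_deriv b f x = a \<bullet> b" for b using partial_deriv_eq[OF assms] .
  then show ?thesis by (simp add: grad_def euclidean_representation)
qed

section \<open>A smooth substitute for the positive part\<close>

text \<open>Polynomials in 1/x times exp (-1/x), extended by zero. The family is closed under
  differentiation, so a single derivative formula makes every member smooth.\<close>

definition flat_exp :: "real poly \<Rightarrow> real \<Rightarrow> real" where
  "flat_exp p x = (if x \<le> 0 then 0 else poly p (1 / x) * exp (- (1 / x)))"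

lemma tendsto_poly_exp_minus: "((\<lambda>x::real. poly p x * exp (- x)) \<longlongrightarrow> 0) at_top"
proof -
  have "((\<lambda>x::real. \<Sum>i\<le>degree p. coeff p i * (x ^ i / exp x)) \<longlongrightarrow> (\<Sum>i\<le>degree p. coeff p i * 0)) at_top"
    by (intro tendsto_intros tendsto_power_div_exp_0)
  moreover have "(\<lambda>x::real. poly p x * exp (- x)) = (\<lambda>x. \<Sum>i\<le>degree p. coeff p i * (x ^ i / exp x))"
    by (simp add: poly_altdef sum_distrib_right exp_minus divide_inverse mult.assoc)
  ultimately show ?thesis by simp
qed

lemma flat_exp_at_right: "((\<lambda>x. flat_exp p x) \<longlongrightarrow> 0) (at_right 0)"
proof -
  have "((\<lambda>x. poly p (inverse x) * exp (- inverse x)) \<longlongrightarrow> 0) (at_right (0::real))"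
    using filterlim_compose[OF tendsto_poly_exp_minus filterlim_inverse_at_top_right] .
  moreover have "\<forall>\<^sub>F x in at_right (0::real). poly p (inverse x) * exp (- inverse x) = flat_exp p x"
    unfolding eventually_at_right[OF zero_less_one] by (auto simp: flat_exp_def field_simps intro!: exI[of _ 1])
  ultimately show ?thesis using Lim_transform_eventually by blast
qed

lemma flat_exp_tendsto_0: "(flat_exp p \<longlongrightarrow> 0) (at 0)"
proof -
  have "(flat_exp p \<longlongrightarrow> 0) (at_left 0)"
    by (rule tendsto_eventually) (auto simp: flat_exp_def eventually_at_left[of "-1"] intro!: exI[of _ "-1"])
  then show ?thesis using flat_exp_at_right filterlim_split_at by blast
qed

text \<open>With y = 1/x, differentiating p(y) exp (-y) with respect to x gives y^2 (p - p')(y) exp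
  (-y), which explains the polynomial.\<close>

lemma flat_exp_deriv:
  "(flat_exp p has_real_derivative flat_exp ([:0, 0, 1:] * (p - pderiv p)) x) (at x)"
proof -
  consider "x < 0" | "x > 0" | "x = 0" by linarith
  then show ?thesis
  proof cases
    case 1
    have "((\<lambda>_. 0) has_real_derivative 0) (at x)" by simp
    then have "(flat_exp p has_real_derivative 0) (at x)"
      by (rule has_field_derivative_transform_within_open[of _ _ _ "{..<0}"]) (use 1 in \<open>auto simp: flat_exp_def\<close>)
    then show ?thesis using 1 by (simp add: flat_exp_def)
  next
    case 2
    have "((\<lambda>x. poly p (1 / x) * exp (- (1 / x))) has_real_derivative
        (poly p (1/x) * (exp (- (1/x)) * (1 / x\<^sup>2)) + poly (pderiv p) (1/x) * (- 1 / x\<^sup>2) * exp (- (1/x)))) (at x)"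
      using 2 by (auto intro!: derivative_eq_intros DERIV_chain2[OF poly_DERIV] simp: power2_eq_square)
    also have "(poly p (1/x) * (exp (- (1/x)) * (1 / x\<^sup>2)) + poly (pderiv p) (1/x) * (- 1 / x\<^sup>2) * exp (- (1/x)))
        = flat_exp ([:0, 0, 1:] * (p - pderiv p)) x"
      using 2 by (simp add: flat_exp_def field_simps power2_eq_square)
    finally show ?thesis
      by (rule has_field_derivative_transform_within_open[of _ _ _ "{0<..}"]) (use 2 in \<open>auto simp: flat_exp_def\<close>)
  next
    case 3
    \<comment> \<open>Dividing by the argument multiplies the polynomial by its variable, so the
      difference quotient at 0 is again a member of the family and tends to 0.\<close>
    have "(flat_exp ([:0, 1:] * p) \<longlongrightarrow> 0) (at 0)" by (rule flat_exp_tendsto_0)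
    moreover have "flat_exp ([:0, 1:] * p) = (\<lambda>y. (flat_exp p y - flat_exp p 0) / (y - 0))"
      by (auto simp: flat_exp_def fun_eq_iff)
    ultimately have "(flat_exp p has_real_derivative 0) (at 0)"
      unfolding has_field_derivative_iff by simp
    then show ?thesis using 3 by (simp add: flat_exp_def)
  qed
qed

text \<open>A smooth replacement for max 0 x: positive exactly where x is, nondecreasing, convex and
  1-Lipschitz. It lies outside the family \<open>flat_exp\<close> because of the factor x, but its
  derivative, (1 + y) exp (-y) with y = 1/x, lies inside.\<close>

definition soft_pos :: "real \<Rightarrow> real" where
  "soft_pos x = (if x \<le> 0 then 0 else x * exp (- (1 / x)))"

definition soft_pos' :: "real \<Rightarrow> real" where "soft_pos' = flat_exp [:1, 1:]"
definition soft_pos'' :: "real \<Rightarrow> real" where "soft_pos'' = flat_exp [:0, 0, 0, 1:]"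

lemma soft_pos_deriv: "(soft_pos has_real_derivative soft_pos' x) (at x)"
proof -
  consider "x < 0" | "x > 0" | "x = 0" by linarith
  then show ?thesis
  proof cases
    case 1
    have "((\<lambda>_. 0) has_real_derivative 0) (at x)" by simp
    then have "(soft_pos has_real_derivative 0) (at x)"
      by (rule has_field_derivative_transform_within_open[of _ _ _ "{..<0}"]) (use 1 in \<open>auto simp: soft_pos_def\<close>)
    then show ?thesis using 1 by (simp add: flat_exp_def soft_pos'_def)
  next
    case 2
    have "((\<lambda>x. x * exp (- (1 / x))) has_real_derivative soft_pos' x) (at x)"
      using 2 by (auto intro!: derivative_eq_intros simp: soft_pos'_def flat_exp_def power2_eq_square field_simps)
    then show ?thesis
      by (rule has_field_derivative_transform_within_open[of _ _ _ "{0<..}"]) (use 2 in \<open>auto simp: soft_pos_def\<close>)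
  next
    case 3
    have "(flat_exp [:1:] \<longlongrightarrow> 0) (at 0)" by (rule flat_exp_tendsto_0)
    moreover have "flat_exp [:1:] = (\<lambda>y. (soft_pos y - soft_pos 0) / (y - 0))"
      by (auto simp: flat_exp_def soft_pos_def fun_eq_iff)
    ultimately have "(soft_pos has_real_derivative 0) (at 0)"
      unfolding has_field_derivative_iff by simp
    then show ?thesis using 3 by (simp add: flat_exp_def soft_pos'_def)
  qed
qed

lemma soft_pos'_deriv: "(soft_pos' has_real_derivative soft_pos'' x) (at x)"
proof -
  have "[:0, 0, 1::real:] * ([:1, 1:] - pderiv [:1, 1:]) = [:0, 0, 0, 1:]"
    by (simp add: pderiv_pCons)
  then show ?thesis using flat_exp_deriv[of "[:1, 1:]" x] by (simp add: soft_pos'_def soft_pos''_def)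
qed

lemma smooth_flat_exp: "smooth f \<Longrightarrow> smooth (\<lambda>x. flat_exp p (f x))"
proof -
  define H where "H m = flat_exp (((\<lambda>p. [:0, 0, 1:] * (p - pderiv p)) ^^ m) p)" for m
  have "(H m has_real_derivative H (Suc m) x) (at x)" for m x
    unfolding H_def using flat_exp_deriv by simp
  then show "smooth f \<Longrightarrow> smooth (\<lambda>x. flat_exp p (f x))"
    using smooth_compose[of H f 0] by (simp add: H_def)
qed

lemma smooth_soft_pos: "smooth f \<Longrightarrow> smooth (\<lambda>x. soft_pos (f x))"
proof -
  define H where "H m = (case m of 0 \<Rightarrow> soft_pos
     | Suc m \<Rightarrow> flat_exp (((\<lambda>p. [:0, 0, 1:] * (p - pderiv p)) ^^ m) [:1, 1:]))" for m
  have "(H m has_real_derivative H (Suc m) x) (at x)" for m x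
    unfolding H_def using flat_exp_deriv soft_pos_deriv by (cases m) (simp_all add: soft_pos'_def)
  then show "smooth f \<Longrightarrow> smooth (\<lambda>x. soft_pos (f x))"
    using smooth_compose[of H f 0] by (simp add: H_def)
qed

lemma soft_pos_nonneg [simp]: "0 \<le> soft_pos x"
  by (simp add: soft_pos_def)

lemma soft_pos_pos_iff [simp]: "0 < soft_pos x \<longleftrightarrow> 0 < x"
  by (auto simp: soft_pos_def)

lemma soft_pos_eq_0_iff [simp]: "soft_pos x = 0 \<longleftrightarrow> x \<le> 0"
  by (auto simp: soft_pos_def)

lemma soft_pos_le: "0 \<le> x \<Longrightarrow> soft_pos x \<le> x"
  by (auto simp: soft_pos_def mult_le_cancel_left1)

lemma soft_pos'_bounds: "0 \<le> soft_pos' x" "soft_pos' x \<le> 1"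
proof -
  show "0 \<le> soft_pos' x" by (auto simp: soft_pos'_def flat_exp_def)
  have "(1 + y) * exp (- y) \<le> 1" for y :: real
    using exp_ge_add_one_self[of y] by (simp add: exp_minus field_simps)
  from this[of "1/x"] show "soft_pos' x \<le> 1" by (auto simp: soft_pos'_def flat_exp_def)
qed

lemma soft_pos''_nonneg: "0 \<le> soft_pos'' x"
  by (auto simp: soft_pos''_def flat_exp_def)

lemma soft_pos_lipschitz: "\<bar>soft_pos x - soft_pos y\<bar> \<le> \<bar>x - y\<bar>"
  using field_differentiable_bound[of UNIV soft_pos soft_pos' 1 x y] soft_pos'_bounds soft_pos_deriv
  by auto

text \<open>Takes the place of the identity between the square of the positive part and x times the
  positive part when a truncated difference is used as test function in an energy estimate.\<close>

lemma soft_pos_mult_ge: "soft_pos x * soft_pos x \<le> x * soft_pos x"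
proof (cases "x \<le> 0")
  case False
  then show ?thesis using soft_pos_le[of x] by (intro mult_right_mono) auto
qed (simp add: soft_pos_def)

lemma soft_pos_continuous: "continuous_on S soft_pos" "continuous_on S soft_pos'"
  using DERIV_isCont[OF soft_pos_deriv] DERIV_isCont[OF soft_pos'_deriv]
  by (auto intro: continuous_at_imp_continuous_on)

lemma soft_pos_measurable [measurable]: "soft_pos \<in> borel_measurable borel" "soft_pos' \<in> borel_measurable borel"
  using soft_pos_continuous borel_measurable_continuous_onI by auto

section \<open>Test functions\<close>

lemma test_function_smooth: "\<phi> \<in> test_functions \<Omega> \<Longrightarrow> smooth \<phi>"
  by (simp add: test_functions_def)

text \<open>Spares computing the support: a compact set is closed, hence contains the closure of the
  set where \<phi> is nonzero as soon as \<phi> vanishes outside it.\<close>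

lemma test_functionI:
  assumes "smooth \<phi>" "compact K" "K \<subseteq> \<Omega>" "\<And>x. x \<notin> K \<Longrightarrow> \<phi> x = 0"
  shows "\<phi> \<in> test_functions \<Omega>"
proof -
  have "closure {x. \<phi> x \<noteq> 0} \<subseteq> K"
    using assms by (intro closure_minimal) (auto intro: compact_imp_closed)
  then show ?thesis
    unfolding test_functions_def using assms closed_Int_compact[OF closed_closure, of K "{x. \<phi> x \<noteq> 0}"]
    by (simp add: inf.absorb1)
qed

lemma test_functionE:
  assumes "\<phi> \<in> test_functions \<Omega>"
  obtains K where "compact K" "K \<subseteq> \<Omega>" "\<And>x. x \<notin> K \<Longrightarrow> \<phi> x = 0"
proof (rule that[of "closure {x. \<phi> x \<noteq> 0}"])
  show "\<phi> x = 0" if "x \<notin> closure {x. \<phi> x \<noteq> 0}" for x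
    using that closure_subset[of "{x. \<phi> x \<noteq> 0}"] by auto
qed (use assms in \<open>auto simp: test_functions_def\<close>)

lemma test_functions_mono: "U \<subseteq> V \<Longrightarrow> test_functions U \<subseteq> test_functions V"
  by (auto simp: test_functions_def)

lemma test_function_outside: "\<phi> \<in> test_functions \<Omega> \<Longrightarrow> x \<notin> \<Omega> \<Longrightarrow> \<phi> x = 0"
  by (auto elim: test_functionE)

lemma test_function_zero [simp]: "(\<lambda>x. 0) \<in> test_functions \<Omega>"
  by (rule test_functionI[of _ "{}"]) auto

lemma test_function_add:
  assumes "\<phi> \<in> test_functions \<Omega>" "\<psi> \<in> test_functions \<Omega>"
  shows "(\<lambda>x. \<phi> x + \<psi> x) \<in> test_functions \<Omega>"
proof -
  obtain K where K: "compact K" "K \<subseteq> \<Omega>" "\<And>x. x \<notin> K \<Longrightarrow> \<phi> x = 0" using assms test_functionE by blast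
  obtain L where L: "compact L" "L \<subseteq> \<Omega>" "\<And>x. x \<notin> L \<Longrightarrow> \<psi> x = 0" using assms test_functionE by blast
  show ?thesis
    by (rule test_functionI[of _ "K \<union> L"]) (use K L assms in \<open>auto intro: smooth_add test_function_smooth\<close>)
qed

lemma test_function_mult:
  assumes "\<phi> \<in> test_functions \<Omega>" "smooth f"
  shows "(\<lambda>x. f x * \<phi> x) \<in> test_functions \<Omega>"
proof -
  obtain K where K: "compact K" "K \<subseteq> \<Omega>" "\<And>x. x \<notin> K \<Longrightarrow> \<phi> x = 0" using assms test_functionE by blast
  show ?thesis
    by (rule test_functionI[of _ K]) (use K assms in \<open>auto intro: smooth_mult test_function_smooth\<close>)
qed

lemma test_function_scale: "\<phi> \<in> test_functions \<Omega> \<Longrightarrow> (\<lambda>x. c * \<phi> x) \<in> test_functions \<Omega>"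
  using test_function_mult[of \<phi> \<Omega> "\<lambda>x. c"] by simp

lemma test_function_diff:
  "\<phi> \<in> test_functions \<Omega> \<Longrightarrow> \<psi> \<in> test_functions \<Omega> \<Longrightarrow> (\<lambda>x. \<phi> x - \<psi> x) \<in> test_functions \<Omega>"
  using test_function_add[of \<phi> \<Omega> "\<lambda>x. -1 * \<psi> x"] test_function_scale[of \<psi> \<Omega> "-1"] by simp

lemma test_function_sum:
  "(\<And>i. i \<in> I \<Longrightarrow> f i \<in> test_functions \<Omega>) \<Longrightarrow> (\<lambda>x. \<Sum>i\<in>I. f i x) \<in> test_functions \<Omega>"
  by (induction I rule: infinite_finite_induct) (auto intro: test_function_add)

lemma partial_deriv_zero_outside:
  assumes "closed K" "\<And>x. x \<notin> K \<Longrightarrow> \<phi> x = (0::real)" "x \<notin> K"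
  shows "partial_deriv b \<phi> x = 0"
proof -
  have "((\<lambda>x. 0) has_derivative (\<lambda>h. 0)) (at x)" by simp
  then have "(\<phi> has_derivative (\<lambda>h. 0)) (at x)"
    by (rule has_derivative_transform_within_open[of _ _ _ _ "-K"]) (use assms in auto)
  then show ?thesis using partial_deriv_eq by metis
qed

lemma test_function_partial_deriv:
  assumes "\<phi> \<in> test_functions \<Omega>" "b \<in> Basis"
  shows "partial_deriv b \<phi> \<in> test_functions \<Omega>"
proof -
  obtain K where K: "compact K" "K \<subseteq> \<Omega>" "\<And>x. x \<notin> K \<Longrightarrow> \<phi> x = 0" using assms test_functionE by blast
  show ?thesis
    by (rule test_functionI[of _ K])
      (use K assms in \<open>auto intro: smooth_partial_deriv test_function_smooth compact_imp_closed partial_deriv_zero_outside[where K=K]\<close>)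
qed

lemma test_function_laplacian: "\<phi> \<in> test_functions \<Omega> \<Longrightarrow> laplacian \<phi> \<in> test_functions \<Omega>"
  unfolding laplacian_def by (intro test_function_sum test_function_partial_deriv)

lemma test_function_continuous: "\<phi> \<in> test_functions \<Omega> \<Longrightarrow> continuous_on S \<phi>"
  by (auto dest: test_function_smooth smooth_continuous)

lemma test_function_differentiable: "\<phi> \<in> test_functions \<Omega> \<Longrightarrow> \<phi> differentiable (at x)"
  by (auto dest: test_function_smooth smooth_differentiable)

lemma test_function_measurable: "\<phi> \<in> test_functions \<Omega> \<Longrightarrow> \<phi> \<in> borel_measurable borel"
  by (auto dest: test_function_smooth smooth_borel_measurable)

lemma test_function_bounded:
  assumes "\<phi> \<in> test_functions \<Omega>"
  obtains C where "C > 0" "\<And>x. \<bar>\<phi> x\<bar> \<le> C"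
proof -
  obtain K where K: "compact K" "K \<subseteq> \<Omega>" "\<And>x. x \<notin> K \<Longrightarrow> \<phi> x = 0" using assms test_functionE by blast
  have "bounded (\<phi> ` K)"
    using K test_function_continuous[OF assms] by (intro compact_imp_bounded compact_continuous_image)
  then obtain C where C: "C > 0" "\<And>x. x \<in> K \<Longrightarrow> \<bar>\<phi> x\<bar> \<le> C"
    unfolding bounded_pos by auto
  show ?thesis using C K by (intro that[of C]) (metis abs_zero less_imp_le)+
qed

lemma integrable_continuous_compact_support:
  fixes f :: "'a::euclidean_space \<Rightarrow> 'b::{banach, second_countable_topology}"
  assumes "compact K" "continuous_on UNIV f" "\<And>x. x \<notin> K \<Longrightarrow> f x = 0"
  shows "integrable lborel f"
proof -
  have "integrable lborel (\<lambda>x. indicator K x *\<^sub>R f x)"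
    using borel_integrable_compact[OF assms(1), of f] assms(2) continuous_on_subset
    by (auto simp: set_integrable_def if_distrib intro: continuous_on_subset)
  also have "(\<lambda>x. indicator K x *\<^sub>R f x) = f"
    using assms(3) by (auto simp: indicator_def fun_eq_iff)
  finally show ?thesis .
qed

lemma test_function_integrable: "\<phi> \<in> test_functions \<Omega> \<Longrightarrow> integrable lborel \<phi>"
  by (metis integrable_continuous_compact_support test_functionE test_function_continuous)

section \<open>Differentiation under the integral and integration by parts\<close>

text \<open>Along any sequence tending to \<open>x0\<close> the difference quotients tend to 0
  pointwise, and the mean value inequality on the convex set \<open>U\<close> bounds them by
  \<open>2 * g\<close>; dominated convergence does the rest. A vector \<open>f'\<close> instead of a
  linear map allows the derivative itself to be integrated.\<close>

lemma has_derivative_integral: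
  fixes f :: "'b::euclidean_space \<Rightarrow> 'm \<Rightarrow> real"
  assumes U: "open U" "convex U" "x0 \<in> U"
    and d: "\<And>x m. x \<in> U \<Longrightarrow> m \<in> space M \<Longrightarrow> ((\<lambda>x. f x m) has_derivative (\<lambda>h. f' x m \<bullet> h)) (at x)"
    and b: "\<And>x m. x \<in> U \<Longrightarrow> m \<in> space M \<Longrightarrow> norm (f' x m) \<le> g m"
    and g: "integrable M g" and f: "\<And>x. x \<in> U \<Longrightarrow> integrable M (f x)"
    and f'[measurable]: "f' x0 \<in> borel_measurable M"
  shows "((\<lambda>x. \<integral>m. f x m \<partial>M) has_derivative (\<lambda>h. (\<integral>m. f' x0 m \<partial>M) \<bullet> h)) (at x0)"
proof -
  have f'i: "integrable M (f' x0)"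
    by (rule Bochner_Integration.integrable_bound[OF g]) (use b U(3) in \<open>fastforce intro!: AE_I2\<close>)+
  have lip: "\<bar>f x m - f x0 m\<bar> \<le> g m * norm (x - x0)" if "x \<in> U" "m \<in> space M" for x m
  proof -
    have "norm (f x m - f x0 m) \<le> g m * norm (x - x0)"
    proof (rule differentiable_bound[OF U(2), of "\<lambda>x. f x m" "\<lambda>x h. f' x m \<bullet> h"])
      show "((\<lambda>x. f x m) has_derivative (\<lambda>h. f' x m \<bullet> h)) (at x within U)" if "x \<in> U" for x
        using d[OF that \<open>m \<in> space M\<close>] has_derivative_at_withinI by blast
      show "onorm (\<lambda>h. f' x m \<bullet> h) \<le> g m" if "x \<in> U" for x
      proof (rule onorm_le)
        fix h
        have "norm (f' x m \<bullet> h) \<le> norm (f' x m) * norm h" by (simp add: Cauchy_Schwarz_ineq2)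
        also have "\<dots> \<le> g m * norm h" using b[OF that \<open>m \<in> space M\<close>] by (intro mult_right_mono) auto
        finally show "norm (f' x m \<bullet> h) \<le> g m * norm h" .
      qed
    qed (use that U in auto)
    then show ?thesis by simp
  qed
  define F where "F x = (\<integral>m. f x m \<partial>M)" for x
  define A where "A = (\<integral>m. f' x0 m \<partial>M)"
  have "((\<lambda>y. norm (F y - F x0 - A \<bullet> (y - x0)) / norm (y - x0)) \<longlongrightarrow> 0) (at x0)"
    unfolding tendsto_at_iff_sequentially
  proof (intro allI impI)
    fix X assume X: "\<forall>i. X i \<in> UNIV - {x0}" "X \<longlonglongrightarrow> x0"
    \<comment> \<open>The sequence enters \<open>U\<close> only eventually, whereas measurability
      and the bound by \<open>2 * g\<close> are required for every index; hence the default value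
      0.\<close>
    define q where "q i m = (if X i \<in> U then (f (X i) m - f x0 m - f' x0 m \<bullet> (X i - x0)) / norm (X i - x0) else 0)" for i m
    have ev: "\<forall>\<^sub>F i in sequentially. X i \<in> U" using X(2) U topological_tendstoD by blast
    have qm: "q i \<in> borel_measurable M" for i
      unfolding q_def using f[OF U(3)] f by (cases "X i \<in> U") auto
    have "(\<lambda>i. \<integral>m. q i m \<partial>M) \<longlonglongrightarrow> (\<integral>m. 0 \<partial>M)"
    proof (rule integral_dominated_convergence[where w="\<lambda>m. 2 * g m"])
      show "AE m in M. (\<lambda>i. q i m) \<longlonglongrightarrow> 0"
      proof (rule AE_I2)
        fix m assume m: "m \<in> space M"
        have "((\<lambda>y. norm (f y m - f x0 m - f' x0 m \<bullet> (y - x0)) / norm (y - x0)) \<longlongrightarrow> 0) (at x0)"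
          using d[OF U(3) m] has_derivative_iff_norm[of "\<lambda>x. f x m"] by simp
        then have "(\<lambda>i. norm (f (X i) m - f x0 m - f' x0 m \<bullet> (X i - x0)) / norm (X i - x0)) \<longlonglongrightarrow> 0"
          unfolding tendsto_at_iff_sequentially using X by (auto simp: o_def)
        then have "(\<lambda>i. norm (f (X i) m - f x0 m - f' x0 m \<bullet> (X i - x0)) / norm (X i - x0)) \<longlonglongrightarrow> 0 
           \<and> (\<forall>\<^sub>F i in sequentially. norm (f (X i) m - f x0 m - f' x0 m \<bullet> (X i - x0)) / norm (X i - x0) = norm (q i m))"
          using ev by (auto elim!: eventually_mono simp: q_def)
        then have "(\<lambda>i. norm (q i m)) \<longlonglongrightarrow> 0" by (elim conjE Lim_transform_eventually)
        then show "(\<lambda>i. q i m) \<longlonglongrightarrow> 0" by (rule tendsto_norm_zero_cancel)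
      qed
      show "AE m in M. norm (q i m) \<le> 2 * g m" for i
      proof (rule AE_I2)
        fix m assume m: "m \<in> space M"
        show "norm (q i m) \<le> 2 * g m"
        proof (cases "X i \<in> U")
          case True
          have ne: "norm (X i - x0) > 0" using X by auto
          have "\<bar>f' x0 m \<bullet> (X i - x0)\<bar> \<le> norm (f' x0 m) * norm (X i - x0)" by (simp add: Cauchy_Schwarz_ineq2)
          also have "\<dots> \<le> g m * norm (X i - x0)" using b[OF U(3) m] by (intro mult_right_mono) auto
          finally have "\<bar>f (X i) m - f x0 m - f' x0 m \<bullet> (X i - x0)\<bar> \<le> 2 * g m * norm (X i - x0)"
            using lip[OF True m] by linarith
          then show ?thesis using True ne by (simp add: q_def divide_simps)
        next
          case False
          then show ?thesis using order_trans[OF norm_ge_zero b[OF U(3) m]] by (simp add: q_def)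
        qed
      qed
    qed (use g qm in auto)
    then have "(\<lambda>i. norm (\<integral>m. q i m \<partial>M)) \<longlonglongrightarrow> 0" by (simp del: real_norm_def add: tendsto_norm_zero)
    moreover have "\<forall>\<^sub>F i in sequentially. norm (\<integral>m. q i m \<partial>M) = norm (F (X i) - F x0 - A \<bullet> (X i - x0)) / norm (X i - x0)"
      using ev
    proof eventually_elim
      case (elim i)
      have "(\<integral>m. q i m \<partial>M) = (F (X i) - F x0 - A \<bullet> (X i - x0)) / norm (X i - x0)"
      proof -
        have "(\<integral>m. q i m \<partial>M) = (\<integral>m. (f (X i) m - f x0 m - f' x0 m \<bullet> (X i - x0)) / norm (X i - x0) \<partial>M)"
          unfolding q_def using elim by simp
        also have "\<dots> = (\<integral>m. f (X i) m - f x0 m - f' x0 m \<bullet> (X i - x0) \<partial>M) / norm (X i - x0)"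
          by (rule integral_divide_zero)
        also have "(\<integral>m. f (X i) m - f x0 m - f' x0 m \<bullet> (X i - x0) \<partial>M) = F (X i) - F x0 - A \<bullet> (X i - x0)"
          unfolding F_def A_def
          using f[OF elim] f[OF U(3)] f'i by (simp add: Bochner_Integration.integrable_diff)
        finally show ?thesis .
      qed
      then show ?case by simp
    qed
    ultimately show "((\<lambda>y. norm (F y - F x0 - A \<bullet> (y - x0)) / norm (y - x0)) \<circ> X) \<longlonglongrightarrow> 0"
      unfolding o_def by (rule Lim_transform_eventually)
  qed
  then show ?thesis
    unfolding has_derivative_iff_norm F_def[symmetric] A_def[symmetric] by (auto intro: bounded_linear_inner_right)
qed

lemma grad_measurable: "smooth f \<Longrightarrow> grad f \<in> borel_measurable borel"
  unfolding grad_def by (intro borel_measurable_sum borel_measurable_scaleR borel_measurable_const smooth_borel_measurable smooth_partial_deriv)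

lemma grad_continuous: "smooth f \<Longrightarrow> continuous_on S (grad f)"
  unfolding grad_def by (intro continuous_intros smooth_continuous smooth_partial_deriv)

lemma test_function_grad_bounded:
  assumes "\<phi> \<in> test_functions \<Omega>"
  obtains C where "C > 0" "\<And>x. norm (grad \<phi> x) \<le> C"
proof -
  have "\<exists>C. \<forall>x. \<bar>partial_deriv b \<phi> x\<bar> \<le> C" if "b \<in> Basis" for b
    using test_function_bounded[OF test_function_partial_deriv[OF assms that]] by metis
  then obtain C where C: "\<And>b x. b \<in> Basis \<Longrightarrow> \<bar>partial_deriv b \<phi> x\<bar> \<le> C b" by metis
  have "norm (grad \<phi> x) \<le> (\<Sum>b\<in>Basis. C b)" for x
    unfolding grad_def by (rule sum_norm_le) (use C in auto)
  then have "norm (grad \<phi> x) \<le> \<bar>\<Sum>b\<in>Basis. C b\<bar> + 1" for x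
    by (smt (verit))
  then show ?thesis using that[of "\<bar>\<Sum>b\<in>Basis. C b\<bar> + 1"] by (auto simp: add_nonneg_pos)
qed

section \<open>Averages of a test function over shifts by a random vector\<close>

context
  fixes M :: "'m measure" and Y :: "'m \<Rightarrow> 'a::euclidean_space"
  assumes fin: "finite_measure M" and Y[measurable]: "Y \<in> borel_measurable M"
begin

lemma integrable_average:
  assumes "\<phi> \<in> test_functions UNIV"
  shows "integrable M (\<lambda>m. \<phi> (x - Y m))"
proof -
  obtain C where C: "C > 0" "\<And>x. \<bar>\<phi> x\<bar> \<le> C" using test_function_bounded[OF assms] by blast
  have [measurable]: "\<phi> \<in> borel_measurable borel" using test_function_measurable[OF assms] .
  show ?thesis
    by (rule finite_measure.integrable_const_bound[OF fin, of _ C]) (use C in auto)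
qed

lemma average_has_derivative:
  assumes "\<phi> \<in> test_functions UNIV"
  shows "((\<lambda>x. \<integral>m. \<phi> (x - Y m) \<partial>M) has_derivative (\<lambda>h. (\<integral>m. grad \<phi> (x - Y m) \<partial>M) \<bullet> h)) (at x)"
proof -
  obtain C where C: "C > 0" "\<And>x. norm (grad \<phi> x) \<le> C" using test_function_grad_bounded[OF assms] by blast
  have [measurable]: "grad \<phi> \<in> borel_measurable borel"
    using grad_measurable test_function_smooth assms by blast
  show ?thesis
  proof (rule has_derivative_integral[of UNIV _ _ _ _ "\<lambda>m. C"])
    show "((\<lambda>x. \<phi> (x - Y m)) has_derivative (\<lambda>h. grad \<phi> (x - Y m) \<bullet> h)) (at x)" for x m
      by (rule has_derivative_compose[of "\<lambda>x. x - Y m" "\<lambda>h. h" _ _ \<phi>])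
        (auto intro!: derivative_eq_intros grad_has_derivative test_function_differentiable[OF assms])
    show "integrable M (\<lambda>m. C)" using fin by (simp add: finite_measure.integrable_const)
  qed (use C integrable_average[OF assms] in auto)
qed

lemma partial_deriv_average:
  assumes "\<phi> \<in> test_functions UNIV" "b \<in> Basis"
  shows "partial_deriv b (\<lambda>x. \<integral>m. \<phi> (x - Y m) \<partial>M) x = (\<integral>m. partial_deriv b \<phi> (x - Y m) \<partial>M)"
proof -
  obtain C where C: "C > 0" "\<And>x. norm (grad \<phi> x) \<le> C" using test_function_grad_bounded[OF assms(1)] by blast
  have [measurable]: "grad \<phi> \<in> borel_measurable borel"
    using grad_measurable test_function_smooth assms by blast
  have "integrable M (\<lambda>m. grad \<phi> (x - Y m))"
    by (rule finite_measure.integrable_const_bound[OF fin, of _ C]) (use C in auto)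
  then have "(\<integral>m. grad \<phi> (x - Y m) \<partial>M) \<bullet> b = (\<integral>m. grad \<phi> (x - Y m) \<bullet> b \<partial>M)"
    by (simp add: integral_inner_left)
  then show ?thesis
    using partial_deriv_eq[OF average_has_derivative[OF assms(1)], of b x] assms(2) by (simp add: grad_inner_Basis)
qed

text \<open>Every derivative falls on \<phi>, and its partial derivatives are test functions again,
  so induction on the order works. The measure and the shift are general in order to cover both the
  mollification of an indicator and the averaging over heat kernels in
  \<open>space_resolvent\<close>.\<close>

lemma smooth_average:
  assumes "\<phi> \<in> test_functions UNIV"
  shows "smooth (\<lambda>x. \<integral>m. \<phi> (x - Y m) \<partial>M)"
proof -
  have diff: "(\<lambda>x. \<integral>m. \<phi> (x - Y m) \<partial>M) differentiable_on UNIV" if "\<phi> \<in> test_functions UNIV" for \<phi>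
    using average_has_derivative[OF that] unfolding differentiable_on_def differentiable_def by blast
  have "C_diff k (\<lambda>x. \<integral>m. \<phi> (x - Y m) \<partial>M)" for k
    using assms
  proof (induction k arbitrary: \<phi>)
    case 0
    then show ?case using diff differentiable_imp_continuous_on by auto
  next
    case (Suc k)
    have "C_diff k (partial_deriv b (\<lambda>x. \<integral>m. \<phi> (x - Y m) \<partial>M))" if "b \<in> Basis" for b
    proof -
      have "partial_deriv b (\<lambda>x. \<integral>m. \<phi> (x - Y m) \<partial>M) = (\<lambda>x. \<integral>m. partial_deriv b \<phi> (x - Y m) \<partial>M)"
        by (intro ext partial_deriv_average Suc.prems that)
      then show ?thesis using Suc.IH[OF test_function_partial_deriv[OF Suc.prems that]] by simp
    qed
    then show ?case using diff[OF Suc.prems] by simp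
  qed
  then show ?thesis by (simp add: smooth_def)
qed

end

lemma lborel_integral_translate:
  fixes f :: "'a::euclidean_space \<Rightarrow> 'b::{banach, second_countable_topology}"
  assumes [measurable]: "f \<in> borel_measurable borel"
  shows "(\<integral>x. f (c + x) \<partial>lborel) = (\<integral>x. f x \<partial>lborel)"
proof -
  have "(\<integral>x. f x \<partial>lborel) = (\<integral>x. f x \<partial>(distr lborel borel ((+) c)))"
    by (simp add: lborel_distr_plus)
  also have "\<dots> = (\<integral>x. f (c + x) \<partial>lborel)" by (rule integral_distr) auto
  finally show ?thesis by simp
qed

lemma lborel_distr_reflect: "distr lborel borel (\<lambda>y. x - y) = (lborel :: 'a::euclidean_space measure)"
  using lborel_affine[of "-1" x] by (simp add: density_1)

lemma lborel_integral_reflect: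
  fixes f :: "'a::euclidean_space \<Rightarrow> 'b::{banach, second_countable_topology}"
  assumes [measurable]: "f \<in> borel_measurable borel"
  shows "(\<integral>y. f (x - y) \<partial>lborel) = (\<integral>y. f y \<partial>lborel)"
proof -
  have "(\<integral>y. f y \<partial>lborel) = (\<integral>y. f y \<partial>(distr lborel borel (\<lambda>y. x - y)))"
    by (simp add: lborel_distr_reflect)
  also have "\<dots> = (\<integral>y. f (x - y) \<partial>lborel)" by (subst integral_distr) auto
  finally show ?thesis by simp
qed

lemma lborel_integrable_reflect:
  fixes f :: "'a::euclidean_space \<Rightarrow> 'b::{banach, second_countable_topology}"
  assumes "integrable lborel f"
  shows "integrable lborel (\<lambda>y. f (x - y))"
proof -
  have [measurable]: "f \<in> borel_measurable borel" using assms borel_measurable_integrable by fastforce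
  have "integrable (distr lborel borel (\<lambda>y. x - y)) f" using assms by (simp add: lborel_distr_reflect)
  then show ?thesis by (subst (asm) integrable_distr_eq) auto
qed

lemma open_null_lborel_empty:
  fixes U :: "'a::euclidean_space set"
  assumes "open U" "U \<in> null_sets lborel"
  shows "U = {}"
proof (rule ccontr)
  assume "U \<noteq> {}"
  then obtain a where a: "a \<in> U" by blast
  then obtain e where "e > 0" "ball a e \<subseteq> U" using assms(1) openE by blast
  moreover have "negligible U" using assms(2) null_sets_completionI negligible_iff_null_sets by blast
  ultimately show False using open_not_negligible[OF assms(1)] a by auto
qed

text \<open>By translation invariance the integral of f (s b + x) over x does not depend on s.
  Differentiating under the integral at s = 0 gives the claim, with no iterated integration.\<close>

lemma integral_partial_deriv_eq_0:
  fixes f :: "'a::euclidean_space \<Rightarrow> real"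
  assumes f: "C_diff 1 f" and K: "compact K" "\<And>x. x \<notin> K \<Longrightarrow> f x = 0" and bb: "b \<in> Basis"
  shows "(\<integral>x. partial_deriv b f x \<partial>lborel) = 0"
proof -
  have dif: "f differentiable (at x)" for x
    using f by (auto intro: differentiable_on_UNIV_at)
  have cont: "continuous_on UNIV f" "continuous_on UNIV (partial_deriv b f)"
    using f bb by (auto intro: differentiable_imp_continuous_on)
  have [measurable]: "f \<in> borel_measurable borel" "partial_deriv b f \<in> borel_measurable borel"
    using cont borel_measurable_continuous_onI by auto
  have out: "partial_deriv b f x = 0" if "x \<notin> K" for x
    using that K partial_deriv_zero_outside compact_imp_closed by blast
  have "bounded (partial_deriv b f ` K)"
    using K cont by (intro compact_imp_bounded compact_continuous_image) (auto intro: continuous_on_subset)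
  then obtain C where C: "C > 0" "\<And>x. x \<in> K \<Longrightarrow> \<bar>partial_deriv b f x\<bar> \<le> C"
    unfolding bounded_pos by auto
  then have C': "\<bar>partial_deriv b f x\<bar> \<le> C" for x
    using out[of x] by (cases "x \<in> K") auto
  obtain R where R: "\<And>x. x \<in> K \<Longrightarrow> norm x \<le> R"
    using compact_imp_bounded[OF K(1)] unfolding bounded_pos by auto
  have "((\<lambda>s. \<integral>x. f (s *\<^sub>R b + x) \<partial>lborel) has_derivative (\<lambda>h. (\<integral>x. partial_deriv b f (0 *\<^sub>R b + x) \<partial>lborel) \<bullet> h)) (at (0::real))"
  \<comment> \<open>Shifts of length below 1 move the support from the ball of radius
    \<open>R\<close> into the ball of radius \<open>R + 1\<close>, which gives the dominating
    function.\<close>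
  proof (rule has_derivative_integral[where U="ball 0 1" and f'="\<lambda>s x. partial_deriv b f (s *\<^sub>R b + x)"
        and g = "\<lambda>x. C * indicator (cball 0 (R + 1)) x"])
    fix s :: real and x :: 'a
    have "((\<lambda>s. f (s *\<^sub>R b + x)) has_derivative (\<lambda>h. grad f (s *\<^sub>R b + x) \<bullet> (h *\<^sub>R b))) (at s)"
      by (rule has_derivative_compose[of "\<lambda>s. s *\<^sub>R b + x" _ _ _ f])
        (auto intro!: derivative_eq_intros grad_has_derivative dif)
    then show "((\<lambda>s. f (s *\<^sub>R b + x)) has_derivative (\<lambda>h. partial_deriv b f (s *\<^sub>R b + x) \<bullet> h)) (at s)"
      using bb by (simp add: grad_inner_Basis mult.commute)
    assume s: "s \<in> ball 0 1"
    show "norm (partial_deriv b f (s *\<^sub>R b + x)) \<le> C * indicator (cball 0 (R + 1)) x"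
    proof (cases "s *\<^sub>R b + x \<in> K")
      case True
      have "norm x \<le> norm (s *\<^sub>R b + x) + norm (s *\<^sub>R b)"
        using norm_triangle_ineq4[of "s *\<^sub>R b + x" "s *\<^sub>R b"] by simp
      also have "\<dots> \<le> R + 1" using R[OF True] s bb by auto
      finally show ?thesis using C' by (auto simp: indicator_def)
    next
      case False
      then show ?thesis using out C by (auto simp: indicator_def)
    qed
  next
    fix s :: real assume s: "s \<in> ball 0 1"
    have "integrable lborel (\<lambda>x. f (s *\<^sub>R b + x))"
    proof (rule integrable_continuous_compact_support[of "(+) (- (s *\<^sub>R b)) ` K"])
      show "compact ((+) (- (s *\<^sub>R b)) ` K)" using K(1) by (rule compact_translation)
      show "f (s *\<^sub>R b + x) = 0" if "x \<notin> (+) (- (s *\<^sub>R b)) ` K" for x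
        using that by (intro K) (force simp: image_iff)
    qed (auto intro!: continuous_intros continuous_on_compose2[OF cont(1)])
    then show "integrable lborel (\<lambda>x. f (s *\<^sub>R b + x))" .
  qed (use emeasure_compact_finite[of "cball (0::'a) (R + 1)"] in
      \<open>auto intro!: integrable_mult_right simp: integrable_indicator_iff\<close>)
  moreover have "(\<lambda>s. \<integral>x. f (s *\<^sub>R b + x) \<partial>lborel) = (\<lambda>s. \<integral>x. f x \<partial>lborel)"
    by (auto simp: lborel_integral_translate)
  ultimately have "((\<lambda>s::real. \<integral>x. f x \<partial>lborel) has_derivative (\<lambda>h. (\<integral>x. partial_deriv b f x \<partial>lborel) * h)) (at (0::real))"
    by simp
  moreover have "((\<lambda>s::real. \<integral>x. f x \<partial>lborel) has_derivative (\<lambda>h. 0)) (at (0::real))" by simp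
  ultimately have "(\<lambda>h. (\<integral>x. partial_deriv b f x \<partial>lborel) * h) = (\<lambda>h::real. 0)"
    using has_derivative_unique by blast
  then show ?thesis by (metis mult.right_neutral)
qed

text \<open>The product rule reduces this to the vanishing of the integral of a derivative, and for
  that it is enough that one factor has compact support. With \<open>C_diff 1\<close> the other
  factor may be a cosine, a sine, or the quotient by a positive solution that occurs in the strict
  comparison.\<close>

lemma integration_by_parts:
  fixes f g :: "'a::euclidean_space \<Rightarrow> real"
  assumes f: "C_diff 1 f" and g: "C_diff 1 g" and K: "compact K" "\<And>x. x \<notin> K \<Longrightarrow> f x = 0" and b: "b \<in> Basis"
  shows "(\<integral>x. f x * partial_deriv b g x \<partial>lborel) = - (\<integral>x. partial_deriv b f x * g x \<partial>lborel)"
proof -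
  have dif: "f differentiable (at x)" "g differentiable (at x)" for x
    using f g by (auto intro: differentiable_on_UNIV_at)
  have cont: "continuous_on UNIV f" "continuous_on UNIV g" "continuous_on UNIV (partial_deriv b f)" "continuous_on UNIV (partial_deriv b g)"
    using f g b by (auto intro: differentiable_imp_continuous_on)
  have out: "partial_deriv b f x = 0" if "x \<notin> K" for x
    using that K partial_deriv_zero_outside compact_imp_closed by blast
  have i: "integrable lborel (\<lambda>x. f x * partial_deriv b g x)" "integrable lborel (\<lambda>x. partial_deriv b f x * g x)"
    using K out cont by (auto intro!: integrable_continuous_compact_support[OF K(1)] continuous_on_mult)
  have "0 = (\<integral>x. partial_deriv b (\<lambda>x. f x * g x) x \<partial>lborel)"
    by (rule integral_partial_deriv_eq_0[OF C_diff_mult[OF f g] K(1) _ b, symmetric]) (simp add: K)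
  also have "\<dots> = (\<integral>x. f x * partial_deriv b g x + partial_deriv b f x * g x \<partial>lborel)"
    using dif by (simp add: partial_deriv_mult)
  also have "\<dots> = (\<integral>x. f x * partial_deriv b g x \<partial>lborel) + (\<integral>x. partial_deriv b f x * g x \<partial>lborel)"
    by (rule Bochner_Integration.integral_add[OF i])
  finally show ?thesis by simp
qed

lemma integral_grad_grad:
  assumes "smooth f" "\<phi> \<in> test_functions \<Omega>"
  shows "(\<integral>x. grad f x \<bullet> grad \<phi> x \<partial>lborel) = - (\<integral>x. f x * laplacian \<phi> x \<partial>lborel)"
proof -
  obtain K where K: "compact K" "K \<subseteq> \<Omega>" "\<And>x. x \<notin> K \<Longrightarrow> \<phi> x = 0" using assms test_functionE by blast
  have s: "smooth \<phi>" using assms test_function_smooth by blast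
  have out: "partial_deriv b \<phi> x = 0" if "x \<notin> K" for x b
    using that K partial_deriv_zero_outside compact_imp_closed by blast
  have out2: "partial_deriv b (partial_deriv b \<phi>) x = 0" if "x \<notin> K" for x b
    by (rule partial_deriv_zero_outside[OF compact_imp_closed[OF K(1)] out that])
  have i: "integrable lborel (\<lambda>x. partial_deriv b f x * partial_deriv b \<phi> x)"
          "integrable lborel (\<lambda>x. f x * partial_deriv b (partial_deriv b \<phi>) x)" if "b \<in> Basis" for b
    using K out out2 that by (auto intro!: integrable_continuous_compact_support[OF K(1)] smooth_continuous smooth_mult
       smooth_partial_deriv assms s)
  have "(\<integral>x. grad f x \<bullet> grad \<phi> x \<partial>lborel) = (\<Sum>b\<in>Basis. \<integral>x. partial_deriv b f x * partial_deriv b \<phi> x \<partial>lborel)"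
    unfolding grad_inner_grad by (rule Bochner_Integration.integral_sum) (use i in auto)
  also have "\<dots> = (\<Sum>b\<in>Basis. \<integral>x. partial_deriv b \<phi> x * partial_deriv b f x \<partial>lborel)"
    by (simp add: mult.commute)
  also have "\<dots> = (\<Sum>b\<in>Basis. - (\<integral>x. partial_deriv b (partial_deriv b \<phi>) x * f x \<partial>lborel))"
    by (intro sum.cong refl integration_by_parts[OF smooth_C_diff[OF smooth_partial_deriv[OF s]]
          smooth_C_diff[OF assms(1)] K(1) out])
  also have "\<dots> = - (\<integral>x. f x * laplacian \<phi> x \<partial>lborel)"
    unfolding laplacian_def sum_distrib_left
    by (subst Bochner_Integration.integral_sum) (use i in \<open>auto simp: sum_negf mult.commute\<close>)
  finally show ?thesis .
qed

section \<open>Bump functions and positive distributions\<close>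

lemma exists_bump:
  assumes "\<delta> > 0"
  obtains \<eta> :: "'a::euclidean_space \<Rightarrow> real" where "\<eta> \<in> test_functions UNIV" "\<And>x. 0 \<le> \<eta> x"
    "\<And>x. norm x \<ge> \<delta> \<Longrightarrow> \<eta> x = 0" "(\<integral>x. \<eta> x \<partial>lborel) = 1"
proof -
  define q where "q x = soft_pos (\<delta>\<^sup>2 - (norm (x - 0))\<^sup>2)" for x :: 'a
  have q0: "q x = 0 \<longleftrightarrow> \<delta> \<le> norm x" for x
    using assms by (auto simp: q_def power_mono_iff)
  have qt: "q \<in> test_functions UNIV"
  proof (rule test_functionI[of _ "cball 0 \<delta>"])
    show "smooth q" unfolding q_def by (intro smooth_soft_pos smooth_diff smooth_const smooth_dist_square)
    show "q x = 0" if "x \<notin> cball 0 \<delta>" for x using that by (auto simp: q0)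
  qed auto
  have "(\<integral>x. q x \<partial>lborel) \<noteq> 0"
  proof
    assume "(\<integral>x. q x \<partial>lborel) = 0"
    then have "AE x in lborel. q x = 0"
      using integral_nonneg_eq_0_iff_AE[OF test_function_integrable[OF qt]] by (fastforce simp: q_def[abs_def])
    then have "AE x in lborel. x \<notin> ball (0::'a) \<delta>" by eventually_elim (auto simp: q0)
    then have "ball 0 \<delta> \<in> null_sets (lborel :: 'a measure)"
      by (simp add: AE_iff_null_sets)
    then show False using assms open_null_lborel_empty[of "ball (0::'a) \<delta>"] by auto
  qed
  moreover have "(\<integral>x. q x \<partial>lborel) \<ge> 0" by (simp add: q_def)
  ultimately show thesis
    using q0 by (intro that[of "\<lambda>x. (1 / (\<integral>x. q x \<partial>lborel)) * q x"] test_function_scale[OF qt]) (auto simp: q_def)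
qed

text \<open>The indicator of the closed \<open>\<delta> n\<close>-neighbourhood of \<open>K\<close>
  is mollified by a bump of radius \<open>\<delta> n\<close>. The result is 1 on \<open>K\<close>,
  lies between 0 and 1, and vanishes at distance more than \<open>2 * \<delta> n\<close> from
  \<open>K\<close>.\<close>

lemma approx_indicator_compact:
  fixes K :: "'a::euclidean_space set"
  assumes K: "compact K" "K \<subseteq> \<Omega>" and "open \<Omega>"
  obtains ch where "\<And>n::nat. ch n \<in> test_functions \<Omega>" "\<And>n x. 0 \<le> ch n x" "\<And>n x. ch n x \<le> 1"
    "\<And>x. (\<lambda>n. ch n x) \<longlonglongrightarrow> indicator K x"
proof (cases "K = {}")
  case True
  then show ?thesis by (intro that[of "\<lambda>n x. 0"]) auto
next
  case ne: False
  obtain e where e: "e > 0" "{x. infdist x K \<le> e} \<subseteq> \<Omega>"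
    using compact_in_open_separated[OF ne K(1) assms(3) K(2)] by metis
  \<comment> \<open>The half makes the doubled radius at most \<open>e\<close>, so that all supports
    stay in \<Omega>.\<close>
  define \<delta> where "\<delta> n = e / 2 / real (Suc n)" for n
  have \<delta>: "\<delta> n > 0" "2 * \<delta> n \<le> e" for n
    using e by (auto simp: \<delta>_def field_simps)
  have "\<exists>\<eta>::'a \<Rightarrow> real. \<eta> \<in> test_functions UNIV \<and> (\<forall>x. 0 \<le> \<eta> x) \<and> (\<forall>x. norm x \<ge> \<delta> n \<longrightarrow> \<eta> x = 0) \<and> (\<integral>x. \<eta> x \<partial>lborel) = 1" for n
    using exists_bump[OF \<delta>(1)[of n]] by metis
  then obtain \<eta> where \<eta>: "\<And>n. \<eta> n \<in> test_functions UNIV" "\<And>n x. 0 \<le> \<eta> n x"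
    "\<And>n x. norm (x::'a) \<ge> \<delta> n \<Longrightarrow> \<eta> n x = 0" "\<And>n. (\<integral>x. \<eta> n x \<partial>lborel) = 1" by metis
  have [measurable]: "\<eta> n \<in> borel_measurable borel" for n using \<eta>(1) test_function_measurable by blast
  define N where "N n = {x. infdist x K \<le> \<delta> n}" for n
  have Nc: "compact (N n)" "compact {x. infdist x K \<le> 2 * \<delta> n}" for n
    unfolding N_def using compact_infdist_le[OF ne K(1)] \<delta> by auto
  then have [measurable]: "N n \<in> sets borel" for n by (auto intro: borel_closed compact_imp_closed)
  have fin: "emeasure lborel (N n) < \<infinity>" for n
    using Nc by (intro emeasure_compact_finite)
  define M where "M n = density lborel (\<lambda>x::'a. ennreal (indicator (N n) x))" for n
  define ch where "ch n x = (\<integral>y. \<eta> n (x - y) \<partial>M n)" for n x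
  have fm: "finite_measure (M n)" for n
    unfolding M_def using fin[of n] by (intro finite_measureI) (simp add: emeasure_density ennreal_indicator)
  have ch_eq: "ch n x = (\<integral>y. indicator (N n) y * \<eta> n (x - y) \<partial>lborel)" for n x
    unfolding ch_def M_def
    by (subst integral_density) auto
  have int: "integrable lborel (\<lambda>y. \<eta> n (x - y))" for n x
    using \<eta>(1) lborel_integrable_reflect test_function_integrable by blast
  have inti: "integrable lborel (\<lambda>y. indicator (N n) y * \<eta> n (x - y))" for n x
    using integrable_mult_indicator[OF _ int, of "N n" n x] by simp
  have ch0: "ch n x = 0" if "infdist x K > 2 * \<delta> n" for n x
  proof -
    have "indicator (N n) y * \<eta> n (x - y) = 0" for y
    proof (cases "y \<in> N n")
      case True
      have "infdist x K \<le> infdist y K + dist x y" by (rule infdist_triangle)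
      then have "norm (x - y) \<ge> \<delta> n" using that True by (simp add: N_def dist_norm)
      then show ?thesis using \<eta>(3) by simp
    qed simp
    then show ?thesis unfolding ch_eq by (intro integral_eq_zero_AE AE_I2)
  qed
  have ch1: "ch n x = 1" if "x \<in> K" for n x
  proof -
    have "indicator (N n) y * \<eta> n (x - y) = \<eta> n (x - y)" for y
    proof (cases "y \<in> N n")
      case False
      have "infdist y K \<le> dist y x" using that by (rule infdist_le)
      then have "norm (x - y) \<ge> \<delta> n" using False by (simp add: N_def dist_norm norm_minus_commute)
      then show ?thesis using \<eta>(3) by simp
    qed simp
    then have "ch n x = (\<integral>y. \<eta> n (x - y) \<partial>lborel)"
      unfolding ch_eq by (intro Bochner_Integration.integral_cong refl)
    then show ?thesis by (simp add: lborel_integral_reflect \<eta>(4))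
  qed
  show ?thesis
  proof (rule that[of ch])
    fix n
    show "ch n \<in> test_functions \<Omega>"
    proof (rule test_functionI[OF _ Nc(2)[of n]])
      show "smooth (ch n)" unfolding ch_def
        by (rule smooth_average[OF fm _ \<eta>(1)]) (simp add: M_def)
      show "{x. infdist x K \<le> 2 * \<delta> n} \<subseteq> \<Omega>" using e(2) \<delta>(2)[of n] by auto
    qed (use ch0 in auto)
    fix x
    show "0 \<le> ch n x" unfolding ch_eq by (intro integral_nonneg_AE) (auto simp: \<eta>(2))
    have "ch n x \<le> (\<integral>y. \<eta> n (x - y) \<partial>lborel)"
      unfolding ch_eq using inti int by (intro integral_mono) (auto simp: indicator_def \<eta>(2))
    then show "ch n x \<le> 1" by (simp add: lborel_integral_reflect \<eta>(4))
  next
    fix x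
    show "(\<lambda>n. ch n x) \<longlonglongrightarrow> indicator K x"
    proof (cases "x \<in> K")
      case True
      then show ?thesis using ch1 by simp
    next
      case False
      then have "infdist x K > 0"
        using K ne by (simp add: compact_imp_closed infdist_pos_not_in_closed)
      moreover have "(\<lambda>n. 2 * \<delta> n) \<longlonglongrightarrow> 0"
      proof -
        have "(\<lambda>n. 2 * \<delta> n) = (\<lambda>n. e / real (Suc n))" by (auto simp: \<delta>_def field_simps)
        then show ?thesis using LIMSEQ_Suc[OF lim_const_over_n[of e]] by simp
      qed
      ultimately have "\<forall>\<^sub>F n in sequentially. 2 * \<delta> n < infdist x K"
        using order_tendstoD(2) by blast
      then have "\<forall>\<^sub>F n in sequentially. ch n x = 0" by eventually_elim (simp add: ch0)
      then show ?thesis using False by (simp add: tendsto_eventually)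
    qed
  qed
qed

text \<open>On a compact subset of the set where f is negative, testing with approximations of its
  indicator shows in the limit that the integral of f is nonnegative, so the subset is a null set.
  Inner regularity passes from these subsets to the whole set.\<close>

lemma positive_distribution_AE_nonneg:
  fixes f :: "'a::euclidean_space \<Rightarrow> real"
  assumes "open \<Omega>" and [measurable]: "f \<in> borel_measurable borel" and fi: "set_integrable lborel \<Omega> f"
    and pos: "\<And>\<phi>. \<phi> \<in> test_functions \<Omega> \<Longrightarrow> (\<And>x. 0 \<le> \<phi> x) \<Longrightarrow> 0 \<le> (\<integral>x. f x * \<phi> x \<partial>lborel)"
  shows "AE x in lborel. x \<in> \<Omega> \<longrightarrow> 0 \<le> f x"
proof -
  have [measurable]: "\<Omega> \<in> sets borel" using assms(1) by simp
  define E where "E = {x \<in> \<Omega>. f x < 0}"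
  have [measurable]: "E \<in> sets borel" unfolding E_def by measurable
  have cpt: "emeasure lborel K = 0" if K: "compact K" "K \<subseteq> E" for K
  proof -
    have KO: "K \<subseteq> \<Omega>" using K by (auto simp: E_def)
    have [measurable]: "K \<in> sets borel" using K by (auto intro: borel_closed compact_imp_closed)
    obtain ch where ch: "\<And>n::nat. ch n \<in> test_functions \<Omega>" "\<And>n x. 0 \<le> ch n x" "\<And>n x. ch n x \<le> 1"
      "\<And>x. (\<lambda>n. ch n x) \<longlonglongrightarrow> indicator K x"
      using approx_indicator_compact[OF K(1) KO assms(1)] by blast
    have [measurable]: "ch n \<in> borel_measurable borel" for n using ch(1) test_function_measurable by blast
    have "(\<lambda>n. \<integral>x. f x * ch n x \<partial>lborel) \<longlonglongrightarrow> (\<integral>x. f x * indicator K x \<partial>lborel)"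
    proof (rule integral_dominated_convergence[where w="\<lambda>x. norm (indicator \<Omega> x *\<^sub>R f x)"])
      show "integrable lborel (\<lambda>x. norm (indicator \<Omega> x *\<^sub>R f x))"
        using fi by (simp add: set_integrable_def)
      show "AE x in lborel. (\<lambda>n. f x * ch n x) \<longlonglongrightarrow> f x * indicator K x"
        by (intro AE_I2 tendsto_intros ch)
      show "AE x in lborel. norm (f x * ch n x) \<le> norm (indicator \<Omega> x *\<^sub>R f x)" for n
      proof (rule AE_I2)
        fix x show "norm (f x * ch n x) \<le> norm (indicator \<Omega> x *\<^sub>R f x)"
          using test_function_outside[OF ch(1)[of n]] ch(2,3)[of n x]
          by (cases "x \<in> \<Omega>") (auto simp: abs_mult mult_left_le)
      qed
    qed auto
    then have 1: "0 \<le> (\<integral>x. f x * indicator K x \<partial>lborel)"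
      by (rule LIMSEQ_le_const) (use pos ch in auto)
    have fK: "integrable lborel (\<lambda>x. f x * indicator K x)"
      by (rule Bochner_Integration.integrable_bound[OF fi[unfolded set_integrable_def]])
       (use KO in \<open>auto intro!: AE_I2 simp: indicator_def\<close>)
    have "(\<integral>x. - (f x * indicator K x) \<partial>lborel) = 0"
      using 1 K by (intro antisym integral_nonneg_AE) (auto intro!: AE_I2 mult_nonpos_nonneg simp: E_def indicator_def)
    then have "AE x in lborel. - (f x * indicator K x) = 0"
    proof (subst (asm) integral_nonneg_eq_0_iff_AE)
      show "AE x in lborel. 0 \<le> - (f x * indicator K x)"
        using K by (intro AE_I2) (auto simp: E_def indicator_def)
    qed (use fK in auto)
    then have "AE x in lborel. x \<notin> K" by eventually_elim (use K in \<open>auto simp: E_def indicator_def\<close>)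
    then show ?thesis using AE_iff_null_sets[of K lborel] by auto
  qed
  \<comment> \<open>The inner approximation below is by closed sets, so the compact case is first
    extended to closed sets by exhaustion with balls.\<close>
  have closed0: "emeasure lborel T = 0" if T: "closed T" "T \<subseteq> E" for T
  proof -
    have "emeasure lborel (\<Union>n::nat. T \<inter> cball 0 (real n)) = 0"
    proof (rule emeasure_UN_eq_0)
      show "emeasure lborel (T \<inter> cball 0 (real n)) = 0" for n
        using T by (intro cpt closed_Int_compact) auto
      show "range (\<lambda>n. T \<inter> cball 0 (real n)) \<subseteq> sets lborel" using T by auto
    qed
    moreover have "(\<Union>n::nat. T \<inter> cball 0 (real n)) = T"
      by (auto simp: real_arch_simple)
    ultimately show ?thesis by simp
  qed
  have "emeasure lborel E \<le> 0"
  proof (rule ennreal_le_epsilon)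
    fix e :: real assume e: "0 < e"
    have "E \<in> sets lebesgue" by simp
    obtain T where T: "closed T" "T \<subseteq> E" "emeasure lebesgue (E - T) < ennreal e"
      by (rule sets_lebesgue_inner_closed[OF \<open>E \<in> sets lebesgue\<close> e])
    then have [measurable]: "T \<in> sets borel" by simp
    have "emeasure lborel E = emeasure lborel T + emeasure lborel (E - T)"
      using T by (subst plus_emeasure) (auto simp: Un_absorb1)
    also have "\<dots> \<le> 0 + ennreal e" using closed0[OF T(1,2)] T(3) by (simp add: less_imp_le)
    finally show "emeasure lborel E \<le> 0 + ennreal e" .
  qed
  then have "AE x in lborel. x \<notin> E" using AE_iff_null_sets[of E lborel] by (auto simp: null_sets_def)
  then show ?thesis by eventually_elim (auto simp: E_def)
qed

lemma null_distribution_AE_zero: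
  fixes f :: "'a::euclidean_space \<Rightarrow> real"
  assumes "open \<Omega>" and [measurable]: "f \<in> borel_measurable borel" and fi: "set_integrable lborel \<Omega> f"
    and zero: "\<And>\<phi>. \<phi> \<in> test_functions \<Omega> \<Longrightarrow> (\<integral>x. f x * \<phi> x \<partial>lborel) = 0"
  shows "AE x in lborel. x \<in> \<Omega> \<longrightarrow> f x = 0"
proof -
  have "AE x in lborel. x \<in> \<Omega> \<longrightarrow> 0 \<le> f x"
    by (rule positive_distribution_AE_nonneg) (use assms in auto)
  moreover have "AE x in lborel. x \<in> \<Omega> \<longrightarrow> 0 \<le> - f x"
    by (rule positive_distribution_AE_nonneg) (use assms in \<open>auto simp: set_integrable_def\<close>)
  ultimately show ?thesis by eventually_elim auto
qed

section \<open>The Hilbert space of square-integrable functions\<close>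

definition sqint :: "('a::euclidean_space \<Rightarrow> 'b::euclidean_space) \<Rightarrow> bool" where
  "sqint f \<longleftrightarrow> f \<in> borel_measurable lborel \<and> integrable lborel (\<lambda>x. (norm (f x))\<^sup>2)"

lemma sqint_integrable_inner:
  assumes "sqint f" "sqint g"
  shows "integrable lborel (\<lambda>x. f x \<bullet> g x)"
proof (rule Bochner_Integration.integrable_bound)
  have [measurable]: "f \<in> borel_measurable borel" "g \<in> borel_measurable borel" using assms by (auto simp: sqint_def)
  show "integrable lborel (\<lambda>x. (norm (f x))\<^sup>2 + (norm (g x))\<^sup>2)"
    using assms by (auto simp: sqint_def)
  show "(\<lambda>x. f x \<bullet> g x) \<in> borel_measurable lborel" by measurable
  have "\<bar>f x \<bullet> g x\<bar> \<le> (norm (f x))\<^sup>2 + (norm (g x))\<^sup>2" for x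
  proof -
    have "\<bar>f x \<bullet> g x\<bar> \<le> norm (f x) * norm (g x)" by (rule Cauchy_Schwarz_ineq2)
    also have "\<dots> \<le> (norm (f x))\<^sup>2 + (norm (g x))\<^sup>2"
    proof -
      have "0 \<le> norm (f x) * norm (g x)" by simp
      then show ?thesis using sum_squares_bound[of "norm (f x)" "norm (g x)"] by linarith
    qed
    finally show ?thesis .
  qed
  then show "AE x in lborel. norm (f x \<bullet> g x) \<le> norm ((norm (f x))\<^sup>2 + (norm (g x))\<^sup>2)"
    by (auto intro!: AE_I2)
qed

lemma sqint_add:
  assumes "sqint f" "sqint g"
  shows "sqint (\<lambda>x. f x + g x)"
  unfolding sqint_def
proof
  have [measurable]: "f \<in> borel_measurable borel" "g \<in> borel_measurable borel" using assms by (auto simp: sqint_def)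
  show "(\<lambda>x. f x + g x) \<in> borel_measurable lborel" by measurable
  have "(\<lambda>x. (norm (f x + g x))\<^sup>2) = (\<lambda>x. (norm (f x))\<^sup>2 + (norm (g x))\<^sup>2 + 2 * (f x \<bullet> g x))"
    by (auto simp: power2_norm_eq_inner inner_add inner_commute)
  then show "integrable lborel (\<lambda>x. (norm (f x + g x))\<^sup>2)"
    using assms sqint_integrable_inner[OF assms] by (auto simp: sqint_def)
qed

lemma sqint_scale: "sqint f \<Longrightarrow> sqint (\<lambda>x. c *\<^sub>R f x)"
  by (auto simp: sqint_def power_mult_distrib)

lemma sqint_zero [simp]: "sqint (\<lambda>x. 0)"
  by (simp add: sqint_def)

lemma sqint_diff: "sqint f \<Longrightarrow> sqint g \<Longrightarrow> sqint (\<lambda>x. f x - g x)"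
  using sqint_add[of f "\<lambda>x. (-1) *\<^sub>R g x"] sqint_scale[of g "-1"] by simp

\<comment> \<open>A partial quotient: a function that is not square-integrable is not even related
  to itself. The general codomain makes functions and their gradients instances of the same
  construction.\<close>
quotient_type (overloaded) ('a, 'b) l2 = "'a::euclidean_space \<Rightarrow> 'b::euclidean_space" / partial:
  "\<lambda>f g. sqint f \<and> sqint g \<and> (AE x in lborel. f x = g x)"
  morphisms rep_l2 abs_l2
proof (rule part_equivpI)
  show "\<exists>x::'a \<Rightarrow> 'b. sqint x \<and> sqint x \<and> (AE y in lborel. x y = x y)"
    by (rule exI[of _ "\<lambda>x. 0"]) simp
  show "symp (\<lambda>f g::'a \<Rightarrow> 'b. sqint f \<and> sqint g \<and> (AE x in lborel. f x = g x))"
    by (auto intro!: sympI elim: AE_mp)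
  show "transp (\<lambda>f g::'a \<Rightarrow> 'b. sqint f \<and> sqint g \<and> (AE x in lborel. f x = g x))"
  proof (rule transpI)
    fix f g h :: "'a \<Rightarrow> 'b"
    assume fg: "sqint f \<and> sqint g \<and> (AE x in lborel. f x = g x)"
      and gh: "sqint g \<and> sqint h \<and> (AE x in lborel. g x = h x)"
    from fg gh have "AE x in lborel. f x = g x" "AE x in lborel. g x = h x" by auto
    then have "AE x in lborel. f x = h x" by eventually_elim simp
    with fg gh show "sqint f \<and> sqint h \<and> (AE x in lborel. f x = h x)" by simp
  qed
qed

lemma sqint_rep: "sqint (rep_l2 X)" and abs_rep_l2: "abs_l2 (rep_l2 X) = X"
  using Quotient_abs_rep[OF Quotient_l2, of X] Quotient_rep_reflp[OF Quotient_l2, of X] by auto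

lemma abs_l2_eq_iff:
  assumes "sqint f" "sqint g"
  shows "abs_l2 f = abs_l2 g \<longleftrightarrow> (AE x in lborel. f x = g x)"
  using Quotient_rel[OF Quotient_l2, of f g] assms by auto

lemma l2_cases: obtains f where "sqint f" "X = abs_l2 f"
  using sqint_rep abs_rep_l2 by metis

instantiation l2 :: (euclidean_space, euclidean_space) real_vector
begin

lift_definition zero_l2 :: "('a, 'b) l2" is "\<lambda>x. 0" by simp
lift_definition plus_l2 :: "('a, 'b) l2 \<Rightarrow> ('a, 'b) l2 \<Rightarrow> ('a, 'b) l2" is "\<lambda>f g x. f x + g x"
  by (auto intro: sqint_add)
lift_definition scaleR_l2 :: "real \<Rightarrow> ('a, 'b) l2 \<Rightarrow> ('a, 'b) l2" is "\<lambda>c f x. c *\<^sub>R f x"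
  by (auto intro: sqint_scale)
lift_definition minus_l2 :: "('a, 'b) l2 \<Rightarrow> ('a, 'b) l2 \<Rightarrow> ('a, 'b) l2" is "\<lambda>f g x. f x - g x"
  by (auto intro: sqint_diff)
lift_definition uminus_l2 :: "('a, 'b) l2 \<Rightarrow> ('a, 'b) l2" is "\<lambda>f x. - f x"
  using sqint_scale[of _ "-1"] by auto

instance
  by standard (transfer; auto simp: algebra_simps intro!: sqint_add sqint_scale sqint_diff)+
end

lemma abs_l2_zero: "abs_l2 (\<lambda>x. 0) = 0"
  by (simp add: zero_l2_def)

lemma abs_l2_add: "sqint f \<Longrightarrow> sqint g \<Longrightarrow> abs_l2 f + abs_l2 g = abs_l2 (\<lambda>x. f x + g x)"
  by (simp add: plus_l2.abs_eq)

lemma abs_l2_diff: "sqint f \<Longrightarrow> sqint g \<Longrightarrow> abs_l2 f - abs_l2 g = abs_l2 (\<lambda>x. f x - g x)"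
  by (simp add: minus_l2.abs_eq)

lemma abs_l2_scale: "sqint f \<Longrightarrow> c *\<^sub>R abs_l2 f = abs_l2 (\<lambda>x. c *\<^sub>R f x)"
  by (simp add: scaleR_l2.abs_eq)

instantiation l2 :: (euclidean_space, euclidean_space) real_inner
begin

lift_definition inner_l2 :: "('a, 'b) l2 \<Rightarrow> ('a, 'b) l2 \<Rightarrow> real" is "\<lambda>f g. \<integral>x. f x \<bullet> g x \<partial>lborel"
proof -
  fix f1 f2 g1 g2 :: "'a \<Rightarrow> 'b"
  assume f: "sqint f1 \<and> sqint f2 \<and> (AE x in lborel. f1 x = f2 x)"
    and g: "sqint g1 \<and> sqint g2 \<and> (AE x in lborel. g1 x = g2 x)"
  then have [measurable]: "f1 \<in> borel_measurable borel" "g1 \<in> borel_measurable borel"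
    "f2 \<in> borel_measurable borel" "g2 \<in> borel_measurable borel" by (auto simp: sqint_def)
  from f g have "AE x in lborel. f1 x = f2 x" "AE x in lborel. g1 x = g2 x" by auto
  then have "AE x in lborel. f1 x \<bullet> g1 x = f2 x \<bullet> g2 x" by eventually_elim simp
  then show "(\<integral>x. f1 x \<bullet> g1 x \<partial>lborel) = (\<integral>x. f2 x \<bullet> g2 x \<partial>lborel)"
    by (intro integral_cong_AE) auto
qed

definition norm_l2 :: "('a, 'b) l2 \<Rightarrow> real" where "norm_l2 X = sqrt (inner X X)"
definition dist_l2 :: "('a, 'b) l2 \<Rightarrow> ('a, 'b) l2 \<Rightarrow> real" where "dist_l2 X Y = norm (X - Y)"
definition sgn_l2 :: "('a, 'b) l2 \<Rightarrow> ('a, 'b) l2" where "sgn_l2 X = X /\<^sub>R norm X"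
definition uniformity_l2 :: "(('a, 'b) l2 \<times> ('a, 'b) l2) filter" where
  "uniformity_l2 = (INF e\<in>{0 <..}. principal {(X, Y). dist X Y < e})"
definition open_l2 :: "('a, 'b) l2 set \<Rightarrow> bool" where
  "open_l2 U = (\<forall>X\<in>U. eventually (\<lambda>(X', Y). X' = X \<longrightarrow> Y \<in> U) uniformity)"

instance
proof
  fix X Y Z :: "('a, 'b) l2" and r :: real
  show "inner X Y = inner Y X" by transfer (simp add: inner_commute)
  show "inner (X + Y) Z = inner X Z + inner Y Z"
    by transfer (simp add: inner_add_left sqint_integrable_inner)
  show "inner (scaleR r X) Y = r * inner X Y"
    by transfer simp
  show "0 \<le> inner X X" by transfer simp
  show "(inner X X = 0) = (X = 0)"
  proof transfer
    fix f :: "'a \<Rightarrow> 'b" assume "sqint f \<and> sqint f \<and> (AE x in lborel. f x = f x)"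
    then show "((\<integral>x. f x \<bullet> f x \<partial>lborel) = 0) = (sqint f \<and> sqint (\<lambda>x. 0::'b) \<and> (AE x in lborel. f x = 0))"
      by (subst integral_nonneg_eq_0_iff_AE) (auto intro: sqint_integrable_inner)
  qed
qed (simp_all add: norm_l2_def dist_l2_def sgn_l2_def uniformity_l2_def open_l2_def)
end

lemma inner_abs_l2: "sqint f \<Longrightarrow> sqint g \<Longrightarrow> inner (abs_l2 f) (abs_l2 g) = (\<integral>x. f x \<bullet> g x \<partial>lborel)"
  by (simp add: inner_l2.abs_eq)

lemma norm_abs_l2: "sqint f \<Longrightarrow> (norm (abs_l2 f))\<^sup>2 = (\<integral>x. (norm (f x))\<^sup>2 \<partial>lborel)"
  by (simp add: power2_norm_eq_inner inner_abs_l2)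

lemma nn_integral_norm_l2:
  assumes "sqint f"
  shows "(\<integral>\<^sup>+x. ennreal ((norm (f x))\<^sup>2) \<partial>lborel) = ennreal ((norm (abs_l2 f))\<^sup>2)"
  using assms by (subst nn_integral_eq_integral) (auto simp: norm_abs_l2 sqint_def)

lemma sqintI_nn_integral:
  assumes "f \<in> borel_measurable borel" "(\<integral>\<^sup>+x. ennreal ((norm (f x))\<^sup>2) \<partial>lborel) < \<infinity>"
  shows "sqint f"
  unfolding sqint_def using assms by (auto intro!: integrableI_nonneg)

text \<open>Weighting the squared increments by 4^k leaves a convergent series of integrals, with
  terms at most (1/4)^k. Hence almost everywhere the weighted squares tend to 0, the increments are
  eventually below (1/2)^k, and the telescoping series converges.\<close>

lemma l2_rapidly_Cauchy_converges_AE: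
  fixes f :: "nat \<Rightarrow> 'a::euclidean_space \<Rightarrow> 'b::euclidean_space"
  assumes f: "\<And>k. sqint (f k)" and n: "\<And>k. norm (abs_l2 (f (Suc k)) - abs_l2 (f k)) \<le> (1/4) ^ k"
  shows "AE x in lborel. convergent (\<lambda>k. f k x)"
proof -
  have [measurable]: "f k \<in> borel_measurable borel" for k using f by (auto simp: sqint_def)
  define D where "D k x = norm (f (Suc k) x - f k x)" for k x
  have [measurable]: "D k \<in> borel_measurable borel" for k unfolding D_def by measurable
  have "(\<integral>\<^sup>+x. (\<Sum>k. ennreal (4 ^ k * (D k x)\<^sup>2)) \<partial>lborel) = (\<Sum>k. \<integral>\<^sup>+x. ennreal (4 ^ k * (D k x)\<^sup>2) \<partial>lborel)"
    by (rule nn_integral_suminf) auto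
  also have "\<dots> \<le> (\<Sum>k. ennreal ((1/4) ^ k))"
  proof (rule suminf_le)
    fix k
    have "(\<integral>\<^sup>+x. ennreal (4 ^ k * (D k x)\<^sup>2) \<partial>lborel) = ennreal (4 ^ k) * (\<integral>\<^sup>+x. ennreal ((D k x)\<^sup>2) \<partial>lborel)"
      by (subst nn_integral_cmult[symmetric]) (auto simp: ennreal_mult)
    also have "(\<integral>\<^sup>+x. ennreal ((D k x)\<^sup>2) \<partial>lborel) = ennreal ((norm (abs_l2 (f (Suc k)) - abs_l2 (f k)))\<^sup>2)"
      unfolding D_def using nn_integral_norm_l2[OF sqint_diff[OF f[of "Suc k"] f[of k]]] by (simp add: abs_l2_diff f)
    also have "ennreal (4 ^ k) * \<dots> = ennreal (4 ^ k * (norm (abs_l2 (f (Suc k)) - abs_l2 (f k)))\<^sup>2)"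
      by (simp add: ennreal_mult)
    also have "\<dots> \<le> ennreal (4 ^ k * ((1/4) ^ k)\<^sup>2)"
      using n[of k] by (intro ennreal_leI mult_left_mono power_mono) auto
    also have "4 ^ k * ((1/4::real) ^ k)\<^sup>2 = (1/4) ^ k"
      by (simp add: power2_eq_square power_divide)
    finally show "(\<integral>\<^sup>+x. ennreal (4 ^ k * (D k x)\<^sup>2) \<partial>lborel) \<le> ennreal ((1/4) ^ k)" .
  qed auto
  also have "\<dots> = ennreal (\<Sum>k. (1/4) ^ k)" by (rule suminf_ennreal2) auto
  also have "\<dots> < \<infinity>" by simp
  finally have "(\<integral>\<^sup>+x. (\<Sum>k. ennreal (4 ^ k * (D k x)\<^sup>2)) \<partial>lborel) \<noteq> \<infinity>" by simp
  then have "AE x in lborel. (\<Sum>k. ennreal (4 ^ k * (D k x)\<^sup>2)) \<noteq> \<infinity>"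
    by (intro nn_integral_PInf_AE) auto
  then show ?thesis
  proof eventually_elim
    case (elim x)
    have "summable (\<lambda>k. 4 ^ k * (D k x)\<^sup>2)"
      using elim by (intro summable_suminf_not_top) (auto simp: D_def)
    then have "(\<lambda>k. 4 ^ k * (D k x)\<^sup>2) \<longlonglongrightarrow> 0" by (rule summable_LIMSEQ_zero)
    then have "\<forall>\<^sub>F k in sequentially. 4 ^ k * (D k x)\<^sup>2 < 1" by (rule order_tendstoD) simp
    then have "\<forall>\<^sub>F k in sequentially. norm (f (Suc k) x - f k x) \<le> (1/2) ^ k"
    proof eventually_elim
      case (elim k)
      have "(2::real) ^ k * 2 ^ k = 4 ^ k" by (simp flip: power_mult_distrib)
      then have "(2 ^ k * D k x)\<^sup>2 = 4 ^ k * (D k x)\<^sup>2"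
        by (simp add: power2_eq_square mult.assoc mult.left_commute flip: mult.assoc)
      then have "(2 ^ k * D k x)\<^sup>2 \<le> 1\<^sup>2" using elim by simp
      then have "2 ^ k * D k x \<le> 1" by (rule power2_le_imp_le) simp
      then show ?case by (simp add: D_def power_divide field_simps)
    qed
    then have "summable (\<lambda>k. f (Suc k) x - f k x)"
      by (intro summable_comparison_test_ev[of "\<lambda>k. f (Suc k) x - f k x" "\<lambda>k. (1/2) ^ k"]) auto
    then have "convergent (\<lambda>n. \<Sum>k<n. f (Suc k) x - f k x)" by (simp add: summable_iff_convergent)
    moreover have "(\<lambda>n. \<Sum>k<n. f (Suc k) x - f k x) = (\<lambda>n. f n x - f 0 x)"
      by (intro ext sum_lessThan_telescope)
    ultimately have "convergent (\<lambda>n. (f n x - f 0 x) + f 0 x)"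
      by (intro convergent_add convergent_const) simp
    then show ?case by simp
  qed
qed

text \<open>Riesz-Fischer: a rapidly Cauchy subsequence converges almost everywhere, and Fatou's
  lemma, applied to its distance from a fixed member of the sequence, shows that the whole sequence
  converges to that limit in norm.\<close>

instance l2 :: (euclidean_space, euclidean_space) complete_space
proof
  fix X :: "nat \<Rightarrow> ('a, 'b) l2" assume C: "Cauchy X"
  define f where "f n = rep_l2 (X n)" for n
  have f: "sqint (f n)" "X n = abs_l2 (f n)" for n by (auto simp: f_def sqint_rep abs_rep_l2)
  have [measurable]: "f k \<in> borel_measurable borel" for k using f by (auto simp: sqint_def)
  have "\<forall>k. \<exists>N. \<forall>m\<ge>N. \<forall>n\<ge>N. norm (X m - X n) < (1/4) ^ k"
    using C unfolding Cauchy_iff by simp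
  then obtain N where N: "\<And>k m n. m \<ge> N k \<Longrightarrow> n \<ge> N k \<Longrightarrow> norm (X m - X n) < (1/4) ^ k" by metis
  \<comment> \<open>The partial sums make \<open>r\<close> nondecreasing and at least
    \<open>N k\<close>; the summand \<open>k\<close> makes it unbounded.\<close>
  define r where "r k = (\<Sum>i\<le>k. N i) + k" for k
  have rN: "r k \<ge> N k" for k
    unfolding r_def by (rule trans_le_add1) (simp add: member_le_sum)
  have rs: "r k \<le> r (Suc k)" for k by (simp add: r_def)
  have rk: "r k \<ge> k" for k by (simp add: r_def)
  have "AE x in lborel. convergent (\<lambda>k. f (r k) x)"
  proof (rule l2_rapidly_Cauchy_converges_AE)
    show "norm (abs_l2 (f (r (Suc k))) - abs_l2 (f (r k))) \<le> (1/4) ^ k" for k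
      using N[of k "r (Suc k)" "r k"] rN[of k] rs[of k] f(2) by (simp add: less_imp_le)
  qed (use f in auto)
  then have AE: "AE x in lborel. (\<lambda>k. f (r k) x) \<longlonglongrightarrow> lim (\<lambda>k. f (r k) x)"
    by eventually_elim (simp add: convergent_LIMSEQ_iff)
  define g where "g x = lim (\<lambda>k. f (r k) x)" for x
  have [measurable]: "g \<in> borel_measurable borel" unfolding g_def
    by (rule borel_measurable_lim_metric) auto
  have fatou: "(\<integral>\<^sup>+x. ennreal ((norm (g x - f m x))\<^sup>2) \<partial>lborel) \<le> ennreal (((1/4) ^ k)\<^sup>2)" if m: "m \<ge> N k" for m k
  proof -
    have "(\<integral>\<^sup>+x. ennreal ((norm (g x - f m x))\<^sup>2) \<partial>lborel)
      = (\<integral>\<^sup>+x. liminf (\<lambda>i. ennreal ((norm (f (r i) x - f m x))\<^sup>2)) \<partial>lborel)"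
    proof (rule nn_integral_cong_AE)
      show "AE x in lborel. ennreal ((norm (g x - f m x))\<^sup>2) = liminf (\<lambda>i. ennreal ((norm (f (r i) x - f m x))\<^sup>2))"
        using AE
      proof eventually_elim
        case (elim x)
        then have "(\<lambda>i. ennreal ((norm (f (r i) x - f m x))\<^sup>2)) \<longlonglongrightarrow> ennreal ((norm (g x - f m x))\<^sup>2)"
          unfolding g_def by (intro tendsto_intros)
        then show ?case using lim_imp_Liminf by force
      qed
    qed
    also have "\<dots> \<le> liminf (\<lambda>i. \<integral>\<^sup>+x. ennreal ((norm (f (r i) x - f m x))\<^sup>2) \<partial>lborel)"
      by (rule nn_integral_liminf) auto
    also have "\<dots> \<le> liminf (\<lambda>i. ennreal (((1/4) ^ k)\<^sup>2))"
    proof (rule Liminf_mono)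
      show "\<forall>\<^sub>F i in sequentially. (\<integral>\<^sup>+x. ennreal ((norm (f (r i) x - f m x))\<^sup>2) \<partial>lborel) \<le> ennreal (((1/4) ^ k)\<^sup>2)"
        using eventually_ge_at_top[of "N k"]
      proof eventually_elim
        case (elim i)
        have "(\<integral>\<^sup>+x. ennreal ((norm (f (r i) x - f m x))\<^sup>2) \<partial>lborel) = ennreal ((norm (X (r i) - X m))\<^sup>2)"
          using nn_integral_norm_l2[OF sqint_diff[OF f(1)[of "r i"] f(1)[of m]]] by (simp add: abs_l2_diff f)
        also have "\<dots> \<le> ennreal (((1/4) ^ k)\<^sup>2)"
          using N[of k "r i" m] m elim rk[of i] by (intro ennreal_leI power_mono) auto
        finally show ?case .
      qed
    qed
    also have "\<dots> = ennreal (((1/4) ^ k)\<^sup>2)" by (simp add: Liminf_const)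
    finally show ?thesis .
  qed
  \<comment> \<open>Fatou bounds only differences, so square-integrability of the limit is obtained
    by adding back a member of the sequence.\<close>
  have "sqint (\<lambda>x. g x - f (N 0) x)"
    using fatou[of 0 "N 0"] by (intro sqintI_nn_integral) (auto simp: le_less_trans)
  from sqint_add[OF this f(1)[of "N 0"]] have g: "sqint g" by simp
  have le: "norm (abs_l2 g - X m) \<le> (1/4) ^ k" if "m \<ge> N k" for k m
  proof -
    have "ennreal ((norm (abs_l2 g - X m))\<^sup>2) \<le> ennreal (((1/4) ^ k)\<^sup>2)"
      using fatou[OF that] nn_integral_norm_l2[OF sqint_diff[OF g f(1)[of m]]] by (simp add: abs_l2_diff f g)
    then have "(norm (abs_l2 g - X m))\<^sup>2 \<le> ((1/4) ^ k)\<^sup>2" by (subst (asm) ennreal_le_iff) auto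
    then show ?thesis by (rule power2_le_imp_le) simp
  qed
  have "X \<longlonglongrightarrow> abs_l2 g"
    unfolding LIMSEQ_iff
  proof (intro allI impI)
    fix e :: real assume "e > 0"
    then obtain k where "(1/4) ^ k < e" using real_arch_pow_inv[of e "1/4"] by auto
    then show "\<exists>no. \<forall>n\<ge>no. norm (X n - abs_l2 g) < e"
      using le[of k] by (intro exI[of _ "N k"]) (auto simp: norm_minus_commute intro: le_less_trans)
  qed
  then show "convergent X" by (auto simp: convergent_def)
qed

instance l2 :: (euclidean_space, euclidean_space) banach ..

lemma abs_l2_tendsto_iff:
  assumes "\<And>k. sqint (f k)" "sqint g"
  shows "(\<lambda>k. abs_l2 (f k)) \<longlonglongrightarrow> abs_l2 g \<longleftrightarrow> (\<lambda>k. \<integral>x. (norm (f k x - g x))\<^sup>2 \<partial>lborel) \<longlonglongrightarrow> 0"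
proof -
  have "(\<lambda>k. abs_l2 (f k)) \<longlonglongrightarrow> abs_l2 g \<longleftrightarrow> (\<lambda>k. norm (abs_l2 (f k) - abs_l2 g)) \<longlonglongrightarrow> 0"
    by (simp add: tendsto_norm_zero_iff LIM_zero_iff)
  also have "\<dots> \<longleftrightarrow> (\<lambda>k. (norm (abs_l2 (f k) - abs_l2 g))\<^sup>2) \<longlonglongrightarrow> 0"
  proof
    assume "(\<lambda>k. (norm (abs_l2 (f k) - abs_l2 g))\<^sup>2) \<longlonglongrightarrow> 0"
    from tendsto_real_sqrt[OF this] show "(\<lambda>k. norm (abs_l2 (f k) - abs_l2 g)) \<longlonglongrightarrow> 0" by simp
  qed (auto intro!: tendsto_null_power)
  also have "(\<lambda>k. (norm (abs_l2 (f k) - abs_l2 g))\<^sup>2) = (\<lambda>k. \<integral>x. (norm (f k x - g x))\<^sup>2 \<partial>lborel)"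
    using assms by (simp add: abs_l2_diff norm_abs_l2 sqint_diff)
  finally show ?thesis .
qed

section \<open>Hilbert space geometry\<close>

text \<open>A minimising sequence for the distance is Cauchy by the parallelogram law, since
  midpoints stay in the subspace; orthogonality is the first-order condition at the minimum.\<close>

lemma orthogonal_projection_exists:
  fixes S :: "'h::{real_inner, banach} set"
  assumes S: "subspace S" "closed S"
  shows "\<exists>y\<in>S. \<forall>z\<in>S. inner (x - y) z = 0"
proof -
  have ne: "S \<noteq> {}" using S subspace_0 by blast
  define d where "d = infdist x S"
  have d: "0 \<le> d" "\<And>y. y \<in> S \<Longrightarrow> d \<le> norm (x - y)"
    unfolding d_def using infdist_le[of _ S x] by (auto simp: infdist_nonneg dist_norm)
  have "\<exists>y. y \<in> S \<and> norm (x - y) < d + 1 / real (Suc n)" for n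
  proof (rule ccontr)
    assume "\<nexists>y. y \<in> S \<and> norm (x - y) < d + 1 / real (Suc n)"
    then have "d + 1 / real (Suc n) \<le> infdist x S"
      unfolding infdist_notempty[OF ne] by (intro cINF_greatest ne) (auto simp: dist_norm not_less)
    then show False by (simp add: d_def)
  qed
  then obtain Y where Y: "\<And>n. Y n \<in> S" "\<And>n. norm (x - Y n) < d + 1 / real (Suc n)" by metis
  have par: "(norm (Y n - Y m))\<^sup>2 \<le> 2 * (norm (x - Y n))\<^sup>2 + 2 * (norm (x - Y m))\<^sup>2 - 4 * d\<^sup>2" for n m
  proof -
    have mid: "(1/2) *\<^sub>R (Y n + Y m) \<in> S" using Y S by (auto intro: subspace_scale subspace_add)
    have "(norm (Y n - Y m))\<^sup>2 = 2 * (norm (x - Y n))\<^sup>2 + 2 * (norm (x - Y m))\<^sup>2 - 4 * (norm (x - (1/2) *\<^sub>R (Y n + Y m)))\<^sup>2"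
      unfolding power2_norm_eq_inner
      by (simp add: inner_diff_left inner_diff_right inner_add_left inner_add_right inner_commute algebra_simps)
    moreover have "d\<^sup>2 \<le> (norm (x - (1/2) *\<^sub>R (Y n + Y m)))\<^sup>2" using d(2)[OF mid] d(1) by (intro power_mono) auto
    ultimately show ?thesis by linarith
  qed
  have lim: "(\<lambda>n. norm (x - Y n)) \<longlonglongrightarrow> d"
  proof (rule tendsto_sandwich[of "\<lambda>n. d" _ _ "\<lambda>n. d + 1 / real (Suc n)"])
    have "(\<lambda>n. d + 1 / real (Suc n)) \<longlonglongrightarrow> d + 0"
      using LIMSEQ_Suc[OF lim_1_over_n] by (intro tendsto_intros) simp
    then show "(\<lambda>n. d + 1 / real (Suc n)) \<longlonglongrightarrow> d" by simp
    show "\<forall>\<^sub>F n in sequentially. norm (x - Y n) \<le> d + 1 / real (Suc n)"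
      using Y(2) by (intro always_eventually allI less_imp_le)
  qed (use d Y in auto)
  have "Cauchy Y"
    unfolding Cauchy_iff
  proof (intro allI impI)
    fix e :: real assume e: "e > 0"
    have "(\<lambda>n. (norm (x - Y n))\<^sup>2) \<longlonglongrightarrow> d\<^sup>2" by (intro tendsto_intros lim)
    then have "\<forall>\<^sub>F n in sequentially. (norm (x - Y n))\<^sup>2 < d\<^sup>2 + e\<^sup>2 / 4"
      by (rule order_tendstoD) (use e in auto)
    then obtain M where M: "\<And>n. n \<ge> M \<Longrightarrow> (norm (x - Y n))\<^sup>2 < d\<^sup>2 + e\<^sup>2 / 4"
      by (auto simp: eventually_sequentially)
    show "\<exists>M. \<forall>m\<ge>M. \<forall>n\<ge>M. norm (Y m - Y n) < e"
    proof (intro exI[of _ M] allI impI)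
      fix m n assume "M \<le> m" "M \<le> n"
      then have "(norm (Y m - Y n))\<^sup>2 < e\<^sup>2" using par[of m n] M[of m] M[of n] by linarith
      then show "norm (Y m - Y n) < e" using e by (simp add: power_less_imp_less_base)
    qed
  qed
  then obtain y where y: "Y \<longlonglongrightarrow> y" by (auto simp: Cauchy_convergent_iff convergent_def)
  have yS: "y \<in> S" using closed_sequentially[OF S(2) _ y] Y by blast
  have "(\<lambda>n. norm (x - Y n)) \<longlonglongrightarrow> norm (x - y)" by (intro tendsto_intros y)
  then have dy: "norm (x - y) = d" using lim LIMSEQ_unique by blast
  have "inner (x - y) z = 0" if z: "z \<in> S" for z
  proof (cases "z = 0")
    case False
    \<comment> \<open>The minimiser of the quadratic polynomial that gives the squared distance from
      \<open>x\<close> to \<open>y + t *\<^sub>R z\<close>.\<close>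
    define t where "t = inner (x - y) z / (norm z)\<^sup>2"
    have "y + t *\<^sub>R z \<in> S" using yS z S by (auto intro: subspace_add subspace_scale)
    then have "d\<^sup>2 \<le> (norm (x - (y + t *\<^sub>R z)))\<^sup>2" using d by (intro power_mono) auto
    also have "\<dots> = (norm (x - y))\<^sup>2 - 2 * t * inner (x - y) z + t\<^sup>2 * (norm z)\<^sup>2"
      unfolding power2_norm_eq_inner
      by (simp add: inner_diff_left inner_diff_right inner_add_left inner_add_right inner_commute power2_eq_square algebra_simps)
    also have "\<dots> = d\<^sup>2 - (inner (x - y) z)\<^sup>2 / (norm z)\<^sup>2"
      using False unfolding dy t_def by (simp add: field_simps power2_eq_square)
    finally have "(inner (x - y) z)\<^sup>2 / (norm z)\<^sup>2 \<le> 0" by simp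
    then show ?thesis using False by (simp add: divide_le_0_iff)
  qed simp
  then show ?thesis using yS by blast
qed

text \<open>The eigenvalue is the supremum \<open>m\<close> of the quadratic form on the unit ball.
  By positivity a maximising sequence consists of approximate eigenvectors, and compactness of the
  images extracts a limit. The invariant subspace \<open>K\<close> is explicit because the lemma is
  applied to an orthogonal complement.\<close>

lemma compact_symmetric_has_eigenvector:
  fixes T :: "'h::{real_inner, banach} \<Rightarrow> 'h"
  assumes T: "bounded_linear T" and K: "subspace K" "closed K" "T ` K \<subseteq> K" and ne: "K \<noteq> {0}"
    and sym: "\<And>x y. x \<in> K \<Longrightarrow> y \<in> K \<Longrightarrow> inner (T x) y = inner x (T y)"
    and pos: "\<And>x. x \<in> K \<Longrightarrow> x \<noteq> 0 \<Longrightarrow> 0 < inner (T x) x"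
    and cpt: "\<And>X. (\<And>n::nat. X n \<in> K) \<Longrightarrow> (\<And>n. norm (X n) \<le> 1) \<Longrightarrow>
      \<exists>r. strict_mono r \<and> convergent (\<lambda>n. T (X (r n)))"
  shows "\<exists>m>0. \<exists>x\<in>K. x \<noteq> 0 \<and> T x = m *\<^sub>R x"
proof -
  interpret T: bounded_linear T by fact
  define Q where "Q = (\<lambda>x. inner (T x) x) ` {x \<in> K. norm x \<le> 1}"
  obtain B where B: "\<And>x. norm (T x) \<le> norm x * B" "B > 0" using T.pos_bounded by blast
  have q: "inner (T x) x \<le> B" if "norm x \<le> 1" for x
  proof -
    have "inner (T x) x \<le> norm (T x) * norm x" by (rule norm_cauchy_schwarz)
    also have "\<dots> \<le> (norm x * B) * norm x" using B by (intro mult_right_mono) auto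
    also have "\<dots> \<le> (1 * B) * 1" using B that by (intro mult_mono) auto
    finally show ?thesis by simp
  qed
  then have bdd: "bdd_above Q" unfolding Q_def by (auto intro!: bdd_aboveI)
  have "0 \<in> K" using K subspace_0 by blast
  then have Qne: "Q \<noteq> {}" by (auto simp: Q_def intro!: exI[of _ 0])
  define m where "m = Sup Q"
  have upper: "inner (T x) x \<le> m * (norm x)\<^sup>2" if "x \<in> K" for x
  proof (cases "x = 0")
    case False
    have "(1 / norm x) *\<^sub>R x \<in> {x \<in> K. norm x \<le> 1}" using that False K by (auto intro: subspace_scale)
    then have "inner (T ((1 / norm x) *\<^sub>R x)) ((1 / norm x) *\<^sub>R x) \<le> m"
      unfolding m_def Q_def by (intro cSup_upper bdd[unfolded Q_def] image_eqI[OF refl])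
    then show ?thesis using False by (simp add: T.scaleR power2_eq_square field_simps)
  qed (simp add: T.zero)
  have "\<exists>x\<in>K. x \<noteq> 0" using ne \<open>0 \<in> K\<close> by auto
  then obtain x0 where x0: "x0 \<in> K" "x0 \<noteq> 0" by blast
  have "0 < m * (norm x0)\<^sup>2" using pos[OF x0] upper[OF x0(1)] by linarith
  then have m0: "m > 0" using x0 by (simp add: zero_less_mult_iff)
  \<comment> \<open>The form is nonnegative at \<open>x - (1/m) *\<^sub>R T x\<close>; expanding
    this and bounding the form at \<open>T x\<close> by \<open>m\<close> gives what Cauchy-Schwarz
    for the form would give.\<close>
  have TT: "(norm (T x))\<^sup>2 \<le> m * inner (T x) x" if "x \<in> K" for x
  proof -
    have TK: "T x \<in> K" using that K by auto
    have yK: "x - (1/m) *\<^sub>R T x \<in> K" using that TK K by (auto intro: subspace_diff subspace_scale)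
    have "0 \<le> inner (T (x - (1/m) *\<^sub>R T x)) (x - (1/m) *\<^sub>R T x)"
      using pos[OF yK] by (cases "x - (1/m) *\<^sub>R T x = 0") (auto simp: T.zero)
    also have "\<dots> = inner (T x) x - 2 / m * (norm (T x))\<^sup>2 + (1/m)\<^sup>2 * inner (T (T x)) (T x)"
      using sym[OF TK that] unfolding power2_norm_eq_inner
      by (simp add: T.diff T.scaleR inner_diff_left inner_diff_right power2_eq_square inner_commute algebra_simps)
    also have "\<dots> \<le> inner (T x) x - 2 / m * (norm (T x))\<^sup>2 + (1/m)\<^sup>2 * (m * (norm (T x))\<^sup>2)"
      using upper[OF TK] by (intro add_left_mono mult_left_mono) auto
    also have "\<dots> = inner (T x) x - (1 / m) * (norm (T x))\<^sup>2" using m0 by (simp add: power2_eq_square field_simps)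
    finally show ?thesis using m0 by (simp add: field_simps)
  qed
  have "\<exists>x. x \<in> K \<and> norm x \<le> 1 \<and> m - 1 / real (Suc n) < inner (T x) x" for n
  proof -
    have "m - 1 / real (Suc n) < Sup Q" by (simp add: m_def)
    then obtain y where "y \<in> Q" "m - 1 / real (Suc n) < y" using less_cSup_iff[OF Qne bdd] by auto
    then show ?thesis by (auto simp: Q_def)
  qed
  then obtain X where X: "\<And>n. X n \<in> K" "\<And>n. norm (X n) \<le> 1" "\<And>n. m - 1 / real (Suc n) < inner (T (X n)) (X n)"
    by metis
  have XT: "(norm (T (X n) - m *\<^sub>R X n))\<^sup>2 \<le> m * (1 / real (Suc n))" for n
  proof -
    have "(norm (T (X n) - m *\<^sub>R X n))\<^sup>2 = (norm (T (X n)))\<^sup>2 - 2 * m * inner (T (X n)) (X n) + m\<^sup>2 * (norm (X n))\<^sup>2"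
      unfolding power2_norm_eq_inner
      by (simp add: inner_diff_left inner_diff_right inner_commute power2_eq_square algebra_simps)
    also have "\<dots> \<le> m * inner (T (X n)) (X n) - 2 * m * inner (T (X n)) (X n) + m\<^sup>2 * 1"
      using TT[OF X(1)] X(2)[of n] m0 by (intro add_mono diff_mono mult_left_mono power_le_one) auto
    also have "\<dots> = m * (m - inner (T (X n)) (X n))" by (simp add: power2_eq_square algebra_simps)
    also have "\<dots> \<le> m * (1 / real (Suc n))" using m0 X(3)[of n] by (intro mult_left_mono) auto
    finally show ?thesis .
  qed
  obtain r where r: "strict_mono r" "convergent (\<lambda>n. T (X (r n)))" using cpt[of X, OF X(1) X(2)] by auto
  then obtain g where g: "(\<lambda>n. T (X (r n))) \<longlonglongrightarrow> g" by (auto simp: convergent_def)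
  have "(\<lambda>n. m * (1 / real (Suc n))) \<longlonglongrightarrow> m * 0"
    by (rule tendsto_mult_left[OF LIMSEQ_Suc[OF lim_1_over_n]])
  then have lim0: "(\<lambda>n. m * (1 / real (Suc n))) \<longlonglongrightarrow> 0" by simp
  have "(\<lambda>n. (norm (T (X n) - m *\<^sub>R X n))\<^sup>2) \<longlonglongrightarrow> 0"
    by (rule tendsto_sandwich[OF _ _ tendsto_const lim0]) (use XT in \<open>auto intro!: always_eventually\<close>)
  from tendsto_real_sqrt[OF this] have "(\<lambda>n. T (X n) - m *\<^sub>R X n) \<longlonglongrightarrow> 0"
    by (simp add: tendsto_norm_zero_iff)
  from LIMSEQ_subseq_LIMSEQ[OF this r(1)] have z: "(\<lambda>n. T (X (r n)) - m *\<^sub>R X (r n)) \<longlonglongrightarrow> 0"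
    by (simp add: o_def)
  \<comment> \<open>The vectors themselves are recovered from their convergent images and the
    vanishing defect, because \<open>m\<close> is positive.\<close>
  have "(\<lambda>n. (1/m) *\<^sub>R (T (X (r n)) - (T (X (r n)) - m *\<^sub>R X (r n)))) \<longlonglongrightarrow> (1/m) *\<^sub>R (g - 0)"
    by (intro tendsto_intros g z)
  then have Xg: "(\<lambda>n. X (r n)) \<longlonglongrightarrow> (1/m) *\<^sub>R g" using m0 by simp
  define x where "x = (1/m) *\<^sub>R g"
  have xK: "x \<in> K" using closed_sequentially[OF K(2) _ Xg] X(1) by (simp add: x_def)
  have "(\<lambda>n. T (X (r n))) \<longlonglongrightarrow> T x" using T.tendsto[OF Xg] by (simp add: x_def)
  then have Tx: "T x = m *\<^sub>R x" using g LIMSEQ_unique m0 by (fastforce simp: x_def)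
  \<comment> \<open>The values of the form along the sequence tend to \<open>m > 0\<close>, which
    would be impossible with limit 0.\<close>
  have "x \<noteq> 0"
  proof
    assume "x = 0"
    then have "(\<lambda>n. inner (T (X (r n))) (X (r n))) \<longlonglongrightarrow> inner (T 0) 0"
      using Xg by (intro tendsto_inner T.tendsto) (auto simp: x_def)
    then have *: "(\<lambda>n. inner (T (X (r n))) (X (r n))) \<longlonglongrightarrow> 0" by simp
    have "(\<lambda>n. m - 1 / real (Suc n)) \<longlonglongrightarrow> m - 0"
      using LIMSEQ_Suc[OF lim_1_over_n] by (intro tendsto_intros) simp
    from LIMSEQ_subseq_LIMSEQ[OF this r(1)] have "(\<lambda>n. m - 1 / real (Suc (r n))) \<longlonglongrightarrow> m" by (simp add: o_def)
    from tendsto_le[OF _ * this] have "m \<le> 0" using X(3) by (auto intro: less_imp_le eventuallyI)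
    then show False using m0 by simp
  qed
  then show ?thesis using m0 xK Tx by blast
qed

definition orthonormal_seq :: "(nat \<Rightarrow> 'h::real_inner) \<Rightarrow> bool" where
  "orthonormal_seq e \<longleftrightarrow> (\<forall>i j. inner (e i) (e j) = (if i = j then 1 else 0))"

lemma norm_orthonormal_sum:
  assumes "orthonormal_seq e" "finite I"
  shows "(norm (\<Sum>i\<in>I. c i *\<^sub>R e i))\<^sup>2 = (\<Sum>i\<in>I. (c i)\<^sup>2)"
proof -
  have d: "inner (e i) (e j) = (if i = j then 1 else 0)" for i j
    using assms(1) by (simp only: orthonormal_seq_def)
  have "inner (\<Sum>i\<in>I. c i *\<^sub>R e i) (e j) = c j" if "j \<in> I" for j
    using that assms(2) unfolding inner_sum_left inner_scaleR_left d by (simp add: if_distrib cong: if_cong)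
  then show ?thesis
    unfolding power2_norm_eq_inner inner_sum_right by (simp add: power2_eq_square)
qed

lemma Bessel_finite:
  assumes e: "orthonormal_seq e"
  shows "(\<Sum>i<n. (inner x (e i))\<^sup>2) \<le> (norm x)\<^sup>2"
proof -
  let ?s = "\<Sum>i<n. inner x (e i) *\<^sub>R e i"
  have 1: "inner x ?s = (\<Sum>i<n. (inner x (e i))\<^sup>2)"
    by (simp add: inner_sum_right power2_eq_square)
  have "0 \<le> (norm (x - ?s))\<^sup>2" by simp
  also have "\<dots> = (norm x)\<^sup>2 - 2 * inner x ?s + (norm ?s)\<^sup>2"
    by (simp add: power2_norm_eq_inner inner_diff_left inner_diff_right inner_commute)
  also have "\<dots> = (norm x)\<^sup>2 - (\<Sum>i<n. (inner x (e i))\<^sup>2)"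
    unfolding 1 by (simp add: norm_orthonormal_sum[OF e])
  finally show ?thesis by simp
qed

lemma Bessel_summable:
  assumes e: "orthonormal_seq e"
  shows "summable (\<lambda>i. (inner x (e i))\<^sup>2)"
  by (rule summableI_nonneg_bounded[of _ "(norm x)\<^sup>2"]) (use Bessel_finite[OF e] in auto)

text \<open>Bessel's inequality makes the partial sums Cauchy, and the difference between x and
  their limit is orthogonal to the whole system. Completeness is asked only inside a closed
  subspace, since the eigenfunctions can exhaust only the functions living on \<Omega>.\<close>

lemma orthonormal_expansion:
  fixes e :: "nat \<Rightarrow> 'h::{real_inner, banach}"
  assumes e: "orthonormal_seq e" "\<And>i. e i \<in> S" and S: "subspace S" "closed S"
    and complete: "\<And>x. x \<in> S \<Longrightarrow> (\<And>i. inner x (e i) = 0) \<Longrightarrow> x = 0" and x: "x \<in> S"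
  shows "(\<lambda>i. inner x (e i) *\<^sub>R e i) sums x"
proof -
  have "summable (\<lambda>i. inner x (e i) *\<^sub>R e i)"
    unfolding summable_Cauchy
  proof (intro allI impI)
    fix \<epsilon> :: real assume \<epsilon>: "\<epsilon> > 0"
    then obtain N where N: "\<And>m n. m \<ge> N \<Longrightarrow> norm (\<Sum>i=m..<n. (inner x (e i))\<^sup>2) < \<epsilon>\<^sup>2"
      using Bessel_summable[OF e(1), of x] unfolding summable_Cauchy by (meson zero_less_power)
    show "\<exists>N. \<forall>m\<ge>N. \<forall>n. norm (\<Sum>i=m..<n. inner x (e i) *\<^sub>R e i) < \<epsilon>"
    proof (intro exI[of _ N] allI impI)
      fix m n assume "N \<le> m"
      have "(norm (\<Sum>i=m..<n. inner x (e i) *\<^sub>R e i))\<^sup>2 < \<epsilon>\<^sup>2"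
        using N[OF \<open>N \<le> m\<close>, of n] by (simp add: norm_orthonormal_sum[OF e(1)] sum_nonneg)
      then show "norm (\<Sum>i=m..<n. inner x (e i) *\<^sub>R e i) < \<epsilon>"
        using \<epsilon> by (simp add: power_less_imp_less_base)
    qed
  qed
  then have s: "(\<lambda>i. inner x (e i) *\<^sub>R e i) sums (\<Sum>i. inner x (e i) *\<^sub>R e i)" (is "_ sums ?y") by (rule summable_sums)
  have yS: "?y \<in> S"
  proof (rule closed_sequentially[OF S(2)])
    show "(\<lambda>n. \<Sum>i<n. inner x (e i) *\<^sub>R e i) \<longlonglongrightarrow> ?y" using s by (simp add: sums_def)
    show "(\<Sum>i<n. inner x (e i) *\<^sub>R e i) \<in> S" for n
      using e(2) S by (intro subspace_sum subspace_scale)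
  qed
  have "inner ?y (e j) = inner x (e j)" for j
  proof -
    have "(\<lambda>i. inner (inner x (e i) *\<^sub>R e i) (e j)) sums inner ?y (e j)"
      by (rule bounded_linear.sums[OF bounded_linear_inner_left s])
    moreover have "(\<lambda>i. inner (inner x (e i) *\<^sub>R e i) (e j)) sums inner x (e j)"
    proof -
      have "inner (e i) (e j) = (if i = j then 1 else 0)" for i j
        using e(1) by (simp only: orthonormal_seq_def)
      then have "(\<lambda>i. inner (inner x (e i) *\<^sub>R e i) (e j)) = (\<lambda>i. if i = j then inner x (e i) else 0)"
        by (simp only: inner_scaleR_left) auto
      then show ?thesis using sums_single[of j "\<lambda>i. inner x (e i)"] by simp
    qed
    ultimately show ?thesis using sums_unique2 by blast
  qed
  then have "x - ?y = 0" using yS x S by (intro complete) (auto simp: subspace_diff inner_diff_left)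
  then show ?thesis using s by simp
qed

section \<open>Fourier analysis\<close>

text \<open>Serves the interchanges whose integrand is bounded by a product of one-variable
  integrable functions; that product is integrable on the product space.\<close>

lemma Fubini_dominated:
  fixes f :: "'x \<Rightarrow> 'y \<Rightarrow> 'b::{banach, second_countable_topology}"
  assumes "sigma_finite_measure M" "sigma_finite_measure N"
    and f[measurable]: "case_prod f \<in> borel_measurable (M \<Otimes>\<^sub>M N)"
    and g: "integrable M g" and h: "integrable N h"
    and b: "\<And>x y. x \<in> space M \<Longrightarrow> y \<in> space N \<Longrightarrow> norm (f x y) \<le> g x * h y"
  shows "integrable (M \<Otimes>\<^sub>M N) (case_prod f)"
    and "(\<integral>y. (\<integral>x. f x y \<partial>M) \<partial>N) = (\<integral>x. (\<integral>y. f x y \<partial>N) \<partial>M)"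
proof -
  interpret M: sigma_finite_measure M by fact
  interpret N: sigma_finite_measure N by fact
  interpret pair_sigma_finite M N ..
  have [measurable]: "g \<in> borel_measurable M" "h \<in> borel_measurable N" using g h by auto
  have "integrable (M \<Otimes>\<^sub>M N) (\<lambda>z. g (fst z) * h (snd z))"
  proof (rule Fubini_integrable)
    have "integrable M (\<lambda>x. norm (g x) * (\<integral>y. norm (h y) \<partial>N))"
      using g by (intro integrable_mult_left integrable_norm)
    also have "(\<lambda>x. norm (g x) * (\<integral>y. norm (h y) \<partial>N)) = (\<lambda>x. \<integral>y. norm (g (fst (x, y)) * h (snd (x, y))) \<partial>N)"
      by (simp add: abs_mult)
    finally show "integrable M \<dots>" .
    show "AE x in M. integrable N (\<lambda>y. g (fst (x, y)) * h (snd (x, y)))"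
      using h by simp
  qed measurable
  then show i: "integrable (M \<Otimes>\<^sub>M N) (case_prod f)"
    by (rule Bochner_Integration.integrable_bound)
      (auto intro!: AE_I2 order_trans[OF b] simp: space_pair_measure)
  show "(\<integral>y. (\<integral>x. f x y \<partial>M) \<partial>N) = (\<integral>x. (\<integral>y. f x y \<partial>N) \<partial>M)"
    by (rule Fubini_integral[OF i])
qed

lemma lborel_integral_affine:
  fixes f :: "'a::euclidean_space \<Rightarrow> 'b::{banach, second_countable_topology}"
  assumes [measurable]: "f \<in> borel_measurable borel" and c: "c \<noteq> 0"
  shows "(\<integral>x. f x \<partial>lborel) = \<bar>c\<bar> ^ DIM('a) *\<^sub>R (\<integral>x. f (t + c *\<^sub>R x) \<partial>lborel)"
proof -
  have "(\<integral>x. f x \<partial>lborel) = (\<integral>x. f x \<partial>(density (distr lborel borel (\<lambda>x. t + c *\<^sub>R x)) (\<lambda>_. ennreal (\<bar>c\<bar> ^ DIM('a)))))"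
    using lborel_affine[OF c, of t] by (simp add: ennreal_power)
  also have "\<dots> = \<bar>c\<bar> ^ DIM('a) *\<^sub>R (\<integral>x. f (t + c *\<^sub>R x) \<partial>lborel)"
    by (subst integral_density) (auto simp: integral_distr)
  finally show ?thesis .
qed

lemma lborel_integrable_affine:
  fixes f :: "'a::euclidean_space \<Rightarrow> 'b::{banach, second_countable_topology}"
  assumes f: "integrable lborel f" and c: "c \<noteq> 0"
  shows "integrable lborel (\<lambda>x. f (t + c *\<^sub>R x))"
proof -
  have [measurable]: "f \<in> borel_measurable borel" using f borel_measurable_integrable by fastforce
  have "integrable (density (distr lborel borel (\<lambda>x. t + c *\<^sub>R x)) (\<lambda>_. ennreal (\<bar>c\<bar> ^ DIM('a)))) f"
    using f lborel_affine[OF c, of t] by (simp add: ennreal_power)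
  then have "integrable (distr lborel borel (\<lambda>x. t + c *\<^sub>R x)) (\<lambda>x. \<bar>c\<bar> ^ DIM('a) *\<^sub>R f x)"
    by (subst (asm) integrable_density) auto
  then have "integrable lborel (\<lambda>x. \<bar>c\<bar> ^ DIM('a) *\<^sub>R f (t + c *\<^sub>R x))"
    by (subst (asm) integrable_distr_eq) auto
  then have "integrable lborel (\<lambda>x. inverse (\<bar>c\<bar> ^ DIM('a)) *\<^sub>R \<bar>c\<bar> ^ DIM('a) *\<^sub>R f (t + c *\<^sub>R x))"
    by (rule integrable_scaleR_right)
  then show ?thesis using c by simp
qed

section \<open>The Gaussian and its Fourier transform\<close>

definition gauss :: "'a::euclidean_space \<Rightarrow> real" where
  "gauss z = exp (- (norm z)\<^sup>2 / 2)"

lemma gauss_measurable [measurable]: "gauss \<in> borel_measurable borel"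
  unfolding gauss_def by measurable

lemma gauss_pos [simp]: "0 < gauss z" "0 \<le> gauss z"
  by (simp_all add: gauss_def)

lemma gauss_Fourier_real:
  "integrable lborel (\<lambda>x::real. cis (t * x) * complex_of_real (exp (- x\<^sup>2 / 2)))"
  "(\<integral>x. cis (t * x) * complex_of_real (exp (- x\<^sup>2 / 2)) \<partial>lborel) = complex_of_real (sqrt (2 * pi) * exp (- t\<^sup>2 / 2))"
proof -
  have s: "sqrt (2 * pi) > 0" by simp
  have i: "integrable lborel (\<lambda>x::real. sqrt (2 * pi) * std_normal_density x)"
    by (intro integrable_mult_right integrable_normal_density) simp
  then have i2: "integrable lborel (\<lambda>x::real. exp (- x\<^sup>2 / 2))"
    using s by (simp add: std_normal_density_def)
  show "integrable lborel (\<lambda>x::real. cis (t * x) * complex_of_real (exp (- x\<^sup>2 / 2)))"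
    by (rule Bochner_Integration.integrable_bound[OF i2]) (auto simp: norm_mult cis_conv_exp)
  have "complex_of_real (exp (- t\<^sup>2 / 2)) = char std_normal_distribution t"
    by (simp add: char_std_normal_distribution)
  also have "\<dots> = (\<integral>x. std_normal_density x *\<^sub>R iexp (t * x) \<partial>lborel)"
    unfolding char_def by (subst integral_density) auto
  also have "\<dots> = (\<integral>x. complex_of_real (1 / sqrt (2 * pi)) * (cis (t * x) * complex_of_real (exp (- x\<^sup>2 / 2))) \<partial>lborel)"
    by (intro Bochner_Integration.integral_cong refl) (simp add: std_normal_density_def cis_conv_exp scaleR_conv_of_real mult_ac)
  also have "\<dots> = complex_of_real (1 / sqrt (2 * pi)) * (\<integral>x. cis (t * x) * complex_of_real (exp (- x\<^sup>2 / 2)) \<partial>lborel)"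
    by simp
  finally have "complex_of_real (sqrt (2 * pi)) * complex_of_real (exp (- t\<^sup>2 / 2)) =
    complex_of_real (sqrt (2 * pi)) * (complex_of_real (1 / sqrt (2 * pi)) * (\<integral>x. cis (t * x) * complex_of_real (exp (- x\<^sup>2 / 2)) \<partial>lborel))"
    by simp
  then show "(\<integral>x. cis (t * x) * complex_of_real (exp (- x\<^sup>2 / 2)) \<partial>lborel) = complex_of_real (sqrt (2 * pi) * exp (- t\<^sup>2 / 2))"
    using s by (simp add: mult.assoc[symmetric] flip: of_real_mult)
qed

text \<open>Both the measure and the integrand are products over the basis, so the claim reduces to
  the characteristic function of the standard normal law on the line.\<close>

lemma gauss_Fourier:
  fixes x :: "'a::euclidean_space"
  shows "integrable lborel (\<lambda>z. cis (x \<bullet> z) * complex_of_real (gauss z))"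
    and "(\<integral>z. cis (x \<bullet> z) * complex_of_real (gauss z) \<partial>lborel) = complex_of_real ((2 * pi) powr (real DIM('a) / 2) * gauss x)"
proof -
  define f where "f b t = cis ((x \<bullet> b) * t) * complex_of_real (exp (- t\<^sup>2 / 2))" for b :: 'a and t
  have fm [measurable]: "f b \<in> borel_measurable borel" for b
    unfolding f_def cis_conv_exp by measurable
  interpret product_sigma_finite "\<lambda>b::'a. lborel :: real measure" ..
  have eq: "cis (x \<bullet> z) * complex_of_real (gauss z) = (\<Prod>b\<in>Basis. f b (z \<bullet> b))" for z :: 'a
  proof -
    have "cis (x \<bullet> z) = (\<Prod>b\<in>Basis. cis ((x \<bullet> b) * (z \<bullet> b)))"
      unfolding euclidean_inner[of x z] by (simp add: cis_conv_exp sum_distrib_left exp_sum)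
    moreover have "gauss z = (\<Prod>b\<in>Basis. exp (- (z \<bullet> b)\<^sup>2 / 2))"
      unfolding gauss_def power2_norm_eq_inner euclidean_inner[of z z]
      by (simp add: exp_sum[symmetric] sum_negf sum_divide_distrib power2_eq_square)
    ultimately show ?thesis by (simp add: f_def prod.distrib)
  qed
  have fi: "integrable lborel (f b)" for b unfolding f_def by (rule gauss_Fourier_real)
  have T: "(\<lambda>f. \<Sum>b\<in>Basis. f b *\<^sub>R b) \<in> measurable (\<Pi>\<^sub>M b\<in>(Basis::'a set). lborel) borel" by measurable
  have comp: "(\<Prod>b\<in>Basis. f b ((\<Sum>b\<in>Basis. y b *\<^sub>R b) \<bullet> b)) = (\<Prod>b\<in>Basis. f b (y b))" for y
    by (intro prod.cong refl) (simp add: inner_sum_left inner_Basis if_distrib cong: if_cong)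
  have "integrable (\<Pi>\<^sub>M b\<in>(Basis::'a set). lborel) (\<lambda>y. \<Prod>b\<in>Basis. f b (y b))"
    by (rule product_integrable_prod) (auto simp: fi)
  then have "integrable (distr (\<Pi>\<^sub>M b\<in>(Basis::'a set). lborel) borel (\<lambda>f. \<Sum>b\<in>Basis. f b *\<^sub>R b)) (\<lambda>z. \<Prod>b\<in>Basis. f b (z \<bullet> b))"
    using T by (subst integrable_distr_eq) (auto simp: comp)
  then show "integrable lborel (\<lambda>z. cis (x \<bullet> z) * complex_of_real (gauss z))"
    unfolding eq lborel_eq[symmetric] .
  have "(\<integral>z. cis (x \<bullet> z) * complex_of_real (gauss z) \<partial>lborel) =
    (\<integral>z. (\<Prod>b\<in>Basis. f b (z \<bullet> b)) \<partial>(distr (\<Pi>\<^sub>M b\<in>(Basis::'a set). lborel) borel (\<lambda>f. \<Sum>b\<in>Basis. f b *\<^sub>R b)))"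
    unfolding eq lborel_eq[symmetric] ..
  also have "\<dots> = (\<integral>y. (\<Prod>b\<in>Basis. f b (y b)) \<partial>(\<Pi>\<^sub>M b\<in>(Basis::'a set). lborel))"
    using T by (subst integral_distr) (auto simp: comp)
  also have "\<dots> = (\<Prod>b\<in>Basis. integral\<^sup>L lborel (f b))" by (rule product_integral_prod) (auto simp: fi)
  also have "\<dots> = (\<Prod>b\<in>Basis. complex_of_real (sqrt (2 * pi) * exp (- (x \<bullet> b)\<^sup>2 / 2)))"
    unfolding f_def[abs_def] gauss_Fourier_real(2) ..
  also have "\<dots> = complex_of_real (sqrt (2 * pi) ^ DIM('a) * (\<Prod>b\<in>Basis. exp (- (x \<bullet> b)\<^sup>2 / 2)))"
    by (simp add: prod.distrib)
  also have "(\<Prod>b\<in>Basis. exp (- (x \<bullet> b)\<^sup>2 / 2)) = gauss x"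
    unfolding gauss_def power2_norm_eq_inner euclidean_inner[of x x]
    by (simp add: exp_sum[symmetric] sum_negf sum_divide_distrib power2_eq_square)
  also have "sqrt (2 * pi) ^ DIM('a) = (2 * pi) powr (real DIM('a) / 2)"
    by (simp add: powr_half_sqrt[symmetric] powr_powr powr_realpow[symmetric])
  finally show "(\<integral>z. cis (x \<bullet> z) * complex_of_real (gauss z) \<partial>lborel) = complex_of_real ((2 * pi) powr (real DIM('a) / 2) * gauss x)" .
qed

lemma gauss_integral:
  shows "integrable lborel (gauss :: 'a::euclidean_space \<Rightarrow> real)"
    and "(\<integral>z. gauss (z::'a) \<partial>lborel) = (2 * pi) powr (real DIM('a) / 2)"
proof -
  have "integrable lborel (\<lambda>z::'a. complex_of_real (gauss z))" using gauss_Fourier(1)[of "0::'a"] by simp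
  from integrable_Re[OF this] show "integrable lborel (gauss :: 'a \<Rightarrow> real)" by simp
  have "complex_of_real (\<integral>z. gauss (z::'a) \<partial>lborel) = complex_of_real ((2 * pi) powr (real DIM('a) / 2))"
    using gauss_Fourier(2)[of "0::'a"] by (simp add: gauss_def)
  then show "(\<integral>z. gauss (z::'a) \<partial>lborel) = (2 * pi) powr (real DIM('a) / 2)" by (simp only: of_real_eq_iff)
qed

lemma gauss_Fourier_scaled:
  fixes a :: "'a::euclidean_space"
  assumes "\<epsilon> > 0"
  shows "integrable lborel (\<lambda>\<xi>. cis (\<xi> \<bullet> a) * complex_of_real (gauss (\<epsilon> *\<^sub>R \<xi>)))"
    and "(\<integral>\<xi>. cis (\<xi> \<bullet> a) * complex_of_real (gauss (\<epsilon> *\<^sub>R \<xi>)) \<partial>lborel) =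
      complex_of_real ((2 * pi) powr (real DIM('a) / 2) * (gauss (a /\<^sub>R \<epsilon>) / \<epsilon> ^ DIM('a)))"
proof -
  have m[measurable]: "(\<lambda>z. cis ((a /\<^sub>R \<epsilon>) \<bullet> z) * complex_of_real (gauss z)) \<in> borel_measurable borel"
    unfolding cis_conv_exp by measurable
  have eq: "(\<lambda>\<xi>. cis (\<xi> \<bullet> a) * complex_of_real (gauss (\<epsilon> *\<^sub>R \<xi>))) =
     (\<lambda>\<xi>. cis ((a /\<^sub>R \<epsilon>) \<bullet> (0 + \<epsilon> *\<^sub>R \<xi>)) * complex_of_real (gauss (0 + \<epsilon> *\<^sub>R \<xi>)))"
    using assms by (auto simp: inner_commute field_simps)
  show "integrable lborel (\<lambda>\<xi>. cis (\<xi> \<bullet> a) * complex_of_real (gauss (\<epsilon> *\<^sub>R \<xi>)))"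
    unfolding eq using assms by (intro lborel_integrable_affine[OF gauss_Fourier(1)]) simp
  have "complex_of_real ((2 * pi) powr (real DIM('a) / 2) * gauss (a /\<^sub>R \<epsilon>)) =
     \<bar>\<epsilon>\<bar> ^ DIM('a) *\<^sub>R (\<integral>\<xi>. cis (\<xi> \<bullet> a) * complex_of_real (gauss (\<epsilon> *\<^sub>R \<xi>)) \<partial>lborel)"
    unfolding eq gauss_Fourier(2)[symmetric] using assms by (intro lborel_integral_affine m) auto
  then show "(\<integral>\<xi>. cis (\<xi> \<bullet> a) * complex_of_real (gauss (\<epsilon> *\<^sub>R \<xi>)) \<partial>lborel) =
      complex_of_real ((2 * pi) powr (real DIM('a) / 2) * (gauss (a /\<^sub>R \<epsilon>) / \<epsilon> ^ DIM('a)))"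
    using assms by (simp add: scaleR_conv_of_real field_simps)
qed

section \<open>Fourier transforms of test functions: derivatives, decay, inversion and Parseval's
  identity\<close>

abbreviation fconst :: "'a::euclidean_space itself \<Rightarrow> real" where
  "fconst _ \<equiv> (2 * pi) powr (- real DIM('a) / 2)"

lemma fourier_eq_cis:
  "fourier u \<xi> = complex_of_real (fconst TYPE('a)) * (\<integral>x. cis (- (\<xi> \<bullet> x)) * complex_of_real (u x) \<partial>lborel)"
  for u :: "'a::euclidean_space \<Rightarrow> real"
  unfolding fourier_def cis_conv_exp by simp

lemma cis_measurable [measurable]: "cis \<in> borel_measurable borel"
  unfolding cis_conv_exp[abs_def] by measurable

lemma integrable_cis_mult:
  fixes u :: "'a::euclidean_space \<Rightarrow> real"
  assumes "integrable lborel u" and [measurable]: "g \<in> borel_measurable borel"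
  shows "integrable lborel (\<lambda>x. cis (g x) * complex_of_real (u x))"
  by (rule Bochner_Integration.integrable_bound[OF assms(1)]) (use assms(1) in \<open>auto simp: norm_mult\<close>)

lemma fourier_measurable [measurable]:
  assumes [measurable]: "u \<in> borel_measurable borel"
  shows "fourier u \<in> borel_measurable borel"
proof -
  have "(\<lambda>\<xi>. \<integral>x. cis (- (\<xi> \<bullet> x)) * complex_of_real (u x) \<partial>lborel) \<in> borel_measurable borel"
    by measurable
  then show ?thesis unfolding fourier_eq_cis[abs_def] by measurable
qed

lemma fourier_bounded:
  fixes u :: "'a::euclidean_space \<Rightarrow> real"
  shows "cmod (fourier u \<xi>) \<le> fconst TYPE('a) * (\<integral>x. \<bar>u x\<bar> \<partial>lborel)"
proof -
  have "cmod (\<integral>x. cis (- (\<xi> \<bullet> x)) * complex_of_real (u x) \<partial>lborel) \<le> (\<integral>x. cmod (cis (- (\<xi> \<bullet> x)) * complex_of_real (u x)) \<partial>lborel)"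
    by (rule integral_norm_bound)
  also have "\<dots> = (\<integral>x. \<bar>u x\<bar> \<partial>lborel)" by (simp add: norm_mult)
  finally show ?thesis unfolding fourier_eq_cis by (simp add: norm_mult mult_left_mono)
qed

lemma fourier_add:
  assumes "integrable lborel u" "integrable lborel v"
  shows "fourier (\<lambda>x. u x + v x) \<xi> = fourier u \<xi> + fourier v \<xi>"
  unfolding fourier_eq_cis using assms by (simp add: ring_distribs integrable_cis_mult)

lemma fourier_scale: "fourier (\<lambda>x. c * u x) \<xi> = complex_of_real c * fourier u \<xi>"
  unfolding fourier_eq_cis by (simp add: mult.left_commute)

lemma fourier_diff:
  assumes "integrable lborel u" "integrable lborel v"
  shows "fourier (\<lambda>x. u x - v x) \<xi> = fourier u \<xi> - fourier v \<xi>"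
  unfolding fourier_eq_cis using assms by (simp add: ring_distribs integrable_cis_mult)

lemma fourier_sum:
  assumes "\<And>i. i \<in> I \<Longrightarrow> integrable lborel (u i)"
  shows "fourier (\<lambda>x. \<Sum>i\<in>I. u i x) \<xi> = (\<Sum>i\<in>I. fourier (u i) \<xi>)"
  using assms
proof (induction I rule: infinite_finite_induct)
  case (insert i I)
  then show ?case by (simp add: fourier_add)
qed (simp_all add: fourier_eq_cis)

text \<open>Splits the transform into two real integrals, to which the integration by parts for real
  functions applies.\<close>

lemma fourier_Complex:
  fixes u :: "'a::euclidean_space \<Rightarrow> real"
  assumes "integrable lborel u"
  shows "fourier u \<xi> = complex_of_real (fconst TYPE('a)) *
     Complex (\<integral>x. u x * cos (\<xi> \<bullet> x) \<partial>lborel) (- (\<integral>x. u x * sin (\<xi> \<bullet> x) \<partial>lborel))"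
proof -
  have i: "integrable lborel (\<lambda>x. cis (- (\<xi> \<bullet> x)) * complex_of_real (u x))"
    by (rule integrable_cis_mult[OF assms]) measurable
  have "Re (\<integral>x. cis (- (\<xi> \<bullet> x)) * complex_of_real (u x) \<partial>lborel) = (\<integral>x. u x * cos (\<xi> \<bullet> x) \<partial>lborel)"
    using integral_Re[OF i] by (simp add: mult.commute)
  moreover have "Im (\<integral>x. cis (- (\<xi> \<bullet> x)) * complex_of_real (u x) \<partial>lborel) = - (\<integral>x. u x * sin (\<xi> \<bullet> x) \<partial>lborel)"
    using integral_Im[OF i] by (simp add: mult.commute)
  ultimately show ?thesis unfolding fourier_eq_cis by (simp add: complex_eq_iff)
qed

lemma has_derivative_cos_sin_inner:
  "((\<lambda>x. cos (\<xi> \<bullet> x)) has_derivative (\<lambda>h. - sin (\<xi> \<bullet> x) * (\<xi> \<bullet> h))) (at x)"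
  "((\<lambda>x. sin (\<xi> \<bullet> x)) has_derivative (\<lambda>h. cos (\<xi> \<bullet> x) * (\<xi> \<bullet> h))) (at x)"
  by (auto intro!: derivative_eq_intros)

lemma partial_deriv_cos_sin:
  "partial_deriv b (\<lambda>x. cos (\<xi> \<bullet> x)) x = - sin (\<xi> \<bullet> x) * (\<xi> \<bullet> b)"
  "partial_deriv b (\<lambda>x. sin (\<xi> \<bullet> x)) x = cos (\<xi> \<bullet> x) * (\<xi> \<bullet> b)"
  using partial_deriv_eq[OF has_derivative_cos_sin_inner(1)] partial_deriv_eq[OF has_derivative_cos_sin_inner(2)]
  by auto

lemma C_diff_cos_sin: "C_diff 1 (\<lambda>x. cos (\<xi> \<bullet> x))" "C_diff 1 (\<lambda>x. sin (\<xi> \<bullet> x))"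
proof -
  have "(\<lambda>x. cos (\<xi> \<bullet> x)) differentiable (at x)" "(\<lambda>x. sin (\<xi> \<bullet> x)) differentiable (at x)" for x
    using has_derivative_cos_sin_inner unfolding differentiable_def by blast+
  then show "C_diff 1 (\<lambda>x. cos (\<xi> \<bullet> x))" "C_diff 1 (\<lambda>x. sin (\<xi> \<bullet> x))"
    by (auto simp: differentiable_on_def partial_deriv_cos_sin[abs_def] intro!: continuous_intros)
qed

lemma fourier_partial_deriv:
  assumes \<phi>: "\<phi> \<in> test_functions UNIV" and b: "b \<in> Basis"
  shows "fourier (partial_deriv b \<phi>) \<xi> = \<i> * complex_of_real (\<xi> \<bullet> b) * fourier \<phi> \<xi>"
proof -
  obtain K where K: "compact K" "\<And>x. x \<notin> K \<Longrightarrow> \<phi> x = 0" using test_functionE[OF \<phi>] by metis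
  have c1: "C_diff 1 \<phi>" by (rule smooth_C_diff[OF test_function_smooth[OF \<phi>]])
  have "(\<integral>x. partial_deriv b \<phi> x * cos (\<xi> \<bullet> x) \<partial>lborel) = (\<xi> \<bullet> b) * (\<integral>x. \<phi> x * sin (\<xi> \<bullet> x) \<partial>lborel)"
    using integration_by_parts[OF c1 C_diff_cos_sin(1) K b, of \<xi>]
    by (simp add: partial_deriv_cos_sin mult.assoc[symmetric] mult.commute[of "\<xi> \<bullet> b"])
  moreover have "(\<integral>x. partial_deriv b \<phi> x * sin (\<xi> \<bullet> x) \<partial>lborel) = - (\<xi> \<bullet> b) * (\<integral>x. \<phi> x * cos (\<xi> \<bullet> x) \<partial>lborel)"
    using integration_by_parts[OF c1 C_diff_cos_sin(2) K b, of \<xi>]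
    by (simp add: partial_deriv_cos_sin mult.assoc[symmetric] mult.commute[of "\<xi> \<bullet> b"])
  ultimately show ?thesis
    using test_function_integrable[OF \<phi>] test_function_integrable[OF test_function_partial_deriv[OF \<phi> b]]
    by (simp add: fourier_Complex complex_eq_iff)
qed

lemma fourier_laplacian:
  assumes \<phi>: "\<phi> \<in> test_functions UNIV"
  shows "fourier (laplacian \<phi>) \<xi> = - complex_of_real ((norm \<xi>)\<^sup>2) * fourier \<phi> \<xi>"
proof -
  have "fourier (laplacian \<phi>) \<xi> = (\<Sum>b\<in>Basis. fourier (partial_deriv b (partial_deriv b \<phi>)) \<xi>)"
    unfolding laplacian_def
    by (intro fourier_sum test_function_integrable[of _ UNIV] test_function_partial_deriv \<phi>)
  also have "\<dots> = (\<Sum>b\<in>Basis. - complex_of_real ((\<xi> \<bullet> b) * (\<xi> \<bullet> b)) * fourier \<phi> \<xi>)"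
    by (intro sum.cong refl) (simp add: fourier_partial_deriv test_function_partial_deriv \<phi> algebra_simps)
  also have "\<dots> = - complex_of_real ((norm \<xi>)\<^sup>2) * fourier \<phi> \<xi>"
    unfolding power2_norm_eq_inner euclidean_inner[of \<xi> \<xi>] of_real_sum sum_distrib_right sum_negf[symmetric] by simp
  finally show ?thesis .
qed

text \<open>The weighted transform is the transform of the k-th power of 1 - \<Delta> applied to
  \<phi>; this is a test function, and transforms of integrable functions are bounded.\<close>

lemma fourier_decay:
  assumes \<phi>: "\<phi> \<in> test_functions UNIV"
  obtains C where "\<And>\<xi>. (1 + (norm \<xi>)\<^sup>2) ^ k * cmod (fourier \<phi> \<xi>) \<le> C"
proof -
  have "\<exists>\<psi>\<in>test_functions UNIV. \<forall>\<xi>. fourier \<psi> \<xi> = complex_of_real ((1 + (norm \<xi>)\<^sup>2) ^ k) * fourier \<phi> \<xi>"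
  proof (induction k)
    case 0
    then show ?case using \<phi> by auto
  next
    case (Suc k)
    then obtain \<psi> where \<psi>: "\<psi> \<in> test_functions UNIV" "\<And>\<xi>. fourier \<psi> \<xi> = complex_of_real ((1 + (norm \<xi>)\<^sup>2) ^ k) * fourier \<phi> \<xi>"
      by blast
    have "fourier (\<lambda>x. \<psi> x - laplacian \<psi> x) \<xi> = complex_of_real ((1 + (norm \<xi>)\<^sup>2) ^ Suc k) * fourier \<phi> \<xi>" for \<xi>
      using \<psi> test_function_integrable[OF test_function_laplacian[OF \<psi>(1)]] test_function_integrable[OF \<psi>(1)]
      by (subst fourier_diff) (auto simp: fourier_laplacian algebra_simps)
    then show ?case using \<psi> test_function_diff test_function_laplacian by blast
  qed
  then obtain \<psi> where \<psi>: "\<And>\<xi>. fourier \<psi> \<xi> = complex_of_real ((1 + (norm \<xi>)\<^sup>2) ^ k) * fourier \<phi> \<xi>" by blast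
  have "(1 + (norm \<xi>)\<^sup>2) ^ k * cmod (fourier \<phi> \<xi>) = cmod (fourier \<psi> \<xi>)" for \<xi>
    unfolding \<psi> by (simp add: norm_mult norm_power del: of_real_power of_real_add)
  then show thesis using fourier_bounded[of \<psi>] that by metis
qed

text \<open>Each factor 1 + (\<xi> . b)^2 is at most 1 + |\<xi>|^2, so the power
  \<open>DIM('a)\<close> dominates their product, and the comparison function is a product of copies
  of 1 / (1 + t^2).\<close>

lemma integrable_rational_decay:
  "integrable lborel (\<lambda>\<xi>::'a::euclidean_space. 1 / (1 + (norm \<xi>)\<^sup>2) ^ DIM('a))"
proof -
  have r: "integrable lborel (\<lambda>t::real. 1 / (1 + t\<^sup>2))"
    using integrable_inverse_1_plus_square by (simp add: set_integrable_def divide_inverse)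
  have prod_le: "(\<Prod>b\<in>Basis. 1 + (\<xi> \<bullet> b)\<^sup>2) \<le> (1 + (norm \<xi>)\<^sup>2) ^ DIM('a)" for \<xi> :: 'a
  proof -
    have "(\<Prod>b\<in>Basis. 1 + (\<xi> \<bullet> b)\<^sup>2) \<le> (\<Prod>b\<in>(Basis::'a set). 1 + (norm \<xi>)\<^sup>2)"
    proof (rule prod_mono)
      fix b :: 'a assume "b \<in> Basis"
      then have "\<bar>\<xi> \<bullet> b\<bar> \<le> norm \<xi>" by (rule Basis_le_norm)
      then have "(\<xi> \<bullet> b)\<^sup>2 \<le> (norm \<xi>)\<^sup>2" by (metis abs_norm_cancel abs_le_square_iff)
      then show "0 \<le> 1 + (\<xi> \<bullet> b)\<^sup>2 \<and> 1 + (\<xi> \<bullet> b)\<^sup>2 \<le> 1 + (norm \<xi>)\<^sup>2" by simp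
    qed
    then show ?thesis by simp
  qed
  have "(\<integral>\<^sup>+\<xi>. ennreal (norm (1 / (1 + (norm (\<xi>::'a))\<^sup>2) ^ DIM('a))) \<partial>lborel) \<le>
    (\<integral>\<^sup>+\<xi>. (\<Prod>b\<in>Basis. ennreal (1 / (1 + ((\<xi>::'a) \<bullet> b)\<^sup>2))) \<partial>lborel)"
  proof (rule nn_integral_mono)
    fix \<xi> :: 'a
    have "1 / (1 + (norm \<xi>)\<^sup>2) ^ DIM('a) \<le> 1 / (\<Prod>b\<in>Basis. 1 + (\<xi> \<bullet> b)\<^sup>2)"
      using prod_le by (intro divide_left_mono mult_pos_pos prod_pos) (auto simp: add_pos_nonneg)
    then show "ennreal (norm (1 / (1 + (norm \<xi>)\<^sup>2) ^ DIM('a))) \<le> (\<Prod>b\<in>Basis. ennreal (1 / (1 + (\<xi> \<bullet> b)\<^sup>2)))"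
      by (subst prod_ennreal) (auto simp: prod_dividef intro!: ennreal_leI)
  qed
  also have "\<dots> = (\<Prod>b\<in>(Basis::'a set). \<integral>\<^sup>+t. ennreal (1 / (1 + t\<^sup>2)) \<partial>lborel)"
    by (rule nn_integral_lborel_prod) auto
  also have "\<dots> < \<infinity>"
    using r by (simp add: nn_integral_eq_integral ennreal_power)
  finally show ?thesis by (intro integrableI_bounded) auto
qed

lemma integrable_fourier_weighted:
  fixes \<phi> :: "'a::euclidean_space \<Rightarrow> real"
  assumes \<phi>: "\<phi> \<in> test_functions UNIV"
  shows "integrable lborel (\<lambda>\<xi>. (1 + (norm \<xi>)\<^sup>2) ^ m * cmod (fourier \<phi> \<xi>))"
proof -
  obtain C where C: "\<And>\<xi>. (1 + (norm \<xi>)\<^sup>2) ^ (m + DIM('a)) * cmod (fourier \<phi> \<xi>) \<le> C"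
    using fourier_decay[OF \<phi>] by blast
  have [measurable]: "\<phi> \<in> borel_measurable borel" using \<phi> test_function_measurable by blast
  show ?thesis
  proof (rule Bochner_Integration.integrable_bound)
    show "integrable lborel (\<lambda>\<xi>::'a. C * (1 / (1 + (norm \<xi>)\<^sup>2) ^ DIM('a)))"
      by (intro integrable_mult_right integrable_rational_decay)
    show "AE \<xi> in lborel. norm ((1 + (norm \<xi>)\<^sup>2) ^ m * cmod (fourier \<phi> \<xi>)) \<le> norm (C * (1 / (1 + (norm \<xi>)\<^sup>2) ^ DIM('a)))"
    proof (rule AE_I2)
      fix \<xi> :: 'a
      have p: "(1 + (norm \<xi>)\<^sup>2) ^ DIM('a) > 0" by (simp add: add_pos_nonneg)
      have "(1 + (norm \<xi>)\<^sup>2) ^ m * cmod (fourier \<phi> \<xi>) \<le> C / (1 + (norm \<xi>)\<^sup>2) ^ DIM('a)"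
        using C[of \<xi>] p by (simp add: pos_le_divide_eq power_add mult_ac)
      also have "\<dots> \<le> norm (C * (1 / (1 + (norm \<xi>)\<^sup>2) ^ DIM('a)))" by (simp add: divide_right_mono)
      finally show "norm ((1 + (norm \<xi>)\<^sup>2) ^ m * cmod (fourier \<phi> \<xi>)) \<le> norm (C * (1 / (1 + (norm \<xi>)\<^sup>2) ^ DIM('a)))"
        by (simp add: abs_mult)
    qed
  qed measurable
qed

lemma integrable_fourier:
  assumes \<phi>: "\<phi> \<in> test_functions UNIV"
  shows "integrable lborel (fourier \<phi>)"
proof -
  have [measurable]: "\<phi> \<in> borel_measurable borel" using \<phi> test_function_measurable by blast
  have "integrable lborel (\<lambda>\<xi>. cmod (fourier \<phi> \<xi>))"
    using integrable_fourier_weighted[OF \<phi>, of 0] by simp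
  then show ?thesis by (subst (asm) integrable_norm_iff) auto
qed

lemma gauss_average_tendsto:
  fixes f :: "'a::euclidean_space \<Rightarrow> real"
  assumes f: "continuous_on UNIV f" "\<And>x. \<bar>f x\<bar> \<le> C" and \<epsilon>: "\<epsilon> \<longlonglongrightarrow> 0"
  shows "(\<lambda>k. \<integral>z. f (x - \<epsilon> k *\<^sub>R z) * gauss z \<partial>lborel) \<longlonglongrightarrow> f x * (2 * pi) powr (real DIM('a) / 2)"
proof -
  have [measurable]: "f \<in> borel_measurable borel" using f borel_measurable_continuous_onI by blast
  have "(\<lambda>k. \<integral>z. f (x - \<epsilon> k *\<^sub>R z) * gauss z \<partial>lborel) \<longlonglongrightarrow> (\<integral>z. f x * gauss (z::'a) \<partial>lborel)"
  proof (rule integral_dominated_convergence[where w="\<lambda>z::'a. C * gauss z"])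
    show "integrable lborel (\<lambda>z::'a. C * gauss z)" by (intro integrable_mult_right gauss_integral)
    show "AE z in lborel. (\<lambda>k. f (x - \<epsilon> k *\<^sub>R z) * gauss z) \<longlonglongrightarrow> f x * gauss z"
    proof (intro AE_I2 tendsto_intros)
      fix z
      have "(\<lambda>k. x - \<epsilon> k *\<^sub>R z) \<longlonglongrightarrow> x - 0 *\<^sub>R z" by (intro tendsto_intros \<epsilon>)
      then show "(\<lambda>k. f (x - \<epsilon> k *\<^sub>R z)) \<longlonglongrightarrow> f x"
        using f(1) continuous_on_tendsto_compose[of UNIV f] by auto
    qed
    show "AE z in lborel. norm (f (x - \<epsilon> k *\<^sub>R z) * gauss z) \<le> C * gauss z" for k
      using f(2) by (auto simp: abs_mult intro!: AE_I2 mult_right_mono)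
  qed auto
  then show ?thesis by (simp add: gauss_integral)
qed

lemma fconst_mult [simp]: "fconst TYPE('a::euclidean_space) * (2 * pi) powr (real DIM('a) / 2) = 1"
  by (simp add: powr_add[symmetric])

lemma gauss_convolution_scaled:
  fixes f :: "'a::euclidean_space \<Rightarrow> real"
  assumes [measurable]: "f \<in> borel_measurable borel" and \<epsilon>: "\<epsilon> > 0"
  shows "(\<integral>y. f y * (gauss ((x - y) /\<^sub>R \<epsilon>) / \<epsilon> ^ DIM('a)) \<partial>lborel) = (\<integral>z. f (x - \<epsilon> *\<^sub>R z) * gauss z \<partial>lborel)"
proof -
  have "(\<integral>y. f y * (gauss ((x - y) /\<^sub>R \<epsilon>) / \<epsilon> ^ DIM('a)) \<partial>lborel) =
    \<bar>- \<epsilon>\<bar> ^ DIM('a) *\<^sub>R (\<integral>z. f (x + (- \<epsilon>) *\<^sub>R z) * (gauss ((x - (x + (- \<epsilon>) *\<^sub>R z)) /\<^sub>R \<epsilon>) / \<epsilon> ^ DIM('a)) \<partial>lborel)"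
    by (rule lborel_integral_affine) (use \<epsilon> in auto)
  also have "\<dots> = \<epsilon> ^ DIM('a) * (\<integral>z. (f (x - \<epsilon> *\<^sub>R z) * gauss z) / \<epsilon> ^ DIM('a) \<partial>lborel)"
    using \<epsilon> by simp
  also have "\<dots> = (\<integral>z. f (x - \<epsilon> *\<^sub>R z) * gauss z \<partial>lborel)"
    unfolding integral_divide_zero using \<epsilon> by simp
  finally show ?thesis .
qed

text \<open>A Gaussian factor of width 1/\<epsilon> makes the double integral absolutely convergent.
  Interchanging the integrals produces a Gaussian average of \<phi> at scale \<epsilon> around x;
  integrability of the transform on one side and continuity of \<phi> on the other allow \<epsilon>
  to tend to 0.\<close>

lemma fourier_inversion:
  fixes \<phi> :: "'a::euclidean_space \<Rightarrow> real"
  assumes \<phi>: "\<phi> \<in> test_functions UNIV"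
  shows "complex_of_real (\<phi> x) = complex_of_real (fconst TYPE('a)) * (\<integral>\<xi>. fourier \<phi> \<xi> * cis (\<xi> \<bullet> x) \<partial>lborel)"
proof -
  let ?c = "fconst TYPE('a)"
  have [measurable]: "\<phi> \<in> borel_measurable borel" using \<phi> test_function_measurable by blast
  have i\<phi>: "integrable lborel \<phi>" using \<phi> test_function_integrable by blast
  obtain C where C: "\<And>x. \<bar>\<phi> x\<bar> \<le> C" using test_function_bounded[OF \<phi>] by metis
  define \<epsilon> where "\<epsilon> k = 1 / real (Suc k)" for k
  have \<epsilon>: "\<epsilon> k > 0" "\<epsilon> \<longlonglongrightarrow> 0" for k
    unfolding \<epsilon>_def[abs_def] using LIMSEQ_Suc[OF lim_1_over_n] by auto
  have "(\<lambda>k. \<integral>\<xi>. fourier \<phi> \<xi> * (cis (\<xi> \<bullet> x) * complex_of_real (gauss (\<epsilon> k *\<^sub>R \<xi>))) \<partial>lborel) \<longlonglongrightarrow>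
    (\<integral>\<xi>. fourier \<phi> \<xi> * (cis (\<xi> \<bullet> x) * complex_of_real 1) \<partial>lborel)"
  proof (rule integral_dominated_convergence[where w="\<lambda>\<xi>. cmod (fourier \<phi> \<xi>)"])
    show "integrable lborel (\<lambda>\<xi>. cmod (fourier \<phi> \<xi>))" using integrable_fourier[OF \<phi>] by simp
    show "AE \<xi> in lborel. (\<lambda>k. fourier \<phi> \<xi> * (cis (\<xi> \<bullet> x) * complex_of_real (gauss (\<epsilon> k *\<^sub>R \<xi>)))) \<longlonglongrightarrow> fourier \<phi> \<xi> * (cis (\<xi> \<bullet> x) * complex_of_real 1)"
    proof (intro AE_I2 tendsto_intros)
      fix \<xi> :: 'a
      have "(\<lambda>k. gauss (\<epsilon> k *\<^sub>R \<xi>)) \<longlonglongrightarrow> exp (- (norm (0 *\<^sub>R \<xi>))\<^sup>2 / 2)"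
        unfolding gauss_def by (intro tendsto_intros \<epsilon>) auto
      then show "(\<lambda>k. gauss (\<epsilon> k *\<^sub>R \<xi>)) \<longlonglongrightarrow> 1" by simp
    qed
    show "AE \<xi> in lborel. norm (fourier \<phi> \<xi> * (cis (\<xi> \<bullet> x) * complex_of_real (gauss (\<epsilon> k *\<^sub>R \<xi>)))) \<le> cmod (fourier \<phi> \<xi>)" for k
      by (auto simp: norm_mult gauss_def mult_le_cancel_left1 intro!: AE_I2 mult_left_le)
  qed auto
  moreover have "(\<integral>\<xi>. fourier \<phi> \<xi> * (cis (\<xi> \<bullet> x) * complex_of_real (gauss (\<epsilon> k *\<^sub>R \<xi>))) \<partial>lborel) =
    complex_of_real (\<integral>z. \<phi> (x - \<epsilon> k *\<^sub>R z) * gauss z \<partial>lborel)" for k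
  proof -
    have ig: "integrable lborel (\<lambda>\<xi>::'a. gauss (\<epsilon> k *\<^sub>R \<xi>))"
      using lborel_integrable_affine[OF gauss_integral(1), of "\<epsilon> k" 0] \<epsilon>(1)[of k] by simp
    have "(\<integral>\<xi>. fourier \<phi> \<xi> * (cis (\<xi> \<bullet> x) * complex_of_real (gauss (\<epsilon> k *\<^sub>R \<xi>))) \<partial>lborel) =
      (\<integral>\<xi>. complex_of_real ?c * (\<integral>y. cis (\<xi> \<bullet> (x - y)) * complex_of_real (gauss (\<epsilon> k *\<^sub>R \<xi>) * \<phi> y) \<partial>lborel) \<partial>lborel)"
    proof (intro Bochner_Integration.integral_cong refl)
      fix \<xi> :: 'a
      have "(\<integral>y. cis (\<xi> \<bullet> (x - y)) * complex_of_real (gauss (\<epsilon> k *\<^sub>R \<xi>) * \<phi> y) \<partial>lborel) =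
        (\<integral>y. (cis (\<xi> \<bullet> x) * complex_of_real (gauss (\<epsilon> k *\<^sub>R \<xi>))) * (cis (- (\<xi> \<bullet> y)) * complex_of_real (\<phi> y)) \<partial>lborel)"
      proof (intro Bochner_Integration.integral_cong refl)
        fix y
        have "cis (\<xi> \<bullet> (x - y)) = cis (\<xi> \<bullet> x) * cis (- (\<xi> \<bullet> y))" by (simp add: cis_mult inner_diff_right)
        then show "cis (\<xi> \<bullet> (x - y)) * complex_of_real (gauss (\<epsilon> k *\<^sub>R \<xi>) * \<phi> y) =
          (cis (\<xi> \<bullet> x) * complex_of_real (gauss (\<epsilon> k *\<^sub>R \<xi>))) * (cis (- (\<xi> \<bullet> y)) * complex_of_real (\<phi> y))"
          by (simp only: of_real_mult mult_ac)
      qed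
      also have "\<dots> = (cis (\<xi> \<bullet> x) * complex_of_real (gauss (\<epsilon> k *\<^sub>R \<xi>))) * (\<integral>y. cis (- (\<xi> \<bullet> y)) * complex_of_real (\<phi> y) \<partial>lborel)"
        by (rule integral_mult_right_zero)
      finally show "fourier \<phi> \<xi> * (cis (\<xi> \<bullet> x) * complex_of_real (gauss (\<epsilon> k *\<^sub>R \<xi>))) =
        complex_of_real ?c * (\<integral>y. cis (\<xi> \<bullet> (x - y)) * complex_of_real (gauss (\<epsilon> k *\<^sub>R \<xi>) * \<phi> y) \<partial>lborel)"
        unfolding fourier_eq_cis by (simp only: mult_ac)
    qed
    also have "\<dots> = complex_of_real ?c * (\<integral>\<xi>. (\<integral>y. cis (\<xi> \<bullet> (x - y)) * complex_of_real (gauss (\<epsilon> k *\<^sub>R \<xi>) * \<phi> y) \<partial>lborel) \<partial>lborel)"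
      by simp
    also have "(\<integral>\<xi>. (\<integral>y. cis (\<xi> \<bullet> (x - y)) * complex_of_real (gauss (\<epsilon> k *\<^sub>R \<xi>) * \<phi> y) \<partial>lborel) \<partial>lborel) =
      (\<integral>y. (\<integral>\<xi>. cis (\<xi> \<bullet> (x - y)) * complex_of_real (gauss (\<epsilon> k *\<^sub>R \<xi>) * \<phi> y) \<partial>lborel) \<partial>lborel)"
      by (rule Fubini_dominated(2)[OF lborel.sigma_finite_measure_axioms lborel.sigma_finite_measure_axioms _ _ ig, of _ "\<lambda>y. \<bar>\<phi> y\<bar>"])
       (use i\<phi> in \<open>auto simp: norm_mult mult.commute\<close>)
    also have "\<dots> = (\<integral>y. complex_of_real (\<phi> y) * (\<integral>\<xi>. cis (\<xi> \<bullet> (x - y)) * complex_of_real (gauss (\<epsilon> k *\<^sub>R \<xi>)) \<partial>lborel) \<partial>lborel)"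
      by (simp add: mult_ac flip: Bochner_Integration.integral_mult_right_zero)
    also have "\<dots> = (\<integral>y. complex_of_real ((2 * pi) powr (real DIM('a) / 2) * (\<phi> y * (gauss ((x - y) /\<^sub>R \<epsilon> k) / \<epsilon> k ^ DIM('a)))) \<partial>lborel)"
      unfolding gauss_Fourier_scaled(2)[OF \<epsilon>(1)] by (simp add: mult_ac)
    also have "\<dots> = complex_of_real ((2 * pi) powr (real DIM('a) / 2) * (\<integral>y. \<phi> y * (gauss ((x - y) /\<^sub>R \<epsilon> k) / \<epsilon> k ^ DIM('a)) \<partial>lborel))"
      unfolding integral_complex_of_real by simp
    also have "complex_of_real ?c * \<dots> = complex_of_real (\<integral>y. \<phi> y * (gauss ((x - y) /\<^sub>R \<epsilon> k) / \<epsilon> k ^ DIM('a)) \<partial>lborel)"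
      unfolding of_real_mult[symmetric] mult.assoc[symmetric] fconst_mult by simp
    also have "(\<integral>y. \<phi> y * (gauss ((x - y) /\<^sub>R \<epsilon> k) / \<epsilon> k ^ DIM('a)) \<partial>lborel) = (\<integral>z. \<phi> (x - \<epsilon> k *\<^sub>R z) * gauss z \<partial>lborel)"
      by (rule gauss_convolution_scaled) (use \<epsilon> in auto)
    finally show ?thesis .
  qed
  moreover have "(\<lambda>k. complex_of_real (\<integral>z. \<phi> (x - \<epsilon> k *\<^sub>R z) * gauss z \<partial>lborel)) \<longlonglongrightarrow> complex_of_real (\<phi> x * (2 * pi) powr (real DIM('a) / 2))"
    by (intro tendsto_of_real gauss_average_tendsto[OF test_function_continuous[OF \<phi>] C \<epsilon>(2)])
  ultimately have "(\<integral>\<xi>. fourier \<phi> \<xi> * cis (\<xi> \<bullet> x) \<partial>lborel) = complex_of_real (\<phi> x * (2 * pi) powr (real DIM('a) / 2))"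
    using LIMSEQ_unique by fastforce
  then have "complex_of_real ?c * (\<integral>\<xi>. fourier \<phi> \<xi> * cis (\<xi> \<bullet> x) \<partial>lborel) = complex_of_real (\<phi> x * (?c * (2 * pi) powr (real DIM('a) / 2)))"
    by (simp add: mult_ac)
  then show ?thesis unfolding fconst_mult by simp
qed

text \<open>Averaging over shifts multiplies the transform by the characteristic function
  \<open>k\<close> of the shift, taken to be real. The same identity gives Parseval, for a point
  mass at 0, and the resolvent of the Laplacian, for an exponential mixture of Gaussians. In the
  pairing \<open>u\<close> is merely integrable.\<close>

lemma fourier_average:
  fixes \<phi> u :: "'a::euclidean_space \<Rightarrow> real" and M :: "'m measure"
  assumes M: "finite_measure M" and Y[measurable]: "Y \<in> borel_measurable M"
    and \<phi>: "\<phi> \<in> test_functions UNIV"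
    and k: "\<And>\<xi>. (\<integral>m. cis (- (\<xi> \<bullet> Y m)) \<partial>M) = complex_of_real (k \<xi>)"
  shows "complex_of_real (\<integral>m. \<phi> (x - Y m) \<partial>M) =
      complex_of_real (fconst TYPE('a)) * (\<integral>\<xi>. complex_of_real (k \<xi>) * fourier \<phi> \<xi> * cis (\<xi> \<bullet> x) \<partial>lborel)"
    and "integrable lborel u \<Longrightarrow> complex_of_real (\<integral>x. u x * (\<integral>m. \<phi> (x - Y m) \<partial>M) \<partial>lborel) =
      (\<integral>\<xi>. complex_of_real (k \<xi>) * fourier \<phi> \<xi> * cnj (fourier u \<xi>) \<partial>lborel)"
    and "k \<in> borel_measurable borel" and "\<bar>k \<xi>\<bar> \<le> measure M (space M)"
proof -
  interpret M: finite_measure M by fact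
  have sM: "sigma_finite_measure M" ..
  have [measurable]: "\<phi> \<in> borel_measurable borel" using \<phi> test_function_measurable by blast
  have "(\<lambda>\<xi>. \<integral>m. cis (- (\<xi> \<bullet> Y m)) \<partial>M) \<in> borel_measurable borel" by measurable
  then have "(\<lambda>\<xi>. Re (complex_of_real (k \<xi>))) \<in> borel_measurable borel" unfolding k by measurable
  then show km[measurable]: "k \<in> borel_measurable borel" by simp
  have kb: "\<bar>k \<xi>\<bar> \<le> measure M (space M)" for \<xi>
  proof -
    have "\<bar>k \<xi>\<bar> = cmod (\<integral>m. cis (- (\<xi> \<bullet> Y m)) \<partial>M)" unfolding k by simp
    also have "\<dots> \<le> (\<integral>m. cmod (cis (- (\<xi> \<bullet> Y m))) \<partial>M)" by (rule integral_norm_bound)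
    finally show ?thesis by simp
  qed
  then show "\<bar>k \<xi>\<bar> \<le> measure M (space M)" .
  have if': "integrable lborel (\<lambda>\<xi>. cmod (fourier \<phi> \<xi>))" using integrable_fourier[OF \<phi>] by simp
  have 1: "complex_of_real (\<integral>m. \<phi> (x - Y m) \<partial>M) =
      complex_of_real (fconst TYPE('a)) * (\<integral>\<xi>. complex_of_real (k \<xi>) * fourier \<phi> \<xi> * cis (\<xi> \<bullet> x) \<partial>lborel)" for x
  proof -
    have "complex_of_real (\<integral>m. \<phi> (x - Y m) \<partial>M) = (\<integral>m. complex_of_real (\<phi> (x - Y m)) \<partial>M)" by simp
    also have "\<dots> = complex_of_real (fconst TYPE('a)) * (\<integral>m. (\<integral>\<xi>. fourier \<phi> \<xi> * cis (\<xi> \<bullet> (x - Y m)) \<partial>lborel) \<partial>M)"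
      unfolding fourier_inversion[OF \<phi>] by simp
    also have "(\<integral>m. (\<integral>\<xi>. fourier \<phi> \<xi> * cis (\<xi> \<bullet> (x - Y m)) \<partial>lborel) \<partial>M) = (\<integral>\<xi>. (\<integral>m. fourier \<phi> \<xi> * cis (\<xi> \<bullet> (x - Y m)) \<partial>M) \<partial>lborel)"
      by (rule Fubini_dominated(2)[OF sM lborel.sigma_finite_measure_axioms, of _ "\<lambda>m. 1" "\<lambda>\<xi>. cmod (fourier \<phi> \<xi>)", symmetric])
        (use if' in \<open>auto simp: norm_mult\<close>)
    also have "\<dots> = (\<integral>\<xi>. complex_of_real (k \<xi>) * fourier \<phi> \<xi> * cis (\<xi> \<bullet> x) \<partial>lborel)"
    proof (intro Bochner_Integration.integral_cong refl)
      fix \<xi>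
      have "(\<integral>m. fourier \<phi> \<xi> * cis (\<xi> \<bullet> (x - Y m)) \<partial>M) = (\<integral>m. (fourier \<phi> \<xi> * cis (\<xi> \<bullet> x)) * cis (- (\<xi> \<bullet> Y m)) \<partial>M)"
        by (simp add: inner_diff_right cis_mult mult.assoc)
      also have "\<dots> = complex_of_real (k \<xi>) * fourier \<phi> \<xi> * cis (\<xi> \<bullet> x)"
        using k[of \<xi>] by simp
      finally show "(\<integral>m. fourier \<phi> \<xi> * cis (\<xi> \<bullet> (x - Y m)) \<partial>M) = complex_of_real (k \<xi>) * fourier \<phi> \<xi> * cis (\<xi> \<bullet> x)" .
    qed
    finally show ?thesis .
  qed
  then show "complex_of_real (\<integral>m. \<phi> (x - Y m) \<partial>M) =
      complex_of_real (fconst TYPE('a)) * (\<integral>\<xi>. complex_of_real (k \<xi>) * fourier \<phi> \<xi> * cis (\<xi> \<bullet> x) \<partial>lborel)" .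
  assume u: "integrable lborel u"
  then have [measurable]: "u \<in> borel_measurable borel" using borel_measurable_integrable by fastforce
  have ik: "integrable lborel (\<lambda>\<xi>. cmod (complex_of_real (k \<xi>) * fourier \<phi> \<xi>))"
  proof (rule Bochner_Integration.integrable_bound[OF integrable_mult_right[OF if', of "measure M (space M)"]])
    show "AE \<xi> in lborel. norm (cmod (complex_of_real (k \<xi>) * fourier \<phi> \<xi>)) \<le> norm (measure M (space M) * cmod (fourier \<phi> \<xi>))"
      using kb by (auto simp: norm_mult abs_mult intro!: AE_I2 mult_right_mono)
  qed measurable
  have "complex_of_real (\<integral>x. u x * (\<integral>m. \<phi> (x - Y m) \<partial>M) \<partial>lborel) =
     (\<integral>x. complex_of_real (u x) * complex_of_real (\<integral>m. \<phi> (x - Y m) \<partial>M) \<partial>lborel)"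
    unfolding of_real_mult[symmetric] by (rule integral_complex_of_real[symmetric])
  also have "\<dots> = (\<integral>x. (\<integral>\<xi>. complex_of_real (fconst TYPE('a) * u x) * (complex_of_real (k \<xi>) * fourier \<phi> \<xi> * cis (\<xi> \<bullet> x)) \<partial>lborel) \<partial>lborel)"
    unfolding 1 integral_mult_right_zero of_real_mult by (simp only: mult_ac)
  also have "\<dots> = (\<integral>\<xi>. (\<integral>x. complex_of_real (fconst TYPE('a) * u x) * (complex_of_real (k \<xi>) * fourier \<phi> \<xi> * cis (\<xi> \<bullet> x)) \<partial>lborel) \<partial>lborel)"
    by (rule Fubini_dominated(2)[OF lborel.sigma_finite_measure_axioms lborel.sigma_finite_measure_axioms, of _ "\<lambda>x. \<bar>fconst TYPE('a) * u x\<bar>" "\<lambda>\<xi>. cmod (complex_of_real (k \<xi>) * fourier \<phi> \<xi>)", symmetric])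
      (use u ik in \<open>auto simp: norm_mult abs_mult\<close>)
  also have "\<dots> = (\<integral>\<xi>. complex_of_real (k \<xi>) * fourier \<phi> \<xi> * cnj (fourier u \<xi>) \<partial>lborel)"
  proof (intro Bochner_Integration.integral_cong refl)
    fix \<xi> :: 'a
    have "cnj (fourier u \<xi>) = complex_of_real (fconst TYPE('a)) * (\<integral>x. cnj (cis (- (\<xi> \<bullet> x)) * complex_of_real (u x)) \<partial>lborel)"
      unfolding fourier_eq_cis by (subst complex_cnj_mult) (simp only: complex_cnj_complex_of_real Bochner_Integration.integral_cnj)
    also have "\<dots> = complex_of_real (fconst TYPE('a)) * (\<integral>x. cis (\<xi> \<bullet> x) * complex_of_real (u x) \<partial>lborel)"
      by (simp add: cis_cnj)
    finally have "complex_of_real (k \<xi>) * fourier \<phi> \<xi> * cnj (fourier u \<xi>) =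
      (complex_of_real (k \<xi>) * fourier \<phi> \<xi> * complex_of_real (fconst TYPE('a))) * (\<integral>x. cis (\<xi> \<bullet> x) * complex_of_real (u x) \<partial>lborel)"
      by simp
    also have "\<dots> = (\<integral>x. (complex_of_real (k \<xi>) * fourier \<phi> \<xi> * complex_of_real (fconst TYPE('a))) * (cis (\<xi> \<bullet> x) * complex_of_real (u x)) \<partial>lborel)"
      by (rule integral_mult_right_zero[symmetric])
    finally have eq: "complex_of_real (k \<xi>) * fourier \<phi> \<xi> * cnj (fourier u \<xi>) =
      (\<integral>x. (complex_of_real (k \<xi>) * fourier \<phi> \<xi> * complex_of_real (fconst TYPE('a))) * (cis (\<xi> \<bullet> x) * complex_of_real (u x)) \<partial>lborel)" .
    show "(\<integral>x. complex_of_real (fconst TYPE('a) * u x) * (complex_of_real (k \<xi>) * fourier \<phi> \<xi> * cis (\<xi> \<bullet> x)) \<partial>lborel) = complex_of_real (k \<xi>) * fourier \<phi> \<xi> * cnj (fourier u \<xi>)"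
      unfolding eq by (simp only: of_real_mult mult_ac)
  qed
  finally show "complex_of_real (\<integral>x. u x * (\<integral>m. \<phi> (x - Y m) \<partial>M) \<partial>lborel) =
      (\<integral>\<xi>. complex_of_real (k \<xi>) * fourier \<phi> \<xi> * cnj (fourier u \<xi>) \<partial>lborel)" .
qed

text \<open>The multiplier identity for the point mass at the origin, whose characteristic function
  is 1.\<close>

lemma Parseval_test:
  fixes \<phi> u :: "'a::euclidean_space \<Rightarrow> real"
  assumes \<phi>: "\<phi> \<in> test_functions UNIV" and u: "integrable lborel u"
  shows "complex_of_real (\<integral>x. u x * \<phi> x \<partial>lborel) = (\<integral>\<xi>. fourier \<phi> \<xi> * cnj (fourier u \<xi>) \<partial>lborel)"
proof -
  have [measurable]: "\<phi> \<in> borel_measurable borel" using \<phi> test_function_measurable by blast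
  have r: "(\<integral>m. f m \<partial>return borel (0::'a)) = f 0" if [measurable]: "f \<in> borel_measurable borel" for f :: "'a \<Rightarrow> complex"
    by (rule integral_return) auto
  have r': "(\<integral>m. f m \<partial>return borel (0::'a)) = f 0" if [measurable]: "f \<in> borel_measurable borel" for f :: "'a \<Rightarrow> real"
    by (rule integral_return) auto
  have "complex_of_real (\<integral>x. u x * (\<integral>m. \<phi> (x - m) \<partial>return borel 0) \<partial>lborel) =
     (\<integral>\<xi>. complex_of_real 1 * fourier \<phi> \<xi> * cnj (fourier u \<xi>) \<partial>lborel)"
  proof (rule fourier_average(2)[where Y="\<lambda>m. m" and k="\<lambda>\<xi>. 1", OF _ _ \<phi> _ u])
    show "finite_measure (return borel (0::'a))"
      using prob_space_return[of "0::'a" borel] by (simp add: prob_space_def)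
    show "(\<integral>m. cis (- (\<xi> \<bullet> m)) \<partial>return borel 0) = complex_of_real 1" for \<xi> :: 'a
      by (subst r) auto
  qed simp
  then show ?thesis by (simp add: r')
qed

lemma Plancherel_test:
  fixes \<phi> :: "'a::euclidean_space \<Rightarrow> real"
  assumes \<phi>: "\<phi> \<in> test_functions UNIV"
  shows "(\<integral>x. (\<phi> x)\<^sup>2 \<partial>lborel) = (\<integral>\<xi>. (cmod (fourier \<phi> \<xi>))\<^sup>2 \<partial>lborel)"
proof -
  have "complex_of_real (\<integral>x. (\<phi> x)\<^sup>2 \<partial>lborel) = complex_of_real (\<integral>\<xi>. (cmod (fourier \<phi> \<xi>))\<^sup>2 \<partial>lborel)"
    using Parseval_test[OF \<phi> test_function_integrable[OF \<phi>]]
    by (simp add: power2_eq_square[of "\<phi> _"] complex_norm_square[symmetric] del: of_real_power flip: integral_complex_of_real)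
  then show ?thesis by (simp only: of_real_eq_iff)
qed

lemma integral_grad_eq_fourier:
  fixes \<phi> :: "'a::euclidean_space \<Rightarrow> real"
  assumes \<phi>: "\<phi> \<in> test_functions UNIV"
  shows "(\<integral>x. (norm (grad \<phi> x))\<^sup>2 \<partial>lborel) = (\<integral>\<xi>. (norm \<xi>)\<^sup>2 * (cmod (fourier \<phi> \<xi>))\<^sup>2 \<partial>lborel)"
proof -
  have "complex_of_real (\<integral>x. (norm (grad \<phi> x))\<^sup>2 \<partial>lborel) = - complex_of_real (\<integral>x. \<phi> x * laplacian \<phi> x \<partial>lborel)"
    using integral_grad_grad[OF test_function_smooth[OF \<phi>] \<phi>] by (simp add: power2_norm_eq_inner)
  also have "\<dots> = - (\<integral>\<xi>. - complex_of_real ((norm \<xi>)\<^sup>2) * fourier \<phi> \<xi> * cnj (fourier \<phi> \<xi>) \<partial>lborel)"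
    unfolding Parseval_test[OF test_function_laplacian[OF \<phi>] test_function_integrable[OF \<phi>]] fourier_laplacian[OF \<phi>] ..
  also have "\<dots> = (\<integral>\<xi>. complex_of_real ((norm \<xi>)\<^sup>2 * (cmod (fourier \<phi> \<xi>))\<^sup>2) \<partial>lborel)"
    by (simp add: complex_norm_square mult.assoc del: of_real_power)
  also have "\<dots> = complex_of_real (\<integral>\<xi>. (norm \<xi>)\<^sup>2 * (cmod (fourier \<phi> \<xi>))\<^sup>2 \<partial>lborel)"
    by (rule integral_complex_of_real)
  finally show ?thesis by (simp only: of_real_eq_iff)
qed

lemma integrable_fourier_square:
  fixes \<phi> :: "'a::euclidean_space \<Rightarrow> real"
  assumes \<phi>: "\<phi> \<in> test_functions UNIV"
  shows "integrable lborel (\<lambda>\<xi>. (1 + (norm \<xi>)\<^sup>2) ^ m * (cmod (fourier \<phi> \<xi>))\<^sup>2)"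
proof -
  have [measurable]: "\<phi> \<in> borel_measurable borel" using \<phi> test_function_measurable by blast
  obtain C where C: "\<And>\<xi>. cmod (fourier \<phi> \<xi>) \<le> C" using fourier_bounded by metis
  show ?thesis
  proof (rule Bochner_Integration.integrable_bound[OF integrable_mult_right[OF integrable_fourier_weighted[OF \<phi>, of m], of C]])
    show "AE \<xi> in lborel. norm ((1 + (norm \<xi>)\<^sup>2) ^ m * (cmod (fourier \<phi> \<xi>))\<^sup>2) \<le> norm (C * ((1 + (norm \<xi>)\<^sup>2) ^ m * cmod (fourier \<phi> \<xi>)))"
    proof (rule AE_I2)
      fix \<xi> :: 'a
      have "cmod (fourier \<phi> \<xi>) * ((1 + (norm \<xi>)\<^sup>2) ^ m * cmod (fourier \<phi> \<xi>)) \<le> C * ((1 + (norm \<xi>)\<^sup>2) ^ m * cmod (fourier \<phi> \<xi>))"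
        by (intro mult_right_mono C) auto
      then show "norm ((1 + (norm \<xi>)\<^sup>2) ^ m * (cmod (fourier \<phi> \<xi>))\<^sup>2) \<le> norm (C * ((1 + (norm \<xi>)\<^sup>2) ^ m * cmod (fourier \<phi> \<xi>)))"
        by (simp add: power2_eq_square mult_ac)
    qed
  qed measurable
qed

text \<open>The link between the Fourier definition of the norm and the norm of the pair of a
  function and its gradient, in which the Dirichlet problem is treated.\<close>

lemma sobolev_norm_1_eq:
  fixes \<phi> :: "'a::euclidean_space \<Rightarrow> real"
  assumes \<phi>: "\<phi> \<in> test_functions UNIV"
  shows "(sobolev_norm 1 \<phi>)\<^sup>2 = (\<integral>x. (\<phi> x)\<^sup>2 \<partial>lborel) + (\<integral>x. (norm (grad \<phi> x))\<^sup>2 \<partial>lborel)"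
proof -
  have p: "(1 + (norm \<xi>)\<^sup>2) powr 1 = 1 + (norm \<xi>)\<^sup>2" for \<xi> :: 'a
    by (simp add: add_nonneg_nonneg)
  have [measurable]: "\<phi> \<in> borel_measurable borel" using \<phi> test_function_measurable by blast
  have i: "integrable lborel (\<lambda>\<xi>. (1 + (norm \<xi>)\<^sup>2) * (cmod (fourier \<phi> \<xi>))\<^sup>2)" "integrable lborel (\<lambda>\<xi>. (cmod (fourier \<phi> \<xi>))\<^sup>2)"
    using integrable_fourier_square[OF \<phi>, of 1] integrable_fourier_square[OF \<phi>, of 0] by auto
  have i2: "integrable lborel (\<lambda>\<xi>. (norm \<xi>)\<^sup>2 * (cmod (fourier \<phi> \<xi>))\<^sup>2)"
    using Bochner_Integration.integrable_diff[OF i] by (simp add: algebra_simps)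
  have "(sobolev_norm 1 \<phi>)\<^sup>2 = (\<integral>\<xi>. (1 + (norm \<xi>)\<^sup>2) * (cmod (fourier \<phi> \<xi>))\<^sup>2 \<partial>lborel)"
    unfolding sobolev_norm_def p by (simp add: integral_nonneg_AE add_nonneg_nonneg)
  also have "\<dots> = (\<integral>\<xi>. (cmod (fourier \<phi> \<xi>))\<^sup>2 + (norm \<xi>)\<^sup>2 * (cmod (fourier \<phi> \<xi>))\<^sup>2 \<partial>lborel)"
    by (simp add: algebra_simps)
  also have "\<dots> = (\<integral>\<xi>. (cmod (fourier \<phi> \<xi>))\<^sup>2 \<partial>lborel) + (\<integral>\<xi>. (norm \<xi>)\<^sup>2 * (cmod (fourier \<phi> \<xi>))\<^sup>2 \<partial>lborel)"
    by (rule Bochner_Integration.integral_add[OF i(2) i2])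
  finally show ?thesis by (simp add: Plancherel_test[OF \<phi>] integral_grad_eq_fourier[OF \<phi>])
qed

section \<open>The Sobolev space of the Dirichlet problem\<close>

lemma square_integrable_iff_sqint: "square_integrable u \<longleftrightarrow> sqint u"
  by (simp add: square_integrable_def sqint_def)

lemma sqint_test_function:
  assumes \<phi>: "\<phi> \<in> test_functions \<Omega>"
  shows "sqint \<phi>" "sqint (grad \<phi>)"
proof -
  obtain K where K: "compact K" "K \<subseteq> \<Omega>" "\<And>x. x \<notin> K \<Longrightarrow> \<phi> x = 0" using test_functionE[OF \<phi>] by metis
  have s: "smooth \<phi>" using \<phi> by (rule test_function_smooth)
  have g0: "grad \<phi> x = 0" if "x \<notin> K" for x
    unfolding grad_def using partial_deriv_zero_outside[OF compact_imp_closed[OF K(1)] K(3) that] by simp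
  have c: "continuous_on UNIV \<phi>" "continuous_on UNIV (grad \<phi>)"
    using s by (auto intro: smooth_continuous grad_continuous)
  show "sqint \<phi>" unfolding sqint_def using c K
    by (auto intro!: integrable_continuous_compact_support[OF K(1)] continuous_intros borel_measurable_continuous_onI)
  show "sqint (grad \<phi>)" unfolding sqint_def using c K g0
    by (auto intro!: integrable_continuous_compact_support[OF K(1)] continuous_intros borel_measurable_continuous_onI)
qed

lemma sqint_set_integrable:
  fixes f :: "'a::euclidean_space \<Rightarrow> 'b::euclidean_space"
  assumes f: "sqint f" and A: "A \<in> sets borel" "bounded A"
  shows "set_integrable lborel A f"
proof -
  have [measurable]: "f \<in> borel_measurable borel" "A \<in> sets borel" using f A by (auto simp: sqint_def)
  have fin: "emeasure lborel A < \<infinity>" using emeasure_bounded_finite[OF A(2)] .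
  have "integrable lborel (\<lambda>x. indicator A x + (norm (f x))\<^sup>2)"
    using f fin by (intro Bochner_Integration.integrable_add) (auto simp: sqint_def)
  then show ?thesis unfolding set_integrable_def
  proof (rule Bochner_Integration.integrable_bound)
    have "r \<le> 1 + r\<^sup>2" for r :: real
    proof -
      have "0 \<le> (r - 1)\<^sup>2 + r\<^sup>2 + 1" by simp
      then show ?thesis by (simp add: power2_diff)
    qed
    then show "AE x in lborel. norm (indicator A x *\<^sub>R f x) \<le> norm (indicator A x + (norm (f x))\<^sup>2)"
      by (intro AE_I2) (auto simp: indicator_def)
  qed measurable
qed

lemma grad_add:
  "f differentiable (at x) \<Longrightarrow> g differentiable (at x) \<Longrightarrow> grad (\<lambda>x. f x + g x) x = grad f x + grad g x"
  by (simp add: grad_def partial_deriv_add scaleR_left_distrib sum.distrib)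

lemma grad_scale: 
  assumes "f differentiable (at x)"
  shows "grad (\<lambda>x. c * f x) x = c *\<^sub>R grad f x"
  by (rule has_derivative_grad_unique) (use grad_has_derivative[OF assms] in \<open>auto intro!: derivative_eq_intros\<close>)

lemma grad_diff:
  "f differentiable (at x) \<Longrightarrow> g differentiable (at x) \<Longrightarrow> grad (\<lambda>x. f x - g x) x = grad f x - grad g x"
  by (rule has_derivative_grad_unique) (auto intro!: derivative_eq_intros grad_has_derivative simp: inner_diff_left)

definition embed :: "('a::euclidean_space \<Rightarrow> real) \<Rightarrow> ('a, real) l2 \<times> ('a, 'a) l2" where
  "embed \<phi> = (abs_l2 \<phi>, abs_l2 (grad \<phi>))"

text \<open>The closure of the graph of the gradient. The second component plays the role of the
  weak gradient, and closedness in a product of complete spaces makes this a Hilbert space.\<close>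

definition H01 :: "'a::euclidean_space set \<Rightarrow> (('a, real) l2 \<times> ('a, 'a) l2) set" where
  "H01 \<Omega> = closure (embed ` test_functions \<Omega>)"

lemma embed_add:
  assumes "\<phi> \<in> test_functions \<Omega>" "\<psi> \<in> test_functions \<Omega>"
  shows "embed (\<lambda>x. \<phi> x + \<psi> x) = embed \<phi> + embed \<psi>"
proof -
  have "grad (\<lambda>x. \<phi> x + \<psi> x) = (\<lambda>x. grad \<phi> x + grad \<psi> x)"
    using assms by (intro ext grad_add test_function_differentiable)
  then show ?thesis unfolding embed_def using assms by (simp add: abs_l2_add sqint_test_function)
qed

lemma embed_diff:
  assumes "\<phi> \<in> test_functions \<Omega>" "\<psi> \<in> test_functions \<Omega>"
  shows "embed (\<lambda>x. \<phi> x - \<psi> x) = embed \<phi> - embed \<psi>"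
proof -
  have "grad (\<lambda>x. \<phi> x - \<psi> x) = (\<lambda>x. grad \<phi> x - grad \<psi> x)"
    using assms by (intro ext grad_diff test_function_differentiable)
  then show ?thesis unfolding embed_def using assms by (simp add: abs_l2_diff sqint_test_function)
qed

lemma embed_scale:
  assumes "\<phi> \<in> test_functions \<Omega>"
  shows "embed (\<lambda>x. c * \<phi> x) = c *\<^sub>R embed \<phi>"
proof -
  have "grad (\<lambda>x. c * \<phi> x) = (\<lambda>x. c *\<^sub>R grad \<phi> x)"
    using assms by (intro ext grad_scale test_function_differentiable)
  then show ?thesis unfolding embed_def using assms abs_l2_scale[OF sqint_test_function(1)[OF assms], of c]
    by (simp add: abs_l2_scale sqint_test_function)
qed

lemma norm_embed:
  assumes "\<phi> \<in> test_functions UNIV"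
  shows "norm (embed \<phi>) = sobolev_norm 1 \<phi>"
proof -
  have "(norm (embed \<phi>))\<^sup>2 = (sobolev_norm 1 \<phi>)\<^sup>2"
    unfolding sobolev_norm_1_eq[OF assms] embed_def norm_prod_def
    using assms by (simp add: norm_abs_l2 sqint_test_function)
  moreover have "0 \<le> sobolev_norm 1 \<phi>" unfolding sobolev_norm_def by simp
  ultimately show ?thesis by (simp add: power2_eq_iff_nonneg)
qed

lemma norm_embed_diff:
  assumes "\<phi> \<in> test_functions \<Omega>" "\<psi> \<in> test_functions \<Omega>"
  shows "norm (embed \<phi> - embed \<psi>) = sobolev_norm 1 (\<lambda>x. \<phi> x - \<psi> x)"
proof -
  have "(\<lambda>x. \<phi> x - \<psi> x) \<in> test_functions UNIV"
    using test_function_diff[OF assms] test_functions_mono[of \<Omega> UNIV] by blast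
  then show ?thesis unfolding embed_diff[OF assms, symmetric] by (rule norm_embed)
qed

lemma subspace_closure_l2:
  fixes S :: "'h::real_normed_vector set"
  assumes "subspace S" shows "subspace (closure S)"
  unfolding subspace_def
proof (intro conjI ballI allI)
  show "0 \<in> closure S" using assms subspace_0 closure_subset by blast
next
  fix x y assume "x \<in> closure S" "y \<in> closure S"
  then obtain X Y where "\<And>n. X n \<in> S" "X \<longlonglongrightarrow> x" "\<And>n. Y n \<in> S" "Y \<longlonglongrightarrow> y"
    unfolding closure_sequential by blast
  then show "x + y \<in> closure S" unfolding closure_sequential
    using assms by (intro exI[of _ "\<lambda>n. X n + Y n"]) (auto intro: tendsto_add subspace_add)
next
  fix x and c :: real assume "x \<in> closure S"
  then obtain X where "\<And>n. X n \<in> S" "X \<longlonglongrightarrow> x" unfolding closure_sequential by blast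
  then show "c *\<^sub>R x \<in> closure S" unfolding closure_sequential
    using assms by (intro exI[of _ "\<lambda>n. c *\<^sub>R X n"]) (auto intro: tendsto_scaleR subspace_scale)
qed

lemma subspace_H01: "subspace (H01 \<Omega>)"
  unfolding H01_def
proof (rule subspace_closure_l2, unfold subspace_def, intro conjI ballI allI)
  have "embed (\<lambda>x. 0 * (0::real)) = 0 *\<^sub>R embed (\<lambda>x::'a. 0::real)"
    using embed_scale[OF test_function_zero[of UNIV], of 0] by simp
  then have "0 = embed (\<lambda>x::'a. 0::real)" by simp
  then show "0 \<in> embed ` test_functions \<Omega>" using test_function_zero by blast
next
  fix x y assume "x \<in> embed ` test_functions \<Omega>" "y \<in> embed ` test_functions \<Omega>"
  then obtain \<phi> \<psi> where "\<phi> \<in> test_functions \<Omega>" "\<psi> \<in> test_functions \<Omega>" "x = embed \<phi>" "y = embed \<psi>" by auto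
  then show "x + y \<in> embed ` test_functions \<Omega>"
    using test_function_add[of \<phi> \<Omega> \<psi>] by (simp add: embed_add[symmetric])
next
  fix x and c :: real assume "x \<in> embed ` test_functions \<Omega>"
  then obtain \<phi> where "\<phi> \<in> test_functions \<Omega>" "x = embed \<phi>" by auto
  then show "c *\<^sub>R x \<in> embed ` test_functions \<Omega>"
    using test_function_scale[of \<phi> \<Omega> c] by (simp add: embed_scale[symmetric])
qed

lemma closed_H01: "closed (H01 \<Omega>)"
  by (simp add: H01_def)

lemma embed_in_H01: "\<phi> \<in> test_functions \<Omega> \<Longrightarrow> embed \<phi> \<in> H01 \<Omega>"
  unfolding H01_def by (intro subsetD[OF closure_subset] imageI)

lemma H01E:
  assumes "(v, g) \<in> H01 \<Omega>"
  obtains \<psi> where "\<And>k::nat. \<psi> k \<in> test_functions \<Omega>" "(\<lambda>k. abs_l2 (\<psi> k)) \<longlonglongrightarrow> v" "(\<lambda>k. abs_l2 (grad (\<psi> k))) \<longlonglongrightarrow> g"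
proof -
  obtain X where X: "\<And>n. X n \<in> embed ` test_functions \<Omega>" "X \<longlonglongrightarrow> (v, g)"
    using assms unfolding H01_def closure_sequential by blast
  then have "\<forall>n. \<exists>\<psi>. \<psi> \<in> test_functions \<Omega> \<and> X n = embed \<psi>" by blast
  then obtain \<psi> where \<psi>: "\<And>n. \<psi> n \<in> test_functions \<Omega>" "\<And>n. X n = embed (\<psi> n)" by metis
  have "(\<lambda>n. fst (X n)) \<longlonglongrightarrow> v" "(\<lambda>n. snd (X n)) \<longlonglongrightarrow> g"
    using tendsto_fst[OF X(2)] tendsto_snd[OF X(2)] by auto
  then show thesis using \<psi> by (intro that[of \<psi>]) (auto simp: embed_def)
qed

text \<open>On test functions the Sobolev norm is the graph norm, so a Sobolev-Cauchy sequence is a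
  Cauchy sequence of pairs; its limit supplies the gradient component.\<close>

lemma sobolev_completion_iff:
  "v \<in> sobolev_completion 1 \<Omega> \<longleftrightarrow> sqint v \<and> (\<exists>g. (abs_l2 v, g) \<in> H01 \<Omega>)"
proof
  assume "v \<in> sobolev_completion 1 \<Omega>"
  then obtain \<phi> where v: "sqint v" and \<phi>: "\<And>k::nat. \<phi> k \<in> test_functions \<Omega>"
    and C: "\<And>e. e > 0 \<Longrightarrow> \<exists>N. \<forall>k\<ge>N. \<forall>m\<ge>N. sobolev_norm 1 (\<lambda>x. \<phi> k x - \<phi> m x) < e"
    and lim: "(\<lambda>k. \<integral>x. (\<phi> k x - v x)\<^sup>2 \<partial>lborel) \<longlonglongrightarrow> 0"
    unfolding sobolev_completion_def square_integrable_iff_sqint by blast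
  have n: "norm (embed (\<phi> k) - embed (\<phi> m)) = sobolev_norm 1 (\<lambda>x. \<phi> k x - \<phi> m x)" for k m
    by (rule norm_embed_diff) (rule \<phi>)+
  have "Cauchy (\<lambda>k. embed (\<phi> k))" unfolding Cauchy_iff n using C by blast
  then obtain X where X: "(\<lambda>k. embed (\<phi> k)) \<longlonglongrightarrow> X" by (auto simp: Cauchy_convergent_iff convergent_def)
  have XH: "X \<in> H01 \<Omega>" using closed_sequentially[OF closed_H01 _ X] \<phi> embed_in_H01 by blast
  have "(\<lambda>k. abs_l2 (\<phi> k)) \<longlonglongrightarrow> abs_l2 v"
    using lim by (subst abs_l2_tendsto_iff) (auto simp: v sqint_test_function[OF \<phi>])
  moreover have "(\<lambda>k. abs_l2 (\<phi> k)) \<longlonglongrightarrow> fst X" using tendsto_fst[OF X] by (simp add: embed_def)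
  ultimately have "fst X = abs_l2 v" using LIMSEQ_unique by blast
  then show "sqint v \<and> (\<exists>g. (abs_l2 v, g) \<in> H01 \<Omega>)" using XH v by (metis prod.collapse)
next
  assume "sqint v \<and> (\<exists>g. (abs_l2 v, g) \<in> H01 \<Omega>)"
  then obtain g where v: "sqint v" and H: "(abs_l2 v, g) \<in> H01 \<Omega>" by blast
  obtain \<psi> where \<psi>: "\<And>k::nat. \<psi> k \<in> test_functions \<Omega>" "(\<lambda>k. abs_l2 (\<psi> k)) \<longlonglongrightarrow> abs_l2 v" "(\<lambda>k. abs_l2 (grad (\<psi> k))) \<longlonglongrightarrow> g"
    using H01E[OF H] by blast
  have n: "norm (embed (\<psi> k) - embed (\<psi> m)) = sobolev_norm 1 (\<lambda>x. \<psi> k x - \<psi> m x)" for k m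
    by (rule norm_embed_diff) (rule \<psi>)+
  have "(\<lambda>k. embed (\<psi> k)) \<longlonglongrightarrow> (abs_l2 v, g)" unfolding embed_def by (intro tendsto_Pair \<psi>)
  then have "Cauchy (\<lambda>k. embed (\<psi> k))" using LIMSEQ_imp_Cauchy by blast
  then have C: "\<forall>e>0. \<exists>N. \<forall>k\<ge>N. \<forall>m\<ge>N. sobolev_norm 1 (\<lambda>x. \<psi> k x - \<psi> m x) < e"
    unfolding Cauchy_iff n .
  have "(\<lambda>k. \<integral>x. (\<psi> k x - v x)\<^sup>2 \<partial>lborel) \<longlonglongrightarrow> 0"
    using \<psi>(2) by (subst (asm) abs_l2_tendsto_iff) (auto simp: v sqint_test_function[OF \<psi>(1)])
  then show "v \<in> sobolev_completion 1 \<Omega>"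
    unfolding sobolev_completion_def square_integrable_iff_sqint using v \<psi>(1) C by blast
qed

text \<open>Passes to the limit from the test functions approximating \<open>v\<close>. Their
  compact supports lie in \<Omega>, so \<open>X\<close> need not vanish near the boundary.\<close>

lemma inner_H01_grad:
  assumes "(v, g) \<in> H01 \<Omega>" and \<chi>: "X \<in> test_functions UNIV"
  shows "inner g (abs_l2 (grad X)) = - inner v (abs_l2 (laplacian X))"
proof -
  obtain \<psi> where \<psi>: "\<And>k::nat. \<psi> k \<in> test_functions \<Omega>" "(\<lambda>k. abs_l2 (\<psi> k)) \<longlonglongrightarrow> v" "(\<lambda>k. abs_l2 (grad (\<psi> k))) \<longlonglongrightarrow> g"
    using H01E[OF assms(1)] by blast
  have eq: "inner (abs_l2 (grad (\<psi> k))) (abs_l2 (grad X)) = - inner (abs_l2 (\<psi> k)) (abs_l2 (laplacian X))" for k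
    using integral_grad_grad[OF test_function_smooth[OF \<psi>(1)[of k]] \<chi>]
      sqint_test_function[OF \<psi>(1)[of k]] sqint_test_function[OF \<chi>] sqint_test_function(1)[OF test_function_laplacian[OF \<chi>]]
    by (simp add: inner_abs_l2)
  have "(\<lambda>k. inner (abs_l2 (grad (\<psi> k))) (abs_l2 (grad X))) \<longlonglongrightarrow> inner g (abs_l2 (grad X))"
    by (intro tendsto_intros \<psi>)
  moreover have "(\<lambda>k. inner (abs_l2 (grad (\<psi> k))) (abs_l2 (grad X))) \<longlonglongrightarrow> - inner v (abs_l2 (laplacian X))"
    unfolding eq by (intro tendsto_intros \<psi>)
  ultimately show ?thesis using LIMSEQ_unique by blast
qed

text \<open>Square-integrable functions vanishing outside \<open>\<Omega>\<close>, written as an orthogonal complement so that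
  the set is visibly closed.\<close>

definition L2_on :: "'a::euclidean_space set \<Rightarrow> ('a, real) l2 set" where
  "L2_on \<Omega> = {f. \<forall>h. sqint h \<and> (\<forall>x\<in>\<Omega>. h x = 0) \<longrightarrow> inner f (abs_l2 h) = 0}"

lemma subspace_L2_on: "subspace (L2_on \<Omega>)"
  unfolding subspace_def L2_on_def by (auto simp: inner_add_left)

lemma closed_L2_on: "closed (L2_on \<Omega>)"
proof -
  have "L2_on \<Omega> = (\<Inter>h\<in>{h. sqint h \<and> (\<forall>x\<in>\<Omega>. h x = 0)}. {f. inner f (abs_l2 h) = 0})"
    by (auto simp: L2_on_def)
  then show ?thesis
    by (auto intro!: closed_INT closed_Collect_eq continuous_intros)
qed

lemma abs_l2_in_L2_on_iff:
  assumes f: "sqint f" and "\<Omega> \<in> sets borel"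
  shows "abs_l2 f \<in> L2_on \<Omega> \<longleftrightarrow> (AE x in lborel. x \<notin> \<Omega> \<longrightarrow> f x = 0)"
proof
  have [measurable]: "f \<in> borel_measurable borel" "\<Omega> \<in> sets borel" using assms by (auto simp: sqint_def)
  \<comment> \<open>The part of \<open>f\<close> outside \<Omega>: pairing \<open>f\<close> with it
    gives the square of its norm.\<close>
  define h where "h x = (if x \<in> \<Omega> then 0 else f x)" for x
  have h: "sqint h"
    unfolding sqint_def
  proof
    show hm: "h \<in> borel_measurable lborel" unfolding h_def by measurable
    show "integrable lborel (\<lambda>x. (norm (h x))\<^sup>2)"
    proof (rule Bochner_Integration.integrable_bound)
      show "integrable lborel (\<lambda>x. (norm (f x))\<^sup>2)" using f by (simp add: sqint_def)
      show "(\<lambda>x. (norm (h x))\<^sup>2) \<in> borel_measurable lborel" using hm by measurable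
      show "AE x in lborel. norm ((norm (h x))\<^sup>2) \<le> norm ((norm (f x))\<^sup>2)" by (simp add: h_def)
    qed
  qed
  assume "abs_l2 f \<in> L2_on \<Omega>"
  then have "inner (abs_l2 f) (abs_l2 h) = 0" unfolding L2_on_def using h by (auto simp: h_def)
  then have "(\<integral>x. f x * h x \<partial>lborel) = 0" using f h by (simp add: inner_abs_l2)
  moreover have "(\<lambda>x. f x * h x) = (\<lambda>x. (norm (h x))\<^sup>2)" by (auto simp: h_def power2_eq_square)
  ultimately have "(\<integral>x. (norm (h x))\<^sup>2 \<partial>lborel) = 0" by simp
  then have "AE x in lborel. (norm (h x))\<^sup>2 = 0"
    using h by (subst (asm) integral_nonneg_eq_0_iff_AE) (auto simp: sqint_def)
  then show "AE x in lborel. x \<notin> \<Omega> \<longrightarrow> f x = 0" by eventually_elim (auto simp: h_def)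
next
  assume ae: "AE x in lborel. x \<notin> \<Omega> \<longrightarrow> f x = 0"
  show "abs_l2 f \<in> L2_on \<Omega>" unfolding L2_on_def
  proof (intro CollectI allI impI)
    fix h :: "'a \<Rightarrow> real" assume h: "sqint h \<and> (\<forall>x\<in>\<Omega>. h x = 0)"
    then have [measurable]: "h \<in> borel_measurable borel" "f \<in> borel_measurable borel" using f by (auto simp: sqint_def)
    have "(\<integral>x. f x * h x \<partial>lborel) = 0"
    proof (rule integral_eq_zero_AE)
      show "AE x in lborel. f x * h x = 0" using ae by eventually_elim (use h in auto)
    qed
    then show "inner (abs_l2 f) (abs_l2 h) = 0" using f h by (simp add: inner_abs_l2)
  qed
qed

lemma H01_fst_L2_on:
  assumes "(v, g) \<in> H01 \<Omega>" "\<Omega> \<in> sets borel"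
  shows "v \<in> L2_on \<Omega>"
proof -
  obtain \<psi> where \<psi>: "\<And>k::nat. \<psi> k \<in> test_functions \<Omega>" "(\<lambda>k. abs_l2 (\<psi> k)) \<longlonglongrightarrow> v"
    using H01E[OF assms(1)] by blast
  have "abs_l2 (\<psi> k) \<in> L2_on \<Omega>" for k
    using sqint_test_function[OF \<psi>(1)[of k]] test_function_outside[OF \<psi>(1)[of k]] assms(2)
    by (subst abs_l2_in_L2_on_iff) auto
  then show ?thesis using closed_sequentially[OF closed_L2_on _ \<psi>(2)] by blast
qed

section \<open>The resolvent of the Dirichlet Laplacian\<close>

definition weak_solution :: "'a::euclidean_space set \<Rightarrow> real \<Rightarrow> ('a, real) l2 \<Rightarrow> ('a, real) l2 \<times> ('a, 'a) l2 \<Rightarrow> bool" where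
  "weak_solution \<Omega> t f x \<longleftrightarrow> x \<in> H01 \<Omega> \<and>
    (\<forall>y\<in>H01 \<Omega>. t * inner (fst x) (fst y) + inner (snd x) (snd y) = inner f (fst y))"

text \<open>After scaling the first component by \<open>sqrt t\<close>, the form t (x, y) + (grad x,
  grad y) is the inner product of the product space. The solution is then the orthogonal projection
  of \<open>(f /\<^sub>R sqrt t, 0)\<close> onto the rescaled copy of
  \<open>H01 \<Omega>\<close>.\<close>

lemma weak_solution_exists:
  assumes t: "t > 0"
  shows "\<exists>x. weak_solution \<Omega> t f x"
proof -
  define W where "W = {x. (fst x /\<^sub>R sqrt t, snd x) \<in> H01 \<Omega>}"
  have "closed ((\<lambda>x. (fst x /\<^sub>R sqrt t, snd x)) -` H01 \<Omega>)"
    by (intro closed_vimage closed_H01 continuous_intros)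
  then have cW: "closed W" by (simp add: W_def vimage_def)
  have sW: "subspace W" unfolding subspace_def
  proof (intro conjI ballI allI)
    show "0 \<in> W" using subspace_0[OF subspace_H01[of \<Omega>]] by (simp add: W_def zero_prod_def)
    show "x + y \<in> W" if "x \<in> W" "y \<in> W" for x y
      using that subspace_add[OF subspace_H01[of \<Omega>], of "(fst x /\<^sub>R sqrt t, snd x)" "(fst y /\<^sub>R sqrt t, snd y)"]
      by (simp add: W_def scaleR_right_distrib)
    show "c *\<^sub>R x \<in> W" if "x \<in> W" for x c
      using that subspace_scale[OF subspace_H01[of \<Omega>], of "(fst x /\<^sub>R sqrt t, snd x)" c]
      by (simp add: W_def mult.commute)
  qed
  obtain y where y: "y \<in> W" "\<And>z. z \<in> W \<Longrightarrow> inner ((f /\<^sub>R sqrt t, 0) - y) z = 0"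
    using orthogonal_projection_exists[OF sW cW, of "(f /\<^sub>R sqrt t, 0)"] by blast
  have "weak_solution \<Omega> t f (fst y /\<^sub>R sqrt t, snd y)"
    unfolding weak_solution_def
  proof (intro conjI ballI)
    show "(fst y /\<^sub>R sqrt t, snd y) \<in> H01 \<Omega>" using y(1) by (simp add: W_def)
    fix z assume z: "z \<in> H01 \<Omega>"
    then have "(sqrt t *\<^sub>R fst z, snd z) \<in> W" using t by (simp add: W_def)
    from y(2)[OF this] have "inner f (fst z) - sqrt t * inner (fst y) (fst z) - inner (snd y) (snd z) = 0"
      using t by (simp add: inner_prod_def inner_diff_left right_diff_distrib mult.assoc[symmetric])
    moreover have "t * inverse (sqrt t) = sqrt t" using t real_div_sqrt[of t] by (simp add: divide_inverse)
    ultimately show "t * inner (fst (fst y /\<^sub>R sqrt t, snd y)) (fst z) + inner (snd (fst y /\<^sub>R sqrt t, snd y)) (snd z) = inner f (fst z)"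
      by (simp add: mult.assoc[symmetric])
  qed
  then show ?thesis by blast
qed

lemma weak_solution_energy:
  assumes "weak_solution \<Omega> t f x"
  shows "t * (norm (fst x))\<^sup>2 + (norm (snd x))\<^sup>2 = inner f (fst x)"
  using assms by (simp add: weak_solution_def power2_norm_eq_inner)

lemma weak_solution_unique:
  assumes t: "t > 0" and x: "weak_solution \<Omega> t f x" and y: "weak_solution \<Omega> t f y"
  shows "x = y"
proof -
  have "weak_solution \<Omega> t 0 (x - y)"
    unfolding weak_solution_def
  proof (intro conjI ballI)
    show "x - y \<in> H01 \<Omega>" using x y by (intro subspace_diff[OF subspace_H01]) (auto simp: weak_solution_def)
    fix z assume "z \<in> H01 \<Omega>"
    then have "t * inner (fst x) (fst z) + inner (snd x) (snd z) = inner f (fst z)"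
      "t * inner (fst y) (fst z) + inner (snd y) (snd z) = inner f (fst z)"
      using x y by (auto simp: weak_solution_def)
    then show "t * inner (fst (x - y)) (fst z) + inner (snd (x - y)) (snd z) = inner 0 (fst z)"
      by (simp add: inner_diff_left right_diff_distrib)
  qed
  from weak_solution_energy[OF this] have "t * (norm (fst (x - y)))\<^sup>2 + (norm (snd (x - y)))\<^sup>2 = 0" by simp
  moreover have "0 \<le> t * (norm (fst (x - y)))\<^sup>2" "0 \<le> (norm (snd (x - y)))\<^sup>2" using t by auto
  ultimately have "t * (norm (fst (x - y)))\<^sup>2 = 0 \<and> (norm (snd (x - y)))\<^sup>2 = 0" by linarith
  then show ?thesis using t by (auto simp: prod_eq_iff)
qed

definition resolvent :: "'a::euclidean_space set \<Rightarrow> real \<Rightarrow> ('a, real) l2 \<Rightarrow> ('a, real) l2" where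
  "resolvent \<Omega> t f = fst (THE x. weak_solution \<Omega> t f x)"

lemma resolvent_eqI: "t > 0 \<Longrightarrow> weak_solution \<Omega> t f x \<Longrightarrow> resolvent \<Omega> t f = fst x"
  unfolding resolvent_def by (metis the_equality weak_solution_unique)

lemma resolventE:
  assumes "t > 0"
  obtains g where "weak_solution \<Omega> t f (resolvent \<Omega> t f, g)"
  using weak_solution_exists[OF assms, of \<Omega> f] resolvent_eqI[OF assms] by (metis prod.collapse)

lemma resolvent_symmetric:
  assumes t: "t > 0"
  shows "inner (resolvent \<Omega> t f) h = inner f (resolvent \<Omega> t h)"
proof -
  obtain a where a: "weak_solution \<Omega> t f (resolvent \<Omega> t f, a)" using resolventE[OF t] by blast
  obtain b where b: "weak_solution \<Omega> t h (resolvent \<Omega> t h, b)" using resolventE[OF t] by blast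
  have "t * inner (resolvent \<Omega> t f) (resolvent \<Omega> t h) + inner a b = inner f (resolvent \<Omega> t h)"
    using a b by (auto simp: weak_solution_def)
  moreover have "t * inner (resolvent \<Omega> t h) (resolvent \<Omega> t f) + inner b a = inner h (resolvent \<Omega> t f)"
    using a b by (auto simp: weak_solution_def)
  ultimately show ?thesis by (simp add: inner_commute)
qed

lemma norm_resolvent_le:
  assumes t: "t > 0" and x: "weak_solution \<Omega> t f (v, g)"
  shows "t * norm v \<le> norm f" "t * (norm g)\<^sup>2 \<le> (norm f)\<^sup>2"
proof -
  have e: "t * (norm v)\<^sup>2 + (norm g)\<^sup>2 = inner f v" using weak_solution_energy[OF x] by simp
  have c: "inner f v \<le> norm f * norm v" by (rule norm_cauchy_schwarz)
  have "t * (norm v)\<^sup>2 \<le> norm f * norm v" using e c zero_le_power2[of "norm g"] by linarith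
  then show 1: "t * norm v \<le> norm f"
    by (cases "norm v = 0") (auto simp: power2_eq_square)
  have "0 \<le> t * (norm v)\<^sup>2" using t by simp
  then have "(norm g)\<^sup>2 \<le> norm f * norm v" using e c by linarith
  then have "t * (norm g)\<^sup>2 \<le> norm f * (t * norm v)" using t by (simp add: mult.left_commute mult_left_mono)
  also have "\<dots> \<le> norm f * norm f" using 1 by (intro mult_left_mono) auto
  finally show "t * (norm g)\<^sup>2 \<le> (norm f)\<^sup>2" by (simp add: power2_eq_square)
qed

lemma bounded_linear_resolvent:
  assumes t: "t > 0"
  shows "bounded_linear (resolvent \<Omega> t)"
proof (rule bounded_linear_intro[where K="1 / t"])
  fix f h and c :: real
  obtain a where a: "weak_solution \<Omega> t f (resolvent \<Omega> t f, a)" using resolventE[OF t] by blast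
  obtain b where b: "weak_solution \<Omega> t h (resolvent \<Omega> t h, b)" using resolventE[OF t] by blast
  have "weak_solution \<Omega> t (f + h) ((resolvent \<Omega> t f, a) + (resolvent \<Omega> t h, b))"
    unfolding weak_solution_def
  proof (intro conjI ballI)
    show "(resolvent \<Omega> t f, a) + (resolvent \<Omega> t h, b) \<in> H01 \<Omega>"
      using a b by (intro subspace_add[OF subspace_H01]) (auto simp: weak_solution_def)
    fix z assume "z \<in> H01 \<Omega>"
    then have "t * inner (resolvent \<Omega> t f) (fst z) + inner a (snd z) = inner f (fst z)"
      "t * inner (resolvent \<Omega> t h) (fst z) + inner b (snd z) = inner h (fst z)"
      using a b by (auto simp: weak_solution_def)
    then show "t * inner (fst ((resolvent \<Omega> t f, a) + (resolvent \<Omega> t h, b))) (fst z) +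
      inner (snd ((resolvent \<Omega> t f, a) + (resolvent \<Omega> t h, b))) (snd z) = inner (f + h) (fst z)"
      by (simp add: inner_add_left distrib_left)
  qed
  from resolvent_eqI[OF t this] show "resolvent \<Omega> t (f + h) = resolvent \<Omega> t f + resolvent \<Omega> t h" by simp
  have "weak_solution \<Omega> t (c *\<^sub>R f) (c *\<^sub>R (resolvent \<Omega> t f, a))"
    unfolding weak_solution_def
  proof (intro conjI ballI)
    show "c *\<^sub>R (resolvent \<Omega> t f, a) \<in> H01 \<Omega>"
      using a by (intro subspace_scale[OF subspace_H01]) (auto simp: weak_solution_def)
    fix z assume "z \<in> H01 \<Omega>"
    then have "c * (t * inner (resolvent \<Omega> t f) (fst z) + inner a (snd z)) = c * inner f (fst z)"
      using a by (auto simp: weak_solution_def)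
    then show "t * inner (fst (c *\<^sub>R (resolvent \<Omega> t f, a))) (fst z) + inner (snd (c *\<^sub>R (resolvent \<Omega> t f, a))) (snd z)
      = inner (c *\<^sub>R f) (fst z)" by (simp add: distrib_left mult.left_commute)
  qed
  from resolvent_eqI[OF t this] show "resolvent \<Omega> t (c *\<^sub>R f) = c *\<^sub>R resolvent \<Omega> t f" by simp
  show "norm (resolvent \<Omega> t f) \<le> norm f * (1 / t)"
    using norm_resolvent_le(1)[OF t a] t by (simp add: field_simps)
qed

lemma resolvent_in_L2_on:
  assumes "t > 0" "\<Omega> \<in> sets borel" shows "resolvent \<Omega> t f \<in> L2_on \<Omega>"
  using resolventE[OF assms(1)] H01_fst_L2_on[OF _ assms(2)] unfolding weak_solution_def by metis

lemma L2_on_test_orthogonal: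
  assumes \<Omega>: "open \<Omega>" "bounded \<Omega>" and f: "f \<in> L2_on \<Omega>"
    and orth: "\<And>\<phi>. \<phi> \<in> test_functions \<Omega> \<Longrightarrow> inner f (abs_l2 \<phi>) = 0"
  shows "f = 0"
proof -
  obtain F where F: "sqint F" "f = abs_l2 F" using l2_cases by blast
  then have [measurable]: "F \<in> borel_measurable borel" by (auto simp: sqint_def)
  have [measurable]: "\<Omega> \<in> sets borel" using \<Omega> by auto
  have out: "AE x in lborel. x \<notin> \<Omega> \<longrightarrow> F x = 0"
    using abs_l2_in_L2_on_iff[OF F(1) \<open>\<Omega> \<in> sets borel\<close>] F(2) f by simp
  have "AE x in lborel. x \<in> \<Omega> \<longrightarrow> F x = 0"
  proof (rule null_distribution_AE_zero[OF \<Omega>(1)])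
    show "set_integrable lborel \<Omega> F" by (rule sqint_set_integrable[OF F(1)]) (use \<Omega> in auto)
    show "(\<integral>x. F x * \<phi> x \<partial>lborel) = 0" if "\<phi> \<in> test_functions \<Omega>" for \<phi>
      using orth[OF that] sqint_test_function[OF that] F by (simp add: inner_abs_l2)
  qed simp
  with out have "AE x in lborel. F x = 0" by eventually_elim auto
  then show ?thesis using F abs_l2_eq_iff[OF F(1) sqint_zero] by (simp add: abs_l2_zero)
qed

text \<open>By the energy identity the pairing is a sum of squares. If it vanishes, so does the
  solution, and the weak equation makes f orthogonal to all test functions on \<Omega>.\<close>

lemma resolvent_positive:
  assumes \<Omega>: "open \<Omega>" "bounded \<Omega>" and t: "t > 0" and f: "f \<in> L2_on \<Omega>" "f \<noteq> 0"
  shows "0 < inner (resolvent \<Omega> t f) f"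
proof -
  obtain g where g: "weak_solution \<Omega> t f (resolvent \<Omega> t f, g)" using resolventE[OF t] by blast
  have e: "t * (norm (resolvent \<Omega> t f))\<^sup>2 + (norm g)\<^sup>2 = inner (resolvent \<Omega> t f) f"
    using weak_solution_energy[OF g] by (simp add: inner_commute)
  have nn: "0 \<le> t * (norm (resolvent \<Omega> t f))\<^sup>2" "0 \<le> (norm g)\<^sup>2" using t by auto
  show ?thesis
  proof (rule ccontr)
    assume "\<not> 0 < inner (resolvent \<Omega> t f) f"
    then have "t * (norm (resolvent \<Omega> t f))\<^sup>2 = 0 \<and> (norm g)\<^sup>2 = 0" using e nn by linarith
    then have "resolvent \<Omega> t f = 0" "g = 0" using t by auto
    then have "inner f (fst y) = 0" if "y \<in> H01 \<Omega>" for y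
      using g that by (auto simp: weak_solution_def)
    then have "inner f (abs_l2 \<phi>) = 0" if "\<phi> \<in> test_functions \<Omega>" for \<phi>
      using embed_in_H01[OF that] by (fastforce simp: embed_def)
    then show False using L2_on_test_orthogonal[OF \<Omega> f(1)] f(2) by blast
  qed
qed

section \<open>Compactness and completeness of the eigenfunctions\<close>

lemma cmod_cis_diff_le: "cmod (cis a - cis b) \<le> \<bar>a - b\<bar>"
proof -
  have "cis a - cis b = cis b * (cis (a - b) - 1)"
    by (simp add: cis_mult right_diff_distrib)
  then have "cmod (cis a - cis b) = cmod (cis (a - b) - 1)" by (simp add: norm_mult)
  also have "\<dots> \<le> \<bar>a - b\<bar>" using iexp_approx1[of "a - b" 0] by (simp add: cis_conv_exp)
  finally show ?thesis .
qed

text \<open>Turns an L^2 bound into an L^1 bound by |r| <= 1 + r^2 on a ball, hence into bounds for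
  the transforms that are uniform along a sequence.\<close>

lemma abs_integral_test_le:
  fixes \<psi> :: "'a::euclidean_space \<Rightarrow> real"
  assumes \<psi>: "\<psi> \<in> test_functions \<Omega>" and \<Omega>: "\<Omega> \<subseteq> cball 0 R"
  shows "(\<integral>x. \<bar>\<psi> x\<bar> \<partial>lborel) \<le> measure lborel (cball (0::'a::euclidean_space) R) + (norm (abs_l2 \<psi>))\<^sup>2"
proof -
  have i: "integrable lborel (indicator (cball (0::'a) R) :: 'a \<Rightarrow> real)"
    using emeasure_compact_finite[of "cball (0::'a) R"] by simp
  have i2: "integrable lborel (\<lambda>x. (norm (\<psi> x))\<^sup>2)" using sqint_test_function[OF \<psi>] by (simp add: sqint_def)
  have "(\<integral>x. \<bar>\<psi> x\<bar> \<partial>lborel) \<le> (\<integral>x. indicator (cball 0 R) x + (norm (\<psi> x))\<^sup>2 \<partial>lborel)"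
  proof (rule integral_mono)
    show "integrable lborel (\<lambda>x. \<bar>\<psi> x\<bar>)" using test_function_integrable[OF \<psi>] by simp
    show "integrable lborel (\<lambda>x. indicator (cball 0 R) x + (norm (\<psi> x))\<^sup>2)" using i i2 by simp
    fix x
    have "0 \<le> (\<bar>\<psi> x\<bar> - 1)\<^sup>2 + \<bar>\<psi> x\<bar>\<^sup>2 + 1" by simp
    then have "\<bar>\<psi> x\<bar> \<le> 1 + (\<psi> x)\<^sup>2" by (simp add: power2_diff)
    then show "\<bar>\<psi> x\<bar> \<le> indicator (cball 0 R) x + (norm (\<psi> x))\<^sup>2"
      using test_function_outside[OF \<psi>, of x] \<Omega> by (cases "x \<in> \<Omega>") auto
  qed
  also have "\<dots> = (\<integral>x. indicator (cball (0::'a) R) x \<partial>lborel) + (\<integral>x. (norm (\<psi> x))\<^sup>2 \<partial>lborel)"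
    by (rule Bochner_Integration.integral_add[OF i i2])
  finally show ?thesis by (simp add: norm_abs_l2 sqint_test_function[OF \<psi>])
qed

lemma fourier_lipschitz_test:
  fixes \<psi> :: "'a::euclidean_space \<Rightarrow> real"
  assumes \<psi>: "\<psi> \<in> test_functions \<Omega>" and \<Omega>: "\<Omega> \<subseteq> cball 0 R"
  shows "cmod (fourier \<psi> \<xi> - fourier \<psi> \<eta>) \<le> fconst TYPE('a) * (norm (\<xi> - \<eta>) * R * (\<integral>x. \<bar>\<psi> x\<bar> \<partial>lborel))"
proof -
  have i: "integrable lborel \<psi>" using test_function_integrable[OF \<psi>] .
  have ic: "integrable lborel (\<lambda>x. cis (- (\<xi> \<bullet> x)) * complex_of_real (\<psi> x))" for \<xi>
    by (rule integrable_cis_mult[OF i]) measurable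
  have "fourier \<psi> \<xi> - fourier \<psi> \<eta> = complex_of_real (fconst TYPE('a)) *
    (\<integral>x. cis (- (\<xi> \<bullet> x)) * complex_of_real (\<psi> x) - cis (- (\<eta> \<bullet> x)) * complex_of_real (\<psi> x) \<partial>lborel)"
    unfolding fourier_eq_cis Bochner_Integration.integral_diff[OF ic ic] by (rule right_diff_distrib[symmetric])
  moreover have "cmod (\<integral>x. cis (- (\<xi> \<bullet> x)) * complex_of_real (\<psi> x) - cis (- (\<eta> \<bullet> x)) * complex_of_real (\<psi> x) \<partial>lborel)
    \<le> (\<integral>x. norm (\<xi> - \<eta>) * R * \<bar>\<psi> x\<bar> \<partial>lborel)"
  proof (rule Bochner_Integration.integral_norm_bound_integral)
    fix x
    show "norm (cis (- (\<xi> \<bullet> x)) * complex_of_real (\<psi> x) - cis (- (\<eta> \<bullet> x)) * complex_of_real (\<psi> x)) \<le> norm (\<xi> - \<eta>) * R * \<bar>\<psi> x\<bar>"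
    proof (cases "x \<in> \<Omega>")
      case True
      have "norm (cis (- (\<xi> \<bullet> x)) * complex_of_real (\<psi> x) - cis (- (\<eta> \<bullet> x)) * complex_of_real (\<psi> x))
         = cmod (cis (- (\<xi> \<bullet> x)) - cis (- (\<eta> \<bullet> x))) * \<bar>\<psi> x\<bar>"
        unfolding left_diff_distrib[symmetric] norm_mult by simp
      also have "\<dots> \<le> \<bar>(\<xi> - \<eta>) \<bullet> x\<bar> * \<bar>\<psi> x\<bar>"
        using cmod_cis_diff_le[of "- (\<xi> \<bullet> x)" "- (\<eta> \<bullet> x)"]
        by (intro mult_right_mono) (auto simp: inner_diff_left abs_minus_commute)
      also have "\<dots> \<le> (norm (\<xi> - \<eta>) * norm x) * \<bar>\<psi> x\<bar>"
        by (intro mult_right_mono Cauchy_Schwarz_ineq2) auto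
      also have "\<dots> \<le> (norm (\<xi> - \<eta>) * R) * \<bar>\<psi> x\<bar>"
        using True \<Omega> by (intro mult_right_mono mult_left_mono) auto
      finally show ?thesis .
    qed (use test_function_outside[OF \<psi>] in simp)
  qed (use i ic in auto)
  ultimately show ?thesis by (simp add: norm_mult mult_left_mono)
qed

text \<open>The transforms of the sequence are uniformly bounded and uniformly Lipschitz, because
  all supports lie in one ball. A subsequence therefore converges at a countable dense set of
  frequencies, and by equicontinuity at every frequency. Plancherel turns this into convergence in
  norm, the gradient bound controlling the high frequencies.\<close>

lemma Rellich:
  fixes \<psi> :: "nat \<Rightarrow> 'a::euclidean_space \<Rightarrow> real"
  assumes "bounded \<Omega>" and \<psi>: "\<And>n. \<psi> n \<in> test_functions \<Omega>" and C: "\<And>n. norm (embed (\<psi> n)) \<le> C"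
  shows "\<exists>r. strict_mono r \<and> convergent (\<lambda>n. abs_l2 (\<psi> (r n)))"
proof -
  let ?c = "fconst TYPE('a)"
  obtain R where R: "\<Omega> \<subseteq> cball 0 R" "R > 0"
    using assms(1) by (auto simp: bounded_pos subset_eq)
  have C0: "C \<ge> 0" using C[of 0] norm_ge_zero order_trans by blast
  have nL: "norm (abs_l2 (\<psi> n)) \<le> C" and nG: "norm (abs_l2 (grad (\<psi> n))) \<le> C" for n
    using C[of n] norm_fst_le[of "abs_l2 (\<psi> n)" "abs_l2 (grad (\<psi> n))"] norm_snd_le[of "abs_l2 (grad (\<psi> n))" "abs_l2 (\<psi> n)"]
    unfolding embed_def by linarith+
  have \<psi>U: "\<psi> n \<in> test_functions UNIV" for n using \<psi> test_functions_mono[of \<Omega> UNIV] by blast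
  have [measurable]: "\<psi> n \<in> borel_measurable borel" for n using test_function_measurable[OF \<psi>] .
  define B where "B = measure lborel (cball (0::'a) R) + C\<^sup>2"
  have B: "(\<integral>x. \<bar>\<psi> n x\<bar> \<partial>lborel) \<le> B" for n
  proof -
    have "(norm (abs_l2 (\<psi> n)))\<^sup>2 \<le> C\<^sup>2" using nL by (intro power_mono) auto
    then show ?thesis unfolding B_def by (intro order_trans[OF abs_integral_test_le[OF \<psi> R(1)]] add_left_mono)
  qed
  have B0: "B \<ge> 0" by (simp add: B_def)
  define F where "F n = fourier (\<psi> n)" for n
  have [measurable]: "F n \<in> borel_measurable borel" for n unfolding F_def by measurable
  define M where "M = ?c * B"
  have FM: "cmod (F n \<xi>) \<le> M" for n \<xi>
    unfolding F_def M_def using fourier_bounded[of "\<psi> n" \<xi>] B[of n] by (meson mult_left_mono order_trans powr_ge_zero)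
  \<comment> \<open>The summand 1 makes \<open>Lip\<close> positive, since it is divided by
    below.\<close>
  define Lip where "Lip = ?c * (R * B) + 1"
  have Lip0: "Lip > 0" using R B0 by (simp add: Lip_def add_nonneg_pos)
  have FL: "cmod (F n \<xi> - F n \<eta>) \<le> Lip * norm (\<xi> - \<eta>)" for n \<xi> \<eta>
  proof -
    have "cmod (F n \<xi> - F n \<eta>) \<le> ?c * (norm (\<xi> - \<eta>) * R * (\<integral>x. \<bar>\<psi> n x\<bar> \<partial>lborel))"
      unfolding F_def by (rule fourier_lipschitz_test[OF \<psi> R(1)])
    also have "\<dots> \<le> ?c * (norm (\<xi> - \<eta>) * R * B)" using B[of n] R by (intro mult_left_mono) auto
    also have "\<dots> \<le> Lip * norm (\<xi> - \<eta>)" by (simp add: Lip_def algebra_simps)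
    finally show ?thesis .
  qed
  obtain D :: "'a set" where D: "countable D" "\<And>X. open X \<Longrightarrow> X \<noteq> {} \<Longrightarrow> \<exists>d\<in>D. d \<in> X"
    using countable_dense_setE by blast
  obtain r where r: "strict_mono (r::nat \<Rightarrow> nat)" "\<And>x. x \<in> D \<Longrightarrow> \<exists>l. (\<lambda>n. F (r n) x) \<longlonglongrightarrow> l"
    using function_convergent_subsequence[OF D(1), of F M] FM by metis
  have conv: "convergent (\<lambda>n. F (r n) \<xi>)" for \<xi>
  proof -
    have "Cauchy (\<lambda>n. F (r n) \<xi>)"
      unfolding Cauchy_iff
    proof (intro allI impI)
      fix e :: real assume e: "e > 0"
      obtain d where d: "d \<in> D" "d \<in> ball \<xi> (e / (4 * Lip))"
      proof -
        have "0 < e / (4 * Lip)" using e Lip0 by simp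
        then show thesis using D(2)[of "ball \<xi> (e / (4 * Lip))"] that by (auto simp del: mem_ball simp: ball_eq_empty)
      qed
      have near: "cmod (F n \<xi> - F n d) < e / 4" for n
      proof -
        have "Lip * norm (\<xi> - d) < Lip * (e / (4 * Lip))"
          using d(2) Lip0 by (intro mult_strict_left_mono) (auto simp: dist_norm)
        then show ?thesis using FL[of n \<xi> d] Lip0 by simp
      qed
      have "Cauchy (\<lambda>n. F (r n) d)" using r(2)[OF d(1)] LIMSEQ_imp_Cauchy by blast
      then obtain N where N: "\<And>m n. m \<ge> N \<Longrightarrow> n \<ge> N \<Longrightarrow> cmod (F (r m) d - F (r n) d) < e / 4"
        unfolding Cauchy_iff using e by (meson zero_less_divide_iff zero_less_numeral)
      show "\<exists>M. \<forall>m\<ge>M. \<forall>n\<ge>M. norm (F (r m) \<xi> - F (r n) \<xi>) < e"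
      proof (intro exI[of _ N] allI impI)
        fix m n assume "N \<le> m" "N \<le> n"
        have "F (r m) \<xi> - F (r n) \<xi> = (F (r m) \<xi> - F (r m) d) + (F (r m) d - F (r n) d) - (F (r n) \<xi> - F (r n) d)" by simp
        also have "cmod \<dots> \<le> cmod (F (r m) \<xi> - F (r m) d) + cmod (F (r m) d - F (r n) d) + cmod (F (r n) \<xi> - F (r n) d)"
          by (meson add_mono norm_triangle_ineq norm_triangle_ineq4 order_refl order_trans)
        also have "\<dots> < e" using near[of "r m"] near[of "r n"] N[OF \<open>N \<le> m\<close> \<open>N \<le> n\<close>] e by linarith
        finally show "norm (F (r m) \<xi> - F (r n) \<xi>) < e" .
      qed
    qed
    then show ?thesis by (simp add: Cauchy_convergent_iff)
  qed
  define q where "q \<xi> = lim (\<lambda>n. F (r n) \<xi>)" for \<xi>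
  have q: "(\<lambda>n. F (r n) \<xi>) \<longlonglongrightarrow> q \<xi>" for \<xi>
    using conv[of \<xi>] by (simp add: q_def convergent_LIMSEQ_iff)
  have [measurable]: "q \<in> borel_measurable borel" unfolding q_def by (rule borel_measurable_lim_metric) auto
  have qM: "cmod (q \<xi>) \<le> M" for \<xi>
    by (rule LIMSEQ_le_const2[OF tendsto_norm[OF q]]) (use FM in auto)
  have bound: "(cmod (x - y))\<^sup>2 \<le> (2 * M)\<^sup>2" if "cmod x \<le> M" "cmod y \<le> M" for x y
    using norm_triangle_ineq4[of x y] that by (intro power_mono) auto
  have [measurable]: "cball (0::'a) \<rho> \<in> sets borel" for \<rho> by simp
  have ibd: "integrable lborel (\<lambda>\<xi>. indicator (cball (0::'a) \<rho>) \<xi> * (cmod (G \<xi> - H \<xi>))\<^sup>2)"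
    if [measurable]: "G \<in> borel_measurable borel" "H \<in> borel_measurable borel" and "\<And>\<xi>. cmod (G \<xi>) \<le> M" "\<And>\<xi>. cmod (H \<xi>) \<le> M" for G H \<rho>
  proof (rule Bochner_Integration.integrable_bound[where f="\<lambda>\<xi>. indicator (cball (0::'a) \<rho>) \<xi> * (2 * M)\<^sup>2"])
    show "integrable lborel (\<lambda>\<xi>. indicator (cball (0::'a) \<rho>) \<xi> * (2 * M)\<^sup>2)"
      using emeasure_compact_finite[of "cball (0::'a) \<rho>"] by (intro integrable_mult_left) auto
    show "AE \<xi> in lborel. norm (indicator (cball (0::'a) \<rho>) \<xi> * (cmod (G \<xi> - H \<xi>))\<^sup>2) \<le> norm (indicator (cball (0::'a) \<rho>) \<xi> * (2 * M)\<^sup>2)"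
      using bound that by (intro AE_I2) (auto simp: indicator_def)
    note [measurable] = that(1,2)
    show "(\<lambda>\<xi>. indicator (cball (0::'a) \<rho>) \<xi> * (cmod (G \<xi> - H \<xi>))\<^sup>2) \<in> borel_measurable lborel"
      by measurable
  qed
  have lim0: "(\<lambda>n. \<integral>\<xi>. indicator (cball (0::'a) \<rho>) \<xi> * (cmod (F (r n) \<xi> - q \<xi>))\<^sup>2 \<partial>lborel) \<longlonglongrightarrow> 0" for \<rho>
  proof -
    have "(\<lambda>n. \<integral>\<xi>. indicator (cball (0::'a) \<rho>) \<xi> * (cmod (F (r n) \<xi> - q \<xi>))\<^sup>2 \<partial>lborel) \<longlonglongrightarrow> (\<integral>\<xi>. (0::real) \<partial>(lborel::'a measure))"
    proof (rule integral_dominated_convergence[where w="\<lambda>\<xi>. indicator (cball (0::'a) \<rho>) \<xi> * (2 * M)\<^sup>2"])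
      show "integrable lborel (\<lambda>\<xi>. indicator (cball (0::'a) \<rho>) \<xi> * (2 * M)\<^sup>2)"
        using emeasure_compact_finite[of "cball (0::'a) \<rho>"] by (intro integrable_mult_left) auto
      show "AE \<xi> in lborel. (\<lambda>n. indicator (cball (0::'a) \<rho>) \<xi> * (cmod (F (r n) \<xi> - q \<xi>))\<^sup>2) \<longlonglongrightarrow> 0"
      proof (rule AE_I2)
        fix \<xi>
        have "(\<lambda>n. indicator (cball (0::'a) \<rho>) \<xi> * (cmod (F (r n) \<xi> - q \<xi>))\<^sup>2) \<longlonglongrightarrow> indicator (cball (0::'a) \<rho>) \<xi> * (cmod (q \<xi> - q \<xi>))\<^sup>2"
          by (intro tendsto_intros q)
        then show "(\<lambda>n. indicator (cball (0::'a) \<rho>) \<xi> * (cmod (F (r n) \<xi> - q \<xi>))\<^sup>2) \<longlonglongrightarrow> 0" by simp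
      qed
      show "AE \<xi> in lborel. norm (indicator (cball (0::'a) \<rho>) \<xi> * (cmod (F (r n) \<xi> - q \<xi>))\<^sup>2) \<le> indicator (cball (0::'a) \<rho>) \<xi> * (2 * M)\<^sup>2" for n
        using bound FM qM by (intro AE_I2) (auto simp: indicator_def)
    qed measurable
    then show ?thesis by simp
  qed
  \<comment> \<open>Frequencies up to \<rho> are compared with the pointwise limit \<open>q\<close>;
    beyond \<rho> the factor |\<xi>|^2 / \<rho>^2 is at least 1, so that part costs at most the
    energy of the gradient divided by \<rho>^2.\<close>
  have split: "(norm (abs_l2 (\<psi> m) - abs_l2 (\<psi> n)))\<^sup>2 \<le>
      2 * (\<integral>\<xi>. indicator (cball (0::'a) \<rho>) \<xi> * (cmod (F m \<xi> - q \<xi>))\<^sup>2 \<partial>lborel) +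
      2 * (\<integral>\<xi>. indicator (cball (0::'a) \<rho>) \<xi> * (cmod (F n \<xi> - q \<xi>))\<^sup>2 \<partial>lborel) + (2 * C)\<^sup>2 / \<rho>\<^sup>2" if \<rho>: "\<rho> > 0" for m n \<rho>
  proof -
    define d where "d = (\<lambda>x. \<psi> m x - \<psi> n x)"
    have d: "d \<in> test_functions UNIV" unfolding d_def by (intro test_function_diff \<psi>U)
    have Fd: "fourier d \<xi> = F m \<xi> - F n \<xi>" for \<xi>
      unfolding d_def F_def by (intro fourier_diff test_function_integrable[OF \<psi>])
    have id: "integrable lborel (\<lambda>\<xi>. (norm \<xi>)\<^sup>2 * (cmod (fourier d \<xi>))\<^sup>2)"
      using Bochner_Integration.integrable_diff[OF integrable_fourier_square[OF d, of 1] integrable_fourier_square[OF d, of 0]]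
      by (simp add: algebra_simps)
    have "(norm (abs_l2 (\<psi> m) - abs_l2 (\<psi> n)))\<^sup>2 = (\<integral>x. (norm (d x))\<^sup>2 \<partial>lborel)"
      unfolding d_def using sqint_test_function(1)[OF \<psi>] by (simp add: abs_l2_diff norm_abs_l2 sqint_diff)
    also have "\<dots> = (\<integral>\<xi>. (cmod (fourier d \<xi>))\<^sup>2 \<partial>lborel)" using Plancherel_test[OF d] by simp
    also have "\<dots> \<le> (\<integral>\<xi>. 2 * (indicator (cball (0::'a) \<rho>) \<xi> * (cmod (F m \<xi> - q \<xi>))\<^sup>2)
      + 2 * (indicator (cball (0::'a) \<rho>) \<xi> * (cmod (F n \<xi> - q \<xi>))\<^sup>2)
      + (1 / \<rho>\<^sup>2) * ((norm \<xi>)\<^sup>2 * (cmod (fourier d \<xi>))\<^sup>2) \<partial>lborel)"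
    proof (rule integral_mono)
      show "integrable lborel (\<lambda>\<xi>. (cmod (fourier d \<xi>))\<^sup>2)" using integrable_fourier_square[OF d, of 0] by simp
      show "integrable lborel (\<lambda>\<xi>. 2 * (indicator (cball (0::'a) \<rho>) \<xi> * (cmod (F m \<xi> - q \<xi>))\<^sup>2)
        + 2 * (indicator (cball (0::'a) \<rho>) \<xi> * (cmod (F n \<xi> - q \<xi>))\<^sup>2)
        + (1 / \<rho>\<^sup>2) * ((norm \<xi>)\<^sup>2 * (cmod (fourier d \<xi>))\<^sup>2))"
        by (intro Bochner_Integration.integrable_add integrable_mult_right ibd id FM qM) measurable
      fix \<xi> :: 'a
      show "(cmod (fourier d \<xi>))\<^sup>2 \<le> 2 * (indicator (cball (0::'a) \<rho>) \<xi> * (cmod (F m \<xi> - q \<xi>))\<^sup>2)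
        + 2 * (indicator (cball (0::'a) \<rho>) \<xi> * (cmod (F n \<xi> - q \<xi>))\<^sup>2)
        + (1 / \<rho>\<^sup>2) * ((norm \<xi>)\<^sup>2 * (cmod (fourier d \<xi>))\<^sup>2)"
      proof (cases "\<xi> \<in> cball 0 \<rho>")
        case True
        have "cmod (F m \<xi> - F n \<xi>) \<le> cmod (F m \<xi> - q \<xi>) + cmod (F n \<xi> - q \<xi>)"
          using norm_triangle_ineq4[of "F m \<xi> - q \<xi>" "F n \<xi> - q \<xi>"] by simp
        then have "(cmod (F m \<xi> - F n \<xi>))\<^sup>2 \<le> (cmod (F m \<xi> - q \<xi>) + cmod (F n \<xi> - q \<xi>))\<^sup>2"
          by (intro power_mono) auto
        also have "\<dots> \<le> 2 * (cmod (F m \<xi> - q \<xi>))\<^sup>2 + 2 * (cmod (F n \<xi> - q \<xi>))\<^sup>2"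
          using sum_squares_bound[of "cmod (F m \<xi> - q \<xi>)" "cmod (F n \<xi> - q \<xi>)"] by (simp add: power2_sum)
        moreover have "0 \<le> (1 / \<rho>\<^sup>2) * ((norm \<xi>)\<^sup>2 * (cmod (fourier d \<xi>))\<^sup>2)" by simp
        ultimately show ?thesis using True by (simp only: indicator_simps Fd)
      next
        case False
        then have "\<rho>\<^sup>2 \<le> (norm \<xi>)\<^sup>2" using \<rho> by (intro power_mono) auto
        then have "1 \<le> (norm \<xi>)\<^sup>2 / \<rho>\<^sup>2" using \<rho> by simp
        then have "1 * (cmod (fourier d \<xi>))\<^sup>2 \<le> ((norm \<xi>)\<^sup>2 / \<rho>\<^sup>2) * (cmod (fourier d \<xi>))\<^sup>2"
          by (intro mult_right_mono) auto
        then show ?thesis using False by simp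
      qed
    qed
    also have "\<dots> = 2 * (\<integral>\<xi>. indicator (cball (0::'a) \<rho>) \<xi> * (cmod (F m \<xi> - q \<xi>))\<^sup>2 \<partial>lborel)
      + 2 * (\<integral>\<xi>. indicator (cball (0::'a) \<rho>) \<xi> * (cmod (F n \<xi> - q \<xi>))\<^sup>2 \<partial>lborel)
      + (1 / \<rho>\<^sup>2) * (\<integral>\<xi>. (norm \<xi>)\<^sup>2 * (cmod (fourier d \<xi>))\<^sup>2 \<partial>lborel)"
      using ibd[of "F m" q] ibd[of "F n" q] id FM qM by (simp add: Bochner_Integration.integrable_add)
    also have "(\<integral>\<xi>. (norm \<xi>)\<^sup>2 * (cmod (fourier d \<xi>))\<^sup>2 \<partial>lborel) = (norm (abs_l2 (grad d)))\<^sup>2"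
      using integral_grad_eq_fourier[OF d] sqint_test_function[OF d] by (simp add: norm_abs_l2)
    also have "abs_l2 (grad d) = abs_l2 (grad (\<psi> m)) - abs_l2 (grad (\<psi> n))"
      using embed_diff[OF \<psi>[of m] \<psi>[of n]] unfolding d_def by (simp add: embed_def)
    also have "(norm (abs_l2 (grad (\<psi> m)) - abs_l2 (grad (\<psi> n))))\<^sup>2 \<le> (2 * C)\<^sup>2"
      using norm_triangle_ineq4[of "abs_l2 (grad (\<psi> m))" "abs_l2 (grad (\<psi> n))"] nG[of m] nG[of n]
      by (intro power_mono) auto
    finally show ?thesis using \<rho> by (simp add: mult_left_mono divide_right_mono)
  qed
  have "Cauchy (\<lambda>n. abs_l2 (\<psi> (r n)))"
    unfolding Cauchy_iff
  proof (intro allI impI)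
    fix e :: real assume e: "e > 0"
    \<comment> \<open>Chosen so that the high-frequency part is at most e^2 / 4; the summand 1 keeps
      \<rho> positive when \<open>C\<close> is 0.\<close>
    define \<rho> where "\<rho> = (2 * C + 1) * 2 / e"
    have \<rho>: "\<rho> > 0" using e C0 by (simp add: \<rho>_def)
    have tail: "(2 * C)\<^sup>2 / \<rho>\<^sup>2 \<le> (e / 2)\<^sup>2"
    proof -
      have "(2 * C) / \<rho> \<le> e / 2" using e C0 by (simp add: \<rho>_def field_simps)
      then have "((2 * C) / \<rho>)\<^sup>2 \<le> (e / 2)\<^sup>2" using \<rho> C0 by (intro power_mono) auto
      then show ?thesis by (simp add: power_divide)
    qed
    define a where "a n = (\<integral>\<xi>. indicator (cball (0::'a) \<rho>) \<xi> * (cmod (F (r n) \<xi> - q \<xi>))\<^sup>2 \<partial>lborel)" for n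
    \<comment> \<open>Two doubled low-frequency terms below e^2 / 8 contribute less than e^2 / 2,
      which together with the tail stays below e^2.\<close>
    have "\<forall>\<^sub>F n in sequentially. a n < e\<^sup>2 / 8"
      using order_tendstoD(2)[OF lim0[of \<rho>], of "e\<^sup>2 / 8"] e by (simp add: a_def)
    then obtain N where N: "\<And>n. n \<ge> N \<Longrightarrow> a n < e\<^sup>2 / 8" by (auto simp: eventually_sequentially)
    show "\<exists>M. \<forall>m\<ge>M. \<forall>n\<ge>M. norm (abs_l2 (\<psi> (r m)) - abs_l2 (\<psi> (r n))) < e"
    proof (intro exI[of _ N] allI impI)
      fix m n assume "N \<le> m" "N \<le> n"
      have "(norm (abs_l2 (\<psi> (r m)) - abs_l2 (\<psi> (r n))))\<^sup>2 \<le> 2 * a m + 2 * a n + (2 * C)\<^sup>2 / \<rho>\<^sup>2"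
        using split[OF \<rho>, of "r m" "r n"] by (simp add: a_def)
      also have "\<dots> < e\<^sup>2"
      proof -
        have "(e / 2)\<^sup>2 = e\<^sup>2 / 4" by (simp add: power_divide)
        moreover have "e\<^sup>2 > 0" using e by simp
        ultimately show ?thesis using N[OF \<open>N \<le> m\<close>] N[OF \<open>N \<le> n\<close>] tail by linarith
      qed
      finally show "norm (abs_l2 (\<psi> (r m)) - abs_l2 (\<psi> (r n))) < e" using e by (simp add: power_less_imp_less_base)
    qed
  qed
  then show ?thesis using r(1) by (auto simp: Cauchy_convergent_iff)
qed

text \<open>The energy estimate bounds the solutions in \<open>H01 \<Omega>\<close>. Rellich's
  theorem concerns test functions, so each solution is replaced by a test function at distance below
  \<open>1 / real (Suc n)\<close>, which does not affect convergence of subsequences.\<close>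

lemma resolvent_compact:
  fixes f :: "nat \<Rightarrow> ('a::euclidean_space, real) l2"
  assumes \<Omega>: "bounded \<Omega>" and f: "\<And>n. norm (f n) \<le> 1"
  shows "\<exists>r. strict_mono r \<and> convergent (\<lambda>n. resolvent \<Omega> 1 (f (r n)))"
proof -
  have "\<exists>g. weak_solution \<Omega> 1 (f n) (resolvent \<Omega> 1 (f n), g)" for n
    using resolventE[of 1 \<Omega> "f n"] by fastforce
  then obtain g where g: "\<And>n. weak_solution \<Omega> 1 (f n) (resolvent \<Omega> 1 (f n), g n)" by metis
  define v where "v n = resolvent \<Omega> 1 (f n)" for n
  have vg: "norm (v n, g n) \<le> 2" for n
  proof -
    have "norm (v n) \<le> 1" using norm_resolvent_le(1)[OF _ g[of n]] f[of n] by (simp add: v_def)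
    moreover have "(norm (g n))\<^sup>2 \<le> (norm (f n))\<^sup>2" using norm_resolvent_le(2)[OF _ g[of n]] by simp
    then have "norm (g n) \<le> 1" using f[of n] power2_le_imp_le[of "norm (g n)" "norm (f n)"] by simp
    ultimately show ?thesis using norm_Pair_le[of "v n" "g n"] by linarith
  qed
  have "\<exists>\<psi>\<in>test_functions \<Omega>. dist (embed \<psi>) (v n, g n) < 1 / real (Suc n)" for n
  proof -
    have "(v n, g n) \<in> closure (embed ` test_functions \<Omega>)"
      using g[of n] by (simp add: weak_solution_def H01_def v_def)
    moreover have "1 / real (Suc n) > 0" by simp
    ultimately show ?thesis unfolding closure_approachable by blast
  qed
  then obtain \<psi> where \<psi>: "\<And>n. \<psi> n \<in> test_functions \<Omega>" "\<And>n. norm (embed (\<psi> n) - (v n, g n)) < 1 / real (Suc n)"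
    unfolding dist_norm by metis
  have "norm (embed (\<psi> n)) \<le> 3" for n
  proof -
    have "norm (embed (\<psi> n)) \<le> norm (embed (\<psi> n) - (v n, g n)) + norm (v n, g n)"
      using norm_triangle_ineq[of "embed (\<psi> n) - (v n, g n)" "(v n, g n)"] by simp
    moreover have "1 / real (Suc n) \<le> 1" by simp
    ultimately show ?thesis using \<psi>(2)[of n] vg[of n] by linarith
  qed
  from Rellich[of \<Omega> \<psi>, OF \<Omega> \<psi>(1) this] obtain r where r: "strict_mono r" "convergent (\<lambda>n. abs_l2 (\<psi> (r n)))"
    by (elim exE conjE)
  have "(\<lambda>n. abs_l2 (\<psi> n) - v n) \<longlonglongrightarrow> 0"
  proof (rule Lim_null_comparison)
    show "\<forall>\<^sub>F n in sequentially. norm (abs_l2 (\<psi> n) - v n) \<le> 1 / real (Suc n)"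
    proof (intro always_eventually allI)
      fix n
      have "norm (abs_l2 (\<psi> n) - v n) \<le> norm (embed (\<psi> n) - (v n, g n))"
        using norm_fst_le[of "abs_l2 (\<psi> n) - v n" "abs_l2 (grad (\<psi> n)) - g n"] by (simp add: embed_def)
      then show "norm (abs_l2 (\<psi> n) - v n) \<le> 1 / real (Suc n)" using \<psi>(2)[of n] by linarith
    qed
    show "(\<lambda>n. 1 / real (Suc n)) \<longlonglongrightarrow> 0" by (rule LIMSEQ_Suc[OF lim_1_over_n])
  qed
  from LIMSEQ_subseq_LIMSEQ[OF this r(1)] have "convergent (\<lambda>n. abs_l2 (\<psi> (r n)) - v (r n))"
    by (auto simp: convergent_def o_def)
  from convergent_diff[OF r(2) this] have "convergent (\<lambda>n. v (r n))" by simp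
  then show ?thesis using r(1) by (auto simp: v_def)
qed

lemma weak_solutionI:
  assumes x: "x \<in> H01 \<Omega>"
    and eq: "\<And>\<phi>. \<phi> \<in> test_functions \<Omega> \<Longrightarrow>
      t * inner (fst x) (abs_l2 \<phi>) + inner (snd x) (abs_l2 (grad \<phi>)) = inner f (abs_l2 \<phi>)"
  shows "weak_solution \<Omega> t f x"
  unfolding weak_solution_def
proof (intro conjI ballI x)
  fix y assume y: "y \<in> H01 \<Omega>"
  obtain \<psi> where \<psi>: "\<And>k::nat. \<psi> k \<in> test_functions \<Omega>" "(\<lambda>k. abs_l2 (\<psi> k)) \<longlonglongrightarrow> fst y" "(\<lambda>k. abs_l2 (grad (\<psi> k))) \<longlonglongrightarrow> snd y"
    using H01E[of "fst y" "snd y" \<Omega>] y by auto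
  have "(\<lambda>k. t * inner (fst x) (abs_l2 (\<psi> k)) + inner (snd x) (abs_l2 (grad (\<psi> k)))) \<longlonglongrightarrow> t * inner (fst x) (fst y) + inner (snd x) (snd y)"
    by (intro tendsto_intros \<psi>)
  moreover have "(\<lambda>k. t * inner (fst x) (abs_l2 (\<psi> k)) + inner (snd x) (abs_l2 (grad (\<psi> k)))) \<longlonglongrightarrow> inner f (fst y)"
    unfolding eq[OF \<psi>(1)] by (intro tendsto_intros \<psi>)
  ultimately show "t * inner (fst x) (fst y) + inner (snd x) (snd y) = inner f (fst y)"
    using LIMSEQ_unique by blast
qed

text \<open>Translates the integral over \<Omega> from the definition of an eigensystem into the
  inner product on the whole space; for this one factor has to vanish outside \<Omega>.\<close>

lemma L2_inner_eq_inner: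
  assumes f: "sqint f" and h: "sqint h" and \<Omega>: "\<Omega> \<in> sets borel" and out: "abs_l2 h \<in> L2_on \<Omega>"
  shows "L2_inner \<Omega> f h = inner (abs_l2 f) (abs_l2 h)"
proof -
  have [measurable]: "f \<in> borel_measurable borel" "h \<in> borel_measurable borel" "\<Omega> \<in> sets borel"
    using f h \<Omega> by (auto simp: sqint_def)
  have "AE x in lborel. x \<notin> \<Omega> \<longrightarrow> h x = 0" using out abs_l2_in_L2_on_iff[OF h \<Omega>] by simp
  then have "AE x in lborel. indicator \<Omega> x *\<^sub>R (f x * h x) = f x * h x"
    by eventually_elim (auto simp: indicator_def)
  then have "L2_inner \<Omega> f h = (\<integral>x. f x * h x \<partial>lborel)"
    unfolding L2_inner_def set_lebesgue_integral_def by (intro integral_cong_AE) auto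
  then show ?thesis using f h by (simp add: inner_abs_l2)
qed

lemma test_in_L2_on:
  assumes "\<psi> \<in> test_functions \<Omega>" "\<Omega> \<in> sets borel"
  shows "abs_l2 \<psi> \<in> L2_on \<Omega>"
  using assms test_function_outside[OF assms(1)] by (subst abs_l2_in_L2_on_iff) (auto simp: sqint_test_function)

lemma L2_inner_minus_laplacian:
  assumes v: "sqint v" and H: "(abs_l2 v, g) \<in> H01 \<Omega>" and \<psi>: "\<psi> \<in> test_functions \<Omega>" and \<Omega>: "\<Omega> \<in> sets borel"
  shows "L2_inner \<Omega> v (\<lambda>x. - laplacian \<psi> x) = inner g (abs_l2 (grad \<psi>))"
proof -
  have \<psi>U: "\<psi> \<in> test_functions UNIV" using \<psi> test_functions_mono[of \<Omega> UNIV] by blast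
  have l: "(\<lambda>x. - laplacian \<psi> x) \<in> test_functions \<Omega>"
    using test_function_scale[OF test_function_laplacian[OF \<psi>], of "-1"] by simp
  have "L2_inner \<Omega> v (\<lambda>x. - laplacian \<psi> x) = inner (abs_l2 v) (abs_l2 (\<lambda>x. - laplacian \<psi> x))"
    by (rule L2_inner_eq_inner[OF v sqint_test_function(1)[OF l] \<Omega> test_in_L2_on[OF l \<Omega>]])
  also have "abs_l2 (\<lambda>x. - laplacian \<psi> x) = - abs_l2 (laplacian \<psi>)"
    using abs_l2_scale[OF sqint_test_function(1)[OF test_function_laplacian[OF \<psi>]], of "-1"] by simp
  finally show ?thesis using inner_H01_grad[OF H \<psi>U] by simp
qed

text \<open>An eigenfunction is the weak solution with right-hand side
  \<open>(t + \<mu>) *\<^sub>R abs_l2 v\<close>, so by uniqueness and linearity it is an eigenvector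
  of every resolvent.\<close>

lemma dirichlet_eigenpairD:
  assumes ev: "dirichlet_eigenpair \<Omega> \<mu> v" and \<Omega>: "\<Omega> \<in> sets borel"
  shows "sqint v" "abs_l2 v \<in> L2_on \<Omega>" "\<mu> \<ge> 0"
    "t > 0 \<Longrightarrow> resolvent \<Omega> t (abs_l2 v) = (1 / (t + \<mu>)) *\<^sub>R abs_l2 v"
proof -
  obtain g where v: "sqint v" and H: "(abs_l2 v, g) \<in> H01 \<Omega>"
    using ev unfolding dirichlet_eigenpair_def sobolev_completion_iff by blast
  show "sqint v" by fact
  show "abs_l2 v \<in> L2_on \<Omega>" by (rule H01_fst_L2_on[OF H \<Omega>])
  have eq: "inner g (abs_l2 (grad \<psi>)) = \<mu> * inner (abs_l2 v) (abs_l2 \<psi>)" if \<psi>: "\<psi> \<in> test_functions \<Omega>" for \<psi>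
    using ev L2_inner_minus_laplacian[OF v H \<psi> \<Omega>] L2_inner_eq_inner[OF v sqint_test_function(1)[OF \<psi>] \<Omega> test_in_L2_on[OF \<psi> \<Omega>]] \<psi>
    unfolding dirichlet_eigenpair_def by simp
  have w: "weak_solution \<Omega> t ((t + \<mu>) *\<^sub>R abs_l2 v) (abs_l2 v, g)" for t
    by (rule weak_solutionI[OF H]) (simp add: eq algebra_simps)
  have "abs_l2 v \<noteq> 0"
    using ev abs_l2_eq_iff[OF v sqint_zero] by (auto simp: dirichlet_eigenpair_def abs_l2_zero)
  then have "(norm (abs_l2 v))\<^sup>2 > 0" by simp
  \<comment> \<open>The weak equation holds for every real \<open>t\<close>; at 0 its energy
    identity expresses \<mu> as a Rayleigh quotient.\<close>
  moreover have "(norm g)\<^sup>2 = \<mu> * (norm (abs_l2 v))\<^sup>2"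
    using weak_solution_energy[OF w[of 0]] by (simp add: power2_norm_eq_inner)
  ultimately show \<mu>: "\<mu> \<ge> 0" by (metis zero_le_mult_iff zero_le_power2 not_less)
  assume t: "t > 0"
  have "(t + \<mu>) *\<^sub>R resolvent \<Omega> t (abs_l2 v) = resolvent \<Omega> t ((t + \<mu>) *\<^sub>R abs_l2 v)"
    using bounded_linear.linear[OF bounded_linear_resolvent[OF t]] linear_scale by metis
  also have "\<dots> = abs_l2 v" using resolvent_eqI[OF t w] by simp
  finally show "resolvent \<Omega> t (abs_l2 v) = (1 / (t + \<mu>)) *\<^sub>R abs_l2 v"
    using t \<mu> by (metis add_pos_nonneg divide_inverse mult_1 less_irrefl left_inverse scaleR_one scaleR_scaleR)
qed

text \<open>If the resolvent at 1 maps v to m v, then m v - \<Delta> (m v) = v, and dividing by m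
  gives the eigenvalue 1/m - 1.\<close>

lemma dirichlet_eigenpairI:
  assumes m: "m > 0" and x: "resolvent \<Omega> 1 (abs_l2 v) = m *\<^sub>R abs_l2 v" and v: "sqint v" "abs_l2 v \<noteq> 0" and \<Omega>: "\<Omega> \<in> sets borel"
  shows "dirichlet_eigenpair \<Omega> (1 / m - 1) v"
  unfolding dirichlet_eigenpair_def
proof (intro conjI ballI)
  obtain g where g: "weak_solution \<Omega> 1 (abs_l2 v) (resolvent \<Omega> 1 (abs_l2 v), g)" by (rule resolventE[OF zero_less_one])
  then have "(m *\<^sub>R abs_l2 v, g) \<in> H01 \<Omega>" unfolding x weak_solution_def by blast
  from subspace_scale[OF subspace_H01 this, of "1 / m"] have H: "(abs_l2 v, (1 / m) *\<^sub>R g) \<in> H01 \<Omega>" using m by simp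
  then show "v \<in> sobolev_completion 1 \<Omega>" using v sobolev_completion_iff by blast
  show "\<not> (AE x in lborel. v x = 0)"
    using v abs_l2_eq_iff[OF v(1) sqint_zero] by (simp add: abs_l2_zero)
  fix \<psi> assume \<psi>: "\<psi> \<in> test_functions \<Omega>"
  have "m * inner (abs_l2 v) (abs_l2 \<psi>) + inner g (abs_l2 (grad \<psi>)) = inner (abs_l2 v) (abs_l2 \<psi>)"
    using g embed_in_H01[OF \<psi>] unfolding x weak_solution_def by (fastforce simp: embed_def)
  then have "inner ((1 / m) *\<^sub>R g) (abs_l2 (grad \<psi>)) = (1 / m - 1) * inner (abs_l2 v) (abs_l2 \<psi>)"
    using m by (simp add: field_simps)
  then show "L2_inner \<Omega> v (\<lambda>x. - laplacian \<psi> x) = (1 / m - 1) * L2_inner \<Omega> v \<psi>"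
    using L2_inner_minus_laplacian[OF v(1) H \<psi> \<Omega>] L2_inner_eq_inner[OF v(1) sqint_test_function(1)[OF \<psi>] \<Omega> test_in_L2_on[OF \<psi> \<Omega>]]
    by simp
qed

text \<open>By symmetry the resolvent maps the orthogonal complement \<open>K\<close> of the
  eigenfunctions into itself. If \<open>K\<close> were nonzero, the compact positive resolvent would
  have an eigenvector there, hence a Dirichlet eigenfunction orthogonal to the whole system, against
  maximality.\<close>

lemma eigensystem_orthonormal_complete:
  assumes es: "dirichlet_eigensystem \<Omega> lam phi" and \<Omega>: "open \<Omega>" "bounded \<Omega>"
  shows "orthonormal_seq (\<lambda>j. abs_l2 (phi j))"
    and "f \<in> L2_on \<Omega> \<Longrightarrow> (\<And>j. inner f (abs_l2 (phi j)) = 0) \<Longrightarrow> f = 0"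
proof -
  have \<Omega>m: "\<Omega> \<in> sets borel" using \<Omega> by simp
  have ep: "dirichlet_eigenpair \<Omega> (lam j) (phi j)" for j using es by (simp add: dirichlet_eigensystem_def)
  note D = dirichlet_eigenpairD[OF ep \<Omega>m]
  show "orthonormal_seq (\<lambda>j. abs_l2 (phi j))"
    unfolding orthonormal_seq_def using es L2_inner_eq_inner[OF D(1) D(1) \<Omega>m D(2)]
    by (simp add: dirichlet_eigensystem_def)
  define K where "K = {f \<in> L2_on \<Omega>. \<forall>j. inner f (abs_l2 (phi j)) = 0}"
  have sK: "subspace K"
    using subspace_L2_on[of \<Omega>] unfolding K_def subspace_def by (auto simp: inner_add_left)
  have "K = L2_on \<Omega> \<inter> (\<Inter>j. {f. inner f (abs_l2 (phi j)) = 0})" by (auto simp: K_def)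
  then have cK: "closed K"
    by (auto intro!: closed_Int closed_L2_on closed_INT closed_Collect_eq continuous_intros)
  have RK: "resolvent \<Omega> 1 ` K \<subseteq> K"
  proof
    fix x assume "x \<in> resolvent \<Omega> 1 ` K"
    then obtain f where f: "f \<in> K" "x = resolvent \<Omega> 1 f" by blast
    have "inner x (abs_l2 (phi j)) = 0" for j
      unfolding f(2) resolvent_symmetric[OF zero_less_one] D(4)[OF zero_less_one] using f(1) by (simp add: K_def)
    then show "x \<in> K" using resolvent_in_L2_on[OF zero_less_one \<Omega>m] f by (simp add: K_def)
  qed
  have K0: "K = {0}"
  proof (rule ccontr)
    assume ne: "K \<noteq> {0}"
    have "\<exists>m>0. \<exists>x\<in>K. x \<noteq> 0 \<and> resolvent \<Omega> 1 x = m *\<^sub>R x"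
    proof (rule compact_symmetric_has_eigenvector[OF bounded_linear_resolvent sK cK RK ne])
      show "inner (resolvent \<Omega> 1 x) y = inner x (resolvent \<Omega> 1 y)" for x y by (rule resolvent_symmetric) simp
      show "0 < inner (resolvent \<Omega> 1 x) x" if "x \<in> K" "x \<noteq> 0" for x
        using resolvent_positive[OF \<Omega> zero_less_one _ that(2)] that(1) by (simp add: K_def)
      show "\<exists>r. strict_mono r \<and> convergent (\<lambda>n. resolvent \<Omega> 1 (X (r n)))" if "\<And>n::nat. norm (X n) \<le> 1" for X
        by (rule resolvent_compact[OF \<Omega>(2) that])
    qed simp
    then obtain m x where m: "m > 0" and x: "x \<in> K" "x \<noteq> 0" "resolvent \<Omega> 1 x = m *\<^sub>R x" by blast
    obtain v where v: "sqint v" "x = abs_l2 v" using l2_cases by blast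
    have "dirichlet_eigenpair \<Omega> (1 / m - 1) v"
      by (rule dirichlet_eigenpairI[OF m _ v(1) _ \<Omega>m]) (use x v in auto)
    then obtain j where "L2_inner \<Omega> v (phi j) \<noteq> 0" using es unfolding dirichlet_eigensystem_def by blast
    then show False using L2_inner_eq_inner[OF v(1) D(1) \<Omega>m D(2), of j] x(1) v(2) by (simp add: K_def)
  qed
  show "f = 0" if "f \<in> L2_on \<Omega>" "\<And>j. inner f (abs_l2 (phi j)) = 0"
    using that K0 by (auto simp: K_def)
qed

section \<open>The resolvent of the Laplacian on the whole space\<close>

lemma exp_decay_integral:
  assumes "a > 0"
  shows "integrable lborel (\<lambda>\<tau>::real. indicator {0<..} \<tau> * exp (- (a * \<tau>)))"
    and "(\<integral>\<tau>. indicator {0<..} \<tau> * exp (- (a * \<tau>)) \<partial>lborel) = 1 / (a::real)"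
proof -
  show "integrable lborel (\<lambda>\<tau>::real. indicator {0<..} \<tau> * exp (- (a * \<tau>)))"
    using integrable_I0i_exp_mscale[OF assms] by (simp add: set_integrable_def mult.commute)
  show "(\<integral>\<tau>. indicator {0<..} \<tau> * exp (- (a * \<tau>)) \<partial>lborel) = 1 / (a::real)"
    using LBINT_I0i_exp_mscale[OF assms]
    by (simp add: interval_lebesgue_integral_0_infty set_lebesgue_integral_def mult.commute)
qed

definition resolvent_density :: "real \<Rightarrow> real \<times> 'a::euclidean_space \<Rightarrow> real" where
  "resolvent_density t m = (indicator {0<..} (fst m) * exp (- (t * fst m))) * (fconst TYPE('a) * gauss (snd m))"

text \<open>The exponential mixture of the heat kernels: \<open>(t - \<Delta>)\<^sup>-\<^sup>1\<close> is the integral of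
  \<open>exp (- t \<tau>) exp (\<tau> \<Delta>)\<close> over \<open>\<tau> > 0\<close>, and \<open>exp (\<tau> \<Delta>)\<close> averages over the shifts \<open>sqrt (2 \<tau>) z\<close> with \<open>z\<close>
  standard normal.\<close>

definition resolvent_measure :: "real \<Rightarrow> (real \<times> 'a::euclidean_space) measure" where
  "resolvent_measure t = density lborel (\<lambda>m. ennreal (resolvent_density t m))"

definition shift :: "real \<times> 'a::euclidean_space \<Rightarrow> 'a" where
  "shift m = sqrt (2 * fst m) *\<^sub>R snd m"

definition space_resolvent :: "real \<Rightarrow> ('a::euclidean_space \<Rightarrow> real) \<Rightarrow> 'a \<Rightarrow> real" where
  "space_resolvent t \<phi> x = (\<integral>m. \<phi> (x - shift m) \<partial>resolvent_measure t)"

lemma resolvent_density_nonneg: "0 \<le> resolvent_density t m"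
  by (simp add: resolvent_density_def)

lemma resolvent_density_measurable [measurable]: "resolvent_density t \<in> borel_measurable borel"
proof -
  have [measurable]: "fst \<in> borel_measurable borel" "snd \<in> borel_measurable borel"
    by (auto intro!: borel_measurable_continuous_onI continuous_intros)
  show ?thesis unfolding resolvent_density_def[abs_def] by measurable
qed

lemma shift_continuous: "continuous_on UNIV shift"
  unfolding shift_def by (intro continuous_intros)

lemma shift_measurable [measurable]: "shift \<in> borel_measurable borel"
  using shift_continuous borel_measurable_continuous_onI by blast

lemma resolvent_density_integrable:
  assumes t: "t > 0"
  shows "integrable lborel (resolvent_density t :: real \<times> 'a::euclidean_space \<Rightarrow> real)"
  unfolding lborel_prod[symmetric]
proof -
  have "integrable (lborel \<Otimes>\<^sub>M lborel) (\<lambda>(\<tau>, z::'a). (indicator {0<..} \<tau> * exp (- (t * \<tau>))) * (fconst TYPE('a) * gauss z))"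
    by (rule Fubini_dominated(1)[OF lborel.sigma_finite_measure_axioms lborel.sigma_finite_measure_axioms _ exp_decay_integral(1)[OF t]
          integrable_mult_right[OF gauss_integral(1)]]) (auto simp: abs_mult)
  then show "integrable (lborel \<Otimes>\<^sub>M lborel) (resolvent_density t :: real \<times> 'a \<Rightarrow> real)"
    by (simp add: resolvent_density_def[abs_def] case_prod_beta')
qed

lemma finite_resolvent_measure:
  assumes t: "t > 0"
  shows "finite_measure (resolvent_measure t :: (real \<times> 'a::euclidean_space) measure)"
proof (rule finite_measureI)
  have "emeasure (resolvent_measure t :: (real \<times> 'a) measure) (space (resolvent_measure t)) = (\<integral>\<^sup>+m. ennreal (resolvent_density t (m :: real \<times> 'a)) \<partial>lborel)"
    unfolding resolvent_measure_def by (simp add: emeasure_density)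
  also have "\<dots> = ennreal (\<integral>m. resolvent_density t (m :: real \<times> 'a) \<partial>lborel)"
    by (rule nn_integral_eq_integral[OF resolvent_density_integrable[OF t]]) (simp add: resolvent_density_nonneg)
  finally show "emeasure (resolvent_measure t :: (real \<times> 'a) measure) (space (resolvent_measure t)) \<noteq> \<infinity>" by simp
qed

text \<open>For fixed \<tau> the Gaussian integral at frequency sqrt (2 \<tau>) \<xi> yields exp (-
  \<tau> |\<xi>|^2); integrating this against exp (- t \<tau>) over \<tau> > 0 yields the resolvent
  multiplier.\<close>

lemma resolvent_measure_cis:
  fixes \<xi> :: "'a::euclidean_space"
  assumes t: "t > 0"
  shows "(\<integral>m. cis (- (\<xi> \<bullet> shift m)) \<partial>resolvent_measure t) = complex_of_real (1 / (t + (norm \<xi>)\<^sup>2))"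
proof -
  let ?c = "fconst TYPE('a)"
  have a: "t + (norm \<xi>)\<^sup>2 > 0" using t by (simp add: add_pos_nonneg)
  define f where "f \<tau> z = complex_of_real ((indicator {0<..} \<tau> * exp (- (t * \<tau>))) * (?c * gauss z)) * cis (- (\<xi> \<bullet> (sqrt (2 * \<tau>) *\<^sub>R z)))" for \<tau> and z :: 'a
  have [measurable]: "case_prod f \<in> borel_measurable (lborel \<Otimes>\<^sub>M lborel)" unfolding f_def by measurable
  have fi: "integrable (lborel \<Otimes>\<^sub>M lborel) (case_prod f)"
    by (rule Fubini_dominated(1)[OF lborel.sigma_finite_measure_axioms lborel.sigma_finite_measure_axioms _ exp_decay_integral(1)[OF t]
          integrable_mult_right[OF gauss_integral(1)]]) (auto simp: f_def norm_mult abs_mult)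
  have "(\<integral>m. cis (- (\<xi> \<bullet> shift m)) \<partial>resolvent_measure t) = (\<integral>m. resolvent_density t m *\<^sub>R cis (- (\<xi> \<bullet> shift m)) \<partial>lborel)"
    unfolding resolvent_measure_def by (rule integral_density) (auto simp: resolvent_density_nonneg)
  also have "\<dots> = (\<integral>m. case_prod f m \<partial>(lborel \<Otimes>\<^sub>M lborel))"
    unfolding lborel_prod by (intro Bochner_Integration.integral_cong refl) (auto simp: f_def resolvent_density_def shift_def scaleR_conv_of_real)
  also have "\<dots> = (\<integral>\<tau>. (\<integral>z. f \<tau> z \<partial>lborel) \<partial>lborel)"
    by (rule lborel_pair.integral_fst'[symmetric, OF fi, unfolded split_conv])
  also have "\<dots> = (\<integral>\<tau>. complex_of_real (indicator {0<..} \<tau> * exp (- ((t + (norm \<xi>)\<^sup>2) * \<tau>))) \<partial>lborel)"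
  proof (intro Bochner_Integration.integral_cong refl)
    fix \<tau> :: real
    show "(\<integral>z. f \<tau> z \<partial>lborel) = complex_of_real (indicator {0<..} \<tau> * exp (- ((t + (norm \<xi>)\<^sup>2) * \<tau>)))"
    proof (cases "\<tau> > 0")
      case True
      have "(\<integral>z. f \<tau> z \<partial>lborel) = (\<integral>z. complex_of_real (exp (- (t * \<tau>)) * ?c) * (cis ((- sqrt (2 * \<tau>) *\<^sub>R \<xi>) \<bullet> z) * complex_of_real (gauss z)) \<partial>lborel)"
        using True by (intro Bochner_Integration.integral_cong refl) (simp add: f_def)
      also have "\<dots> = complex_of_real (exp (- (t * \<tau>)) * ?c) * (\<integral>z. cis ((- sqrt (2 * \<tau>) *\<^sub>R \<xi>) \<bullet> z) * complex_of_real (gauss z) \<partial>lborel)"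
        by (rule integral_mult_right_zero)
      also have "\<dots> = complex_of_real (exp (- (t * \<tau>)) * (?c * (2 * pi) powr (real DIM('a) / 2)) * gauss (- sqrt (2 * \<tau>) *\<^sub>R \<xi>))"
        unfolding gauss_Fourier(2) by (simp only: of_real_mult mult_ac)
      also have "gauss (- sqrt (2 * \<tau>) *\<^sub>R \<xi>) = exp (- (\<tau> * (norm \<xi>)\<^sup>2))"
        using True by (simp add: gauss_def power_mult_distrib)
      finally show ?thesis using True unfolding fconst_mult by (simp add: exp_add[symmetric] algebra_simps flip: of_real_mult)
    qed (simp add: f_def)
  qed
  also have "\<dots> = complex_of_real (1 / (t + (norm \<xi>)\<^sup>2))"
    unfolding integral_complex_of_real exp_decay_integral(2)[OF a] ..
  finally show ?thesis .
qed

context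
  fixes \<phi> :: "'a::euclidean_space \<Rightarrow> real" and t :: real
  assumes \<phi>: "\<phi> \<in> test_functions UNIV" and t: "t > 0"
begin

lemma shift_measurable_resolvent [measurable]: "shift \<in> borel_measurable (resolvent_measure t)"
  by (simp add: resolvent_measure_def)

lemma space_resolvent_smooth: "smooth (space_resolvent t \<phi>)"
  unfolding space_resolvent_def[abs_def]
  by (rule smooth_average[OF finite_resolvent_measure[OF t] _ \<phi>]) measurable

lemma space_resolvent_grad_bounded: "\<exists>C. \<forall>x. norm (grad (space_resolvent t \<phi>) x) \<le> C"
proof -
  obtain C where C: "C > 0" "\<And>x. norm (grad \<phi> x) \<le> C" using test_function_grad_bounded[OF \<phi>] by blast
  interpret finite_measure "resolvent_measure t :: (real \<times> 'a) measure" by (rule finite_resolvent_measure[OF t])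
  have [measurable]: "grad \<phi> \<in> borel_measurable borel" using grad_measurable[OF test_function_smooth[OF \<phi>]] .
  have "norm (grad (space_resolvent t \<phi>) x) \<le> (\<integral>m. C \<partial>(resolvent_measure t :: (real \<times> 'a) measure))" for x
  proof -
    have "grad (space_resolvent t \<phi>) x = (\<integral>m. grad \<phi> (x - shift m) \<partial>resolvent_measure t)"
      unfolding space_resolvent_def[abs_def]
      by (rule has_derivative_grad_unique[OF average_has_derivative[OF finite_resolvent_measure[OF t] _ \<phi>]]) measurable
    also have "norm \<dots> \<le> (\<integral>m. norm (grad \<phi> (x - shift m)) \<partial>resolvent_measure t)" by (rule integral_norm_bound)
    also have "\<dots> \<le> (\<integral>m. C \<partial>(resolvent_measure t :: (real \<times> 'a) measure))"
      using C by (intro integral_mono_AE' AE_I2) auto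
    finally show ?thesis .
  qed
  then show ?thesis by blast
qed

lemma space_resolvent_pairing:
  assumes "integrable lborel u"
  shows "complex_of_real (\<integral>x. u x * space_resolvent t \<phi> x \<partial>lborel) =
    (\<integral>\<xi>. complex_of_real (1 / (t + (norm \<xi>)\<^sup>2)) * fourier \<phi> \<xi> * cnj (fourier u \<xi>) \<partial>lborel)"
  unfolding space_resolvent_def
  by (rule fourier_average(2)[OF finite_resolvent_measure[OF t] _ \<phi> resolvent_measure_cis[OF t] assms]) measurable

text \<open>In Fourier variables, applying t - \<Delta> to the test function \<open>X\<close>
  multiplies its transform by t + |\<xi>|^2, which cancels the multiplier of the resolvent. The
  equation thus follows from the pairing with a test function.\<close>

lemma space_resolvent_weak:
  assumes X: "X \<in> test_functions UNIV"
  shows "(\<integral>x. space_resolvent t \<phi> x * (t * X x - laplacian X x) \<partial>lborel) = (\<integral>x. \<phi> x * X x \<partial>lborel)"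
proof -
  define u where "u = (\<lambda>x. t * X x - laplacian X x)"
  have lX: "laplacian X \<in> test_functions UNIV" by (rule test_function_laplacian[OF X])
  have u: "u \<in> test_functions UNIV" unfolding u_def by (intro test_function_diff test_function_scale X lX)
  have Fu: "fourier u \<xi> = complex_of_real (t + (norm \<xi>)\<^sup>2) * fourier X \<xi>" for \<xi>
    unfolding u_def
    by (subst fourier_diff[OF test_function_integrable[OF test_function_scale[OF X]] test_function_integrable[OF lX]])
      (simp add: fourier_scale fourier_laplacian[OF X] algebra_simps)
  have "complex_of_real (\<integral>x. u x * space_resolvent t \<phi> x \<partial>lborel) = (\<integral>\<xi>. fourier \<phi> \<xi> * cnj (fourier X \<xi>) \<partial>lborel)"
    unfolding space_resolvent_pairing[OF test_function_integrable[OF u]] Fu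
  proof (intro Bochner_Integration.integral_cong refl)
    fix \<xi> :: 'a
    have "t + (norm \<xi>)\<^sup>2 \<noteq> 0" using t by (metis add_pos_nonneg less_irrefl zero_le_power2)
    then have "complex_of_real (1 / (t + (norm \<xi>)\<^sup>2)) * complex_of_real (t + (norm \<xi>)\<^sup>2) = 1"
      unfolding of_real_mult[symmetric] by simp
    then show "complex_of_real (1 / (t + (norm \<xi>)\<^sup>2)) * fourier \<phi> \<xi> * cnj (complex_of_real (t + (norm \<xi>)\<^sup>2) * fourier X \<xi>) = fourier \<phi> \<xi> * cnj (fourier X \<xi>)"
      unfolding complex_cnj_mult complex_cnj_complex_of_real by (metis mult.assoc mult.commute mult.left_neutral)
  qed
  also have "\<dots> = complex_of_real (\<integral>x. X x * \<phi> x \<partial>lborel)"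
    by (rule Parseval_test[OF \<phi> test_function_integrable[OF X], symmetric])
  finally show ?thesis unfolding u_def of_real_eq_iff by (simp add: mult.commute)
qed

lemma space_resolvent_weak_grad:
  assumes X: "X \<in> test_functions UNIV"
  shows "t * (\<integral>x. space_resolvent t \<phi> x * X x \<partial>lborel) + (\<integral>x. grad (space_resolvent t \<phi>) x \<bullet> grad X x \<partial>lborel) = (\<integral>x. \<phi> x * X x \<partial>lborel)"
proof -
  let ?w = "space_resolvent t \<phi>"
  have i: "integrable lborel (\<lambda>x. ?w x * h x)" if "h \<in> test_functions UNIV" for h
    using test_function_integrable[OF test_function_mult[OF that space_resolvent_smooth]] .
  have "(\<integral>x. \<phi> x * X x \<partial>lborel) = (\<integral>x. t * (?w x * X x) - ?w x * laplacian X x \<partial>lborel)"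
    unfolding space_resolvent_weak[OF X, symmetric] by (simp add: algebra_simps)
  also have "\<dots> = t * (\<integral>x. ?w x * X x \<partial>lborel) - (\<integral>x. ?w x * laplacian X x \<partial>lborel)"
    using i[OF X] i[OF test_function_laplacian[OF X]] by simp
  finally show ?thesis unfolding integral_grad_grad[OF space_resolvent_smooth X] by simp
qed

lemma space_resolvent_nonneg: "(\<And>x. 0 \<le> \<phi> x) \<Longrightarrow> 0 \<le> space_resolvent t \<phi> x"
  unfolding space_resolvent_def by simp

text \<open>The mixture charges every nonempty open set of pairs (\<tau>, z) with \<tau> > 0, and
  those that shift x to a point where \<phi> is positive form such a set.\<close>

lemma space_resolvent_pos:
  assumes nn: "\<And>x. 0 \<le> \<phi> x" and x0: "\<phi> x0 \<noteq> 0"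
  shows "0 < space_resolvent t \<phi> x"
proof (rule ccontr)
  assume "\<not> 0 < space_resolvent t \<phi> x"
  then have "space_resolvent t \<phi> x = 0" using space_resolvent_nonneg[OF nn, of x] by simp
  then have "AE m in resolvent_measure t. \<phi> (x - shift m) = 0"
    unfolding space_resolvent_def
    using integral_nonneg_eq_0_iff_AE[OF integrable_average[OF finite_resolvent_measure[OF t] shift_measurable_resolvent \<phi>]] nn
    by auto
  then have ae: "AE m in lborel. 0 < resolvent_density t (m :: real \<times> 'a) \<longrightarrow> \<phi> (x - shift m) = 0"
    unfolding resolvent_measure_def by (subst (asm) AE_density) auto
  define S where "S = {m :: real \<times> 'a. 0 < fst m \<and> 0 < \<phi> (x - shift m)}"
  have "AE m in lborel. m \<notin> S"
    using ae by eventually_elim (auto simp: S_def resolvent_density_def)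
  have "open S" unfolding S_def
    by (intro open_Collect_conj open_Collect_less continuous_intros continuous_on_compose2[OF test_function_continuous[OF \<phi>, of UNIV]]
        continuous_on_subset[OF shift_continuous]) auto
  moreover have "S \<in> null_sets lborel"
    using \<open>AE m in lborel. m \<notin> S\<close> \<open>open S\<close> by (subst AE_iff_null_sets) auto
  ultimately have "S = {}" by (rule open_null_lborel_empty)
  \<comment> \<open>At time 1/2 the scaling factor sqrt (2 \<tau>) is 1, so this pair shifts x
    exactly to x0.\<close>
  moreover have "(1 / 2, x - x0) \<in> S" using nn[of x0] x0 by (simp add: S_def shift_def)
  ultimately show False by blast
qed

end

lemma sqint_bound:
  assumes "sqint f" "g \<in> borel_measurable borel" "\<And>x. norm (g x) \<le> norm (f x)"
  shows "sqint g"
  unfolding sqint_def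
proof
  note [measurable] = assms(2)
  show "g \<in> borel_measurable lborel" by measurable
  show "integrable lborel (\<lambda>x. (norm (g x))\<^sup>2)"
  proof (rule Bochner_Integration.integrable_bound)
    show "integrable lborel (\<lambda>x. (norm (f x))\<^sup>2)" using assms(1) by (simp add: sqint_def)
    show "AE x in lborel. norm ((norm (g x))\<^sup>2) \<le> norm ((norm (f x))\<^sup>2)"
      using assms(3) by (auto intro!: AE_I2 power_mono)
  qed measurable
qed

lemma norm_abs_l2_mono:
  assumes f: "sqint f" and g: "sqint g" and le: "\<And>x. norm (f x) \<le> norm (g x)"
  shows "norm (abs_l2 f) \<le> norm (abs_l2 g)"
proof (rule power2_le_imp_le)
  show "(norm (abs_l2 f))\<^sup>2 \<le> (norm (abs_l2 g))\<^sup>2"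
    unfolding norm_abs_l2[OF f] norm_abs_l2[OF g]
    using f g le by (intro integral_mono power_mono) (auto simp: sqint_def)
qed simp

lemma inner_Bseq_tendsto_zero:
  assumes "X \<longlonglongrightarrow> 0" "Bseq Y"
  shows "(\<lambda>k. inner (X k) (Y k)) \<longlonglongrightarrow> 0"
proof -
  obtain B where B: "\<And>k. norm (Y k) \<le> B" using assms(2) unfolding Bseq_def by blast
  show ?thesis
  proof (rule Lim_null_comparison)
    show "\<forall>\<^sub>F k in sequentially. norm (inner (X k) (Y k)) \<le> norm (X k) * B"
    proof (intro always_eventually allI)
      fix k
      have "norm (inner (X k) (Y k)) \<le> norm (X k) * norm (Y k)" by (simp add: Cauchy_Schwarz_ineq2)
      also have "\<dots> \<le> norm (X k) * B" using B by (intro mult_left_mono) auto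
      finally show "norm (inner (X k) (Y k)) \<le> norm (X k) * B" .
    qed
    show "(\<lambda>k. norm (X k) * B) \<longlonglongrightarrow> 0"
      using tendsto_mult_right[OF tendsto_norm_zero[OF assms(1)], of B] by simp
  qed
qed

section \<open>Comparison of the two resolvents\<close>

text \<open>The weak comparison argument tests the difference of the two equations with the positive
  part of V - w. Since V is only a limit of test functions, the argument is run with the smooth
  positive part of \<open>\<psi> k - w\<close> for approximating \<open>\<psi> k\<close>, and the
  resulting error tends to 0.\<close>

lemma resolvent_comparison:
  fixes \<Omega> :: "'a::euclidean_space set"
  assumes \<Omega>: "open \<Omega>" "bounded \<Omega>" and t: "t > 0" and \<phi>: "\<phi> \<in> test_functions \<Omega>" "\<And>x. 0 \<le> \<phi> x"
    and V: "sqint V" "abs_l2 V = resolvent \<Omega> t (abs_l2 \<phi>)"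
  shows "AE x in lborel. V x \<le> space_resolvent t \<phi> x"
proof -
  have \<phi>U: "\<phi> \<in> test_functions UNIV" using \<phi>(1) test_functions_mono[of \<Omega> UNIV] by blast
  define w where "w = space_resolvent t \<phi>"
  have ws: "smooth w" unfolding w_def by (rule space_resolvent_smooth[OF \<phi>U t])
  have [measurable]: "w \<in> borel_measurable borel" using smooth_borel_measurable[OF ws] .
  have [measurable]: "V \<in> borel_measurable borel" using V(1) by (simp add: sqint_def)
  have w0: "0 \<le> w x" for x unfolding w_def by (rule space_resolvent_nonneg[OF \<phi>U t \<phi>(2)])
  obtain C where C: "\<And>x. norm (grad w x) \<le> C" using space_resolvent_grad_bounded[OF \<phi>U t] unfolding w_def by blast
  obtain g where g: "weak_solution \<Omega> t (abs_l2 \<phi>) (abs_l2 V, g)" unfolding V(2) by (rule resolventE[OF t])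
  then obtain \<psi> where \<psi>: "\<And>k::nat. \<psi> k \<in> test_functions \<Omega>" "(\<lambda>k. abs_l2 (\<psi> k)) \<longlonglongrightarrow> abs_l2 V" "(\<lambda>k. abs_l2 (grad (\<psi> k))) \<longlonglongrightarrow> g"
    using H01E[of "abs_l2 V" g \<Omega>] unfolding weak_solution_def by blast
  have [measurable]: "\<psi> k \<in> borel_measurable borel" "grad (\<psi> k) \<in> borel_measurable borel" "grad w \<in> borel_measurable borel" for k
    using test_function_measurable[OF \<psi>(1)] grad_measurable[OF test_function_smooth[OF \<psi>(1)]] grad_measurable[OF ws] by auto
  define X where "X k x = soft_pos (\<psi> k x - w x)" for k x
  \<comment> \<open>Here the boundary condition enters: as w is nonnegative, the truncation vanishes
    wherever \<open>\<psi> k\<close> does, so \<open>X k\<close> is admissible on \<Omega> although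
    w does not vanish on the boundary.\<close>
  have Xout: "soft_pos (\<psi> k x - w x) = 0" "soft_pos' (\<psi> k x - w x) = 0" if "\<psi> k x = 0" for k x
    using that w0[of x] by (auto simp: soft_pos'_def flat_exp_def)
  have XT: "X k \<in> test_functions \<Omega>" for k
  proof -
    obtain K where K: "compact K" "K \<subseteq> \<Omega>" "\<And>x. x \<notin> K \<Longrightarrow> \<psi> k x = 0" using test_functionE[OF \<psi>(1)] by metis
    show ?thesis
      by (rule test_functionI[OF _ K(1,2)])
        (use K Xout in \<open>auto simp: X_def[abs_def] simp del: soft_pos_eq_0_iff intro!: smooth_soft_pos smooth_diff ws test_function_smooth[OF \<psi>(1)]\<close>)
  qed
  have XU: "X k \<in> test_functions UNIV" for k using XT test_functions_mono[of \<Omega> UNIV] by blast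
  have Xgrad: "grad (X k) x = soft_pos' (\<psi> k x - w x) *\<^sub>R (grad (\<psi> k) x - grad w x)" for k x
  proof (rule has_derivative_grad_unique)
    have "((\<lambda>x. \<psi> k x - w x) has_derivative (\<lambda>h. grad (\<psi> k) x \<bullet> h - grad w x \<bullet> h)) (at x)"
      by (intro has_derivative_diff grad_has_derivative test_function_differentiable[OF \<psi>(1)] smooth_differentiable[OF ws])
    from has_derivative_compose[OF this, of soft_pos "\<lambda>h. soft_pos' (\<psi> k x - w x) * h"] soft_pos_deriv
    show "(X k has_derivative (\<lambda>h. (soft_pos' (\<psi> k x - w x) *\<^sub>R (grad (\<psi> k) x - grad w x)) \<bullet> h)) (at x)"
      by (simp add: X_def[abs_def] has_field_derivative_def inner_diff_left)
  qed
  have sp: "\<bar>soft_pos (a - w x)\<bar> \<le> \<bar>a\<bar>" for a x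
  proof (cases "a \<le> w x")
    case True
    then have "soft_pos (a - w x) = 0" by simp
    then show ?thesis by (simp only: abs_zero abs_ge_zero)
  next
    case False
    then have "soft_pos (a - w x) \<le> a - w x" by (intro soft_pos_le) simp
    then show ?thesis using w0[of x] soft_pos_nonneg[of "a - w x"] by linarith
  qed
  then have Xle: "\<bar>X k x\<bar> \<le> \<bar>\<psi> k x\<bar>" for k x
    by (simp only: X_def)
  have sq: "sqint (\<psi> k)" "sqint (grad (\<psi> k))" "sqint (X k)" "sqint (grad (X k))" for k
    using sqint_test_function[OF \<psi>(1)] sqint_test_function[OF XT] by auto
  \<comment> \<open>V and w satisfy the same equation when tested with \<open>X k\<close>. So
    \<open>err k\<close> is both the error of replacing V by \<open>\<psi> k\<close> and the weak
    form of \<open>\<psi> k - w\<close> tested with \<open>X k\<close>; the second reading bounds it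
    below, the first makes it vanish in the limit.\<close>
  define err where "err k = t * inner (abs_l2 (\<psi> k) - abs_l2 V) (abs_l2 (X k)) + inner (abs_l2 (grad (\<psi> k)) - g) (abs_l2 (grad (X k)))" for k
  have energy: "t * (norm (abs_l2 (X k)))\<^sup>2 \<le> err k" for k
  proof -
    have i1: "integrable lborel (\<lambda>x. \<psi> k x * X k x)" "integrable lborel (\<lambda>x. grad (\<psi> k) x \<bullet> grad (X k) x)"
      using sqint_integrable_inner[OF sq(1,3)] sqint_integrable_inner[OF sq(2,4)] by auto
    have i2: "integrable lborel (\<lambda>x. w x * X k x)"
      by (rule test_function_integrable[OF test_function_mult[OF XT ws]])
    have i3: "integrable lborel (\<lambda>x. grad w x \<bullet> grad (X k) x)"
    proof -
      obtain K where K: "compact K" "K \<subseteq> \<Omega>" "\<And>x. x \<notin> K \<Longrightarrow> X k x = 0" using test_functionE[OF XT] by metis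
      have g0: "grad (X k) x = 0" if "x \<notin> K" for x
        unfolding grad_def using partial_deriv_zero_outside[OF compact_imp_closed[OF K(1)] K(3) that] by simp
      show "integrable lborel (\<lambda>x. grad w x \<bullet> grad (X k) x)"
        by (rule integrable_continuous_compact_support[OF K(1)])
          (auto simp: g0 intro!: continuous_intros grad_continuous ws test_function_smooth[OF XT])
    qed
    have i4: "integrable lborel (\<lambda>x. (X k x)\<^sup>2)" using sq(3)[of k] by (simp add: sqint_def)
    have a: "t * inner (abs_l2 V) (abs_l2 (X k)) + inner g (abs_l2 (grad (X k))) = inner (abs_l2 \<phi>) (abs_l2 (X k))"
      using g embed_in_H01[OF XT[of k]] unfolding weak_solution_def by (fastforce simp: embed_def)
    have b: "t * (\<integral>x. w x * X k x \<partial>lborel) + (\<integral>x. grad w x \<bullet> grad (X k) x \<partial>lborel) = inner (abs_l2 \<phi>) (abs_l2 (X k))"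
      using space_resolvent_weak_grad[OF \<phi>U t XU[of k]] sqint_test_function(1)[OF \<phi>(1)] sq(3)[of k]
      by (simp add: inner_abs_l2 w_def)
    have "err k = t * inner (abs_l2 (\<psi> k)) (abs_l2 (X k)) + inner (abs_l2 (grad (\<psi> k))) (abs_l2 (grad (X k)))
        - (t * (\<integral>x. w x * X k x \<partial>lborel) + (\<integral>x. grad w x \<bullet> grad (X k) x \<partial>lborel))"
      unfolding err_def b a[symmetric] by (simp add: inner_diff_left algebra_simps)
    also have "\<dots> = t * ((\<integral>x. \<psi> k x * X k x \<partial>lborel) - (\<integral>x. w x * X k x \<partial>lborel)) + ((\<integral>x. grad (\<psi> k) x \<bullet> grad (X k) x \<partial>lborel) - (\<integral>x. grad w x \<bullet> grad (X k) x \<partial>lborel))"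
      using sq[of k] by (simp add: inner_abs_l2 algebra_simps)
    also have "\<dots> = t * (\<integral>x. (\<psi> k x - w x) * X k x \<partial>lborel) + (\<integral>x. (grad (\<psi> k) x - grad w x) \<bullet> grad (X k) x \<partial>lborel)"
      using i1 i2 i3 by (simp add: left_diff_distrib inner_diff_left)
    finally have e: "err k = t * (\<integral>x. (\<psi> k x - w x) * X k x \<partial>lborel) + (\<integral>x. (grad (\<psi> k) x - grad w x) \<bullet> grad (X k) x \<partial>lborel)" .
    have "(\<integral>x. (X k x)\<^sup>2 \<partial>lborel) \<le> (\<integral>x. (\<psi> k x - w x) * X k x \<partial>lborel)"
    proof (rule integral_mono[OF i4])
      show "integrable lborel (\<lambda>x. (\<psi> k x - w x) * X k x)" using i1 i2 by (simp add: left_diff_distrib)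
      show "(X k x)\<^sup>2 \<le> (\<psi> k x - w x) * X k x" for x unfolding X_def power2_eq_square by (rule soft_pos_mult_ge)
    qed
    then have "t * (norm (abs_l2 (X k)))\<^sup>2 \<le> t * (\<integral>x. (\<psi> k x - w x) * X k x \<partial>lborel)"
      using t sq(3)[of k] by (simp add: norm_abs_l2)
    moreover have "0 \<le> (\<integral>x. (grad (\<psi> k) x - grad w x) \<bullet> grad (X k) x \<partial>lborel)"
      unfolding Xgrad using soft_pos'_bounds by (intro integral_nonneg_AE AE_I2) auto
    ultimately show ?thesis unfolding e by linarith
  qed
  have [measurable]: "\<Omega> \<in> sets borel" using \<Omega> by simp
  have i\<Omega>: "integrable lborel (\<lambda>x. C\<^sup>2 * indicator \<Omega> x :: real)"
    using emeasure_bounded_finite[OF \<Omega>(2)] by (intro integrable_mult_right) simp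
  \<comment> \<open>The error pairs a null sequence with the gradients of \<open>X k\<close>, so
    these must stay bounded; the bound on grad w and the finite measure of \<Omega> take care of the
    part coming from w.\<close>
  have Gbound: "(norm (abs_l2 (grad (X k))))\<^sup>2 \<le> 2 * (norm (abs_l2 (grad (\<psi> k))))\<^sup>2 + 2 * (\<integral>x. C\<^sup>2 * indicator \<Omega> x \<partial>lborel)" for k
  proof -
    have ig: "integrable lborel (\<lambda>x. (norm (grad (\<psi> k) x))\<^sup>2)" using sq(2)[of k] by (simp add: sqint_def)
    have "(\<integral>x. (norm (grad (X k) x))\<^sup>2 \<partial>lborel) \<le> (\<integral>x. 2 * (norm (grad (\<psi> k) x))\<^sup>2 + 2 * (C\<^sup>2 * indicator \<Omega> x) \<partial>lborel)"
    proof (rule integral_mono)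
      show "integrable lborel (\<lambda>x. (norm (grad (X k) x))\<^sup>2)" using sq(4)[of k] by (simp add: sqint_def)
      show "integrable lborel (\<lambda>x. 2 * (norm (grad (\<psi> k) x))\<^sup>2 + 2 * (C\<^sup>2 * indicator \<Omega> x))"
        by (rule Bochner_Integration.integrable_add[OF integrable_mult_right[OF ig] integrable_mult_right[OF i\<Omega>]])
      fix x
      show "(norm (grad (X k) x))\<^sup>2 \<le> 2 * (norm (grad (\<psi> k) x))\<^sup>2 + 2 * (C\<^sup>2 * indicator \<Omega> x)"
      proof (cases "x \<in> \<Omega>")
        case True
        have "norm (grad (X k) x) \<le> 1 * norm (grad (\<psi> k) x - grad w x)"
          unfolding Xgrad norm_scaleR using soft_pos'_bounds[of "\<psi> k x - w x"] by (intro mult_right_mono) auto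
        also have "\<dots> \<le> norm (grad (\<psi> k) x) + C"
          using norm_triangle_ineq4[of "grad (\<psi> k) x" "grad w x"] C[of x] by simp
        finally have "(norm (grad (X k) x))\<^sup>2 \<le> (norm (grad (\<psi> k) x) + C)\<^sup>2" by (intro power_mono) auto
        also have "\<dots> \<le> 2 * (norm (grad (\<psi> k) x))\<^sup>2 + 2 * C\<^sup>2"
          using sum_squares_bound[of "norm (grad (\<psi> k) x)" C] by (simp add: power2_sum)
        finally show ?thesis using True by simp
      next
        case False
        then show ?thesis using Xout(2)[OF test_function_outside[OF \<psi>(1) False]] by (simp add: Xgrad)
      qed
    qed
    also have "\<dots> = 2 * (\<integral>x. (norm (grad (\<psi> k) x))\<^sup>2 \<partial>lborel) + 2 * (\<integral>x. C\<^sup>2 * indicator \<Omega> x \<partial>lborel)"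
      by (subst Bochner_Integration.integral_add[OF integrable_mult_right[OF ig] integrable_mult_right[OF i\<Omega>]])
        (simp only: integral_mult_right_zero)
    finally show ?thesis using sq[of k] by (simp add: norm_abs_l2)
  qed
  have "Bseq (\<lambda>k. abs_l2 (grad (X k)))"
  proof -
    obtain B where B: "\<And>k. norm (abs_l2 (grad (\<psi> k))) \<le> B"
      using convergent_imp_Bseq[OF convergentI[OF \<psi>(3)]] unfolding Bseq_def by blast
    define D where "D = 2 * B\<^sup>2 + 2 * (\<integral>x. C\<^sup>2 * indicator \<Omega> x \<partial>lborel)"
    have "norm (abs_l2 (grad (X k))) \<le> sqrt D" for k
    proof (rule real_le_rsqrt)
      have "(norm (abs_l2 (grad (\<psi> k))))\<^sup>2 \<le> B\<^sup>2" using B by (intro power_mono) auto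
      then show "(norm (abs_l2 (grad (X k))))\<^sup>2 \<le> D" using Gbound[of k] by (simp add: D_def)
    qed
    then show ?thesis by (intro BseqI') auto
  qed
  moreover have "(\<lambda>k. abs_l2 (grad (\<psi> k)) - g) \<longlonglongrightarrow> 0" using \<psi>(3) by (simp add: LIM_zero)
  ultimately have z2: "(\<lambda>k. inner (abs_l2 (grad (\<psi> k)) - g) (abs_l2 (grad (X k)))) \<longlonglongrightarrow> 0"
    by (rule inner_Bseq_tendsto_zero[rotated])
  have "Bseq (\<lambda>k. abs_l2 (X k))"
  proof -
    obtain B where B: "\<And>k. norm (abs_l2 (\<psi> k)) \<le> B"
      using convergent_imp_Bseq[OF convergentI[OF \<psi>(2)]] unfolding Bseq_def by blast
    have "norm (abs_l2 (X k)) \<le> norm (abs_l2 (\<psi> k))" for k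
      by (rule norm_abs_l2_mono[OF sq(3) sq(1)]) (use Xle in auto)
    then show ?thesis using B by (intro BseqI'[of _ B]) (meson order_trans)
  qed
  moreover have "(\<lambda>k. abs_l2 (\<psi> k) - abs_l2 V) \<longlonglongrightarrow> 0" using \<psi>(2) by (simp add: LIM_zero)
  ultimately have "(\<lambda>k. inner (abs_l2 (\<psi> k) - abs_l2 V) (abs_l2 (X k))) \<longlonglongrightarrow> 0"
    by (rule inner_Bseq_tendsto_zero[rotated])
  from tendsto_add[OF tendsto_mult_left[OF this, of t] z2] have "err \<longlonglongrightarrow> 0" by (simp add: err_def[abs_def])
  then have "(\<lambda>k. err k / t) \<longlonglongrightarrow> 0 / t" by (intro tendsto_intros) (use t in auto)
  then have l: "(\<lambda>k. err k / t) \<longlonglongrightarrow> 0" by simp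
  have "(\<lambda>k. (norm (abs_l2 (X k)))\<^sup>2) \<longlonglongrightarrow> 0"
    by (rule tendsto_sandwich[OF _ _ tendsto_const l]) (use energy t in \<open>auto intro!: always_eventually simp: field_simps\<close>)
  from tendsto_real_sqrt[OF this] have X0: "(\<lambda>k. abs_l2 (X k)) \<longlonglongrightarrow> 0" by (simp add: tendsto_norm_zero_iff)
  \<comment> \<open>\<open>X k\<close> tends to 0 by the energy estimate and to \<open>c\<close>
    because \<open>soft_pos\<close> is 1-Lipschitz. Hence \<open>c\<close> vanishes almost
    everywhere, which says that V is at most w.\<close>
  define c where "c x = soft_pos (V x - w x)" for x
  have cle: "\<bar>c x\<bar> \<le> \<bar>V x\<bar>" for x
    using sp by (simp only: c_def)
  have csq: "sqint c"
    by (rule sqint_bound[OF V(1)]) (use cle in \<open>auto simp: c_def[abs_def]\<close>)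
  have "(\<lambda>k. abs_l2 (X k) - abs_l2 c) \<longlonglongrightarrow> 0"
  proof (rule Lim_null_comparison)
    show "\<forall>\<^sub>F k in sequentially. norm (abs_l2 (X k) - abs_l2 c) \<le> norm (abs_l2 (\<psi> k) - abs_l2 V)"
    proof (intro always_eventually allI)
      fix k
      show "norm (abs_l2 (X k) - abs_l2 c) \<le> norm (abs_l2 (\<psi> k) - abs_l2 V)"
        unfolding abs_l2_diff[OF sq(3) csq] abs_l2_diff[OF sq(1) V(1)]
      proof (rule norm_abs_l2_mono[OF sqint_diff[OF sq(3) csq] sqint_diff[OF sq(1) V(1)]])
        show "norm (X k x - c x) \<le> norm (\<psi> k x - V x)" for x
          using soft_pos_lipschitz[of "\<psi> k x - w x" "V x - w x"] by (simp add: X_def c_def)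
      qed
    qed
    show "(\<lambda>k. norm (abs_l2 (\<psi> k) - abs_l2 V)) \<longlonglongrightarrow> 0" using \<psi>(2) by (simp add: tendsto_norm_zero LIM_zero)
  qed
  then have "(\<lambda>k. abs_l2 (X k)) \<longlonglongrightarrow> abs_l2 c" by (simp add: LIM_zero_iff)
  with X0 have "abs_l2 c = abs_l2 (\<lambda>x. 0)" using LIMSEQ_unique by (simp add: abs_l2_zero)
  then have "AE x in lborel. c x = 0" using abs_l2_eq_iff[OF csq sqint_zero] by simp
  then show ?thesis by eventually_elim (simp add: c_def w_def)
qed

section \<open>The strong maximum principle\<close>

text \<open>The family may be uncountable; Lindelof's theorem reduces the union to a countable one,
  for which the exceptional null sets can be joined.\<close>

lemma AE_on_Union_open:
  fixes F :: "'a::euclidean_space set set"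
  assumes "\<And>U. U \<in> F \<Longrightarrow> open U" "\<And>U. U \<in> F \<Longrightarrow> AE x in lborel. x \<in> U \<longrightarrow> P x"
  shows "AE x in lborel. x \<in> \<Union>F \<longrightarrow> P x"
proof -
  obtain F' where F': "F' \<subseteq> F" "countable F'" "\<Union>F' = \<Union>F" using Lindelof[of F] assms(1) by metis
  have "AE x in lborel. \<forall>U\<in>F'. x \<in> U \<longrightarrow> P x"
    by (rule AE_ball_countable[THEN iffD2, OF F'(2)]) (use F'(1) assms(2) in auto)
  then show ?thesis unfolding F'(3)[symmetric] by eventually_elim auto
qed

text \<open>The heat kernel multiplied by (2 pi)^(n/2). Written as a single exponential, it is
  positive for every \<tau> and can be compared with a level through exponents alone.\<close>

definition heat :: "real \<Rightarrow> 'a::euclidean_space \<Rightarrow> real" where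
  "heat \<tau> y = exp (- (real DIM('a) / 2) * ln (2 * \<tau>) - (norm y)\<^sup>2 / (4 * \<tau>))"

lemma heat_pos [simp]: "0 < heat \<tau> y" "0 \<le> heat \<tau> y"
  by (simp_all add: heat_def)

lemma heat_eq_gauss:
  fixes y :: "'a::euclidean_space"
  assumes "\<tau> > 0"
  shows "heat \<tau> y = gauss (y /\<^sub>R sqrt (2 * \<tau>)) / sqrt (2 * \<tau>) ^ DIM('a)"
proof -
  have s: "sqrt (2 * \<tau>) > 0" using assms by simp
  have "sqrt (2 * \<tau>) ^ DIM('a) = exp (real DIM('a) * ln (sqrt (2 * \<tau>)))"
    using s by (simp add: exp_of_nat_mult)
  also have "\<dots> = exp ((real DIM('a) / 2) * ln (2 * \<tau>))" using assms by (simp add: ln_sqrt)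
  finally have 1: "sqrt (2 * \<tau>) ^ DIM('a) = exp ((real DIM('a) / 2) * ln (2 * \<tau>))" .
  have "(norm (y /\<^sub>R sqrt (2 * \<tau>)))\<^sup>2 = (norm y)\<^sup>2 / (2 * \<tau>)"
    using assms by (simp add: power_mult_distrib power_inverse field_simps)
  then have 2: "gauss (y /\<^sub>R sqrt (2 * \<tau>)) = exp (- ((norm y)\<^sup>2 / (4 * \<tau>)))"
    by (simp add: gauss_def)
  show ?thesis unfolding 1 2 heat_def exp_diff[symmetric] by (simp add: algebra_simps)
qed

lemma heat_tau_deriv:
  fixes y :: "'a::euclidean_space"
  assumes "\<tau> > 0"
  shows "((\<lambda>\<tau>. heat \<tau> y) has_real_derivative (- real DIM('a) / (2 * \<tau>) + (norm y)\<^sup>2 / (4 * \<tau>\<^sup>2)) * heat \<tau> y) (at \<tau>)"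
  unfolding heat_def using assms
  by (auto intro!: derivative_eq_intros simp: power2_eq_square field_simps)

lemma heat_smooth: "smooth (\<lambda>y. heat \<tau> (y - x))"
proof -
  have eq: "(\<lambda>y. heat \<tau> (y - x)) = (\<lambda>y. exp ((- (real DIM('a) / 2) * ln (2 * \<tau>)) + (- 1 / (4 * \<tau>)) * (norm (y - x))\<^sup>2))" for x :: 'a
    by (simp add: heat_def)
  show ?thesis
    unfolding eq by (intro smooth_exp smooth_add smooth_mult smooth_const smooth_dist_square)
qed

lemma heat_partial_deriv:
  "partial_deriv b (\<lambda>y. heat \<tau> (y - x)) y = (- 1 / (2 * \<tau>)) * ((y - x) \<bullet> b) * heat \<tau> (y - x)"
proof -
  have "partial_deriv b (\<lambda>y. exp ((- (real DIM('a) / 2) * ln (2 * \<tau>)) + (- 1 / (4 * \<tau>)) * (norm (y - x))\<^sup>2)) y =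
     exp ((- (real DIM('a) / 2) * ln (2 * \<tau>)) + (- 1 / (4 * \<tau>)) * (norm (y - x))\<^sup>2) *
     partial_deriv b (\<lambda>y. (- (real DIM('a) / 2) * ln (2 * \<tau>)) + (- 1 / (4 * \<tau>)) * (norm (y - x))\<^sup>2) y" for x y b :: 'a
    by (rule partial_deriv_compose[OF smooth_differentiable[OF smooth_add[OF smooth_const
          smooth_mult[OF smooth_const smooth_dist_square]]] DERIV_exp])
  moreover have "partial_deriv b (\<lambda>y. (- (real DIM('a) / 2) * ln (2 * \<tau>)) + (- 1 / (4 * \<tau>)) * (norm (y - x))\<^sup>2) y
     = (- 1 / (4 * \<tau>)) * (2 * ((y - x) \<bullet> b))" for x y b :: 'a
    by (subst partial_deriv_add, (intro smooth_differentiable smooth_const smooth_mult smooth_dist_square)+,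
        subst partial_deriv_mult, (intro smooth_differentiable smooth_const smooth_dist_square)+)
      (simp add: partial_deriv_dist_square partial_deriv_eq[OF has_derivative_const])
  ultimately show ?thesis by (simp add: heat_def)
qed

lemma heat_partial_deriv2:
  "partial_deriv b (partial_deriv b (\<lambda>y. heat \<tau> (y - x))) y =
     (- (b \<bullet> b) / (2 * \<tau>) + ((y - x) \<bullet> b)\<^sup>2 / (4 * \<tau>\<^sup>2)) * heat \<tau> (y - x)"
proof -
  have eq: "partial_deriv b (\<lambda>y. heat \<tau> (y - x)) = (\<lambda>y. ((- 1 / (2 * \<tau>)) * ((y - x) \<bullet> b)) * heat \<tau> (y - x))"
    by (rule ext) (simp add: heat_partial_deriv)
  have d: "partial_deriv b (\<lambda>y. (- 1 / (2 * \<tau>)) * ((y - x) \<bullet> b)) y = (- 1 / (2 * \<tau>)) * (b \<bullet> b)"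
    by (subst partial_deriv_mult, (intro smooth_differentiable smooth_const smooth_inner)+)
      (simp add: partial_deriv_inner partial_deriv_eq[OF has_derivative_const])
  show ?thesis unfolding eq
    by (subst partial_deriv_mult, (intro smooth_differentiable smooth_mult smooth_const smooth_inner heat_smooth)+)
      (simp only: d heat_partial_deriv, simp add: power2_eq_square field_simps)
qed

text \<open>A compactly supported subsolution of \<open>\<partial>\<^sub>\<tau> k = \<Delta> k - t k\<close>, subject to the initial value
  \<open>\<delta>\<^sub>0\<close> up to a factor.\<close>

definition barrier :: "real \<Rightarrow> real \<Rightarrow> real \<Rightarrow> 'a::euclidean_space \<Rightarrow> real" where
  "barrier t c \<tau> y = exp (- (t * \<tau>)) * soft_pos (heat \<tau> y - c)"

lemma barrier_smooth: "smooth (\<lambda>y. barrier t c \<tau> (y - x))"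
  unfolding barrier_def by (intro smooth_mult smooth_const smooth_soft_pos smooth_diff heat_smooth)

text \<open>The first summand, with the second derivative of \<open>soft_pos\<close>, is what the
  Laplacian has in excess of the time derivative in \<open>barrier_tau_deriv\<close>. It is
  nonnegative because \<open>soft_pos\<close> is convex; this makes the truncated kernel a
  subsolution.\<close>

lemma barrier_laplacian:
  fixes x y :: "'a::euclidean_space"
  shows "laplacian (\<lambda>y. barrier t c \<tau> (y - x)) y = exp (- (t * \<tau>)) *
    (soft_pos'' (heat \<tau> (y - x) - c) * (\<Sum>b\<in>Basis. (partial_deriv b (\<lambda>y. heat \<tau> (y - x)) y)\<^sup>2)
     + soft_pos' (heat \<tau> (y - x) - c) * ((- real DIM('a) / (2 * \<tau>) + (norm (y - x))\<^sup>2 / (4 * \<tau>\<^sup>2)) * heat \<tau> (y - x)))"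
proof -
  define h where "h y = heat \<tau> (y - x)" for y
  have hs: "smooth h" unfolding h_def by (rule heat_smooth)
  have dh: "(\<lambda>y. h y - c) differentiable (at y)" for y by (intro smooth_differentiable smooth_diff hs smooth_const)
  have pc: "partial_deriv b (\<lambda>y. h y - c) y = partial_deriv b h y" for b y
    using partial_deriv_add[OF smooth_differentiable[OF hs] smooth_differentiable[OF smooth_const], of b "- c" y]
    by (simp add: partial_deriv_eq[OF has_derivative_const])
  have p1: "partial_deriv b (\<lambda>y. exp (- (t * \<tau>)) * soft_pos (h y - c)) = (\<lambda>y. exp (- (t * \<tau>)) * (soft_pos' (h y - c) * partial_deriv b h y))" for b
  proof
    fix y
    show "partial_deriv b (\<lambda>y. exp (- (t * \<tau>)) * soft_pos (h y - c)) y = exp (- (t * \<tau>)) * (soft_pos' (h y - c) * partial_deriv b h y)"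
      by (subst partial_deriv_mult, (intro smooth_differentiable smooth_const smooth_soft_pos smooth_diff hs)+)
        (simp add: partial_deriv_eq[OF has_derivative_const] partial_deriv_compose[OF dh soft_pos_deriv] pc)
  qed
  have s': "smooth (\<lambda>y. soft_pos' (h y - c))"
    unfolding soft_pos'_def by (intro smooth_flat_exp smooth_diff hs smooth_const)
  have p2: "partial_deriv b (partial_deriv b (\<lambda>y. exp (- (t * \<tau>)) * soft_pos (h y - c))) y =
      exp (- (t * \<tau>)) * (soft_pos'' (h y - c) * (partial_deriv b h y)\<^sup>2 + soft_pos' (h y - c) * partial_deriv b (partial_deriv b h) y)"
    if "b \<in> Basis" for b y
    unfolding p1
    by (subst partial_deriv_mult, (intro smooth_differentiable smooth_const smooth_mult s' smooth_partial_deriv hs that)+,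
        subst partial_deriv_mult, (intro smooth_differentiable s' smooth_partial_deriv hs that)+)
      (simp add: partial_deriv_eq[OF has_derivative_const] partial_deriv_compose[OF dh soft_pos'_deriv] pc power2_eq_square algebra_simps)
  have "(\<Sum>b\<in>Basis. partial_deriv b (partial_deriv b h) y) = (\<Sum>b\<in>Basis. (- 1 / (2 * \<tau>) + ((y - x) \<bullet> b)\<^sup>2 / (4 * \<tau>\<^sup>2)) * h y)"
    unfolding h_def by (intro sum.cong refl) (simp add: heat_partial_deriv2)
  also have "\<dots> = (- real DIM('a) / (2 * \<tau>) + (norm (y - x))\<^sup>2 / (4 * \<tau>\<^sup>2)) * h y"
    unfolding power2_norm_eq_inner[of "y - x"] euclidean_inner[of "y - x" "y - x"]
    by (simp add: sum_distrib_right[symmetric] sum_subtractf sum_divide_distrib power2_eq_square)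
  finally have lap: "(\<Sum>b\<in>Basis. partial_deriv b (partial_deriv b h) y) = (- real DIM('a) / (2 * \<tau>) + (norm (y - x))\<^sup>2 / (4 * \<tau>\<^sup>2)) * h y" .
  have "laplacian (\<lambda>y. exp (- (t * \<tau>)) * soft_pos (h y - c)) y =
    (\<Sum>b\<in>Basis. exp (- (t * \<tau>)) * (soft_pos'' (h y - c) * (partial_deriv b h y)\<^sup>2 + soft_pos' (h y - c) * partial_deriv b (partial_deriv b h) y))"
    unfolding laplacian_def by (intro sum.cong refl p2)
  also have "\<dots> = exp (- (t * \<tau>)) * (soft_pos'' (h y - c) * (\<Sum>b\<in>Basis. (partial_deriv b h y)\<^sup>2)
      + soft_pos' (h y - c) * (\<Sum>b\<in>Basis. partial_deriv b (partial_deriv b h) y))"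
    by (simp add: sum_distrib_left sum.distrib algebra_simps)
  finally show ?thesis unfolding lap by (simp add: barrier_def h_def[abs_def])
qed

lemma barrier_tau_deriv:
  fixes y :: "'a::euclidean_space"
  assumes "\<tau> > 0"
  shows "((\<lambda>\<tau>. barrier t c \<tau> y) has_real_derivative (- t * barrier t c \<tau> y + exp (- (t * \<tau>)) *
      (soft_pos' (heat \<tau> y - c) * ((- real DIM('a) / (2 * \<tau>) + (norm y)\<^sup>2 / (4 * \<tau>\<^sup>2)) * heat \<tau> y)))) (at \<tau>)"
proof -
  have s: "((\<lambda>\<tau>. soft_pos (heat \<tau> y - c)) has_real_derivative (soft_pos' (heat \<tau> y - c) * ((- real DIM('a) / (2 * \<tau>) + (norm y)\<^sup>2 / (4 * \<tau>\<^sup>2)) * heat \<tau> y))) (at \<tau>)"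
    by (rule DERIV_chain2[OF soft_pos_deriv]) (use heat_tau_deriv[OF assms, of y] in \<open>auto intro!: derivative_eq_intros\<close>)
  have e: "((\<lambda>\<tau>. exp (- (t * \<tau>))) has_real_derivative (- t * exp (- (t * \<tau>)))) (at \<tau>)"
    by (auto intro!: derivative_eq_intros)
  show ?thesis
    unfolding barrier_def by (rule DERIV_cong[OF DERIV_mult[OF e s]]) (simp only: mult_ac)
qed

text \<open>With this level the support of the barrier stays in the ball of radius \<open>r\<close> for all times and
  fills it at time \<open>r\<^sup>2 / (2 n)\<close>.\<close>

definition heat_level :: "'a::euclidean_space itself \<Rightarrow> real \<Rightarrow> real" where
  "heat_level _ r = exp (- (real DIM('a) / 2) * (1 + ln (r\<^sup>2 / real DIM('a))))"

text \<open>On the sphere of radius r the kernel is largest at time r^2 / (2 n), and the level is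
  its value there. The maximisation over time is the inequality ln x <= x - 1 at x = a / (2
  \<tau>).\<close>

lemma heat_le_level:
  fixes y :: "'a::euclidean_space"
  assumes r: "r > 0" and \<tau>: "\<tau> > 0" and y: "norm y \<ge> r"
  shows "heat \<tau> y \<le> heat_level TYPE('a) r"
proof -
  let ?n = "real DIM('a)"
  have n: "?n > 0" by simp
  define a where "a = r\<^sup>2 / ?n"
  have a: "a > 0" using r n by (simp add: a_def)
  have "ln (a / (2 * \<tau>)) \<le> a / (2 * \<tau>) - 1" using a \<tau> by (intro ln_le_minus_one) simp
  then have "ln a - ln (2 * \<tau>) \<le> a / (2 * \<tau>) - 1" using a \<tau> by (simp add: ln_div)
  then have "(?n / 2) * (ln a - ln (2 * \<tau>)) \<le> (?n / 2) * (a / (2 * \<tau>) - 1)" by (intro mult_left_mono) auto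
  also have "\<dots> = r\<^sup>2 / (4 * \<tau>) - ?n / 2" using n \<tau> by (simp add: a_def field_simps)
  finally have 1: "- (?n / 2) * ln (2 * \<tau>) - r\<^sup>2 / (4 * \<tau>) \<le> - (?n / 2) * (1 + ln a)" by (simp add: algebra_simps)
  have "r\<^sup>2 \<le> (norm y)\<^sup>2" using r y by (intro power_mono) auto
  then have "r\<^sup>2 / (4 * \<tau>) \<le> (norm y)\<^sup>2 / (4 * \<tau>)" using \<tau> by (intro divide_right_mono) auto
  with 1 show ?thesis unfolding heat_def heat_level_def a_def[symmetric] by simp
qed

lemma heat_gt_level:
  fixes y :: "'a::euclidean_space"
  assumes r: "r > 0" and y: "norm y < r"
  shows "heat_level TYPE('a) r < heat (r\<^sup>2 / (2 * real DIM('a))) y"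
proof -
  let ?n = "real DIM('a)"
  have n: "?n > 0" by simp
  have "(norm y)\<^sup>2 < r\<^sup>2" using y r by (intro power_strict_mono) auto
  then have "(norm y)\<^sup>2 / (4 * (r\<^sup>2 / (2 * ?n))) < ?n / 2" using r n by (simp add: field_simps)
  then show ?thesis unfolding heat_def heat_level_def by (simp add: algebra_simps)
qed

lemma barrier_nonneg: "0 \<le> barrier t c \<tau> y"
  by (simp add: barrier_def)

lemma barrier_le_heat: "t \<ge> 0 \<Longrightarrow> \<tau> \<ge> 0 \<Longrightarrow> c \<ge> 0 \<Longrightarrow> barrier t c \<tau> y \<le> heat \<tau> y"
proof -
  assume "t \<ge> 0" "\<tau> \<ge> 0" "c \<ge> 0"
  have "soft_pos (heat \<tau> y - c) \<le> heat \<tau> y"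
  proof (cases "heat \<tau> y \<le> c")
    case True
    then have "soft_pos (heat \<tau> y - c) = 0" by simp
    then show ?thesis by (simp only: heat_pos)
  next
    case False
    then have "soft_pos (heat \<tau> y - c) \<le> heat \<tau> y - c" by (intro soft_pos_le) simp
    then show ?thesis using \<open>c \<ge> 0\<close> by linarith
  qed
  moreover have "exp (- (t * \<tau>)) \<le> 1" using \<open>t \<ge> 0\<close> \<open>\<tau> \<ge> 0\<close> by simp
  ultimately have "exp (- (t * \<tau>)) * soft_pos (heat \<tau> y - c) \<le> 1 * heat \<tau> y"
    by (intro mult_mono) auto
  then show ?thesis by (simp add: barrier_def)
qed

lemma heat_le_max:
  fixes y :: "'a::euclidean_space"
  assumes "0 < a" "a \<le> \<tau>"
  shows "heat \<tau> y \<le> exp (- (real DIM('a) / 2) * ln (2 * a))"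
proof -
  have "(real DIM('a) / 2) * ln (2 * a) \<le> (real DIM('a) / 2) * ln (2 * \<tau>)"
    using assms by (intro mult_left_mono) auto
  moreover have "0 \<le> (norm y)\<^sup>2 / (4 * \<tau>)" using assms by simp
  ultimately show ?thesis unfolding heat_def exp_le_cancel_iff by linarith
qed

lemma barrier_measurable [measurable]: "barrier t c \<tau> \<in> borel_measurable borel"
  using smooth_borel_measurable[OF barrier_smooth[of t c \<tau> 0]] by simp

lemma heat_measurable [measurable]: "heat \<tau> \<in> borel_measurable borel"
  using smooth_borel_measurable[OF heat_smooth[of \<tau> 0]] by simp

section \<open>Nonnegative weak solutions of the homogeneous equation, averaged against the
  barrier\<close>

context
  fixes \<Omega> :: "'a::euclidean_space set" and t :: real and z :: "'a \<Rightarrow> real"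
  assumes t: "t > 0" and z[measurable]: "z \<in> borel_measurable borel" and z0: "\<And>x. 0 \<le> z x"
    and zi: "\<And>A. A \<in> sets borel \<Longrightarrow> bounded A \<Longrightarrow> set_integrable lborel A z"
    and eq: "\<And>X. X \<in> test_functions \<Omega> \<Longrightarrow> (\<integral>x. z x * (t * X x - laplacian X x) \<partial>lborel) = 0"
begin

lemma integrable_mult_bounded_support:
  assumes h: "h \<in> borel_measurable borel" "\<And>y. norm (h y) \<le> C" and A: "A \<in> sets borel" "bounded A" "\<And>y. y \<notin> A \<Longrightarrow> h y = 0"
  shows "integrable lborel (\<lambda>y. z y * h y)"
proof (rule Bochner_Integration.integrable_bound)
  show "integrable lborel (\<lambda>y. C * (indicator A y *\<^sub>R z y))"
    using zi[OF A(1,2)] unfolding set_integrable_def by (rule integrable_mult_right)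
  show "AE y in lborel. norm (z y * h y) \<le> norm (C * (indicator A y *\<^sub>R z y))"
  proof (rule AE_I2)
    fix y
    have "\<bar>h y\<bar> * z y \<le> \<bar>C\<bar> * z y" using h(2)[of y] z0[of y] by (intro mult_right_mono) auto
    then show "norm (z y * h y) \<le> norm (C * (indicator A y *\<^sub>R z y))"
      using A(3)[of y] z0[of y] by (cases "y \<in> A") (auto simp: abs_mult mult.commute)
  qed
qed (use h in measurable)

text \<open>The derivative of the average in \<tau> is the integral of z times the time derivative
  of the barrier. For a subsolution this is at most the integral of z times (\<Delta> - t) of the
  barrier, which the equation makes zero. The support stays in the ball of radius r, so the barrier
  is an admissible test function at every positive time.\<close>

lemma barrier_average_decreasing:
  fixes x :: 'a
  assumes r: "r > 0" and x: "cball x r \<subseteq> \<Omega>" and \<tau>: "0 < \<tau>1" "\<tau>1 \<le> \<tau>2"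
  shows "(\<integral>y. z y * barrier t (heat_level TYPE('a) r) \<tau>2 (y - x) \<partial>lborel) \<le> (\<integral>y. z y * barrier t (heat_level TYPE('a) r) \<tau>1 (y - x) \<partial>lborel)"
proof -
  define c where "c = heat_level TYPE('a) r"
  have c0: "c \<ge> 0" by (simp add: c_def heat_level_def)
  define B where "B \<tau> y = barrier t c \<tau> (y - x)" for \<tau> y
  define D where "D \<tau> y = exp (- (t * \<tau>)) * (soft_pos' (heat \<tau> (y - x) - c) * ((- real DIM('a) / (2 * \<tau>) + (norm (y - x))\<^sup>2 / (4 * \<tau>\<^sup>2)) * heat \<tau> (y - x)))" for \<tau> y
  have [measurable]: "B \<tau> \<in> borel_measurable borel" "D \<tau> \<in> borel_measurable borel" for \<tau>
    unfolding B_def D_def by measurable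
  have small: "heat \<tau> (y - x) - c \<le> 0" if "y \<notin> cball x r" "\<tau> > 0" for y \<tau>
    using heat_le_level[OF r that(2), of "y - x"] that(1) by (simp add: c_def dist_norm norm_minus_commute)
  have B0: "B \<tau> y = 0" and D0: "D \<tau> y = 0" if "y \<notin> cball x r" "\<tau> > 0" for y \<tau>
    using small[OF that] by (auto simp: B_def D_def barrier_def soft_pos'_def flat_exp_def)
  have BT: "B \<tau> \<in> test_functions \<Omega>" if "\<tau> > 0" for \<tau>
    by (rule test_functionI[of _ "cball x r"]) (use x B0 that in \<open>auto simp: B_def[abs_def] intro!: barrier_smooth\<close>)
  have "\<exists>b'. ((\<lambda>\<tau>. \<integral>y. z y * B \<tau> y \<partial>lborel) has_real_derivative b') (at \<tau>) \<and> b' \<le> 0" if \<tau>: "\<tau> > 0" for \<tau>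
  proof -
    \<comment> \<open>Differentiation takes place on the interval from \<tau>/2 to 2 \<tau>; staying
      away from time 0 gives uniform bounds for the kernel and for its time derivative.\<close>
    define a where "a = \<tau> / 2"
    have a: "a > 0" "a < \<tau>" using \<tau> by (auto simp: a_def)
    define P where "P = exp (- (real DIM('a) / 2) * ln (2 * a))"
    have P: "0 \<le> P" "\<And>s y. s \<in> {a<..<2*\<tau>} \<Longrightarrow> heat s (y::'a) \<le> P"
      unfolding P_def using heat_le_max[OF a(1), where ?'a='a] by (simp, simp only: greaterThanLessThan_iff less_imp_le)
    define L where "L = real DIM('a) / (2 * a) + r\<^sup>2 / (4 * a\<^sup>2)"
    have L0: "L \<ge> 0" using a by (simp add: L_def)
    have Bb: "\<bar>B s y\<bar> \<le> P" if s: "s \<in> {a<..<2*\<tau>}" for s y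
      using barrier_le_heat[of t s c "y - x"] P(2)[OF s, of "y - x"] barrier_nonneg[of t c s "y - x"] t s a c0 by (auto simp: B_def)
    have Db: "\<bar>D s y\<bar> \<le> L * P" if s: "s \<in> {a<..<2*\<tau>}" for s y
    proof (cases "y \<in> cball x r")
      case True
      have s0: "s > 0" "a \<le> s" using s a by auto
      have "\<bar>- real DIM('a) / (2 * s) + (norm (y - x))\<^sup>2 / (4 * s\<^sup>2)\<bar> \<le> real DIM('a) / (2 * s) + (norm (y - x))\<^sup>2 / (4 * s\<^sup>2)"
        using s0 by (intro order_trans[OF abs_triangle_ineq]) auto
      also have "\<dots> \<le> L"
        unfolding L_def using s0 a True by (intro add_mono frac_le power_mono mult_left_mono) (auto simp: dist_norm norm_minus_commute)
      finally have 1: "\<bar>- real DIM('a) / (2 * s) + (norm (y - x))\<^sup>2 / (4 * s\<^sup>2)\<bar> \<le> L" .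
      have 2: "\<bar>exp (- (t * s))\<bar> \<le> 1" using t s0 by simp
      have 3: "\<bar>soft_pos' (heat s (y - x) - c)\<bar> \<le> 1" using soft_pos'_bounds by auto
      have 4: "\<bar>heat s (y - x)\<bar> \<le> P" using P(2)[OF s] by simp
      have "\<bar>D s y\<bar> \<le> 1 * (1 * (L * P))"
        unfolding D_def abs_mult by (intro mult_mono 1 2 3 4) (auto simp: L0)
      then show ?thesis by simp
    next
      case False
      then show ?thesis using D0[OF False] s a L0 P by simp
    qed
    have der: "((\<lambda>s. B s y) has_real_derivative (- t * B s y + D s y)) (at s)" if "s > 0" for s y
      unfolding B_def D_def by (rule barrier_tau_deriv[OF that])
    have "((\<lambda>s. \<integral>y. z y * B s y \<partial>lborel) has_derivative (\<lambda>h. (\<integral>y. z y * (- t * B \<tau> y + D \<tau> y) \<partial>lborel) \<bullet> h)) (at \<tau>)"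
    proof (rule has_derivative_integral[where U="{a<..<2*\<tau>}" and f'="\<lambda>s y. z y * (- t * B s y + D s y)" and g="\<lambda>y. (t * P + L * P) * (indicator (cball x r) y *\<^sub>R z y)"])
      fix s y assume s: "s \<in> {a<..<2*\<tau>}"
      then have s0: "s > 0" using a by auto
      show "((\<lambda>s. z y * B s y) has_derivative (\<lambda>h. (z y * (- t * B s y + D s y)) \<bullet> h)) (at s)"
        using DERIV_cmult[OF der[OF s0], of "z y"] by (simp add: has_field_derivative_def)
      show "norm (z y * (- t * B s y + D s y)) \<le> (t * P + L * P) * (indicator (cball x r) y *\<^sub>R z y)"
      proof (cases "y \<in> cball x r")
        case True
        have "\<bar>- t * B s y + D s y\<bar> \<le> \<bar>- t * B s y\<bar> + \<bar>D s y\<bar>" by (rule abs_triangle_ineq)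
        also have "\<dots> \<le> t * P + L * P" using Bb[OF s] Db[OF s] t by (intro add_mono) (auto simp: abs_mult)
        finally have "\<bar>- t * B s y + D s y\<bar> * z y \<le> (t * P + L * P) * z y" using z0 by (intro mult_right_mono)
        then show ?thesis using True z0[of y] by (simp add: abs_mult mult.commute)
      qed (use B0 D0 s0 in simp)
    next
      show "integrable lborel (\<lambda>y. (t * P + L * P) * (indicator (cball x r) y *\<^sub>R z y))"
        using zi[of "cball x r"] unfolding set_integrable_def by (intro integrable_mult_right) auto
      show "integrable lborel (\<lambda>y. z y * B s y)" if s: "s \<in> {a<..<2*\<tau>}" for s
        by (rule integrable_mult_bounded_support[of _ P "cball x r"]) (use Bb[OF s] B0 s a in auto)
    qed (use a \<tau> in auto)
    then have hd: "((\<lambda>s. \<integral>y. z y * B s y \<partial>lborel) has_real_derivative (\<integral>y. z y * (- t * B \<tau> y + D \<tau> y) \<partial>lborel)) (at \<tau>)"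
      by (simp add: has_field_derivative_def mult_commute_abs)
    \<comment> \<open>Convexity of \<open>soft_pos\<close> bounds \<open>D \<tau>\<close> by the
      Laplacian of \<open>B \<tau>\<close>; the integral on the right is then zero by the equation,
      tested with \<open>B \<tau>\<close>.\<close>
    have "(\<integral>y. z y * (- t * B \<tau> y + D \<tau> y) \<partial>lborel) \<le> - (\<integral>y. z y * (t * B \<tau> y - laplacian (B \<tau>) y) \<partial>lborel)"
      unfolding Bochner_Integration.integral_minus[symmetric]
    proof (rule integral_mono)
      have \<tau>m: "\<tau> \<in> {a<..<2*\<tau>}" using a \<tau> by simp
      show "integrable lborel (\<lambda>y. z y * (- t * B \<tau> y + D \<tau> y))"
      proof (rule integrable_mult_bounded_support[of _ "t * P + L * P" "cball x r"])
        fix y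
        have "\<bar>- t * B \<tau> y + D \<tau> y\<bar> \<le> \<bar>- t * B \<tau> y\<bar> + \<bar>D \<tau> y\<bar>" by (rule abs_triangle_ineq)
        also have "\<dots> \<le> t * P + L * P" using Bb[OF \<tau>m] Db[OF \<tau>m] t by (intro add_mono) (auto simp: abs_mult)
        finally show "norm (- t * B \<tau> y + D \<tau> y) \<le> t * P + L * P" by simp
      qed (use B0 D0 \<tau> in auto)
      have hT: "(\<lambda>y. t * B \<tau> y - laplacian (B \<tau>) y) \<in> test_functions \<Omega>"
        by (intro test_function_diff test_function_scale test_function_laplacian BT \<tau>)
      obtain K where K: "compact K" "K \<subseteq> \<Omega>" "\<And>y. y \<notin> K \<Longrightarrow> t * B \<tau> y - laplacian (B \<tau>) y = 0"
        using test_functionE[OF hT] by metis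
      obtain C where C: "\<And>y. \<bar>t * B \<tau> y - laplacian (B \<tau>) y\<bar> \<le> C" using test_function_bounded[OF hT] by metis
      have "integrable lborel (\<lambda>y. z y * (t * B \<tau> y - laplacian (B \<tau>) y))"
        by (rule integrable_mult_bounded_support[of _ C K])
          (use C K test_function_measurable[OF hT] in \<open>auto intro: borel_closed compact_imp_closed compact_imp_bounded\<close>)
      then show "integrable lborel (\<lambda>y. - (z y * (t * B \<tau> y - laplacian (B \<tau>) y)))" by simp
      fix y
      have "0 \<le> exp (- (t * \<tau>)) * (soft_pos'' (heat \<tau> (y - x) - c) * (\<Sum>b\<in>Basis. (partial_deriv b (\<lambda>y. heat \<tau> (y - x)) y)\<^sup>2))"
        by (intro mult_nonneg_nonneg soft_pos''_nonneg sum_nonneg) auto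
      then have "D \<tau> y \<le> laplacian (B \<tau>) y"
        unfolding B_def[abs_def] D_def barrier_laplacian distrib_left by linarith
      then have "z y * (- t * B \<tau> y + D \<tau> y) \<le> z y * (- (t * B \<tau> y - laplacian (B \<tau>) y))"
        using z0 by (intro mult_left_mono) auto
      then show "z y * (- t * B \<tau> y + D \<tau> y) \<le> - (z y * (t * B \<tau> y - laplacian (B \<tau>) y))"
        by (simp only: mult_minus_right)
    qed
    then show ?thesis using hd eq[OF BT[OF \<tau>]] by auto
  qed
  then have "(\<integral>y. z y * B \<tau>2 y \<partial>lborel) \<le> (\<integral>y. z y * B \<tau>1 y \<partial>lborel)"
    using \<tau> by (intro DERIV_nonpos_imp_nonincreasing[of \<tau>1 \<tau>2]) auto
  then show ?thesis unfolding B_def c_def .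
qed

text \<open>The average at the time when the barrier fills its ball is at most the average at any
  smaller time, hence at most the heat average, which concentrates at x as the time tends to 0. As z
  is determined only up to null sets, the limit is taken after integration against nonnegative test
  functions f, and positivity of the resulting distribution gives the bound almost everywhere. The
  factor is the total mass of the unnormalised kernel.\<close>

lemma barrier_average_le:
  fixes y0 :: 'a
  assumes r: "r > 0" and y0: "cball y0 (2 * r) \<subseteq> \<Omega>"
  shows "AE x in lborel. x \<in> ball y0 r \<longrightarrow>
    (\<integral>y. z y * barrier t (heat_level TYPE('a) r) (r\<^sup>2 / (2 * real DIM('a))) (y - x) \<partial>lborel) \<le> (2 * pi) powr (real DIM('a) / 2) * z x"
proof -
  define c where "c = heat_level TYPE('a) r"
  have c0: "c \<ge> 0" by (simp add: c_def heat_level_def)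
  define \<tau>0 where "\<tau>0 = r\<^sup>2 / (2 * real DIM('a))"
  have \<tau>0: "\<tau>0 > 0" using r by (simp add: \<tau>0_def)
  define G where "G = (2 * pi) powr (real DIM('a) / 2)"
  define A where "A = cball y0 (2 * r)"
  have A[measurable]: "A \<in> sets borel" and bA: "bounded A" by (auto simp: A_def)
  \<comment> \<open>Cutting z off to the ball of radius 2 r makes the heat averages converge, and
    does not change the barrier averages centred in the ball of radius r around
    \<open>y0\<close>.\<close>
  define zA where "zA y = indicator A y * z y" for y
  have [measurable]: "zA \<in> borel_measurable borel" unfolding zA_def by measurable
  have zAi: "integrable lborel zA" using zi[OF A bA] by (simp add: set_integrable_def zA_def[abs_def])
  have zA0: "0 \<le> zA y" for y using z0 by (simp add: zA_def)
  define b where "b \<tau> x = (\<integral>y. zA y * barrier t c \<tau> (y - x) \<partial>lborel)" for \<tau> x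
  have [measurable]: "b \<tau> \<in> borel_measurable borel" for \<tau> unfolding b_def by measurable
  have b_eq: "b \<tau> x = (\<integral>y. z y * barrier t c \<tau> (y - x) \<partial>lborel)" if x: "x \<in> ball y0 r" and \<tau>: "\<tau> > 0" for \<tau> x
    unfolding b_def
  proof (intro Bochner_Integration.integral_cong refl)
    fix y
    show "zA y * barrier t c \<tau> (y - x) = z y * barrier t c \<tau> (y - x)"
    proof (cases "y \<in> A")
      case False
      have "dist y0 y \<le> dist y0 x + dist x y" by (rule dist_triangle)
      then have "norm (y - x) \<ge> r" using False x by (simp add: A_def dist_norm norm_minus_commute)
      from heat_le_level[OF r \<tau> this] show ?thesis by (simp add: barrier_def c_def)
    qed (simp add: zA_def)
  qed
  define P where "P = exp (- (real DIM('a) / 2) * ln (2 * \<tau>0))"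
  have bb: "\<bar>b \<tau>0 x\<bar> \<le> P * (\<integral>y. zA y \<partial>lborel)" for x
  proof -
    have k: "barrier t c \<tau>0 (y - x) \<le> P" for y
      using barrier_le_heat[of t \<tau>0 c "y - x"] heat_le_max[OF \<tau>0 order_refl, of "y - x"] t \<tau>0 c0 by (simp add: P_def)
    have "norm (\<integral>y. zA y * barrier t c \<tau>0 (y - x) \<partial>lborel) \<le> (\<integral>y. zA y * P \<partial>lborel)"
    proof (rule Bochner_Integration.integral_norm_bound_integral)
      show "integrable lborel (\<lambda>y. zA y * P)" using zAi by (rule integrable_mult_left)
      show "norm (zA y * barrier t c \<tau>0 (y - x)) \<le> zA y * P" for y
        using k[of y] zA0[of y] barrier_nonneg[of t c \<tau>0 "y - x"] by (simp add: abs_mult mult_left_mono)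
      then show "integrable lborel (\<lambda>y. zA y * barrier t c \<tau>0 (y - x))"
        by (intro Bochner_Integration.integrable_bound[OF \<open>integrable lborel (\<lambda>y. zA y * P)\<close>] AE_I2)
          (auto intro: order_trans[OF _ abs_ge_self])
    qed
    then show ?thesis by (simp add: b_def mult.commute)
  qed
  have "AE x in lborel. x \<in> ball y0 r \<longrightarrow> 0 \<le> G * z x - b \<tau>0 x"
  proof (rule positive_distribution_AE_nonneg)
    have fin: "emeasure lborel (ball y0 r) < \<infinity>" by (rule emeasure_bounded_finite) simp
    have "set_integrable lborel (ball y0 r) (b \<tau>0)"
      unfolding set_integrable_def
    proof (rule Bochner_Integration.integrable_bound)
      show "integrable lborel (\<lambda>x. (P * (\<integral>y. zA y \<partial>lborel)) * indicator (ball y0 r) x)"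
        using fin by (intro integrable_mult_right) simp
      show "AE x in lborel. norm (indicator (ball y0 r) x *\<^sub>R b \<tau>0 x) \<le> norm ((P * (\<integral>y. zA y \<partial>lborel)) * indicator (ball y0 r) x)"
        using bb by (intro AE_I2) (auto simp: indicator_def intro: order_trans[OF _ abs_ge_self])
      have [measurable]: "ball y0 r \<in> sets borel" by simp
      show "(\<lambda>x. indicator (ball y0 r) x *\<^sub>R b \<tau>0 x) \<in> borel_measurable lborel" by measurable
    qed
    then show "set_integrable lborel (ball y0 r) (\<lambda>x. G * z x - b \<tau>0 x)"
      using zi[of "ball y0 r"] by (intro set_integral_diff set_integrable_mult_right) auto
    fix f :: "'a \<Rightarrow> real" assume f: "f \<in> test_functions (ball y0 r)" and f0: "\<And>x. 0 \<le> f x"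
    have [measurable]: "f \<in> borel_measurable borel" using test_function_measurable[OF f] .
    have fi: "integrable lborel f" using test_function_integrable[OF f] .
    obtain C where C: "\<And>x. \<bar>f x\<bar> \<le> C" using test_function_bounded[OF f] by metis
    have heat_conv: "(\<integral>x. f x * heat \<tau> (y - x) \<partial>lborel) = (\<integral>\<zeta>. f (y - sqrt (2 * \<tau>) *\<^sub>R \<zeta>) * gauss \<zeta> \<partial>lborel)" if "\<tau> > 0" for \<tau> y
      using gauss_convolution_scaled[of f "sqrt (2 * \<tau>)" y] that by (simp add: heat_eq_gauss)
    \<comment> \<open>Inside the ball: monotonicity in time, then the barrier is bounded by the heat
      kernel. Fubini moves the kernel from z to f, where its concentration is pointwise convergence
      of a continuous function.\<close>
    have step: "(\<integral>x. f x * b \<tau>0 x \<partial>lborel) \<le> (\<integral>y. zA y * (\<integral>\<zeta>. f (y - sqrt (2 * \<tau>) *\<^sub>R \<zeta>) * gauss \<zeta> \<partial>lborel) \<partial>lborel)" if \<tau>: "0 < \<tau>" "\<tau> \<le> \<tau>0" for \<tau>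
    proof -
      define Q where "Q = exp (- (real DIM('a) / 2) * ln (2 * \<tau>))"
      have Q: "heat \<tau> (y::'a) \<le> Q" for y unfolding Q_def by (rule heat_le_max[OF \<tau>(1) order_refl])
      have Q0: "0 \<le> Q" by (simp add: Q_def)
      have F: "integrable (lborel \<Otimes>\<^sub>M lborel) (\<lambda>(x, y). f x * (zA y * heat \<tau> (y - x)))"
        and swap: "(\<integral>y. (\<integral>x. f x * (zA y * heat \<tau> (y - x)) \<partial>lborel) \<partial>lborel) = (\<integral>x. (\<integral>y. f x * (zA y * heat \<tau> (y - x)) \<partial>lborel) \<partial>lborel)"
      proof -
        have m: "(\<lambda>(x, y). f x * (zA y * heat \<tau> (y - x))) \<in> borel_measurable (lborel \<Otimes>\<^sub>M lborel)" by measurable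
        have bd: "norm (f x * (zA y * heat \<tau> (y - x))) \<le> f x * (zA y * Q)" for x y
          using f0[of x] zA0[of y] Q[of "y - x"] by (simp add: abs_mult mult_left_mono)
        show "integrable (lborel \<Otimes>\<^sub>M lborel) (\<lambda>(x, y). f x * (zA y * heat \<tau> (y - x)))"
          by (rule Fubini_dominated(1)[OF lborel.sigma_finite_measure_axioms lborel.sigma_finite_measure_axioms m fi integrable_mult_left[OF zAi, of Q] bd])
        show "(\<integral>y. (\<integral>x. f x * (zA y * heat \<tau> (y - x)) \<partial>lborel) \<partial>lborel) = (\<integral>x. (\<integral>y. f x * (zA y * heat \<tau> (y - x)) \<partial>lborel) \<partial>lborel)"
          by (rule Fubini_dominated(2)[OF lborel.sigma_finite_measure_axioms lborel.sigma_finite_measure_axioms m fi integrable_mult_left[OF zAi, of Q] bd])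
      qed
      have "(\<integral>x. f x * b \<tau>0 x \<partial>lborel) \<le> (\<integral>x. (\<integral>y. f x * (zA y * heat \<tau> (y - x)) \<partial>lborel) \<partial>lborel)"
      proof (rule integral_mono)
        show "integrable lborel (\<lambda>x. f x * b \<tau>0 x)"
        proof (rule Bochner_Integration.integrable_bound[OF integrable_mult_right[OF fi, of "P * (\<integral>y. zA y \<partial>lborel)"]])
          show "AE x in lborel. norm (f x * b \<tau>0 x) \<le> norm (P * (\<integral>y. zA y \<partial>lborel) * f x)"
          proof (rule AE_I2)
            fix x
            have "\<bar>b \<tau>0 x\<bar> * \<bar>f x\<bar> \<le> \<bar>P * (\<integral>y. zA y \<partial>lborel)\<bar> * \<bar>f x\<bar>"
              using bb[of x] by (intro mult_right_mono) auto
            then show "norm (f x * b \<tau>0 x) \<le> norm (P * (\<integral>y. zA y \<partial>lborel) * f x)"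
              by (simp only: real_norm_def abs_mult mult.commute)
          qed
        qed measurable
        show "integrable lborel (\<lambda>x. \<integral>y. f x * (zA y * heat \<tau> (y - x)) \<partial>lborel)"
          using lborel_pair.integrable_fst'[OF F] by simp
        fix x
        show "f x * b \<tau>0 x \<le> (\<integral>y. f x * (zA y * heat \<tau> (y - x)) \<partial>lborel)"
        proof (cases "x \<in> ball y0 r")
          case True
          have cx: "cball x r \<subseteq> \<Omega>"
          proof
            fix y assume "y \<in> cball x r"
            then have "dist y0 y \<le> 2 * r" using True dist_triangle[of y0 y x] by simp
            then show "y \<in> \<Omega>" using y0 by auto
          qed
          have "b \<tau>0 x \<le> b \<tau> x"
            unfolding b_eq[OF True \<tau>0] b_eq[OF True \<tau>(1)] c_def by (rule barrier_average_decreasing[OF r cx \<tau>])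
          also have "b \<tau> x \<le> (\<integral>y. zA y * heat \<tau> (y - x) \<partial>lborel)"
            unfolding b_def
          proof (rule integral_mono)
            show ih: "integrable lborel (\<lambda>y. zA y * heat \<tau> (y - x))"
              by (rule Bochner_Integration.integrable_bound[OF integrable_mult_left[OF zAi, of Q]])
                (use Q zA0 Q0 in \<open>auto intro!: AE_I2 simp: abs_mult mult_left_mono\<close>)
            show le: "zA y * barrier t c \<tau> (y - x) \<le> zA y * heat \<tau> (y - x)" for y
              using barrier_le_heat[of t \<tau> c "y - x"] t \<tau> c0 zA0 by (intro mult_left_mono) auto
            show "integrable lborel (\<lambda>y. zA y * barrier t c \<tau> (y - x))"
              by (rule Bochner_Integration.integrable_bound[OF ih]) (use le zA0 in \<open>auto intro!: AE_I2 simp: abs_mult barrier_nonneg\<close>)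
          qed
          finally show ?thesis using f0[of x] by (simp add: mult_left_mono)
        next
          case False
          then show ?thesis using test_function_outside[OF f] by simp
        qed
      qed
      also have "\<dots> = (\<integral>y. (\<integral>x. zA y * (f x * heat \<tau> (y - x)) \<partial>lborel) \<partial>lborel)"
        unfolding swap[symmetric] by (simp add: mult.left_commute)
      also have "\<dots> = (\<integral>y. zA y * (\<integral>\<zeta>. f (y - sqrt (2 * \<tau>) *\<^sub>R \<zeta>) * gauss \<zeta> \<partial>lborel) \<partial>lborel)"
        using heat_conv[OF \<tau>(1)] by simp
      finally show ?thesis .
    qed
    define \<epsilon> where "\<epsilon> k = \<tau>0 / real (Suc k)" for k
    have \<epsilon>: "0 < \<epsilon> k" "\<epsilon> k \<le> \<tau>0" for k using \<tau>0 by (auto simp: \<epsilon>_def divide_le_eq)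
    have "\<epsilon> \<longlonglongrightarrow> 0" unfolding \<epsilon>_def[abs_def] by (rule LIMSEQ_Suc[OF lim_const_over_n])
    then have "(\<lambda>k. sqrt (2 * \<epsilon> k)) \<longlonglongrightarrow> sqrt (2 * 0)" by (intro tendsto_intros)
    then have s0: "(\<lambda>k. sqrt (2 * \<epsilon> k)) \<longlonglongrightarrow> 0" by simp
    have "(\<lambda>k. \<integral>y. zA y * (\<integral>\<zeta>. f (y - sqrt (2 * \<epsilon> k) *\<^sub>R \<zeta>) * gauss \<zeta> \<partial>lborel) \<partial>lborel) \<longlonglongrightarrow> (\<integral>y. zA y * (f y * G) \<partial>lborel)"
    proof (rule integral_dominated_convergence[where w="\<lambda>y. zA y * (C * G)"])
      show "integrable lborel (\<lambda>y. zA y * (C * G))" using zAi by (rule integrable_mult_left)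
      show "AE y in lborel. (\<lambda>k. zA y * (\<integral>\<zeta>. f (y - sqrt (2 * \<epsilon> k) *\<^sub>R \<zeta>) * gauss \<zeta> \<partial>lborel)) \<longlonglongrightarrow> zA y * (f y * G)"
        unfolding G_def by (intro AE_I2 tendsto_intros gauss_average_tendsto[OF test_function_continuous[OF f] C s0])
      show "AE y in lborel. norm (zA y * (\<integral>\<zeta>. f (y - sqrt (2 * \<epsilon> k) *\<^sub>R \<zeta>) * gauss \<zeta> \<partial>lborel)) \<le> zA y * (C * G)" for k
      proof (rule AE_I2)
        fix y
        have ig: "integrable lborel (\<lambda>\<zeta>::'a. C * gauss \<zeta>)" by (intro integrable_mult_right gauss_integral)
        have le: "norm (f (y - sqrt (2 * \<epsilon> k) *\<^sub>R \<zeta>) * gauss \<zeta>) \<le> C * gauss \<zeta>" for \<zeta>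
          using C by (auto simp: abs_mult intro!: mult_right_mono)
        have "norm (\<integral>\<zeta>. f (y - sqrt (2 * \<epsilon> k) *\<^sub>R \<zeta>) * gauss \<zeta> \<partial>lborel) \<le> (\<integral>\<zeta>. C * gauss (\<zeta>::'a) \<partial>lborel)"
          by (rule Bochner_Integration.integral_norm_bound_integral[OF Bochner_Integration.integrable_bound[OF ig] ig le])
            (use le in \<open>auto intro!: AE_I2 intro: order_trans[OF _ abs_ge_self]\<close>)
        also have "\<dots> = C * G" by (simp add: gauss_integral G_def)
        finally show "norm (zA y * (\<integral>\<zeta>. f (y - sqrt (2 * \<epsilon> k) *\<^sub>R \<zeta>) * gauss \<zeta> \<partial>lborel)) \<le> zA y * (C * G)"
          using zA0[of y] by (simp add: abs_mult mult_left_mono)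
      qed
    qed measurable
    then have "(\<integral>x. f x * b \<tau>0 x \<partial>lborel) \<le> (\<integral>y. zA y * (f y * G) \<partial>lborel)"
      by (rule LIMSEQ_le_const) (use step \<epsilon> in auto)
    also have "\<dots> = (\<integral>y. (G * z y) * f y \<partial>lborel)"
    proof (intro Bochner_Integration.integral_cong refl)
      fix y
      have "ball y0 r \<subseteq> A" using r by (auto simp: A_def)
      then show "zA y * (f y * G) = G * z y * f y"
        using test_function_outside[OF f, of y] by (cases "y \<in> ball y0 r") (auto simp: zA_def)
    qed
    finally have le: "(\<integral>x. f x * b \<tau>0 x \<partial>lborel) \<le> (\<integral>y. (G * z y) * f y \<partial>lborel)" .
    have i1: "integrable lborel (\<lambda>y. (G * z y) * f y)"
    proof -
      have "integrable lborel (\<lambda>y. z y * (G * f y))"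
        by (rule integrable_mult_bounded_support[of _ "\<bar>G\<bar> * C" "ball y0 r"])
          (use C test_function_outside[OF f] in \<open>auto simp: abs_mult mult_left_mono\<close>)
      then show ?thesis by (simp add: mult_ac)
    qed
    have i2: "integrable lborel (\<lambda>x. b \<tau>0 x * f x)"
    proof (rule Bochner_Integration.integrable_bound[OF integrable_mult_right[OF fi, of "P * (\<integral>y. zA y \<partial>lborel)"]])
      show "AE x in lborel. norm (b \<tau>0 x * f x) \<le> norm (P * (\<integral>y. zA y \<partial>lborel) * f x)"
      proof (rule AE_I2)
        fix x
        have "\<bar>b \<tau>0 x\<bar> * \<bar>f x\<bar> \<le> \<bar>P * (\<integral>y. zA y \<partial>lborel)\<bar> * \<bar>f x\<bar>"
          using bb[of x] by (intro mult_right_mono) auto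
        then show "norm (b \<tau>0 x * f x) \<le> norm (P * (\<integral>y. zA y \<partial>lborel) * f x)"
          by (simp only: real_norm_def abs_mult)
      qed
    qed measurable
    show "0 \<le> (\<integral>x. (G * z x - b \<tau>0 x) * f x \<partial>lborel)"
    proof -
      have "(\<integral>x. (G * z x - b \<tau>0 x) * f x \<partial>lborel) = (\<integral>x. (G * z x) * f x \<partial>lborel) - (\<integral>x. b \<tau>0 x * f x \<partial>lborel)"
        unfolding left_diff_distrib by (rule Bochner_Integration.integral_diff[OF i1 i2])
      then show ?thesis using le by (simp add: mult.commute)
    qed
  qed auto
  then show ?thesis
  proof eventually_elim
    case (elim x)
    show ?case
    proof
      assume x: "x \<in> ball y0 r"
      then show "(\<integral>y. z y * barrier t (heat_level TYPE('a) r) (r\<^sup>2 / (2 * real DIM('a))) (y - x) \<partial>lborel) \<le> (2 * pi) powr (real DIM('a) / 2) * z x"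
        using elim b_eq[OF x \<tau>0] by (simp add: G_def c_def \<tau>0_def)
    qed
  qed
qed

text \<open>If z vanishes at a single point x of \<open>N\<close> outside the exceptional null set,
  its average against a barrier centred at x vanishes. The barrier is positive on the whole ball of
  radius r around x, which contains \<open>N\<close>, so z is zero almost everywhere on
  \<open>N\<close>.\<close>

lemma locally_positive_or_zero:
  assumes "open \<Omega>" "y0 \<in> \<Omega>"
  shows "\<exists>N. open N \<and> y0 \<in> N \<and> N \<subseteq> \<Omega> \<and>
    ((AE x in lborel. x \<in> N \<longrightarrow> 0 < z x) \<or> (AE x in lborel. x \<in> N \<longrightarrow> z x = 0))"
proof -
  obtain e where e: "e > 0" "cball y0 e \<subseteq> \<Omega>" using assms open_contains_cball by blast
  define r where "r = e / 2"
  have r: "r > 0" "cball y0 (2 * r) \<subseteq> \<Omega>" using e by (auto simp: r_def)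
  \<comment> \<open>Half the radius: two points of \<open>N\<close> are then less than r apart, so
    one neighbourhood serves all centres x.\<close>
  define N where "N = ball y0 (r / 2)"
  define k where "k x y = barrier t (heat_level TYPE('a) r) (r\<^sup>2 / (2 * real DIM('a))) (y - x)" for x y :: 'a
  have "(AE x in lborel. x \<in> N \<longrightarrow> 0 < z x) \<or> (AE x in lborel. x \<in> N \<longrightarrow> z x = 0)"
  proof (rule disjCI)
    assume nz: "\<not> (AE x in lborel. x \<in> N \<longrightarrow> z x = 0)"
    show "AE x in lborel. x \<in> N \<longrightarrow> 0 < z x"
      using barrier_average_le[OF r]
    proof eventually_elim
      case (elim x)
      show ?case
      proof
        assume xN: "x \<in> N"
        then have xb: "x \<in> ball y0 r" using r by (auto simp: N_def)
        then have cx: "cball x r \<subseteq> \<Omega>"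
        proof -
          have "y \<in> \<Omega>" if "y \<in> cball x r" for y
            using that xb dist_triangle[of y0 y x] r(2) by (intro subsetD[OF r(2)]) auto
          then show ?thesis by blast
        qed
        show "0 < z x"
        proof (rule ccontr)
          assume "\<not> 0 < z x"
          then have "z x = 0" using z0[of x] by simp
          then have le: "(\<integral>y. z y * k x y \<partial>lborel) \<le> 0" using elim xb by (simp add: k_def)
          have out: "k x y = 0" if "y \<notin> cball x r" for y
            using heat_le_level[OF r(1), of "r\<^sup>2 / (2 * real DIM('a))" "y - x"] that r(1)
            by (simp add: k_def barrier_def dist_norm norm_minus_commute)
          have kT: "k x \<in> test_functions \<Omega>"
            by (rule test_functionI[of _ "cball x r"]) (use cx out in \<open>auto simp: k_def[abs_def] intro!: barrier_smooth\<close>)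
          obtain C where C: "\<And>y. \<bar>k x y\<bar> \<le> C" using test_function_bounded[OF kT] by metis
          have i: "integrable lborel (\<lambda>y. z y * k x y)"
            by (rule integrable_mult_bounded_support[of _ C "cball x r"]) (use C out test_function_measurable[OF kT] in auto)
          have kn: "0 \<le> k x y" for y by (simp add: k_def barrier_nonneg)
          have "(\<integral>y. z y * k x y \<partial>lborel) = 0"
            using le z0 kn by (intro antisym integral_nonneg_AE) auto
          then have "AE y in lborel. z y * k x y = 0"
            using i z0 kn by (subst (asm) integral_nonneg_eq_0_iff_AE) auto
          then have "AE y in lborel. y \<in> N \<longrightarrow> z y = 0"
          proof eventually_elim
            case (elim y)
            show ?case
            proof
              assume "y \<in> N"
              then have "norm (y - x) < r"
                using xN dist_triangle[of y x y0] by (simp add: N_def dist_commute dist_norm[symmetric])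
              from heat_gt_level[OF r(1) this] have "k x y > 0" by (simp add: k_def barrier_def)
              then show "z y = 0" using elim by simp
            qed
          qed
          then show False using nz by blast
        qed
      qed
    qed
  qed
  moreover have "N \<subseteq> \<Omega>" using r by (auto simp: N_def intro!: subsetD[OF r(2)])
  ultimately show ?thesis using r by (intro exI[of _ N]) (auto simp: N_def)
qed

text \<open>The open sets on which z is positive, respectively zero, almost everywhere have unions
  that cover \<Omega>. The intersection of the two unions is open and null, hence empty, and
  connectedness leaves one of them.\<close>

theorem strong_maximum_principle:
  assumes "open \<Omega>" "connected \<Omega>"
  shows "(AE x in lborel. x \<in> \<Omega> \<longrightarrow> 0 < z x) \<or> (AE x in lborel. x \<in> \<Omega> \<longrightarrow> z x = 0)"
proof -
  define F1 where "F1 = {N. open N \<and> N \<subseteq> \<Omega> \<and> (AE x in lborel. x \<in> N \<longrightarrow> 0 < z x)}"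
  define F0 where "F0 = {N. open N \<and> N \<subseteq> \<Omega> \<and> (AE x in lborel. x \<in> N \<longrightarrow> z x = 0)}"
  have a1: "AE x in lborel. x \<in> \<Union>F1 \<longrightarrow> 0 < z x" by (rule AE_on_Union_open) (auto simp: F1_def)
  have a0: "AE x in lborel. x \<in> \<Union>F0 \<longrightarrow> z x = 0" by (rule AE_on_Union_open) (auto simp: F0_def)
  have op: "open (\<Union>F1)" "open (\<Union>F0)" by (auto simp: F1_def F0_def)
  have cover: "\<Omega> \<subseteq> \<Union>F1 \<union> \<Union>F0"
  proof
    fix y assume "y \<in> \<Omega>"
    from locally_positive_or_zero[OF assms(1) this] show "y \<in> \<Union>F1 \<union> \<Union>F0" unfolding F1_def F0_def by blast
  qed
  have "AE x in lborel. x \<notin> \<Union>F1 \<inter> \<Union>F0" using a1 a0 by eventually_elim auto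
  then have "\<Union>F1 \<inter> \<Union>F0 \<in> null_sets lborel" using op by (subst AE_iff_null_sets) auto
  then have disj: "\<Union>F1 \<inter> \<Union>F0 = {}" using open_null_lborel_empty[OF open_Int[OF op]] by simp
  have "\<Union>F1 \<inter> \<Omega> = {} \<or> \<Union>F0 \<inter> \<Omega> = {}"
    using connectedD[OF assms(2) op _ cover] disj by blast
  then have "\<Omega> \<subseteq> \<Union>F0 \<or> \<Omega> \<subseteq> \<Union>F1" using cover by blast
  then show ?thesis
  proof
    assume "\<Omega> \<subseteq> \<Union>F0"
    then have "AE x in lborel. x \<in> \<Omega> \<longrightarrow> z x = 0" using a0 by (auto elim!: eventually_mono)
    then show ?thesis ..
  next
    assume "\<Omega> \<subseteq> \<Union>F1"
    then have "AE x in lborel. x \<in> \<Omega> \<longrightarrow> 0 < z x" using a1 by (auto elim!: eventually_mono)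
    then show ?thesis ..
  qed
qed

end

section \<open>Strict comparison\<close>

text \<open>Brings a continuous function on the whole space, such as the solution w or its
  derivatives, into L^2 by restricting it to a bounded set.\<close>

lemma sqint_indicator_mult:
  fixes f :: "'a::euclidean_space \<Rightarrow> 'b::euclidean_space"
  assumes "bounded \<Omega>" "\<Omega> \<in> sets borel" "continuous_on UNIV f"
  shows "sqint (\<lambda>x. indicator \<Omega> x *\<^sub>R f x)"
proof -
  have [measurable]: "f \<in> borel_measurable borel" "\<Omega> \<in> sets borel"
    using assms borel_measurable_continuous_onI by auto
  have "compact (closure \<Omega>)" using assms(1) by simp
  then have "bounded (f ` closure \<Omega>)"
    using assms(3) by (intro compact_imp_bounded compact_continuous_image) (auto intro: continuous_on_subset)
  then obtain C where C: "\<And>x. x \<in> closure \<Omega> \<Longrightarrow> norm (f x) \<le> C" unfolding bounded_pos by auto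
  show ?thesis
    unfolding sqint_def
  proof
    show "(\<lambda>x. indicator \<Omega> x *\<^sub>R f x) \<in> borel_measurable lborel" by measurable
    show "integrable lborel (\<lambda>x. (norm (indicator \<Omega> x *\<^sub>R f x))\<^sup>2)"
    proof (rule Bochner_Integration.integrable_bound)
      show "integrable lborel (\<lambda>x. C\<^sup>2 * indicator \<Omega> x :: real)"
        using emeasure_bounded_finite[OF assms(1)] by (intro integrable_mult_right) simp
      show "AE x in lborel. norm ((norm (indicator \<Omega> x *\<^sub>R f x))\<^sup>2) \<le> norm (C\<^sup>2 * indicator \<Omega> x)"
      proof (rule AE_I2)
        fix x
        show "norm ((norm (indicator \<Omega> x *\<^sub>R f x))\<^sup>2) \<le> norm (C\<^sup>2 * indicator \<Omega> x)"
        proof (cases "x \<in> \<Omega>")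
          case True
          then have "norm (f x) \<le> C" using C closure_subset by blast
          then have "(norm (f x))\<^sup>2 \<le> C\<^sup>2" by (intro power_mono) auto
          then show ?thesis using True by simp
        qed simp
      qed
    qed measurable
  qed
qed

lemma sqint_scale_real: "sqint f \<Longrightarrow> sqint (\<lambda>x. c * (f x :: real))"
  using sqint_scale[of f c] by simp

text \<open>The approximating test functions have compact support in \<Omega>, so \<eta> needs no
  condition at the boundary. The absence of a boundary term expresses the zero boundary values of v
  without traces.\<close>

lemma H01_integration_by_parts:
  fixes \<eta> :: "'a::euclidean_space \<Rightarrow> real"
  assumes H: "(v, g) \<in> H01 \<Omega>" and \<Omega>: "bounded \<Omega>" "\<Omega> \<in> sets borel" and \<eta>: "C_diff 1 \<eta>" and b: "b \<in> Basis"
  shows "inner v (abs_l2 (\<lambda>x. indicator \<Omega> x *\<^sub>R partial_deriv b \<eta> x)) = - inner g (abs_l2 (\<lambda>x. indicator \<Omega> x *\<^sub>R (\<eta> x *\<^sub>R b)))"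
proof -
  obtain \<psi> where \<psi>: "\<And>k::nat. \<psi> k \<in> test_functions \<Omega>" "(\<lambda>k. abs_l2 (\<psi> k)) \<longlonglongrightarrow> v" "(\<lambda>k. abs_l2 (grad (\<psi> k))) \<longlonglongrightarrow> g"
    using H01E[OF H] by blast
  have c: "continuous_on UNIV (partial_deriv b \<eta>)" "continuous_on UNIV \<eta>"
    using \<eta> b by (auto intro: differentiable_imp_continuous_on)
  have s1: "sqint (\<lambda>x. indicator \<Omega> x *\<^sub>R partial_deriv b \<eta> x)" by (rule sqint_indicator_mult[OF \<Omega> c(1)])
  have s2: "sqint (\<lambda>x. indicator \<Omega> x *\<^sub>R (\<eta> x *\<^sub>R b))"
    by (rule sqint_indicator_mult[OF \<Omega>]) (intro continuous_intros c)
  have eq: "inner (abs_l2 (\<psi> k)) (abs_l2 (\<lambda>x. indicator \<Omega> x *\<^sub>R partial_deriv b \<eta> x)) =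
    - inner (abs_l2 (grad (\<psi> k))) (abs_l2 (\<lambda>x. indicator \<Omega> x *\<^sub>R (\<eta> x *\<^sub>R b)))" for k
  proof -
    obtain K where K: "compact K" "K \<subseteq> \<Omega>" "\<And>x. x \<notin> K \<Longrightarrow> \<psi> k x = 0" using test_functionE[OF \<psi>(1)] by metis
    have g0: "partial_deriv b (\<psi> k) x = 0" if "x \<notin> \<Omega>" for x
      by (rule partial_deriv_zero_outside[OF compact_imp_closed[OF K(1)] K(3)]) (use that K(2) in auto)
    have "inner (abs_l2 (\<psi> k)) (abs_l2 (\<lambda>x. indicator \<Omega> x *\<^sub>R partial_deriv b \<eta> x)) = (\<integral>x. \<psi> k x * partial_deriv b \<eta> x \<partial>lborel)"
      unfolding inner_abs_l2[OF sqint_test_function(1)[OF \<psi>(1)] s1]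
      by (intro Bochner_Integration.integral_cong refl) (use test_function_outside[OF \<psi>(1)] in \<open>auto simp: indicator_def\<close>)
    also have "\<dots> = - (\<integral>x. partial_deriv b (\<psi> k) x * \<eta> x \<partial>lborel)"
      by (rule integration_by_parts[OF smooth_C_diff[OF test_function_smooth[OF \<psi>(1)]] \<eta> K(1,3) b])
    also have "(\<integral>x. partial_deriv b (\<psi> k) x * \<eta> x \<partial>lborel) = inner (abs_l2 (grad (\<psi> k))) (abs_l2 (\<lambda>x. indicator \<Omega> x *\<^sub>R (\<eta> x *\<^sub>R b)))"
      unfolding inner_abs_l2[OF sqint_test_function(2)[OF \<psi>(1)] s2]
      by (intro Bochner_Integration.integral_cong refl) (use g0 b in \<open>auto simp: indicator_def grad_inner_Basis mult.commute\<close>)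
    finally show ?thesis .
  qed
  have "(\<lambda>k. inner (abs_l2 (\<psi> k)) (abs_l2 (\<lambda>x. indicator \<Omega> x *\<^sub>R partial_deriv b \<eta> x))) \<longlonglongrightarrow> inner v (abs_l2 (\<lambda>x. indicator \<Omega> x *\<^sub>R partial_deriv b \<eta> x))"
    by (intro tendsto_intros \<psi>)
  moreover have "(\<lambda>k. inner (abs_l2 (\<psi> k)) (abs_l2 (\<lambda>x. indicator \<Omega> x *\<^sub>R partial_deriv b \<eta> x))) \<longlonglongrightarrow> - inner g (abs_l2 (\<lambda>x. indicator \<Omega> x *\<^sub>R (\<eta> x *\<^sub>R b)))"
    unfolding eq by (intro tendsto_intros \<psi>)
  ultimately show ?thesis using LIMSEQ_unique by blast
qed

text \<open>A function of \<open>H\<^sub>0\<^sup>1(\<Omega>)\<close> cannot agree on \<open>\<Omega>\<close> with a positive smooth function \<open>w\<close>: its zero extension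
  would satisfy \<open>\<integral>\<^sub>\<Omega> \<partial>\<^sub>b (w \<eta>) = 0\<close> for all \<open>\<eta>\<close>, and \<open>w \<eta> = x \<bullet> b\<close> gives \<open>|\<Omega>| = 0\<close>.\<close>

lemma H01_not_positive_smooth:
  fixes \<Omega> :: "'a::euclidean_space set"
  assumes H: "(abs_l2 V, g) \<in> H01 \<Omega>" and V: "sqint V" and \<Omega>: "open \<Omega>" "bounded \<Omega>" "\<Omega> \<noteq> {}"
    and w: "smooth w" "\<And>x. 0 < w x" and Vw: "AE x in lborel. x \<in> \<Omega> \<longrightarrow> V x = w x"
  shows False
proof -
  have \<Omega>m[measurable]: "\<Omega> \<in> sets borel" using \<Omega> by simp
  have [measurable]: "V \<in> borel_measurable borel" "w \<in> borel_measurable borel" using V smooth_borel_measurable[OF w(1)] by (auto simp: sqint_def)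
  obtain b :: 'a where b: "b \<in> Basis" using nonempty_Basis by blast
  obtain Gr where Gr: "sqint Gr" "g = abs_l2 Gr" using l2_cases by blast
  have Grm[measurable]: "Gr \<in> borel_measurable borel" using Gr by (simp add: sqint_def)
  have pm[measurable]: "partial_deriv b w \<in> borel_measurable borel"
    by (rule smooth_borel_measurable[OF smooth_partial_deriv[OF w(1) b]])
  have wsq: "sqint (\<lambda>x. indicator \<Omega> x *\<^sub>R w x)" by (rule sqint_indicator_mult[OF \<Omega>(2) \<Omega>m smooth_continuous[OF w(1)]])
  have ibp: "(\<integral>x. V x * (indicator \<Omega> x * partial_deriv b \<eta> x) \<partial>lborel) = - (\<integral>x. (Gr x \<bullet> b) * (indicator \<Omega> x * \<eta> x) \<partial>lborel)" 
    if \<eta>: "C_diff 1 \<eta>" for \<eta>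
  proof -
    have c: "continuous_on UNIV (partial_deriv b \<eta>)" "continuous_on UNIV \<eta>"
      using \<eta> b by (auto intro: differentiable_imp_continuous_on)
    have s1: "sqint (\<lambda>x. indicator \<Omega> x *\<^sub>R partial_deriv b \<eta> x)" by (rule sqint_indicator_mult[OF \<Omega>(2) \<Omega>m c(1)])
    have s2: "sqint (\<lambda>x. indicator \<Omega> x *\<^sub>R (\<eta> x *\<^sub>R b))"
      by (rule sqint_indicator_mult[OF \<Omega>(2) \<Omega>m]) (intro continuous_intros c)
    show ?thesis
      using H01_integration_by_parts[OF H \<Omega>(2) \<Omega>m \<eta> b] unfolding Gr(2) inner_abs_l2[OF V s1] inner_abs_l2[OF Gr(1) s2]
      by (simp add: mult_ac)
  qed
  have Vint: "(\<integral>x. V x * (indicator \<Omega> x * f x) \<partial>lborel) = (\<integral>x. w x * (indicator \<Omega> x * f x) \<partial>lborel)"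
    if [measurable]: "f \<in> borel_measurable borel" for f
  proof (rule integral_cong_AE)
    show "AE x in lborel. V x * (indicator \<Omega> x * f x) = w x * (indicator \<Omega> x * f x)"
      using Vw by eventually_elim (auto simp: indicator_def)
  qed measurable
  \<comment> \<open>Testing inside \<Omega> identifies the gradient component of V with the
    classical derivative of w there, so that the formula for a general \<eta> becomes an identity
    about w alone.\<close>
  have Grw: "AE x in lborel. x \<in> \<Omega> \<longrightarrow> Gr x \<bullet> b - partial_deriv b w x = 0"
  proof (rule null_distribution_AE_zero[OF \<Omega>(1)])
    have "set_integrable lborel \<Omega> Gr" by (rule sqint_set_integrable[OF Gr(1) \<Omega>m \<Omega>(2)])
    then have i1: "set_integrable lborel \<Omega> (\<lambda>x. Gr x \<bullet> b)"
      unfolding set_integrable_def using integrable_inner_left[of b lborel "\<lambda>x. indicator \<Omega> x *\<^sub>R Gr x"] by simp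
    have "sqint (\<lambda>x. indicator \<Omega> x *\<^sub>R partial_deriv b w x)"
      by (rule sqint_indicator_mult[OF \<Omega>(2) \<Omega>m smooth_continuous[OF smooth_partial_deriv[OF w(1) b]]])
    from sqint_set_integrable[OF this \<Omega>m \<Omega>(2)] have i2: "set_integrable lborel \<Omega> (partial_deriv b w)"
      unfolding set_integrable_def by (rule back_subst[of "integrable lborel"]) (auto simp: indicator_def)
    show "set_integrable lborel \<Omega> (\<lambda>x. Gr x \<bullet> b - partial_deriv b w x)" by (rule set_integral_diff[OF i1 i2])
    fix f :: "'a \<Rightarrow> real" assume f: "f \<in> test_functions \<Omega>"
    have [measurable]: "f \<in> borel_measurable borel" using test_function_measurable[OF f] .
    have fC: "C_diff 1 f" by (rule smooth_C_diff[OF test_function_smooth[OF f]])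
    obtain K where K: "compact K" "K \<subseteq> \<Omega>" "\<And>x. x \<notin> K \<Longrightarrow> f x = 0" using test_functionE[OF f] by metis
    have fo: "indicator \<Omega> x * f x = f x" for x using test_function_outside[OF f, of x] by (auto simp: indicator_def)
    have po: "indicator \<Omega> x * partial_deriv b f x = partial_deriv b f x" for x
      using test_function_outside[OF test_function_partial_deriv[OF f b], of x] by (auto simp: indicator_def)
    have pfm: "partial_deriv b f \<in> borel_measurable borel" by (rule test_function_measurable[OF test_function_partial_deriv[OF f b]])
    have "(\<integral>x. (Gr x \<bullet> b) * f x \<partial>lborel) = - (\<integral>x. w x * partial_deriv b f x \<partial>lborel)"
      using ibp[OF fC] Vint[OF pfm] by (simp add: fo po)
    also have "\<dots> = (\<integral>x. partial_deriv b w x * f x \<partial>lborel)"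
      using integration_by_parts[OF fC smooth_C_diff[OF w(1)] K(1,3) b] by (simp add: mult.commute)
    finally have e: "(\<integral>x. (Gr x \<bullet> b) * f x \<partial>lborel) = (\<integral>x. partial_deriv b w x * f x \<partial>lborel)" .
    have j1: "integrable lborel (\<lambda>x. (Gr x \<bullet> b) * f x)"
    proof -
      have "sqint (\<lambda>x. indicator \<Omega> x *\<^sub>R (f x *\<^sub>R b))"
        by (rule sqint_indicator_mult[OF \<Omega>(2) \<Omega>m]) (intro continuous_intros test_function_continuous[OF f])
      from sqint_integrable_inner[OF Gr(1) this] show ?thesis
      proof (rule back_subst[of "integrable lborel"], intro ext)
        show "Gr x \<bullet> (indicator \<Omega> x *\<^sub>R (f x *\<^sub>R b)) = (Gr x \<bullet> b) * f x" for x
          by (cases "x \<in> \<Omega>") (simp_all add: test_function_outside[OF f])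
      qed
    qed
    have j2: "integrable lborel (\<lambda>x. partial_deriv b w x * f x)"
      by (rule test_function_integrable[OF test_function_mult[OF f smooth_partial_deriv[OF w(1) b]]])
    show "(\<integral>x. (Gr x \<bullet> b - partial_deriv b w x) * f x \<partial>lborel) = 0"
      unfolding left_diff_distrib Bochner_Integration.integral_diff[OF j1 j2] e by simp
  qed measurable
  define \<eta> where "\<eta> x = (x \<bullet> b) / w x" for x
  have d\<eta>: "(\<eta> has_derivative (\<lambda>h. ((h \<bullet> b) * w x - (x \<bullet> b) * (grad w x \<bullet> h)) / (w x * w x))) (at x)" for x
  proof -
    have "((\<lambda>x. (x \<bullet> b) / w x) has_derivative (\<lambda>h. (- (x \<bullet> b) * (inverse (w x) * (grad w x \<bullet> h) * inverse (w x)) + (h \<bullet> b) / w x))) (at x)"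
      using w(2)[of x] by (intro has_derivative_divide grad_has_derivative smooth_differentiable[OF w(1)] has_derivative_inner_left has_derivative_ident) auto
    then show ?thesis unfolding \<eta>_def[abs_def]
      by (rule has_derivative_eq_rhs) (use w(2)[of x] in \<open>auto simp: field_simps\<close>)
  qed
  have p\<eta>: "partial_deriv b' \<eta> x = ((b' \<bullet> b) * w x - (x \<bullet> b) * (grad w x \<bullet> b')) / (w x * w x)" for b' x
    by (rule partial_deriv_eq[OF d\<eta>])
  have C1: "C_diff 1 \<eta>"
  proof -
    have "\<eta> differentiable_on UNIV" unfolding differentiable_on_def differentiable_def using d\<eta> by blast
    moreover have "continuous_on UNIV (partial_deriv b' \<eta>)" for b'
      unfolding p\<eta>[abs_def] using w(2) by (intro continuous_intros smooth_continuous[OF w(1)] grad_continuous[OF w(1)]) (auto simp: less_imp_neq[symmetric])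
    ultimately show ?thesis by simp
  qed
  have p\<eta>m: "partial_deriv b \<eta> \<in> borel_measurable borel" and \<eta>m[measurable]: "\<eta> \<in> borel_measurable borel"
    using C1 b by (auto intro: borel_measurable_continuous_onI dest: differentiable_imp_continuous_on)
  have "(\<integral>x. w x * (indicator \<Omega> x * partial_deriv b \<eta> x) \<partial>lborel) = - (\<integral>x. (Gr x \<bullet> b) * (indicator \<Omega> x * \<eta> x) \<partial>lborel)"
    using ibp[OF C1] Vint[OF p\<eta>m] by simp
  also have "(\<integral>x. (Gr x \<bullet> b) * (indicator \<Omega> x * \<eta> x) \<partial>lborel) = (\<integral>x. partial_deriv b w x * (indicator \<Omega> x * \<eta> x) \<partial>lborel)"
  proof (rule integral_cong_AE)
    show "AE x in lborel. (Gr x \<bullet> b) * (indicator \<Omega> x * \<eta> x) = partial_deriv b w x * (indicator \<Omega> x * \<eta> x)"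
      using Grw by eventually_elim (auto simp: indicator_def)
  qed measurable
  finally have z: "(\<integral>x. w x * (indicator \<Omega> x * partial_deriv b \<eta> x) \<partial>lborel) + (\<integral>x. partial_deriv b w x * (indicator \<Omega> x * \<eta> x) \<partial>lborel) = 0" by simp
  have i1: "integrable lborel (\<lambda>x. w x * (indicator \<Omega> x * partial_deriv b \<eta> x))"
    and i2: "integrable lborel (\<lambda>x. partial_deriv b w x * (indicator \<Omega> x * \<eta> x))"
  proof -
    have cc: "continuous_on UNIV \<eta>" "continuous_on UNIV (partial_deriv b \<eta>)" using C1 b by (auto intro: differentiable_imp_continuous_on)
    have "sqint (\<lambda>x. indicator \<Omega> x *\<^sub>R (w x * partial_deriv b \<eta> x))"
      by (rule sqint_indicator_mult[OF \<Omega>(2) \<Omega>m]) (intro continuous_on_mult smooth_continuous[OF w(1)] cc)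
    from sqint_set_integrable[OF this \<Omega>m \<Omega>(2)] show "integrable lborel (\<lambda>x. w x * (indicator \<Omega> x * partial_deriv b \<eta> x))"
      unfolding set_integrable_def by (rule back_subst[of "integrable lborel"]) (auto simp: indicator_def) 
    have "sqint (\<lambda>x. indicator \<Omega> x *\<^sub>R (partial_deriv b w x * \<eta> x))"
      by (rule sqint_indicator_mult[OF \<Omega>(2) \<Omega>m]) (intro continuous_on_mult smooth_continuous[OF smooth_partial_deriv[OF w(1) b]] cc)
    from sqint_set_integrable[OF this \<Omega>m \<Omega>(2)] show "integrable lborel (\<lambda>x. partial_deriv b w x * (indicator \<Omega> x * \<eta> x))"
      unfolding set_integrable_def by (rule back_subst[of "integrable lborel"]) (auto simp: indicator_def)
  qed
  have "w x * (indicator \<Omega> x * partial_deriv b \<eta> x) + partial_deriv b w x * (indicator \<Omega> x * \<eta> x) = indicator \<Omega> x" for x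
  proof -
    have "w x * partial_deriv b \<eta> x + partial_deriv b w x * \<eta> x = 1"
      unfolding p\<eta> using w(2)[of x] b by (simp add: \<eta>_def grad_inner_Basis field_simps)
    then show ?thesis by (auto simp: indicator_def)
  qed
  then have "(\<integral>x. indicator \<Omega> x \<partial>lborel) = (0::real)"
    using z Bochner_Integration.integral_add[OF i1 i2] by simp
  then have "measure lborel \<Omega> = 0" by simp
  then have "\<Omega> \<in> null_sets lborel"
  proof -
    assume m: "measure lborel \<Omega> = 0"
    have "emeasure lborel \<Omega> = ennreal (measure lborel \<Omega>)"
      by (rule emeasure_eq_ennreal_measure) (use emeasure_bounded_finite[OF \<Omega>(2)] in auto)
    then show ?thesis unfolding m by (intro null_setsI) auto
  qed
  then show False using open_null_lborel_empty[OF \<Omega>(1)] \<Omega>(3) by blast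
qed

text \<open>Both solutions have right-hand side \<phi> in \<Omega>, so their difference solves the
  homogeneous equation there and the strong maximum principle applies. The alternative that they
  coincide on \<Omega> is impossible for a function of \<open>H01 \<Omega>\<close> and a positive
  smooth one. Outside \<Omega> one solution is 0 and the other is positive.\<close>

lemma resolvent_strict_comparison:
  fixes \<Omega> :: "'a::euclidean_space set"
  assumes \<Omega>: "open \<Omega>" "connected \<Omega>" "bounded \<Omega>" "\<Omega> \<noteq> {}" and t: "t > 0"
    and \<phi>: "\<phi> \<in> test_functions \<Omega>" "\<And>x. 0 \<le> \<phi> x" "\<exists>x. \<phi> x \<noteq> 0"
    and V: "sqint V" "abs_l2 V = resolvent \<Omega> t (abs_l2 \<phi>)"
  shows "AE x in lborel. V x < space_resolvent t \<phi> x"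
proof -
  have \<Omega>m: "\<Omega> \<in> sets borel" using \<Omega> by simp
  have \<phi>U: "\<phi> \<in> test_functions UNIV" using \<phi>(1) test_functions_mono[of \<Omega> UNIV] by blast
  define w where "w = space_resolvent t \<phi>"
  have ws: "smooth w" unfolding w_def by (rule space_resolvent_smooth[OF \<phi>U t])
  have wpos: "0 < w x" for x unfolding w_def using space_resolvent_pos[OF \<phi>U t \<phi>(2)] \<phi>(3) by blast
  have [measurable]: "w \<in> borel_measurable borel" "V \<in> borel_measurable borel" using smooth_borel_measurable[OF ws] V by (auto simp: sqint_def)
  obtain g where g: "weak_solution \<Omega> t (abs_l2 \<phi>) (abs_l2 V, g)" unfolding V(2) by (rule resolventE[OF t])
  then have H: "(abs_l2 V, g) \<in> H01 \<Omega>" by (simp add: weak_solution_def)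
  have le: "AE x in lborel. V x \<le> w x" unfolding w_def by (rule resolvent_comparison[OF \<Omega>(1,3) t \<phi>(1,2) V])
  \<comment> \<open>The maximum principle is stated for a function that is nonnegative everywhere,
    whereas the comparison holds almost everywhere.\<close>
  define z where "z x = max 0 (w x - V x)" for x
  have zae: "AE x in lborel. z x = w x - V x" using le by eventually_elim (simp add: z_def)
  have [measurable]: "z \<in> borel_measurable borel" unfolding z_def by measurable
  have "(AE x in lborel. x \<in> \<Omega> \<longrightarrow> 0 < z x) \<or> (AE x in lborel. x \<in> \<Omega> \<longrightarrow> z x = 0)"
  proof (rule strong_maximum_principle[OF t _ _ _ _ \<Omega>(1,2)])
    fix A :: "'a set" assume A: "A \<in> sets borel" "bounded A"
    have "set_integrable lborel A w"
    proof -
      have "sqint (\<lambda>x. indicator A x *\<^sub>R w x)" by (rule sqint_indicator_mult[OF A(2,1) smooth_continuous[OF ws]])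
      from sqint_set_integrable[OF this A] show ?thesis unfolding set_integrable_def by (rule back_subst[of "integrable lborel"]) (auto simp: indicator_def)
    qed
    from set_integral_diff(1)[OF this sqint_set_integrable[OF V(1) A]] have "set_integrable lborel A (\<lambda>x. w x - V x)" .
    then show "set_integrable lborel A z"
      unfolding set_integrable_def
    proof (rule integrable_cong_AE_imp)
      have [measurable]: "A \<in> sets borel" by fact
      show "(\<lambda>x. indicator A x *\<^sub>R z x) \<in> borel_measurable lborel" by measurable
      show "AE x in lborel. indicator A x *\<^sub>R (w x - V x) = indicator A x *\<^sub>R z x" using zae by eventually_elim simp
    qed
  next
    fix X assume X: "X \<in> test_functions \<Omega>"
    have XU: "X \<in> test_functions UNIV" using X test_functions_mono[of \<Omega> UNIV] by blast
    define h where "h x = t * X x - laplacian X x" for x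
    have h: "h \<in> test_functions UNIV" unfolding h_def[abs_def]
      by (intro test_function_diff test_function_scale test_function_laplacian XU)
    have hs: "abs_l2 h = t *\<^sub>R abs_l2 X - abs_l2 (laplacian X)"
      unfolding h_def[abs_def] using sqint_test_function(1)[OF X] sqint_test_function(1)[OF test_function_laplacian[OF X]]
      by (simp add: abs_l2_scale abs_l2_diff sqint_scale_real)
    \<comment> \<open>The weak equation on \<Omega> carries the pairing of V with t X - \<Delta> X
      to the pairing of \<phi> with X, and the equation on the whole space carries that to the
      pairing of w.\<close>
    have "(\<integral>x. V x * h x \<partial>lborel) = inner (abs_l2 V) (abs_l2 h)"
      using inner_abs_l2[OF V(1) sqint_test_function(1)[OF h]] by simp
    also have "\<dots> = t * inner (abs_l2 V) (abs_l2 X) + inner g (abs_l2 (grad X))"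
      unfolding hs inner_diff_right using inner_H01_grad[OF H XU] by simp
    also have "\<dots> = inner (abs_l2 \<phi>) (abs_l2 X)"
      using g embed_in_H01[OF X] unfolding weak_solution_def by (fastforce simp: embed_def)
    also have "\<dots> = (\<integral>x. \<phi> x * X x \<partial>lborel)"
      using inner_abs_l2[OF sqint_test_function(1)[OF \<phi>(1)] sqint_test_function(1)[OF X]] by simp
    also have "\<dots> = (\<integral>x. w x * h x \<partial>lborel)"
      unfolding w_def h_def by (rule space_resolvent_weak[OF \<phi>U t XU, symmetric])
    finally have e: "(\<integral>x. V x * h x \<partial>lborel) = (\<integral>x. w x * h x \<partial>lborel)" .
    have i1: "integrable lborel (\<lambda>x. w x * h x)" by (rule test_function_integrable[OF test_function_mult[OF h ws]])
    have i2: "integrable lborel (\<lambda>x. V x * h x)"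
      using sqint_integrable_inner[OF V(1) sqint_test_function(1)[OF h]] by simp
    have [measurable]: "h \<in> borel_measurable borel" using test_function_measurable[OF h] .
    have "(\<integral>x. z x * h x \<partial>lborel) = (\<integral>x. (w x - V x) * h x \<partial>lborel)"
    proof (rule integral_cong_AE)
      show "AE x in lborel. z x * h x = (w x - V x) * h x" using zae by eventually_elim simp
    qed measurable
    also have "\<dots> = 0" unfolding left_diff_distrib Bochner_Integration.integral_diff[OF i1 i2] e by simp
    finally show "(\<integral>x. z x * (t * X x - laplacian X x) \<partial>lborel) = 0" by (simp add: h_def)
  qed (simp_all add: z_def)
  moreover have "\<not> (AE x in lborel. x \<in> \<Omega> \<longrightarrow> z x = 0)"
  proof
    assume "AE x in lborel. x \<in> \<Omega> \<longrightarrow> z x = 0"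
    with zae have "AE x in lborel. x \<in> \<Omega> \<longrightarrow> V x = w x" by eventually_elim auto
    then show False by (rule H01_not_positive_smooth[OF H V(1) \<Omega>(1,3,4) ws wpos])
  qed
  ultimately have "AE x in lborel. x \<in> \<Omega> \<longrightarrow> 0 < z x" by blast
  moreover have "AE x in lborel. x \<notin> \<Omega> \<longrightarrow> V x = 0"
    using H01_fst_L2_on[OF H \<Omega>m] abs_l2_in_L2_on_iff[OF V(1) \<Omega>m] by simp
  ultimately show ?thesis using zae
  proof eventually_elim
    case (elim x)
    then show ?case using wpos[of x] by (cases "x \<in> \<Omega>") (auto simp: w_def)
  qed
qed

section \<open>Powers as integrals of resolvents\<close>

definition powr_kernel :: "real \<Rightarrow> real \<Rightarrow> real \<Rightarrow> real" where
  "powr_kernel s \<mu> t = indicator {0<..} t * (t powr (s - 1) * (\<mu> / (t + \<mu>)))"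

text \<open>Equal to pi / sin (pi s); the argument rests on its being finite and positive.\<close>

definition powr_const :: "real \<Rightarrow> real" where
  "powr_const s = (\<integral>t. powr_kernel s 1 t \<partial>lborel)"

lemma powr_kernel_measurable [measurable]: "(\<lambda>(\<mu>, t). powr_kernel s \<mu> t) \<in> borel_measurable (borel \<Otimes>\<^sub>M borel)"
  unfolding powr_kernel_def by measurable

lemma powr_kernel_nonneg: "\<mu> \<ge> 0 \<Longrightarrow> 0 \<le> powr_kernel s \<mu> t"
  by (auto simp: powr_kernel_def indicator_def)

text \<open>The kernel is at most t^(s-1) below 1 and at most t^(s-2) above 1; integrability at 0
  comes from s > 0, and at infinity from s < 1.\<close>

lemma powr_kernel_1_integrable:
  assumes s: "0 < s" "s < 1"
  shows "integrable lborel (powr_kernel s 1)"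
proof -
  have a: "set_integrable lborel (einterval 0 1) (\<lambda>t. t powr (s - 1))"
  proof (rule interval_integral_FTC_nonneg(1)[where F="\<lambda>t. t powr s / s" and A=0 and B="1 / s"])
    fix x assume "(0::ereal) < ereal x" "ereal x < 1"
    then have x: "x > 0" by simp
    show "((\<lambda>t. t powr s / s) has_real_derivative x powr (s - 1)) (at x)"
      using x s by (auto intro!: derivative_eq_intros)
    show "isCont (\<lambda>t. t powr (s - 1)) x" using x by (intro continuous_intros) auto
  next
    have "((\<lambda>t. t powr s / s) \<longlongrightarrow> 0 powr s / s) (at_right 0)"
      using s by (intro tendsto_intros tendsto_powr') (auto simp: eventually_at_right_less intro!: eventually_mono[OF eventually_at_right_less])
    then show "(((\<lambda>t. t powr s / s) \<circ> real_of_ereal) \<longlongrightarrow> 0) (at_right 0)"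
      unfolding zero_ereal_def by (subst ereal_tendsto_simps) simp
    have "((\<lambda>t. t powr s / s) \<longlongrightarrow> 1 powr s / s) (at_left 1)"
      using s by (intro tendsto_intros) auto
    then show "(((\<lambda>t. t powr s / s) \<circ> real_of_ereal) \<longlongrightarrow> 1 / s) (at_left 1)"
      unfolding one_ereal_def by (subst ereal_tendsto_simps) simp
  qed auto
  have b: "set_integrable lborel (einterval 1 \<infinity>) (\<lambda>t. t powr (s - 2))"
  proof (rule interval_integral_FTC_nonneg(1)[where F="\<lambda>t. t powr (s - 1) / (s - 1)" and A="1 / (s - 1)" and B=0])
    fix x assume "(1::ereal) < ereal x" "ereal x < \<infinity>"
    then have x: "x > 1" by (simp add: one_ereal_def)
    have "s - 1 - 1 = s - 2" by simp
    then show "((\<lambda>t. t powr (s - 1) / (s - 1)) has_real_derivative x powr (s - 2)) (at x)"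
      using x s by (auto intro!: derivative_eq_intros)
    show "isCont (\<lambda>t. t powr (s - 2)) x" using x by (intro continuous_intros) auto
  next
    have "((\<lambda>t. t powr (s - 1) / (s - 1)) \<longlongrightarrow> 1 powr (s - 1) / (s - 1)) (at_right 1)"
      using s by (intro tendsto_intros) auto
    then show "(((\<lambda>t. t powr (s - 1) / (s - 1)) \<circ> real_of_ereal) \<longlongrightarrow> 1 / (s - 1)) (at_right 1)"
      unfolding one_ereal_def by (subst ereal_tendsto_simps) simp
    have "((\<lambda>t. t powr (s - 1) / (s - 1)) \<longlongrightarrow> 0 / (s - 1)) at_top"
      using s by (intro tendsto_divide tendsto_neg_powr filterlim_ident tendsto_const) auto
    then show "(((\<lambda>t. t powr (s - 1) / (s - 1)) \<circ> real_of_ereal) \<longlongrightarrow> 0) (at_left \<infinity>)"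
      by (subst ereal_tendsto_simps) simp
  qed auto
  have "integrable lborel (\<lambda>t. indicator (einterval 0 1) t *\<^sub>R t powr (s - 1) + indicator (einterval 1 \<infinity>) t *\<^sub>R t powr (s - 2))"
    using a b unfolding set_integrable_def by (rule Bochner_Integration.integrable_add)
  then show ?thesis
  proof (rule Bochner_Integration.integrable_bound)
    show "powr_kernel s 1 \<in> borel_measurable lborel" unfolding powr_kernel_def[abs_def] by measurable
    show "AE t in lborel. norm (powr_kernel s 1 t) \<le> norm (indicator (einterval 0 1) t *\<^sub>R t powr (s - 1) + indicator (einterval 1 \<infinity>) t *\<^sub>R t powr (s - 2))"
      using AE_lborel_singleton[of "1::real"]
    proof eventually_elim
      case (elim t)
      consider "t \<le> 0" | "0 < t" "t < 1" | "t > 1" using elim by linarith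
      then show ?case
      proof cases
        case 2
        then have "t powr (s - 1) * (1 / (t + 1)) \<le> t powr (s - 1) * 1" by (intro mult_left_mono) auto
        then show ?thesis using 2 by (simp add: powr_kernel_def einterval_def one_ereal_def)
      next
        case 3
        have "t powr (s - 1) * (1 / (t + 1)) \<le> t powr (s - 1) * (1 / t)" using 3 by (intro mult_left_mono divide_left_mono) auto
        also have "\<dots> = t powr (s - 2)" using 3 powr_diff[of t "s - 1" 1] by simp
        finally show ?thesis using 3 by (simp add: powr_kernel_def einterval_def one_ereal_def)
      qed (simp add: powr_kernel_def)
    qed
  qed
qed

lemma powr_const_pos:
  assumes s: "0 < s" "s < 1"
  shows "0 < powr_const s"
proof -
  have nn: "0 \<le> powr_kernel s 1 t" for t by (rule powr_kernel_nonneg) simp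
  have "powr_const s \<noteq> 0"
  proof
    assume "powr_const s = 0"
    then have "AE t in lborel. powr_kernel s 1 t = 0"
      unfolding powr_const_def using nn by (subst (asm) integral_nonneg_eq_0_iff_AE[OF powr_kernel_1_integrable[OF s]]) auto
    then have "AE t in lborel. t \<notin> {0::real<..}" by eventually_elim (auto simp: powr_kernel_def)
    then have "{0::real<..} \<in> null_sets lborel" by (subst AE_iff_null_sets) auto
    then show False using open_null_lborel_empty[of "{0::real<..}"] by auto
  qed
  moreover have "0 \<le> powr_const s" unfolding powr_const_def using nn by simp
  ultimately show ?thesis by simp
qed

text \<open>Substituting t = \<mu> t' reduces the kernel to the one for 1 and produces the power of
  \<mu>.\<close>

lemma powr_kernel_integral:
  assumes s: "0 < s" "s < 1" and \<mu>: "\<mu> \<ge> 0"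
  shows "integrable lborel (powr_kernel s \<mu>)" "(\<integral>t. powr_kernel s \<mu> t \<partial>lborel) = powr_const s * \<mu> powr s"
proof -
  have "integrable lborel (powr_kernel s \<mu>) \<and> (\<integral>t. powr_kernel s \<mu> t \<partial>lborel) = powr_const s * \<mu> powr s"
  proof (cases "\<mu> = 0")
    \<comment> \<open>For \<mu> = 0 the kernel vanishes identically, in agreement with
      \<open>0 powr s = 0\<close>.\<close>
    case True
    then have "powr_kernel s \<mu> = (\<lambda>t. 0)" by (simp add: powr_kernel_def fun_eq_iff)
    then show ?thesis using True by simp
  next
    case False
    then have \<mu>0: "\<mu> > 0" using \<mu> by simp
    have eq: "powr_kernel s \<mu> = (\<lambda>t. \<mu> powr (s - 1) * powr_kernel s 1 (0 + (1 / \<mu>) *\<^sub>R t))"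
    proof
      fix t
      show "powr_kernel s \<mu> t = \<mu> powr (s - 1) * powr_kernel s 1 (0 + (1 / \<mu>) *\<^sub>R t)"
      proof (cases "t > 0")
        case True
        have 1: "\<mu> powr (s - 1) * (t / \<mu>) powr (s - 1) = t powr (s - 1)"
          using True \<mu>0 by (simp add: powr_mult[symmetric])
        have 2: "1 / (t / \<mu> + 1) = \<mu> / (t + \<mu>)" using True \<mu>0 by (simp add: field_simps)
        have "\<mu> powr (s - 1) * powr_kernel s 1 (0 + (1 / \<mu>) *\<^sub>R t) = (\<mu> powr (s - 1) * (t / \<mu>) powr (s - 1)) * (1 / (t / \<mu> + 1))"
          using True \<mu>0 by (simp add: powr_kernel_def)
        then show ?thesis unfolding 1 2 using True by (simp add: powr_kernel_def)
      next
        case f: False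
        then have "\<not> 0 < t / \<mu>" using \<mu>0 by (simp add: zero_less_divide_iff)
        then show ?thesis using f by (simp add: powr_kernel_def)
      qed
    qed
    have i: "integrable lborel (powr_kernel s \<mu>)"
      unfolding eq using \<mu>0 by (intro integrable_mult_right lborel_integrable_affine[OF powr_kernel_1_integrable[OF s]]) auto
    have "powr_const s = \<bar>1 / \<mu>\<bar> ^ DIM(real) *\<^sub>R (\<integral>t. powr_kernel s 1 (0 + (1 / \<mu>) *\<^sub>R t) \<partial>lborel)"
      unfolding powr_const_def using \<mu>0 powr_kernel_1_integrable[OF s] by (intro lborel_integral_affine) auto
    then have "(\<integral>t. powr_kernel s 1 (0 + (1 / \<mu>) *\<^sub>R t) \<partial>lborel) = \<mu> * powr_const s" using \<mu>0 by simp
    then have "(\<integral>t. powr_kernel s \<mu> t \<partial>lborel) = \<mu> powr (s - 1) * (\<mu> * powr_const s)"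
      unfolding eq by simp
    also have "\<dots> = powr_const s * \<mu> powr s" using \<mu>0 powr_add[of \<mu> "s - 1" 1] by simp
    finally show ?thesis using i by blast
  qed
  then show "integrable lborel (powr_kernel s \<mu>)" "(\<integral>t. powr_kernel s \<mu> t \<partial>lborel) = powr_const s * \<mu> powr s" by auto
qed

text \<open>Lets the power of the Laplacian be dominated by the identity and the Laplacian itself,
  both of which preserve test functions.\<close>

lemma powr_le_1_plus:
  assumes "x \<ge> 0" "0 < s" "s < (1::real)"
  shows "x powr s \<le> 1 + x"
proof (cases "x \<le> 1")
  case True
  then have "x powr s \<le> 1" using assms powr_mono2[of s x 1] by simp
  then show ?thesis using assms by linarith
next
  case False
  then have "x powr s \<le> x powr 1" using assms by (intro powr_mono) auto
  then show ?thesis using False by simp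
qed

lemma Re_complex_of_real_mult: "Re (complex_of_real r * z) = r * Re z"
  by simp

section \<open>Integral representations of the two fractional Laplacians\<close>

text \<open>Fubini for the kernel at |\<xi>|^2 times the product of transforms. Integrating first
  over t restores the multiplier |\<xi>|^(2 s); integrating first over \<xi> gives the two terms of
  \<open>I\<close>, by Parseval and by \<open>space_resolvent_pairing\<close>. The decay of the
  transform of \<phi> makes the double integral absolutely convergent.\<close>

lemma dirichlet_frac_laplacian_integral:
  fixes u \<phi> :: "'a::euclidean_space \<Rightarrow> real"
  assumes s: "0 < s" "s < 1" and \<phi>: "\<phi> \<in> test_functions UNIV" and u: "integrable lborel u"
  defines "I \<equiv> \<lambda>t. indicator {0<..} t * (t powr (s - 1) * ((\<integral>x. u x * \<phi> x \<partial>lborel) - t * (\<integral>x. u x * space_resolvent t \<phi> x \<partial>lborel)))"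
  shows "integrable lborel I" and "(\<integral>t. I t \<partial>lborel) = powr_const s * dirichlet_frac_laplacian s u \<phi>"
proof -
  have [measurable]: "\<phi> \<in> borel_measurable borel" "u \<in> borel_measurable borel"
    using test_function_measurable[OF \<phi>] u borel_measurable_integrable by fastforce+
  define P where "P \<xi> = Re (fourier \<phi> \<xi> * cnj (fourier u \<xi>))" for \<xi>
  have cm: "(\<lambda>\<xi>. fourier \<phi> \<xi> * cnj (fourier u \<xi>)) \<in> borel_measurable borel"
    by (intro borel_measurable_times fourier_measurable borel_measurable_continuous_on[of cnj] continuous_intros) measurable
  then have [measurable]: "P \<in> borel_measurable borel" unfolding P_def by measurable
  define M where "M = fconst TYPE('a) * (\<integral>x. \<bar>u x\<bar> \<partial>lborel)"
  have cb: "cmod (fourier \<phi> \<xi> * cnj (fourier u \<xi>)) \<le> M * cmod (fourier \<phi> \<xi>)" for \<xi>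
    using fourier_bounded[of u \<xi>] by (simp add: norm_mult M_def mult.commute mult_left_mono)
  then have Pb: "\<bar>P \<xi>\<bar> \<le> M * cmod (fourier \<phi> \<xi>)" for \<xi>
    unfolding P_def by (rule order_trans[OF abs_Re_le_cmod])
  have iw: "integrable lborel (\<lambda>\<xi>. M * ((1 + (norm \<xi>)\<^sup>2) ^ 1 * cmod (fourier \<phi> \<xi>)))" "integrable lborel (\<lambda>\<xi>. M * cmod (fourier \<phi> \<xi>))"
    using integrable_fourier_weighted[OF \<phi>, of 1] integrable_fourier_weighted[OF \<phi>, of 0] by (auto intro!: integrable_mult_right)
  have p2: "norm \<xi> powr (2 * s) = (norm \<xi>)\<^sup>2 powr s" for \<xi> :: 'a
  proof (cases "\<xi> = 0")
    case False
    then have "(norm \<xi>)\<^sup>2 = norm \<xi> powr 2" by simp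
    then show ?thesis by (simp only: powr_powr)
  qed simp
  have ps: "(norm \<xi>)\<^sup>2 powr s \<le> 1 + (norm \<xi>)\<^sup>2" for \<xi> :: 'a
    using powr_le_1_plus[of "(norm \<xi>)\<^sup>2" s] s by simp
  have iF: "integrable lborel (\<lambda>\<xi>. complex_of_real (norm \<xi> powr (2 * s)) * (fourier \<phi> \<xi> * cnj (fourier u \<xi>)))"
  proof (rule Bochner_Integration.integrable_bound[OF iw(1)])
    show "(\<lambda>\<xi>. complex_of_real (norm \<xi> powr (2 * s)) * (fourier \<phi> \<xi> * cnj (fourier u \<xi>))) \<in> borel_measurable lborel"
      using cm by measurable
    show "AE \<xi> in lborel. norm (complex_of_real (norm \<xi> powr (2 * s)) * (fourier \<phi> \<xi> * cnj (fourier u \<xi>))) \<le> norm (M * ((1 + (norm \<xi>)\<^sup>2) ^ 1 * cmod (fourier \<phi> \<xi>)))"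
    proof (rule AE_I2)
      fix \<xi> :: 'a
      have "norm (complex_of_real (norm \<xi> powr (2 * s)) * (fourier \<phi> \<xi> * cnj (fourier u \<xi>))) = (norm \<xi>)\<^sup>2 powr s * cmod (fourier \<phi> \<xi> * cnj (fourier u \<xi>))"
        unfolding p2 norm_mult[of "complex_of_real _"] norm_of_real by simp
      also have "\<dots> \<le> (1 + (norm \<xi>)\<^sup>2) * (M * cmod (fourier \<phi> \<xi>))" using ps cb by (intro mult_mono) auto
      also have "\<dots> \<le> norm (M * ((1 + (norm \<xi>)\<^sup>2) ^ 1 * cmod (fourier \<phi> \<xi>)))" by (simp add: mult_ac)
      finally show "norm (complex_of_real (norm \<xi> powr (2 * s)) * (fourier \<phi> \<xi> * cnj (fourier u \<xi>))) \<le> norm (M * ((1 + (norm \<xi>)\<^sup>2) ^ 1 * cmod (fourier \<phi> \<xi>)))" .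
    qed
  qed
  have D: "dirichlet_frac_laplacian s u \<phi> = (\<integral>\<xi>. (norm \<xi>)\<^sup>2 powr s * P \<xi> \<partial>lborel)"
  proof -
    \<comment> \<open>The definition conjugates the transform of \<phi>, Parseval that of u; passing
      to the conjugate leaves the real part unchanged.\<close>
    have "dirichlet_frac_laplacian s u \<phi> = Re (cnj (\<integral>\<xi>. complex_of_real (norm \<xi> powr (2 * s)) * fourier u \<xi> * cnj (fourier \<phi> \<xi>) \<partial>lborel))"
      by (simp add: dirichlet_frac_laplacian_def)
    also have "cnj (\<integral>\<xi>. complex_of_real (norm \<xi> powr (2 * s)) * fourier u \<xi> * cnj (fourier \<phi> \<xi>) \<partial>lborel) =
      (\<integral>\<xi>. complex_of_real (norm \<xi> powr (2 * s)) * (fourier \<phi> \<xi> * cnj (fourier u \<xi>)) \<partial>lborel)"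
      unfolding Bochner_Integration.integral_cnj[symmetric] by (simp add: mult_ac)
    also have "Re \<dots> = (\<integral>\<xi>. Re (complex_of_real (norm \<xi> powr (2 * s)) * (fourier \<phi> \<xi> * cnj (fourier u \<xi>))) \<partial>lborel)"
      by (rule integral_Re[OF iF, symmetric])
    also have "\<dots> = (\<integral>\<xi>. (norm \<xi>)\<^sup>2 powr s * P \<xi> \<partial>lborel)"
      unfolding P_def p2 Re_complex_of_real_mult ..
    finally show ?thesis .
  qed
  define F where "F = (\<lambda>(\<xi>, t). powr_kernel s ((norm (\<xi>::'a))\<^sup>2) t * P \<xi>)"
  have Fm: "F \<in> borel_measurable (lborel \<Otimes>\<^sub>M lborel)" unfolding F_def powr_kernel_def by measurable
  have n2: "(norm (\<xi>::'a))\<^sup>2 \<ge> 0" for \<xi> by simp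
  note pk = powr_kernel_integral[OF s n2]
  have FI: "integrable (lborel \<Otimes>\<^sub>M lborel) F"
  proof (rule lborel_pair.Fubini_integrable[OF Fm])
    have "(\<lambda>\<xi>. \<integral>t. norm (F (\<xi>, t)) \<partial>lborel) = (\<lambda>\<xi>. powr_const s * ((norm \<xi>)\<^sup>2 powr s * \<bar>P \<xi>\<bar>))"
      by (rule ext) (simp add: F_def abs_mult powr_kernel_nonneg pk)
    moreover have "integrable lborel (\<lambda>\<xi>. (norm \<xi>)\<^sup>2 powr s * \<bar>P \<xi>\<bar>)"
    proof (rule Bochner_Integration.integrable_bound[OF iw(1)])
      show "AE \<xi> in lborel. norm ((norm \<xi>)\<^sup>2 powr s * \<bar>P \<xi>\<bar>) \<le> norm (M * ((1 + (norm \<xi>)\<^sup>2) ^ 1 * cmod (fourier \<phi> \<xi>)))"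
      proof (rule AE_I2)
        fix \<xi> :: 'a
        have "(norm \<xi>)\<^sup>2 powr s * \<bar>P \<xi>\<bar> \<le> (1 + (norm \<xi>)\<^sup>2) * (M * cmod (fourier \<phi> \<xi>))" using ps Pb by (intro mult_mono) auto
        also have "\<dots> \<le> norm (M * ((1 + (norm \<xi>)\<^sup>2) ^ 1 * cmod (fourier \<phi> \<xi>)))" by (simp add: mult_ac)
        finally show "norm ((norm \<xi>)\<^sup>2 powr s * \<bar>P \<xi>\<bar>) \<le> norm (M * ((1 + (norm \<xi>)\<^sup>2) ^ 1 * cmod (fourier \<phi> \<xi>)))" by simp
      qed
    qed measurable
    ultimately show "integrable lborel (\<lambda>\<xi>. \<integral>t. norm (F (\<xi>, t)) \<partial>lborel)" by simp
    show "AE \<xi> in lborel. integrable lborel (\<lambda>t. F (\<xi>, t))"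
      unfolding F_def split_conv by (intro AE_I2 integrable_mult_left pk)
  qed
  have inner: "(\<integral>\<xi>. F (\<xi>, t) \<partial>lborel) = I t" for t
  proof (cases "t > 0")
    case t: True
    have pos: "t + (norm \<xi>)\<^sup>2 > 0" for \<xi> :: 'a using t by (simp add: add_pos_nonneg)
    have iP: "integrable lborel P" by (rule Bochner_Integration.integrable_bound[OF iw(2)]) (use Pb in \<open>auto intro!: AE_I2 intro: order_trans[OF _ abs_ge_self]\<close>)
    have iPt: "integrable lborel (\<lambda>\<xi>. (1 / (t + (norm \<xi>)\<^sup>2)) * P \<xi>)"
    proof (rule Bochner_Integration.integrable_bound[OF integrable_mult_right[OF iP, of "1 / t"]])
      show "AE \<xi> in lborel. norm ((1 / (t + (norm \<xi>)\<^sup>2)) * P \<xi>) \<le> norm (1 / t * P \<xi>)"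
      proof (rule AE_I2)
        fix \<xi> :: 'a
        have "1 / (t + (norm \<xi>)\<^sup>2) \<le> 1 / t" using t pos[of \<xi>] by (intro divide_left_mono) auto
        then have "(1 / (t + (norm \<xi>)\<^sup>2)) * \<bar>P \<xi>\<bar> \<le> (1 / t) * \<bar>P \<xi>\<bar>" by (intro mult_right_mono) auto
        then show "norm ((1 / (t + (norm \<xi>)\<^sup>2)) * P \<xi>) \<le> norm (1 / t * P \<xi>)"
          using t pos[of \<xi>] by (simp add: abs_mult)
      qed
    qed measurable
    have icp: "integrable lborel (\<lambda>\<xi>. fourier \<phi> \<xi> * cnj (fourier u \<xi>))"
      by (rule Bochner_Integration.integrable_bound[OF iw(2)]) (use cm cb in \<open>auto intro!: AE_I2 intro: order_trans[OF _ abs_ge_self]\<close>)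
    have 1: "(\<integral>\<xi>. P \<xi> \<partial>lborel) = (\<integral>x. u x * \<phi> x \<partial>lborel)"
      unfolding P_def integral_Re[OF icp] Parseval_test[OF \<phi> u, symmetric] by simp
    have icp2: "integrable lborel (\<lambda>\<xi>. complex_of_real (1 / (t + (norm \<xi>)\<^sup>2)) * (fourier \<phi> \<xi> * cnj (fourier u \<xi>)))"
    proof (rule Bochner_Integration.integrable_bound[OF integrable_mult_right[OF icp, of "complex_of_real (1 / t)"]])
      show "AE \<xi> in lborel. norm (complex_of_real (1 / (t + (norm \<xi>)\<^sup>2)) * (fourier \<phi> \<xi> * cnj (fourier u \<xi>))) \<le> norm (complex_of_real (1 / t) * (fourier \<phi> \<xi> * cnj (fourier u \<xi>)))"
      proof (rule AE_I2)
        fix \<xi> :: 'a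
        have "1 / (t + (norm \<xi>)\<^sup>2) \<le> 1 / t" using t pos[of \<xi>] by (intro divide_left_mono) auto
        then have "\<bar>1 / (t + (norm \<xi>)\<^sup>2)\<bar> \<le> \<bar>1 / t\<bar>" using t pos[of \<xi>] by simp
        then show "norm (complex_of_real (1 / (t + (norm \<xi>)\<^sup>2)) * (fourier \<phi> \<xi> * cnj (fourier u \<xi>))) \<le> norm (complex_of_real (1 / t) * (fourier \<phi> \<xi> * cnj (fourier u \<xi>)))"
          unfolding norm_mult[of "complex_of_real _"] norm_of_real by (intro mult_right_mono) auto
      qed
      show "(\<lambda>\<xi>. complex_of_real (1 / (t + (norm \<xi>)\<^sup>2)) * (fourier \<phi> \<xi> * cnj (fourier u \<xi>))) \<in> borel_measurable lborel" using cm by measurable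
    qed
    have 2: "(\<integral>\<xi>. (1 / (t + (norm \<xi>)\<^sup>2)) * P \<xi> \<partial>lborel) = (\<integral>x. u x * space_resolvent t \<phi> x \<partial>lborel)"
    proof -
      have "(\<integral>\<xi>. (1 / (t + (norm \<xi>)\<^sup>2)) * P \<xi> \<partial>lborel) = Re (\<integral>\<xi>. complex_of_real (1 / (t + (norm \<xi>)\<^sup>2)) * (fourier \<phi> \<xi> * cnj (fourier u \<xi>)) \<partial>lborel)"
        unfolding P_def Re_complex_of_real_mult[symmetric] by (rule integral_Re[OF icp2])
      moreover have "complex_of_real (\<integral>x. u x * space_resolvent t \<phi> x \<partial>lborel) =
        (\<integral>\<xi>. complex_of_real (1 / (t + (norm \<xi>)\<^sup>2)) * (fourier \<phi> \<xi> * cnj (fourier u \<xi>)) \<partial>lborel)"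
        using space_resolvent_pairing[OF \<phi> t u] by (simp only: mult.assoc)
      ultimately show ?thesis by (metis Re_complex_of_real)
    qed
    have "(\<integral>\<xi>. F (\<xi>, t) \<partial>lborel) = (\<integral>\<xi>. t powr (s - 1) * (P \<xi> - t * ((1 / (t + (norm \<xi>)\<^sup>2)) * P \<xi>)) \<partial>lborel)"
    proof (intro Bochner_Integration.integral_cong refl)
      fix \<xi> :: 'a
      have frac: "(norm \<xi>)\<^sup>2 / (t + (norm \<xi>)\<^sup>2) = 1 - t * (1 / (t + (norm \<xi>)\<^sup>2))" using pos[of \<xi>] by (simp add: field_simps)
      have "F (\<xi>, t) = t powr (s - 1) * ((norm \<xi>)\<^sup>2 / (t + (norm \<xi>)\<^sup>2)) * P \<xi>"
        using t by (simp add: F_def powr_kernel_def)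
      also have "\<dots> = t powr (s - 1) * (1 - t * (1 / (t + (norm \<xi>)\<^sup>2))) * P \<xi>" unfolding frac ..
      also have "\<dots> = t powr (s - 1) * (P \<xi> - t * ((1 / (t + (norm \<xi>)\<^sup>2)) * P \<xi>))"
        by (simp only: right_diff_distrib left_diff_distrib mult_1_right mult_1_left mult.assoc)
      finally show "F (\<xi>, t) = t powr (s - 1) * (P \<xi> - t * ((1 / (t + (norm \<xi>)\<^sup>2)) * P \<xi>))" .
    qed
    also have "\<dots> = t powr (s - 1) * ((\<integral>\<xi>. P \<xi> \<partial>lborel) - t * (\<integral>\<xi>. (1 / (t + (norm \<xi>)\<^sup>2)) * P \<xi> \<partial>lborel))"
      unfolding integral_mult_right_zero Bochner_Integration.integral_diff[OF iP integrable_mult_right[OF iPt]] ..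
    finally show ?thesis unfolding 1 2 using t by (simp add: I_def)
  qed (simp add: F_def I_def powr_kernel_def)
  have F': "integrable (lborel \<Otimes>\<^sub>M lborel) (case_prod (\<lambda>\<xi> t. F (\<xi>, t)))" using FI by simp
  have "integrable lborel (\<lambda>t. \<integral>\<xi>. F (\<xi>, t) \<partial>lborel)"
    using lborel_pair.integrable_snd[OF F'] .
  then show "integrable lborel I" unfolding inner .
  have "(\<integral>t. I t \<partial>lborel) = (\<integral>t. (\<integral>\<xi>. F (\<xi>, t) \<partial>lborel) \<partial>lborel)" unfolding inner ..
  also have "\<dots> = (\<integral>\<xi>. (\<integral>t. F (\<xi>, t) \<partial>lborel) \<partial>lborel)" by (rule lborel_pair.Fubini_integral[OF F'])
  also have "\<dots> = (\<integral>\<xi>. powr_const s * ((norm \<xi>)\<^sup>2 powr s * P \<xi>) \<partial>lborel)"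
    unfolding F_def split_conv integral_mult_left_zero pk(2) by (simp only: mult.assoc)
  also have "\<dots> = powr_const s * dirichlet_frac_laplacian s u \<phi>" unfolding D by simp
  finally show "(\<integral>t. I t \<partial>lborel) = powr_const s * dirichlet_frac_laplacian s u \<phi>" .
qed

text \<open>The discrete counterpart, with a series over the eigenvalues in place of the integral
  over frequencies. Integrating each term over t gives the powers of the eigenvalues, and summing at
  fixed t gives \<open>J\<close>, by the eigenfunction expansion.\<close>

lemma navier_frac_laplacian_integral:
  fixes \<Omega> :: "'a::euclidean_space set"
  assumes s: "0 < s" "s < 1" and \<Omega>: "open \<Omega>" "bounded \<Omega>" and es: "dirichlet_eigensystem \<Omega> lam phi"
    and \<phi>: "\<phi> \<in> test_functions \<Omega>" and u: "sqint u"
  defines "J \<equiv> \<lambda>t. indicator {0<..} t * (t powr (s - 1) * (inner (abs_l2 u) (abs_l2 \<phi>) - t * inner (abs_l2 u) (resolvent \<Omega> t (abs_l2 \<phi>))))"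
  shows "integrable lborel J" and "(\<integral>t. J t \<partial>lborel) = powr_const s * navier_frac_laplacian \<Omega> lam phi s u \<phi>"
proof -
  have \<Omega>m: "\<Omega> \<in> sets borel" using \<Omega> by simp
  have ep: "dirichlet_eigenpair \<Omega> (lam j) (phi j)" for j using es by (simp add: dirichlet_eigensystem_def)
  note E = dirichlet_eigenpairD[OF ep \<Omega>m]
  note oc = eigensystem_orthonormal_complete[OF es \<Omega>]
  define e where "e j = abs_l2 (phi j)" for j
  have on: "orthonormal_seq e" using oc(1) by (simp add: e_def[abs_def])
  define x where "x j = inner (abs_l2 u) (e j)" for j
  define y where "y j = inner (abs_l2 \<phi>) (e j)" for j
  have lap: "(\<lambda>x. - laplacian \<phi> x) \<in> test_functions \<Omega>"
    using test_function_scale[OF test_function_laplacian[OF \<phi>], of "-1"] by simp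
  \<comment> \<open>The numbers \<open>lam j * y j\<close> are the coefficients of -\<Delta>\<phi>,
    hence square-summable by Bessel. This controls the growth of the powers of the eigenvalues in
    the series.\<close>
  have ly: "lam j * y j = inner (abs_l2 (\<lambda>x. - laplacian \<phi> x)) (e j)" for j
  proof -
    have "L2_inner \<Omega> (phi j) (\<lambda>x. - laplacian \<phi> x) = lam j * L2_inner \<Omega> (phi j) \<phi>"
      using ep[of j] \<phi> unfolding dirichlet_eigenpair_def by blast
    then show ?thesis
      unfolding L2_inner_eq_inner[OF E(1) sqint_test_function(1)[OF lap] \<Omega>m test_in_L2_on[OF lap \<Omega>m]]
        L2_inner_eq_inner[OF E(1) sqint_test_function(1)[OF \<phi>] \<Omega>m test_in_L2_on[OF \<phi> \<Omega>m]]
      by (simp add: y_def e_def inner_commute)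
  qed
  have xs: "summable (\<lambda>j. (x j)\<^sup>2)" and ys: "summable (\<lambda>j. (y j)\<^sup>2)"
    unfolding x_def y_def by (rule Bessel_summable[OF on])+
  have lys: "summable (\<lambda>j. (lam j * y j)\<^sup>2)" unfolding ly by (rule Bessel_summable[OF on])
  have prod: "summable (\<lambda>j. \<bar>a j * b j\<bar>)" if "summable (\<lambda>j. (a j)\<^sup>2)" "summable (\<lambda>j. (b j)\<^sup>2)" for a b :: "nat \<Rightarrow> real"
  proof (rule summable_comparison_test'[OF summable_add[OF that]])
    fix j
    show "norm \<bar>a j * b j\<bar> \<le> (a j)\<^sup>2 + (b j)\<^sup>2"
    proof -
      have "0 \<le> \<bar>a j\<bar> * \<bar>b j\<bar>" by simp
      then show ?thesis
        using sum_squares_bound[of "\<bar>a j\<bar>" "\<bar>b j\<bar>"] unfolding real_norm_def abs_abs abs_mult power2_abs by linarith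
    qed
  qed
  have s1: "summable (\<lambda>j. \<bar>x j * y j\<bar>)" by (rule prod[OF xs ys])
  have s2: "summable (\<lambda>j. \<bar>x j * (lam j * y j)\<bar>)" by (rule prod[OF xs lys])
  have ss: "summable (\<lambda>j. lam j powr s * \<bar>x j * y j\<bar>)"
  proof (rule summable_comparison_test'[OF summable_add[OF s1 s2]])
    fix j
    have "lam j powr s \<le> 1 + lam j" using powr_le_1_plus[OF E(3)] s by simp
    then have "lam j powr s * \<bar>x j * y j\<bar> \<le> (1 + lam j) * \<bar>x j * y j\<bar>" by (intro mult_right_mono) auto
    also have "\<dots> = \<bar>x j * y j\<bar> + \<bar>x j * (lam j * y j)\<bar>" using E(3)[of j] by (simp add: abs_mult algebra_simps)
    finally show "norm (lam j powr s * \<bar>x j * y j\<bar>) \<le> \<bar>x j * y j\<bar> + \<bar>x j * (lam j * y j)\<bar>" by simp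
  qed
  define f where "f j t = powr_kernel s (lam j) t * (x j * y j)" for j t
  note pk = powr_kernel_integral[OF s E(3)]
  have fi: "integrable lborel (f j)" for j unfolding f_def[abs_def] by (intro integrable_mult_left pk)
  have fn: "(\<integral>t. norm (f j t) \<partial>lborel) = powr_const s * (lam j powr s * \<bar>x j * y j\<bar>)" for j
  proof -
    have "norm (f j t) = powr_kernel s (lam j) t * \<bar>x j * y j\<bar>" for t
      using powr_kernel_nonneg[OF E(3)] by (simp add: f_def abs_mult)
    then show ?thesis using pk(2) by simp
  qed
  have AEs: "AE t in lborel. summable (\<lambda>j. norm (f j t))"
  proof (rule AE_I2)
    fix t :: real
    show "summable (\<lambda>j. norm (f j t))"
    proof (rule summable_comparison_test'[OF summable_mult[OF s1, of "t powr (s - 1)"]])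
      fix j
      show "norm (norm (f j t)) \<le> t powr (s - 1) * \<bar>x j * y j\<bar>"
      proof (cases "t > 0")
        case True
        have "lam j / (t + lam j) \<le> 1" "0 \<le> lam j / (t + lam j)" using True E(3)[of j] by auto
        then have "t powr (s - 1) * (lam j / (t + lam j)) * \<bar>x j * y j\<bar> \<le> t powr (s - 1) * 1 * \<bar>x j * y j\<bar>"
          by (intro mult_right_mono mult_left_mono) auto
        moreover have "\<bar>lam j\<bar> = lam j" "\<bar>t + lam j\<bar> = t + lam j" using True E(3)[of j] by auto
        ultimately show ?thesis using True by (simp add: f_def powr_kernel_def abs_mult)
      qed (simp add: f_def powr_kernel_def)
    qed
  qed
  have sumn: "summable (\<lambda>j. \<integral>t. norm (f j t) \<partial>lborel)" unfolding fn by (intro summable_mult ss)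
  have fJ: "(\<Sum>j. f j t) = J t" for t
  proof (cases "t > 0")
    case t: True
    have \<phi>L: "abs_l2 \<phi> \<in> L2_on \<Omega>" by (rule test_in_L2_on[OF \<phi> \<Omega>m])
    \<comment> \<open>The expansion is applied to \<phi> and to its resolvent, which lie in
      \<open>L2_on \<Omega>\<close>, and only then paired with u. Here completeness turns the sum of
      products of coefficients into (u, \<phi>).\<close>
    have exp: "(\<lambda>j. inner h (e j) *\<^sub>R e j) sums h" if "h \<in> L2_on \<Omega>" for h
      by (rule orthonormal_expansion[OF on _ subspace_L2_on closed_L2_on _ that]) (use E(2) oc(2) in \<open>auto simp: e_def\<close>)
    have S: "(\<lambda>j. x j * inner h (e j)) sums inner (abs_l2 u) h" if "h \<in> L2_on \<Omega>" for h
      using bounded_linear.sums[OF bounded_linear_inner_right exp[OF that], of "abs_l2 u"] by (simp add: x_def mult.commute)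
    have R: "inner (resolvent \<Omega> t (abs_l2 \<phi>)) (e j) = y j / (t + lam j)" for j
      unfolding resolvent_symmetric[OF t] e_def E(4)[OF t] by (simp add: y_def e_def)
    have "(\<lambda>j. x j * y j - t * (x j * (y j / (t + lam j)))) sums (inner (abs_l2 u) (abs_l2 \<phi>) - t * inner (abs_l2 u) (resolvent \<Omega> t (abs_l2 \<phi>)))"
      using S[OF \<phi>L] S[OF resolvent_in_L2_on[OF t \<Omega>m], of "abs_l2 \<phi>"] unfolding R y_def[symmetric]
      by (intro sums_diff sums_mult)
    from sums_mult[OF this, of "t powr (s - 1)"]
    have "(\<lambda>j. t powr (s - 1) * (x j * y j - t * (x j * (y j / (t + lam j))))) sums J t" using t by (simp add: J_def)
    moreover have "t powr (s - 1) * (x j * y j - t * (x j * (y j / (t + lam j)))) = f j t" for j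
    proof -
      have "t + lam j > 0" using t E(3)[of j] by simp
      then have "lam j / (t + lam j) = 1 - t * (1 / (t + lam j))" by (simp add: field_simps)
      then have "f j t = t powr (s - 1) * (1 - t * (1 / (t + lam j))) * (x j * y j)"
        using t by (simp add: f_def powr_kernel_def)
      also have "\<dots> = t powr (s - 1) * (x j * y j - t * ((1 / (t + lam j)) * (x j * y j)))"
        by (simp only: right_diff_distrib left_diff_distrib mult_1_right mult_1_left mult.assoc)
      finally show ?thesis by simp
    qed
    ultimately show ?thesis by (simp add: sums_iff)
  qed (simp add: f_def powr_kernel_def J_def)
  show "integrable lborel J"
    using integrable_suminf[OF fi AEs sumn] unfolding fJ .
  have "(\<integral>t. J t \<partial>lborel) = (\<Sum>j. \<integral>t. f j t \<partial>lborel)"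
    using integral_suminf[OF fi AEs sumn] unfolding fJ .
  also have "\<dots> = (\<Sum>j. powr_const s * (lam j powr s * x j * y j))"
    unfolding f_def integral_mult_left_zero pk(2) by (simp only: mult.assoc)
  also have "\<dots> = powr_const s * (\<Sum>j. lam j powr s * x j * y j)"
  proof (rule suminf_mult)
    show "summable (\<lambda>j. lam j powr s * x j * y j)"
      by (rule summable_norm_cancel) (use ss in \<open>simp add: abs_mult mult.assoc\<close>)
  qed
  also have "(\<Sum>j. lam j powr s * x j * y j) = navier_frac_laplacian \<Omega> lam phi s u \<phi>"
    unfolding navier_frac_laplacian_def x_def y_def e_def
      L2_inner_eq_inner[OF u E(1) \<Omega>m E(2)] L2_inner_eq_inner[OF sqint_test_function(1)[OF \<phi>] E(1) \<Omega>m E(2)] ..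
  finally show "(\<integral>t. J t \<partial>lborel) = powr_const s * navier_frac_laplacian \<Omega> lam phi s u \<phi>" .
qed

lemma H_tildeD:
  assumes "u \<in> H_tilde s \<Omega>" "bounded \<Omega>"
  shows "sqint u" "integrable lborel u" "AE x in lborel. x \<notin> closure \<Omega> \<longrightarrow> u x = 0"
proof -
  show sq: "sqint u"
    using assms(1) by (auto simp: H_tilde_def H_space_def sobolev_completion_def square_integrable_iff_sqint)
  have "AE x in lborel. x \<in> \<Union>{U. open U \<and> (AE x in lborel. x \<in> U \<longrightarrow> u x = 0)} \<longrightarrow> u x = 0"
    by (rule AE_on_Union_open) auto
  moreover have "- closure \<Omega> \<subseteq> \<Union>{U. open U \<and> (AE x in lborel. x \<in> U \<longrightarrow> u x = 0)}"
    using assms(1) unfolding H_tilde_def ess_support_def by blast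
  ultimately show ae: "AE x in lborel. x \<notin> closure \<Omega> \<longrightarrow> u x = 0"
    by (auto elim!: eventually_mono)
  have "set_integrable lborel (closure \<Omega>) u" using assms(2) by (intro sqint_set_integrable[OF sq]) auto
  then show "integrable lborel u"
    unfolding set_integrable_def
  proof (rule integrable_cong_AE_imp)
    show "u \<in> borel_measurable lborel" using sq by (simp add: sqint_def)
    show "AE x in lborel. indicator (closure \<Omega>) x *\<^sub>R u x = u x" using ae by eventually_elim (auto simp: indicator_def)
  qed
qed

text \<open>After the terms (u, \<phi>) cancel, the difference of the two representations is the
  integral of t^s \<open>q t\<close>, where \<open>q t\<close> pairs u with the difference of the
  two resolvents of \<phi>. The comparison makes \<open>q t\<close> nonnegative. If neither u nor
  \<phi> vanishes, the strict comparison makes it positive for every t > 0, and so the integral is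
  positive.\<close>

lemma frac_laplacian_difference:
  fixes \<Omega> :: "'a::euclidean_space set"
  assumes s: "0 < s" "s < 1" and \<Omega>: "open \<Omega>" "connected \<Omega>" "bounded \<Omega>" "\<Omega> \<noteq> {}"
    and es: "dirichlet_eigensystem \<Omega> lam phi"
    and u: "u \<in> H_tilde s \<Omega>" "AE x in lborel. 0 \<le> u x"
    and \<phi>: "\<phi> \<in> test_functions \<Omega>" "\<And>x. 0 \<le> \<phi> x"
  shows "0 \<le> navier_frac_laplacian \<Omega> lam phi s u \<phi> - dirichlet_frac_laplacian s u \<phi>"
    and "\<exists>x. \<phi> x \<noteq> 0 \<Longrightarrow> \<not> (AE x in lborel. u x = 0) \<Longrightarrow>
      0 < navier_frac_laplacian \<Omega> lam phi s u \<phi> - dirichlet_frac_laplacian s u \<phi>"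
proof -
  have \<phi>U: "\<phi> \<in> test_functions UNIV" using \<phi>(1) test_functions_mono[of \<Omega> UNIV] by blast
  note U = H_tildeD[OF u(1) \<Omega>(3)]
  have [measurable]: "u \<in> borel_measurable borel" using U(1) by (simp add: sqint_def)
  note N = navier_frac_laplacian_integral[OF s \<Omega>(1,3) es \<phi>(1) U(1)]
  note D = dirichlet_frac_laplacian_integral[OF s \<phi>U U(2)]
  define q where "q t = (\<integral>x. u x * space_resolvent t \<phi> x \<partial>lborel) - inner (abs_l2 u) (resolvent \<Omega> t (abs_l2 \<phi>))" for t
  define h where "h t = indicator {0<..} t * (t powr (s - 1) * (t * q t))" for t
  have uphi: "inner (abs_l2 u) (abs_l2 \<phi>) = (\<integral>x. u x * \<phi> x \<partial>lborel)"
    using inner_abs_l2[OF U(1) sqint_test_function(1)[OF \<phi>(1)]] by simp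
  have heq: "h = (\<lambda>t. indicator {0<..} t * (t powr (s - 1) * (inner (abs_l2 u) (abs_l2 \<phi>) - t * inner (abs_l2 u) (resolvent \<Omega> t (abs_l2 \<phi>))))
    - indicator {0<..} t * (t powr (s - 1) * ((\<integral>x. u x * \<phi> x \<partial>lborel) - t * (\<integral>x. u x * space_resolvent t \<phi> x \<partial>lborel))))"
    unfolding h_def[abs_def] q_def uphi by (simp add: algebra_simps)
  have hi: "integrable lborel h" unfolding heq by (rule Bochner_Integration.integrable_diff[OF N(1) D(1)])
  have hI: "(\<integral>t. h t \<partial>lborel) = powr_const s * (navier_frac_laplacian \<Omega> lam phi s u \<phi> - dirichlet_frac_laplacian s u \<phi>)"
    unfolding heq Bochner_Integration.integral_diff[OF N(1) D(1)] N(2) D(2) by (simp add: right_diff_distrib)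
  have q: "0 \<le> q t" "\<exists>x. \<phi> x \<noteq> 0 \<Longrightarrow> \<not> (AE x in lborel. u x = 0) \<Longrightarrow> 0 < q t" if t: "t > 0" for t
  proof -
    obtain V where V: "sqint V" "resolvent \<Omega> t (abs_l2 \<phi>) = abs_l2 V" using l2_cases by blast
    define w where "w = space_resolvent t \<phi>"
    have ws: "smooth w" unfolding w_def by (rule space_resolvent_smooth[OF \<phi>U t])
    have [measurable]: "w \<in> borel_measurable borel" "V \<in> borel_measurable borel"
      using smooth_borel_measurable[OF ws] V by (auto simp: sqint_def)
    have i1: "integrable lborel (\<lambda>x. u x * w x)"
    proof -
      have "sqint (\<lambda>x. indicator (closure \<Omega>) x *\<^sub>R w x)"
        using \<Omega>(3) by (intro sqint_indicator_mult smooth_continuous[OF ws]) auto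
      from sqint_integrable_inner[OF U(1) this] show ?thesis
      proof (rule integrable_cong_AE_imp)
        show "AE x in lborel. u x \<bullet> (indicator (closure \<Omega>) x *\<^sub>R w x) = u x * w x"
          using U(3) by eventually_elim (auto simp: indicator_def)
      qed measurable
    qed
    have i2: "integrable lborel (\<lambda>x. u x * V x)" using sqint_integrable_inner[OF U(1) V(1)] by simp
    have i: "integrable lborel (\<lambda>x. u x * (w x - V x))" unfolding right_diff_distrib by (rule Bochner_Integration.integrable_diff[OF i1 i2])
    have qe: "q t = (\<integral>x. u x * (w x - V x) \<partial>lborel)"
      unfolding q_def V(2) inner_abs_l2[OF U(1) V(1)] right_diff_distrib Bochner_Integration.integral_diff[OF i1 i2]
      by (simp add: w_def)
    have "AE x in lborel. V x \<le> w x"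
      unfolding w_def by (rule resolvent_comparison[OF \<Omega>(1,3) t \<phi> V(1) V(2)[symmetric]])
    then have nn: "AE x in lborel. 0 \<le> u x * (w x - V x)" using u(2) by eventually_elim simp
    then show "0 \<le> q t" unfolding qe by (rule integral_nonneg_AE)
    assume ne: "\<exists>x. \<phi> x \<noteq> 0" "\<not> (AE x in lborel. u x = 0)"
    have lt: "AE x in lborel. V x < w x"
      unfolding w_def by (rule resolvent_strict_comparison[OF \<Omega> t \<phi> ne(1) V(1) V(2)[symmetric]])
    have "q t \<noteq> 0"
    proof
      assume "q t = 0"
      then have "AE x in lborel. u x * (w x - V x) = 0" unfolding qe using integral_nonneg_eq_0_iff_AE[OF i nn] by simp
      then have "AE x in lborel. u x = 0" using lt by eventually_elim auto
      then show False using ne(2) by blast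
    qed
    with \<open>0 \<le> q t\<close> show "0 < q t" by simp
  qed
  have c: "powr_const s > 0" by (rule powr_const_pos[OF s])
  have hn: "0 \<le> h t" for t using q(1)[of t] by (auto simp: h_def indicator_def)
  have "0 \<le> (\<integral>t. h t \<partial>lborel)" using hn by simp
  then show "0 \<le> navier_frac_laplacian \<Omega> lam phi s u \<phi> - dirichlet_frac_laplacian s u \<phi>"
    unfolding hI using c by (simp add: zero_le_mult_iff)
  assume ne: "\<exists>x. \<phi> x \<noteq> 0" "\<not> (AE x in lborel. u x = 0)"
  have "(\<integral>t. h t \<partial>lborel) \<noteq> 0"
  proof
    assume "(\<integral>t. h t \<partial>lborel) = 0"
    then have "AE t in lborel. h t = 0" using integral_nonneg_eq_0_iff_AE[OF hi] hn by simp
    then have "AE t in lborel. t \<notin> {0::real<..}"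
    proof eventually_elim
      case (elim t)
      show ?case
      proof
        assume "t \<in> {0<..}"
        then have "t > 0" by simp
        then show False using q(2)[OF \<open>t > 0\<close> ne] elim by (simp add: h_def)
      qed
    qed
    then have "{0::real<..} \<in> null_sets lborel" by (subst AE_iff_null_sets) auto
    then show False using open_null_lborel_empty[of "{0::real<..}"] by auto
  qed
  with \<open>0 \<le> (\<integral>t. h t \<partial>lborel)\<close> have "0 < (\<integral>t. h t \<partial>lborel)" by simp
  then show "0 < navier_frac_laplacian \<Omega> lam phi s u \<phi> - dirichlet_frac_laplacian s u \<phi>"
    unfolding hI using c by (simp add: zero_less_mult_iff)
qed

theorem theorem1:
  fixes \<Omega> :: "'a::euclidean_space set" and s :: real
    and lam :: "nat \<Rightarrow> real" and phi :: "nat \<Rightarrow> 'a \<Rightarrow> real"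
    and u :: "'a \<Rightarrow> real"
  assumes "0 < s" and "s < 1"
    and "is_domain \<Omega>" and "bounded \<Omega>" and "lipschitz_boundary \<Omega>"
    and "dirichlet_eigensystem \<Omega> lam phi"
    and "u \<in> H_tilde s \<Omega>" and "AE x in lborel. 0 \<le> u x"
  shows "dist_ge \<Omega> (navier_frac_laplacian \<Omega> lam phi s u) (dirichlet_frac_laplacian s u) \<and>
    (\<not> (AE x in lborel. u x = 0) \<longrightarrow>
      dist_gt \<Omega> (navier_frac_laplacian \<Omega> lam phi s u) (dirichlet_frac_laplacian s u))"
proof -
  have \<Omega>: "open \<Omega>" "connected \<Omega>" "\<Omega> \<noteq> {}" using assms(3) by (auto simp: is_domain_def)
  note diff = frac_laplacian_difference[OF assms(1,2) \<Omega>(1,2) assms(4) \<Omega>(3) assms(6-8)]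
  show ?thesis unfolding dist_ge_def dist_gt_def using diff by blast
qed

end
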